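(* Let $p$ be an odd prime and $m\ge 1$ an integer. Call an integer $\ell$ admissible if $p\nmid \ell$ and, in case $(p,m)=(3,1)$, also $\ell\equiv 1 \bmod 3$. Let $\ell,\ell'$ be admissible integers and put $\alpha=1+p^m\ell$, $\alpha'=1+p^m\ell'$. Let $J_1(\cdot)$, $H_1(\cdot)$, $K_1(\cdot)$ be the groups defined in the context. Then: (1) $J_1(\alpha)\cong J_1(\alpha')$ if and only if $\alpha\equiv\alpha' \bmod p^{2m}$. In particular, for fixed $p$ and $m$, there are exactly $\varphi(p^m)$ isomorphism classes of groups $J_1(1+p^m\ell)$ ($\ell$ admissible), where $\varphi$ is Euler's function, except when $(p,m)=(3,1)$, in which case $J_1(1+3\ell)\cong J_1(4)$ for every admissible $\ell$. On the other hand, for all admissible $\ell,\ell'$, all corresponding proper terms and all corresponding factors of the upper central series of $J_1(\alpha)$ and $J_1(\alpha')$ are isomorphic. (2) The exact same result holds for $H_1$: $H_1(\alpha)\cong H_1(\alpha')$ if and only if $\alpha\equiv\alpha'\bmod p^{2m}$; for fixed $p$ and $m$ there are exactly $\varphi(p^m)$ isomorphism classes of groups $H_1(1+p^m\ell)$ ($\ell$ admissible), except when $(p,m)=(3,1)$, in which case $H_1(1+3\ell)\cong H_1(4)$; and all corresponding proper terms and all corresponding factors of the upper central series of $H_1(\alpha)$ and $H_1(\alpha')$ are isomorphic. (3) $K_1(1+p^m\ell)\cong K_1(1+p^m)$.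
   Context: Conventions: $[a,b]=a^{-1}b^{-1}ab$ and $b^a=a^{-1}ba$. For a group $T$, $Z_0(T)=1$ and $Z_{i+1}(T)/Z_i(T)$ is the center of $T/Z_i(T)$; $Z(T)=Z_1(T)$. The proper terms of the upper central series are the $Z_i(T)$ different from $T$; its factors are the quotients $Z_{i+1}(T)/Z_i(T)$. For $\alpha=1+p^m\ell$ as in the claim, $$J_1(\alpha)=\langle x,y\mid x^{[x,y]}=x^{\alpha},\ y^{[y,x]}=y^{\alpha},\ x^{p^{3m}}=y^{p^{3m}}=1\rangle,$$ $H_1(\alpha)=J_1(\alpha)/Z(J_1(\alpha))$ and $K_1(\alpha)=J_1(\alpha)/Z_2(J_1(\alpha))$. *)

theory Defs
  imports "HOL-Algebra.Algebra" "HOL-Number_Theory.Number_Theory"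
begin

text \<open>A word is a list of letters; \<open>(a, True)\<close> stands for the generator \<open>a\<close> and
  \<open>(a, False)\<close> for its formal inverse. The free group consists of the classes of words modulo
  insertion and deletion of subwords of the form \<open>a a\<inverse>\<close> or \<open>a\<inverse> a\<close>.\<close>

type_synonym 'a letters = "('a \<times> bool) list"

inductive free_eq :: "'a letters \<Rightarrow> 'a letters \<Rightarrow> bool" where
  refl: "free_eq u u"
| sym: "free_eq u v \<Longrightarrow> free_eq v u"
| trans: "free_eq u v \<Longrightarrow> free_eq v w \<Longrightarrow> free_eq u w"
| cancel: "free_eq (u @ [(a, b), (a, \<not> b)] @ v) (u @ v)"

definition free_class :: "'a letters \<Rightarrow> 'a letters set" where
  "free_class u = {v. free_eq u v}"

definition free_group :: "'a letters set monoid" where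
  "free_group = \<lparr>carrier = range free_class,
     monoid.mult = (\<lambda>A B. {w. \<exists>u\<in>A. \<exists>v\<in>B. free_eq (u @ v) w}),
     one = free_class []\<rparr>"

definition free_gen :: "'a \<Rightarrow> 'a letters set" where
  "free_gen a = free_class [(a, True)]"

lemma free_eq_append_right: "free_eq u v \<Longrightarrow> free_eq (u @ w) (v @ w)"
proof (induction rule: free_eq.induct)
  case (cancel u a b v)
  then show ?case using free_eq.cancel[of u a b "v @ w"] by simp
qed (auto intro: free_eq.intros)

lemma free_eq_append_left: "free_eq u v \<Longrightarrow> free_eq (w @ u) (w @ v)"
proof (induction rule: free_eq.induct)
  case (cancel u a b v)
  then show ?case using free_eq.cancel[of "w @ u" a b v] by simp
qed (auto intro: free_eq.intros)

lemma free_eq_append: "free_eq u u' \<Longrightarrow> free_eq v v' \<Longrightarrow> free_eq (u @ v) (u' @ v')"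
  by (blast intro: free_eq.trans free_eq_append_left free_eq_append_right)

lemma free_class_eq_iff: "free_class u = free_class v \<longleftrightarrow> free_eq u v"
  unfolding free_class_def by (blast intro: free_eq.intros)

lemma free_group_mult:
  "free_class u \<otimes>\<^bsub>free_group\<^esub> free_class v = free_class (u @ v)"
proof -
  have "(\<exists>u'. free_eq u u' \<and> (\<exists>v'. free_eq v v' \<and> free_eq (u' @ v') w)) \<longleftrightarrow> free_eq (u @ v) w" for w
    by (blast intro: free_eq.refl free_eq.trans free_eq_append)
  then show ?thesis by (simp add: free_group_def free_class_def)
qed

lemma free_eq_inverse: "free_eq (rev (map (\<lambda>(a, b). (a, \<not> b)) u) @ u) []"
proof (induction u)
  case Nil
  then show ?case by (simp add: free_eq.refl)
next
  case (Cons x u)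
  obtain a b where x: "x = (a, b)" by (cases x)
  have "free_eq (rev (map (\<lambda>(a, b). (a, \<not> b)) u) @ [(a, \<not> b), (a, \<not> \<not> b)] @ u)
          (rev (map (\<lambda>(a, b). (a, \<not> b)) u) @ u)"
    by (rule free_eq.cancel)
  with Cons show ?case by (auto simp: x intro: free_eq.trans)
qed

lemma group_free_group: "group free_group"
proof (rule groupI)
  fix x :: "'a letters set"
  assume "x \<in> carrier free_group"
  then obtain u where u: "x = free_class u" by (auto simp: free_group_def)
  let ?v = "free_class (rev (map (\<lambda>(a, b). (a, \<not> b)) u))"
  have "?v \<otimes>\<^bsub>free_group\<^esub> x = free_class []"
    by (simp add: u free_group_mult free_class_eq_iff free_eq_inverse)
  then have "?v \<otimes>\<^bsub>free_group\<^esub> x = \<one>\<^bsub>free_group\<^esub>"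
    by (simp add: free_group_def)
  moreover have "?v \<in> carrier free_group" by (simp add: free_group_def)
  ultimately show "\<exists>y\<in>carrier free_group. y \<otimes>\<^bsub>free_group\<^esub> x = \<one>\<^bsub>free_group\<^esub>"
    by blast
next
  fix x y :: "'a letters set"
  assume "x \<in> carrier free_group" "y \<in> carrier free_group"
  then obtain u v where "x = free_class u" "y = free_class v" by (auto simp: free_group_def)
  then show "x \<otimes>\<^bsub>free_group\<^esub> y \<in> carrier free_group"
    by (simp add: free_group_mult) (simp add: free_group_def)
next
  fix x y z :: "'a letters set"
  assume "x \<in> carrier free_group" "y \<in> carrier free_group" "z \<in> carrier free_group"
  then obtain u v w where "x = free_class u" "y = free_class v" "z = free_class w"
    by (auto simp: free_group_def)
  then show "x \<otimes>\<^bsub>free_group\<^esub> y \<otimes>\<^bsub>free_group\<^esub> z = x \<otimes>\<^bsub>free_group\<^esub> (y \<otimes>\<^bsub>free_group\<^esub> z)"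
    by (simp add: free_group_mult)
next
  show "\<one>\<^bsub>free_group\<^esub> \<in> carrier (free_group :: 'a letters set monoid)"
    by (simp add: free_group_def)
next
  fix x :: "'a letters set"
  assume "x \<in> carrier free_group"
  then obtain u where u: "x = free_class u" by (auto simp: free_group_def)
  have "\<one>\<^bsub>free_group\<^esub> = free_class ([] :: 'a letters)" by (simp add: free_group_def)
  then show "\<one>\<^bsub>free_group\<^esub> \<otimes>\<^bsub>free_group\<^esub> x = x" by (simp add: u free_group_mult)
qed

definition normal_closure :: "('a, 'b) monoid_scheme \<Rightarrow> 'a set \<Rightarrow> 'a set" where
  "normal_closure G R = generate G {inv\<^bsub>G\<^esub> g \<otimes>\<^bsub>G\<^esub> r \<otimes>\<^bsub>G\<^esub> g | g r. g \<in> carrier G \<and> r \<in> R}"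

text \<open>Relations are pairs of elements of the free group, to be identified in the quotient.\<close>

definition presented_group ::
    "('a letters set \<times> 'a letters set) set \<Rightarrow> 'a letters set set monoid" where
  "presented_group R =
     free_group Mod normal_closure free_group
       {u \<otimes>\<^bsub>free_group\<^esub> inv\<^bsub>free_group\<^esub> v | u v. (u, v) \<in> R}"

lemma (in group) normal_closure_normal:
  assumes "R \<subseteq> carrier G"
  shows "normal_closure G R \<lhd> G"
  unfolding normal_closure_def
proof (rule normal_generateI)
  let ?C = "{inv g \<otimes> r \<otimes> g | g r. g \<in> carrier G \<and> r \<in> R}"
  show "?C \<subseteq> carrier G" using assms by auto
  fix h g assume "h \<in> ?C" and g: "g \<in> carrier G"
  then obtain k r where k: "k \<in> carrier G" "r \<in> R" "h = inv k \<otimes> r \<otimes> k" by blast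
  with assms g have "g \<otimes> h \<otimes> inv g = inv (k \<otimes> inv g) \<otimes> r \<otimes> (k \<otimes> inv g)"
    by (simp add: m_assoc inv_mult_group subsetD)
  with k g show "g \<otimes> h \<otimes> inv g \<in> ?C" by blast
qed

lemma group_presented_group:
  fixes R :: "('a letters set \<times> 'a letters set) set"
  assumes "R \<subseteq> carrier free_group \<times> carrier free_group"
  shows "group (presented_group R)"
proof -
  interpret F: group "free_group :: 'a letters set monoid" by (rule group_free_group)
  have "{u \<otimes>\<^bsub>free_group\<^esub> inv\<^bsub>free_group\<^esub> v | u v. (u, v) \<in> R} \<subseteq> carrier free_group"
    using assms by auto
  then show ?thesis
    unfolding presented_group_def by (intro normal.factorgroup_is_group F.normal_closure_normal)
qed

definition group_center :: "('a, 'b) monoid_scheme \<Rightarrow> 'a set" where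
  "group_center G = {z \<in> carrier G. \<forall>g\<in>carrier G. z \<otimes>\<^bsub>G\<^esub> g = g \<otimes>\<^bsub>G\<^esub> z}"

primrec upper_central :: "('a, 'b) monoid_scheme \<Rightarrow> nat \<Rightarrow> 'a set" where
  "upper_central G 0 = {\<one>\<^bsub>G\<^esub>}"
| "upper_central G (Suc i) =
     {g \<in> carrier G. upper_central G i #>\<^bsub>G\<^esub> g \<in> group_center (G Mod upper_central G i)}"

definition upper_central_factor :: "('a, 'b) monoid_scheme \<Rightarrow> nat \<Rightarrow> 'a set monoid" where
  "upper_central_factor G i =
     G\<lparr>carrier := upper_central G (Suc i)\<rparr> Mod upper_central G i"

text \<open>A term of one series is proper exactly when the corresponding term of the other one is,
  so that the two lists of proper terms do correspond.\<close>

definition isomorphic_upper_central_series ::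
    "('a, 'c) monoid_scheme \<Rightarrow> ('b, 'd) monoid_scheme \<Rightarrow> bool" where
  "isomorphic_upper_central_series G H \<longleftrightarrow>
     (\<forall>i. (upper_central G i \<noteq> carrier G \<longleftrightarrow> upper_central H i \<noteq> carrier H) \<and>
          (upper_central G i \<noteq> carrier G \<longrightarrow>
             G\<lparr>carrier := upper_central G i\<rparr> \<cong> H\<lparr>carrier := upper_central H i\<rparr>)) \<and>
     (\<forall>i. upper_central_factor G i \<cong> upper_central_factor H i)"

definition iso_classes :: "('a, 'b) monoid_scheme set \<Rightarrow> ('a, 'b) monoid_scheme set set" where
  "iso_classes S = S // {(G, H). G \<in> S \<and> H \<in> S \<and> G \<cong> H}"

definition group_conj :: "('a, 'b) monoid_scheme \<Rightarrow> 'a \<Rightarrow> 'a \<Rightarrow> 'a" where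
  "group_conj G b a = inv\<^bsub>G\<^esub> a \<otimes>\<^bsub>G\<^esub> b \<otimes>\<^bsub>G\<^esub> a"

definition group_comm :: "('a, 'b) monoid_scheme \<Rightarrow> 'a \<Rightarrow> 'a \<Rightarrow> 'a" where
  "group_comm G a b = inv\<^bsub>G\<^esub> a \<otimes>\<^bsub>G\<^esub> inv\<^bsub>G\<^esub> b \<otimes>\<^bsub>G\<^esub> a \<otimes>\<^bsub>G\<^esub> b"

datatype gen = GenX | GenY

definition J1 :: "nat \<Rightarrow> nat \<Rightarrow> int \<Rightarrow> gen letters set set monoid" where
  "J1 p m \<alpha> =
    (let F = free_group; x = free_gen GenX; y = free_gen GenY in
     presented_group
       {(group_conj F x (group_comm F x y), x [^]\<^bsub>F\<^esub> \<alpha>),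
        (group_conj F y (group_comm F y x), y [^]\<^bsub>F\<^esub> \<alpha>),
        (x [^]\<^bsub>F\<^esub> (p ^ (3 * m)), \<one>\<^bsub>F\<^esub>),
        (y [^]\<^bsub>F\<^esub> (p ^ (3 * m)), \<one>\<^bsub>F\<^esub>)})"

definition H1 :: "nat \<Rightarrow> nat \<Rightarrow> int \<Rightarrow> gen letters set set set monoid" where
  "H1 p m \<alpha> = J1 p m \<alpha> Mod upper_central (J1 p m \<alpha>) 1"

definition K1 :: "nat \<Rightarrow> nat \<Rightarrow> int \<Rightarrow> gen letters set set set monoid" where
  "K1 p m \<alpha> = J1 p m \<alpha> Mod upper_central (J1 p m \<alpha>) 2"

definition admissible :: "nat \<Rightarrow> nat \<Rightarrow> int \<Rightarrow> bool" where
  "admissible p m l \<longleftrightarrow> \<not> int p dvd l \<and> (p = 3 \<and> m = 1 \<longrightarrow> [l = 1] (mod 3))"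

lemma group_J1: "group (J1 p m \<alpha>)"
proof -
  interpret F: group "free_group :: gen letters set monoid" by (rule group_free_group)
  have "free_gen a \<in> carrier free_group" for a :: gen
    by (simp add: free_gen_def free_group_def)
  then show ?thesis
    unfolding J1_def Let_def group_conj_def group_comm_def by (intro group_presented_group) auto
qed

end

theory Submission
  imports Defs
begin

text \<open>Write \<open>q = p ^ m\<close> and \<open>C = [A, B]\<close> for the commutator of the generators of \<open>J\<^sub>1\<close>. The relations force
  \<open>A ^ q\<^sup>2 = B ^ (- q\<^sup>2)\<close> and \<open>C ^ q\<^sup>2 = 1\<close>, so that every element has the form \<open>C\<^sup>k A\<^sup>i B\<^sup>j\<close>; the action on the cosets of
  \<open>\<langle>C\<rangle>\<close>, written down explicitly on pairs \<open>(i, j)\<close>, shows that \<open>C\<^sup>k A\<^sup>i B\<^sup>j = 1\<close> only if \<open>q\<^sup>2\<close> divides \<open>k\<close> and \<open>i\<close> and \<open>q\<^sup>3\<close>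
  divides \<open>i - j\<close>. The upper central series can then be read off: its fourth term, given by \<open>q dvd i\<close> and \<open>q dvd j\<close>, is
  abelian, and raising \<open>C\<close> to the power \<open>t\<close>, where \<open>t l' = l\<close> modulo \<open>q\<close>, matches these terms for two parameters.

  If \<open>l = l'\<close> modulo \<open>q\<close>, then \<open>A B\<^sup>s\<close> and \<open>B A\<^sup>s\<close>, for a suitable multiple \<open>s\<close> of \<open>q\<close>, satisfy in the group of \<open>l\<close> the
  relations of \<open>l'\<close>. In \<open>K\<^sub>1\<close> the elements \<open>A\<^sup>t\<close> and \<open>B\<close> with \<open>t l = l'\<close> modulo \<open>q\<close> do so for all \<open>l\<close> and \<open>l'\<close>.

  Conversely, let \<open>x\<close> and \<open>y\<close> be the images of the generators under an isomorphism onto \<open>H\<^sub>1\<close>, with exponents \<open>x\<^sub>1, x\<^sub>2\<close> and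
  \<open>y\<^sub>1, y\<^sub>2\<close> of \<open>A\<close> and \<open>B\<close>. Up to exchanging \<open>x\<close> and \<open>y\<close>, the relations read in \<open>K\<^sub>1\<close> force \<open>x\<^sub>2 = y\<^sub>1 = 0\<close> and
  \<open>l x\<^sub>1 y\<^sub>2 = l'\<close> modulo \<open>q\<close>; read in \<open>H\<^sub>1\<close>, they then force \<open>x\<^sub>1 = y\<^sub>2 = 1\<close> modulo \<open>q\<close>.\<close>

section \<open>Groups given by generators and relations\<close>

text \<open>The two computations of \<open>a al \<otimes> b 1\<close> give
  \<open>a kap \<otimes> b kap = \<one>\<close>, where \<open>kap\<close> is q^2 times an integer
  with main part l^2 / 2. That integer is prime to p unless p = 3, m = 1 and l = 2 modulo 3: this is
  the case that admissibility excludes, and the same unit condition returns when the multiple s of q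
  is solved for. Exponents live modulo q^3, so powers of 1 + w become quadratic polynomials in the
  exponent; their denominators 2 and 6 are the lasting obstacle at p = 3. A multiplication on
  triples would require a proof of associativity; an action on pairs needs only the defining
  relations, and the order of C is then forced by its action on A. In the converse, K1 binds only
  the product of x1 and y2, in keeping with its independence of l. The single exponents show in the
  C-part of the relations modulo q^2, which K1 forgets and H1 keeps. The q-th powers in K1 involve
  the sum of the squares below q, which p divides unless p = 3 and m = 1; there all admissible l
  agree modulo q anyway.\<close>

fun eval_word :: "('b, 'c) monoid_scheme \<Rightarrow> ('a \<Rightarrow> 'b) \<Rightarrow> 'a letters \<Rightarrow> 'b" where
  "eval_word G f [] = \<one>\<^bsub>G\<^esub>"
| "eval_word G f ((a, b) # w) = (if b then f a else inv\<^bsub>G\<^esub> (f a)) \<otimes>\<^bsub>G\<^esub> eval_word G f w"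

context group
begin

lemma eval_word_closed [simp]:
  assumes "\<And>a. f a \<in> carrier G"
  shows "eval_word G f w \<in> carrier G"
  by (induction w) (auto simp: assms)

lemma eval_word_append:
  assumes "\<And>a. f a \<in> carrier G"
  shows "eval_word G f (u @ v) = eval_word G f u \<otimes> eval_word G f v"
  by (induction u) (auto simp: assms m_assoc)

lemma eval_word_free_eq:
  assumes f: "\<And>a. f a \<in> carrier G" and "free_eq u v"
  shows "eval_word G f u = eval_word G f v"
  using assms(2)
proof (induction rule: free_eq.induct)
  case (cancel u a b v)
  have "eval_word G f [(a, b), (a, \<not> b)] = \<one>" by (simp add: f)
  then show ?case by (simp only: eval_word_append[OF f]) (simp add: f)
qed auto

lemma free_group_universal:
  assumes f: "\<And>a. f a \<in> carrier G"
  obtains h where "h \<in> hom free_group G" "\<And>a. h (free_gen a) = f a"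
proof -
  \<comment> \<open>Any representing word may be evaluated; \<open>eval_word_free_eq\<close> makes
    the choice immaterial.\<close>
  define h where "h S = eval_word G f (SOME u. S = free_class u)" for S
  have h: "h (free_class u) = eval_word G f u" for u
    unfolding h_def
    by (rule someI2[of _ u]) (auto simp: free_class_eq_iff intro!: eval_word_free_eq f intro: free_eq.sym)
  show thesis
  proof
    show "h \<in> hom free_group G"
    proof (rule homI)
      fix x y :: "'c letters set" assume "x \<in> carrier free_group" "y \<in> carrier free_group"
      then obtain u v where "x = free_class u" "y = free_class v" by (auto simp: free_group_def)
      then show "h (x \<otimes>\<^bsub>free_group\<^esub> y) = h x \<otimes> h y"
        by (simp add: free_group_mult h eval_word_append f)
    qed (auto simp: free_group_def h f)
    show "h (free_gen a) = f a" for a by (simp add: free_gen_def h f)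
  qed
qed

end

lemma free_gen_closed [simp]: "free_gen a \<in> carrier free_group"
  by (simp add: free_gen_def free_group_def)

lemma generate_free_group: "generate free_group (range free_gen) = carrier free_group"
proof
  interpret F: group "free_group :: 'a letters set monoid" by (rule group_free_group)
  show "generate free_group (range free_gen) \<subseteq> (carrier free_group :: 'a letters set set)"
    by (rule F.generate_incl) auto
  have "free_class u \<in> generate free_group (range free_gen)" for u :: "'a letters"
  proof (induction u)
    case Nil
    show ?case using generate.one[of free_group] by (simp add: free_group_def)
  next
    case (Cons x u)
    obtain a b where x: "x = (a, b)" by (cases x)
    have inv: "inv\<^bsub>free_group\<^esub> (free_gen a) = free_class [(a, False)]"
    proof (rule F.inv_equality)
      show "free_class [(a, False)] \<otimes>\<^bsub>free_group\<^esub> free_gen a = \<one>\<^bsub>free_group\<^esub>"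
        using free_eq.cancel[of "[]" a False "[]"]
        by (simp add: free_gen_def free_group_mult) (simp add: free_group_def free_class_eq_iff)
    qed (auto simp: free_group_def free_gen_def)
    have "free_class [x] \<in> generate free_group (range free_gen)"
      using generate.incl[of "free_gen a" "range free_gen" free_group]
            generate.inv[of "free_gen a" "range free_gen" free_group]
      by (cases b) (auto simp: x inv, simp add: free_gen_def)
    then have "free_class [x] \<otimes>\<^bsub>free_group\<^esub> free_class u \<in> generate free_group (range free_gen)"
      using Cons by (rule generate.eng)
    then show ?case by (simp add: free_group_mult)
  qed
  then show "(carrier free_group :: 'a letters set set) \<subseteq> generate free_group (range free_gen)"
    by (auto simp: free_group_def)
qed

definition presented_map ::
    "('a letters set \<times> 'a letters set) set \<Rightarrow> 'a letters set \<Rightarrow> 'a letters set set" where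
  "presented_map R x = normal_closure free_group
     {u \<otimes>\<^bsub>free_group\<^esub> inv\<^bsub>free_group\<^esub> v | u v. (u, v) \<in> R} #>\<^bsub>free_group\<^esub> x"

definition presented_gen :: "('a letters set \<times> 'a letters set) set \<Rightarrow> 'a \<Rightarrow> 'a letters set set" where
  "presented_gen R a = presented_map R (free_gen a)"

context
  fixes R :: "('a letters set \<times> 'a letters set) set"
  assumes R: "R \<subseteq> carrier free_group \<times> carrier free_group"
begin

interpretation F: group "free_group :: 'a letters set monoid" by (rule group_free_group)

abbreviation "relators \<equiv> {u \<otimes>\<^bsub>free_group\<^esub> inv\<^bsub>free_group\<^esub> v | u v. (u, v) \<in> R}"

lemma relators_closed: "relators \<subseteq> carrier free_group"
  using R by auto

interpretation N: normal "normal_closure free_group relators" "free_group"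
  by (rule F.normal_closure_normal[OF relators_closed])

lemma presented_map_hom: "presented_map R \<in> hom free_group (presented_group R)"
  unfolding presented_group_def presented_map_def by (rule N.r_coset_hom_Mod)

lemma presented_map_surj: "presented_map R ` carrier free_group = carrier (presented_group R)"
  by (simp add: presented_group_def presented_map_def carrier_FactGroup)

lemma presented_map_rel:
  assumes uv: "(u, v) \<in> R"
  shows "presented_map R u = presented_map R v"
proof -
  let ?N = "normal_closure free_group relators"
    have c: "u \<in> carrier free_group" "v \<in> carrier free_group" using uv R by auto
    have "inv\<^bsub>free_group\<^esub> \<one>\<^bsub>free_group\<^esub> \<otimes>\<^bsub>free_group\<^esub> (u \<otimes>\<^bsub>free_group\<^esub> inv\<^bsub>free_group\<^esub> v) \<otimes>\<^bsub>free_group\<^esub> \<one>\<^bsub>free_group\<^esub> \<in> ?N"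
      unfolding normal_closure_def using uv c by (intro generate.incl) blast
    then have "u \<otimes>\<^bsub>free_group\<^esub> inv\<^bsub>free_group\<^esub> v \<in> ?N" using c by simp
    then have "u \<in> ?N #>\<^bsub>free_group\<^esub> v"
      using c by (intro subgroup.rcos_module_rev[OF N.subgroup_axioms F.is_group]) auto
    then show ?thesis
      using c unfolding presented_map_def by (intro F.repr_independence[symmetric, OF _ _ N.subgroup_axioms]) auto
qed

lemma generate_presented_group:
  "generate (presented_group R) (range (presented_gen R)) = carrier (presented_group R)"
proof -
  interpret h: group_hom free_group "presented_group R" "presented_map R"
    by (simp add: group_hom_def group_hom_axioms_def group_free_group group_presented_group R presented_map_hom)
  have "generate (presented_group R) (presented_map R ` range free_gen) = presented_map R ` generate free_group (range free_gen)"
    by (rule h.generate_img) auto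
  then show ?thesis by (simp add: generate_free_group presented_map_surj image_image presented_gen_def)
qed

text \<open>Von Dyck's theorem. The relations are demanded of every homomorphism that extends
  \<open>f\<close>, so that both sides of a relation can be evaluated by homomorphism rules without
  naming the extension.\<close>

lemma presented_group_universal:
  assumes G: "group G" and f: "\<And>a. f a \<in> carrier G"
    and rel: "\<And>h u v. h \<in> hom free_group G \<Longrightarrow> (\<And>a. h (free_gen a) = f a) \<Longrightarrow> (u, v) \<in> R \<Longrightarrow> h u = h v"
  obtains g where "g \<in> hom (presented_group R) G" "\<And>a. g (presented_gen R a) = f a"
proof -
  interpret G: group G by (rule G)
  obtain h where h: "h \<in> hom free_group G" "\<And>a. h (free_gen a) = f a"
    using G.free_group_universal[of f] f by auto
  interpret h: group_hom free_group G h
    by (simp add: group_hom_def group_hom_axioms_def group_free_group h(1) G)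
  let ?N = "normal_closure free_group relators"
  have "?N \<subseteq> kernel free_group G h"
    unfolding normal_closure_def
  proof (rule F.generate_subgroup_incl[OF _ h.subgroup_kernel])
    show "{inv\<^bsub>free_group\<^esub> g \<otimes>\<^bsub>free_group\<^esub> r \<otimes>\<^bsub>free_group\<^esub> g | g r. g \<in> carrier free_group \<and> r \<in> relators}
       \<subseteq> kernel free_group G h"
    proof clarify
      fix g :: "'a letters set" and u v assume g: "g \<in> carrier free_group" and uv: "(u, v) \<in> R"
      have c: "u \<in> carrier free_group" "v \<in> carrier free_group" using uv R by auto
      have "h u = h v" using rel[OF h uv] .
      then show "inv\<^bsub>free_group\<^esub> g \<otimes>\<^bsub>free_group\<^esub> (u \<otimes>\<^bsub>free_group\<^esub> inv\<^bsub>free_group\<^esub> v) \<otimes>\<^bsub>free_group\<^esub> g \<in> kernel free_group G h"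
        using c g by (simp add: kernel_def)
    qed
  qed
  then obtain g where "g \<in> hom (free_group Mod ?N) G"
      "\<And>x. x \<in> carrier free_group \<Longrightarrow> g (?N #>\<^bsub>free_group\<^esub> x) = h x"
    using h.FactGroup_universal_kernel[OF N.normal_axioms] by blast
  then show thesis using that[of g] h
    by (simp add: presented_group_def presented_gen_def presented_map_def)
qed

end

section \<open>Upper central series\<close>

text \<open>The quotient \<open>inv y \<otimes> x\<close> has the inverse on the left because for x
  = g h and y = h g it is the commutator of g and h in the convention of
  \<open>group_comm\<close>.\<close>

lemma (in normal) rcos_eq_iff:
  assumes "x \<in> carrier G" "y \<in> carrier G"
  shows "H #> x = H #> y \<longleftrightarrow> inv y \<otimes> x \<in> H"
proof -
  have "H #> x = H #> y \<longleftrightarrow> x \<in> H #> y"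
    using assms rcos_self repr_independence subgroup_axioms by metis
  also have "\<dots> \<longleftrightarrow> x \<otimes> inv y \<in> H"
    using assms rcos_module[OF is_group] by auto
  also have "\<dots> \<longleftrightarrow> inv y \<otimes> x \<in> H"
  proof
    assume "x \<otimes> inv y \<in> H"
    from inv_op_closed1[OF assms(2) this] show "inv y \<otimes> x \<in> H"
      using assms by (simp add: m_assoc)
  next
    assume "inv y \<otimes> x \<in> H"
    from inv_op_closed2[OF assms(2) this] show "x \<otimes> inv y \<in> H"
      using assms by (simp flip: m_assoc)
  qed
  finally show ?thesis .
qed

lemma (in normal) rcos_mult:
  "x \<in> carrier G \<Longrightarrow> y \<in> carrier G \<Longrightarrow> (H #> x) \<otimes>\<^bsub>G Mod H\<^esub> (H #> y) = H #> (x \<otimes> y)"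
  by (simp add: rcos_sum)

lemma (in normal) group_hom_rcos: "group_hom G (G Mod H) (\<lambda>x. H #> x)"
  by (simp add: group_hom_def group_hom_axioms_def is_group factorgroup_is_group r_coset_hom_Mod)

lemma (in normal) rcos_eq_self_iff:
  assumes "x \<in> carrier G"
  shows "H #> x = H \<longleftrightarrow> x \<in> H"
  using rcos_eq_iff[of x \<one>] assms by (simp add: coset_mult_one subset)

lemma (in group) commute_inv:
  assumes "x \<in> carrier G" "a \<in> carrier G" and comm: "x \<otimes> a = a \<otimes> x"
  shows "x \<otimes> inv a = inv a \<otimes> x"
proof -
  have "inv a \<otimes> (x \<otimes> a) \<otimes> inv a = x \<otimes> inv a"
    unfolding comm using assms(1,2) by (simp flip: m_assoc)
  then show ?thesis using assms(1,2) by (simp add: m_assoc)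
qed

lemma (in group) commute_mult:
  assumes "x \<in> carrier G" "a \<in> carrier G" "b \<in> carrier G" and "x \<otimes> a = a \<otimes> x" "x \<otimes> b = b \<otimes> x"
  shows "x \<otimes> (a \<otimes> b) = a \<otimes> b \<otimes> x"
proof -
  have "x \<otimes> (a \<otimes> b) = a \<otimes> (x \<otimes> b)" using assms(1-4) by (simp flip: m_assoc)
  then show ?thesis using assms(1-3,5) by (simp add: m_assoc)
qed

lemma (in group) normal_group_center: "group_center G \<lhd> G"
proof (rule normal_invI)
  show "subgroup (group_center G) G"
  proof (rule subgroupI)
    fix a assume "a \<in> group_center G"
    then have a: "a \<in> carrier G" "\<And>g. g \<in> carrier G \<Longrightarrow> a \<otimes> g = g \<otimes> a" by (auto simp: group_center_def)
    have "inv a \<otimes> g = g \<otimes> inv a" if "g \<in> carrier G" for g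
      by (rule commute_inv[symmetric, OF that a(1) a(2)[OF that, symmetric]])
    with a(1) show "inv a \<in> group_center G" unfolding group_center_def by blast
  next
    fix a b assume "a \<in> group_center G" "b \<in> group_center G"
    then have ab: "a \<in> carrier G" "b \<in> carrier G"
      "\<And>g. g \<in> carrier G \<Longrightarrow> a \<otimes> g = g \<otimes> a" "\<And>g. g \<in> carrier G \<Longrightarrow> b \<otimes> g = g \<otimes> b"
      by (auto simp: group_center_def)
    have "a \<otimes> b \<otimes> g = g \<otimes> (a \<otimes> b)" if "g \<in> carrier G" for g
      by (rule commute_mult[symmetric, OF that ab(1,2) ab(3)[OF that, symmetric] ab(4)[OF that, symmetric]])
    with ab(1,2) show "a \<otimes> b \<in> group_center G" unfolding group_center_def by blast
  qed (auto simp: group_center_def)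
  show "x \<otimes> h \<otimes> inv x \<in> group_center G" if "x \<in> carrier G" "h \<in> group_center G" for x h
  proof -
    have "x \<otimes> h \<otimes> inv x = h"
    proof -
      have h: "h \<in> carrier G" and hx: "x \<otimes> h = h \<otimes> x" using that by (auto simp: group_center_def)
      show ?thesis unfolding hx using that(1) h by (simp add: m_assoc)
    qed
    then show ?thesis using that by simp
  qed
qed

lemma (in group_hom) normal_vimage:
  assumes "K \<lhd> H"
  shows "{g \<in> carrier G. h g \<in> K} \<lhd> G"
proof -
  interpret K: normal K H by (rule assms)
  show ?thesis
  proof (rule G.normal_invI)
    show "subgroup {g \<in> carrier G. h g \<in> K} G"
      by (rule G.subgroupI) (auto intro!: exI[of _ "\<one>\<^bsub>G\<^esub>"])
    show "x \<otimes> y \<otimes> inv x \<in> {g \<in> carrier G. h g \<in> K}"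
      if "x \<in> carrier G" "y \<in> {g \<in> carrier G. h g \<in> K}" for x y
      using that K.inv_op_closed2[of "h x" "h y"] by auto
  qed
qed

section \<open>The upper central series in terms of commutators\<close>

context group
begin

lemma upper_central_normal: "upper_central G i \<lhd> G"
proof (induction i)
  case 0
  show ?case using one_is_normal by simp
next
  case (Suc i)
  then interpret N: normal "upper_central G i" G .
  interpret h: group_hom G "G Mod upper_central G i" "\<lambda>x. upper_central G i #> x"
    by (rule N.group_hom_rcos)
  show ?case using h.normal_vimage[OF h.H.normal_group_center] by simp
qed

lemma upper_central_closed: "x \<in> upper_central G i \<Longrightarrow> x \<in> carrier G"
  by (rule subgroup.mem_carrier[OF normal_imp_subgroup[OF upper_central_normal]])

lemma upper_central_subset: "upper_central G i \<subseteq> carrier G"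
  by (rule subsetI) (rule upper_central_closed)

lemma group_comm_closed [simp]:
  "x \<in> carrier G \<Longrightarrow> y \<in> carrier G \<Longrightarrow> group_comm G x y \<in> carrier G"
  by (simp add: group_comm_def)

lemma mult_group_comm:
  "x \<in> carrier G \<Longrightarrow> y \<in> carrier G \<Longrightarrow> y \<otimes> x \<otimes> group_comm G x y = x \<otimes> y"
proof -
  assume xy: "x \<in> carrier G" "y \<in> carrier G"
  have "y \<otimes> x \<otimes> group_comm G x y = y \<otimes> (x \<otimes> inv x) \<otimes> inv y \<otimes> x \<otimes> y"
    using xy by (simp only: group_comm_def m_assoc m_closed inv_closed)
  then show ?thesis using xy by simp
qed

lemma group_comm_eqI:
  assumes "x \<in> carrier G" "y \<in> carrier G" "z \<in> carrier G" "x \<otimes> y = y \<otimes> x \<otimes> z"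
  shows "group_comm G x y = z"
  using mult_group_comm[of x y] assms by (metis group_comm_closed l_cancel m_closed)

text \<open>The cosets of g and h commute in the quotient exactly when [g, h] lies in the subgroup.
  The recursion thus takes place inside the group, which is the form used from here on.\<close>

lemma mem_upper_central_Suc:
  "g \<in> upper_central G (Suc i) \<longleftrightarrow> g \<in> carrier G \<and> (\<forall>h\<in>carrier G. group_comm G g h \<in> upper_central G i)"
proof (cases "g \<in> carrier G")
  case True
  interpret N: normal "upper_central G i" G by (rule upper_central_normal)
  have "(upper_central G i #> g) \<otimes>\<^bsub>G Mod upper_central G i\<^esub> (upper_central G i #> h)
      = (upper_central G i #> h) \<otimes>\<^bsub>G Mod upper_central G i\<^esub> (upper_central G i #> g)
    \<longleftrightarrow> group_comm G g h \<in> upper_central G i" if "h \<in> carrier G" for h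
    using that True
    by (simp only: N.rcos_mult) (simp add: N.rcos_eq_iff group_comm_def inv_mult_group m_assoc)
  with True show ?thesis
    by (auto simp: group_center_def carrier_FactGroup)
qed simp

lemma upper_central_commute:
  assumes "g \<in> upper_central G (Suc i)" "h \<in> carrier G"
  obtains z where "z \<in> upper_central G i" "g \<otimes> h = h \<otimes> g \<otimes> z"
  using assms mult_group_comm[of g h] by (metis mem_upper_central_Suc)

text \<open>The elements that commute with g modulo the i-th term form a subgroup, so generators
  suffice. The witness z is the commutator, placed as in \<open>mult_group_comm\<close>.\<close>

lemma upper_central_SucI:
  assumes gen: "generate G S = carrier G" and S: "S \<subseteq> carrier G" and g: "g \<in> carrier G"
    and comm: "\<And>s. s \<in> S \<Longrightarrow> \<exists>z\<in>upper_central G i. g \<otimes> s = s \<otimes> g \<otimes> z"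
  shows "g \<in> upper_central G (Suc i)"
proof -
  interpret N: normal "upper_central G i" G by (rule upper_central_normal)
  let ?N = "upper_central G i"
  have eq: "?N #> (g \<otimes> h) = ?N #> (h \<otimes> g) \<longleftrightarrow> group_comm G g h \<in> ?N" if "h \<in> carrier G" for h
    using that g by (simp add: N.rcos_eq_iff group_comm_def inv_mult_group m_assoc)
  have eq': "?N #> (g \<otimes> h) = ?N #> (h \<otimes> g) \<longleftrightarrow>
      (?N #> g) \<otimes>\<^bsub>G Mod ?N\<^esub> (?N #> h) = (?N #> h) \<otimes>\<^bsub>G Mod ?N\<^esub> (?N #> g)" if "h \<in> carrier G" for h
    using that g by (simp only: N.rcos_mult)
  interpret h: group_hom G "G Mod ?N" "\<lambda>x. ?N #> x"
    by (rule N.group_hom_rcos)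
  let ?C = "{h \<in> carrier G. (?N #> g) \<otimes>\<^bsub>G Mod ?N\<^esub> (?N #> h) = (?N #> h) \<otimes>\<^bsub>G Mod ?N\<^esub> (?N #> g)}"
  have "subgroup ?C G"
  proof (rule subgroupI)
    fix a assume a: "a \<in> ?C"
    then have "(?N #> g) \<otimes>\<^bsub>G Mod ?N\<^esub> inv\<^bsub>G Mod ?N\<^esub> (?N #> a) = inv\<^bsub>G Mod ?N\<^esub> (?N #> a) \<otimes>\<^bsub>G Mod ?N\<^esub> (?N #> g)"
      using g by (intro h.H.commute_inv h.hom_closed) auto
    with a show "inv a \<in> ?C" using h.hom_inv[of a] by (simp del: mult_FactGroup)
  next
    fix a b assume ab: "a \<in> ?C" "b \<in> ?C"
    then have "(?N #> g) \<otimes>\<^bsub>G Mod ?N\<^esub> ((?N #> a) \<otimes>\<^bsub>G Mod ?N\<^esub> (?N #> b))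
        = (?N #> a) \<otimes>\<^bsub>G Mod ?N\<^esub> (?N #> b) \<otimes>\<^bsub>G Mod ?N\<^esub> (?N #> g)"
      using g by (intro h.H.commute_mult h.hom_closed) auto
    with ab show "a \<otimes> b \<in> ?C" using h.hom_mult[of a b] by (simp del: mult_FactGroup)
  next
    have "(?N #> g) \<otimes>\<^bsub>G Mod ?N\<^esub> (?N #> \<one>) = (?N #> \<one>) \<otimes>\<^bsub>G Mod ?N\<^esub> (?N #> g)"
      using g h.hom_closed[OF g] h.hom_one by (simp del: mult_FactGroup one_FactGroup)
    then show "?C \<noteq> {}" by blast
  qed auto
  moreover have "S \<subseteq> ?C"
  proof
    fix s assume s: "s \<in> S"
    then obtain z where z: "z \<in> ?N" "g \<otimes> s = s \<otimes> g \<otimes> z" using comm by blast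
    have sc: "s \<in> carrier G" using s S by blast
    have "group_comm G g s = z"
      using z g sc by (intro group_comm_eqI) auto
    with z sc have "?N #> (g \<otimes> s) = ?N #> (s \<otimes> g)" using eq[OF sc] by simp
    then show "s \<in> ?C" using eq'[OF sc] sc by blast
  qed
  ultimately have "generate G S \<subseteq> ?C" by (rule generate_subgroup_incl[rotated])
  then have "carrier G \<subseteq> ?C" by (simp add: gen)
  then have "group_comm G g h \<in> ?N" if "h \<in> carrier G" for h
    using eq eq' that by blast
  then show ?thesis using g by (simp add: mem_upper_central_Suc del: upper_central.simps)
qed

text \<open>[g, h] is the inverse of g times a conjugate of g, and the term is normal.\<close>

lemma upper_central_mono_Suc: "upper_central G i \<subseteq> upper_central G (Suc i)"
proof
  interpret N: normal "upper_central G i" G by (rule upper_central_normal)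
  fix g assume g: "g \<in> upper_central G i"
  have "group_comm G g h \<in> upper_central G i" if h: "h \<in> carrier G" for h
  proof -
    have "inv g \<otimes> (inv h \<otimes> g \<otimes> h) \<in> upper_central G i"
      by (rule N.m_closed[OF N.m_inv_closed[OF g] N.inv_op_closed1[OF h g]])
    moreover have "group_comm G g h = inv g \<otimes> (inv h \<otimes> g \<otimes> h)"
      using g h by (simp add: group_comm_def m_assoc upper_central_closed)
    ultimately show ?thesis by simp
  qed
  then show "g \<in> upper_central G (Suc i)" using g by (simp add: mem_upper_central_Suc upper_central_closed del: upper_central.simps)
qed

lemma upper_central_mono: "i \<le> j \<Longrightarrow> upper_central G i \<subseteq> upper_central G j"
  using upper_central_mono_Suc by (rule lift_Suc_mono_le)

end

lemma (in group_hom) hom_group_comm: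
  "x \<in> carrier G \<Longrightarrow> y \<in> carrier G \<Longrightarrow> h (group_comm G x y) = group_comm H (h x) (h y)"
  by (simp add: group_comm_def)

lemma (in group_hom) hom_relation:
  assumes "x \<in> carrier G" "y \<in> carrier G" "group_conj G x (group_comm G x y) = x [^]\<^bsub>G\<^esub> (\<alpha> :: int)"
  shows "group_conj H (h x) (group_comm H (h x) (h y)) = h x [^]\<^bsub>H\<^esub> \<alpha>"
proof -
  have "h (group_conj G x (group_comm G x y)) = h (x [^]\<^bsub>G\<^esub> \<alpha>)" unfolding assms(3) ..
  then show ?thesis using assms(1,2) by (simp add: group_conj_def hom_int_pow flip: hom_group_comm)
qed

text \<open>An isomorphism maps commutators to commutators. Later this carries an isomorphism
  between groups J1 over to the quotients by their centres.\<close>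

lemma iso_upper_central:
  assumes G: "group G" and H: "group H" and f: "f \<in> iso G H"
  shows "f ` upper_central G i = upper_central H i"
proof (induction i)
  interpret f: group_hom G H f
    using G H f by (simp add: group_hom_def group_hom_axioms_def iso_def)
  case 0
  show ?case by simp
next
  interpret f: group_hom G H f
    using G H f by (simp add: group_hom_def group_hom_axioms_def iso_def)
  case (Suc i)
  have inj: "inj_on f (carrier G)" and surj: "f ` carrier G = carrier H"
    using f by (auto simp: iso_def bij_betw_def)
  have *: "f x \<in> upper_central H i \<longleftrightarrow> x \<in> upper_central G i" if "x \<in> carrier G" for x
    using that inj f.G.upper_central_subset[of i] by (auto simp flip: Suc simp: inj_on_image_mem_iff)
  have "f g \<in> upper_central H (Suc i) \<longleftrightarrow> g \<in> upper_central G (Suc i)" if g: "g \<in> carrier G" for g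
    unfolding f.G.mem_upper_central_Suc f.H.mem_upper_central_Suc
    unfolding surj[symmetric] using g by (simp add: * flip: f.hom_group_comm)
  then show ?case
    using f.G.upper_central_subset[of "Suc i"] f.H.upper_central_subset[of "Suc i"]
    unfolding surj[symmetric] by (auto simp del: upper_central.simps)
qed

lemma FactGroup_iso_of_hom:
  assumes G: "group G" and H: "group H" and f: "f \<in> hom G H" "f ` carrier G = carrier H"
    and N: "N = {x \<in> carrier G. f x = \<one>\<^bsub>H\<^esub>}"
  shows "G Mod N \<cong> H"
proof -
  interpret f: group_hom G H f
    using G H f by (simp add: group_hom_def group_hom_axioms_def)
  show ?thesis using f.FactGroup_iso[OF f(2)] by (simp add: kernel_def N)
qed

lemma iso_Mod_iso:
  assumes G: "group G" and H: "group H" and f: "f \<in> iso G H" and N: "N \<lhd> G" "f ` N \<lhd> H"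
  shows "G Mod N \<cong> H Mod (f ` N)"
proof -
  interpret N: normal N G by fact
  interpret M: normal "f ` N" H by fact
  interpret f: group_hom G H f
    using G H f by (simp add: group_hom_def group_hom_axioms_def iso_def)
  interpret r: group_hom H "H Mod (f ` N)" "\<lambda>x. f ` N #>\<^bsub>H\<^esub> x"
    by (rule M.group_hom_rcos)
  have inj: "inj_on f (carrier G)" and surj: "f ` carrier G = carrier H"
    using f by (auto simp: iso_def bij_betw_def)
  show ?thesis
  proof (rule FactGroup_iso_of_hom)
    show "(\<lambda>x. f ` N #>\<^bsub>H\<^esub> f x) \<in> hom G (H Mod (f ` N))"
      by (auto intro!: homI simp del: mult_FactGroup)
    show "(\<lambda>x. f ` N #>\<^bsub>H\<^esub> f x) ` carrier G = carrier (H Mod (f ` N))"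
      by (simp add: carrier_FactGroup flip: surj image_image)
    show "N = {x \<in> carrier G. f ` N #>\<^bsub>H\<^esub> f x = \<one>\<^bsub>H Mod f ` N\<^esub>}"
    proof -
      have "f ` N #>\<^bsub>H\<^esub> f x = \<one>\<^bsub>H Mod f ` N\<^esub> \<longleftrightarrow> x \<in> N" if "x \<in> carrier G" for x
        using that M.rcos_eq_self_iff[of "f x"] inj_on_image_mem_iff[OF inj that N.subset] by simp
      then show ?thesis using N.subset by blast
    qed
  qed (auto intro: G M.factorgroup_is_group)
qed

text \<open>The series of the quotient by the centre is the original one shifted by one step; this
  is how facts about J1 become facts about H1.\<close>

lemma (in group) upper_central_Mod:
  "upper_central (G Mod upper_central G (Suc 0)) i
     = (\<lambda>x. upper_central G (Suc 0) #> x) ` upper_central G (Suc i)"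
proof (induction i)
  interpret N: normal "upper_central G (Suc 0)" G by (rule upper_central_normal)
  case 0
  have "upper_central G (Suc 0) #> x = upper_central G (Suc 0)" if "x \<in> upper_central G (Suc 0)" for x
    using that N.rcos_eq_self_iff[of x] N.mem_carrier by blast
  then have "(\<lambda>x. upper_central G (Suc 0) #> x) ` upper_central G (Suc 0)
      = (\<lambda>_. upper_central G (Suc 0)) ` upper_central G (Suc 0)"
    by (intro image_cong HOL.refl)
  also have "\<dots> = {upper_central G (Suc 0)}" by (rule image_constant[OF N.one_closed])
  finally have "(\<lambda>x. upper_central G (Suc 0) #> x) ` upper_central G (Suc 0) = {upper_central G (Suc 0)}" .
  then show ?case by (simp only: upper_central.simps(1) one_FactGroup)
next
  interpret N: normal "upper_central G (Suc 0)" G by (rule upper_central_normal)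
  interpret r: group_hom G "G Mod upper_central G (Suc 0)" "\<lambda>x. upper_central G (Suc 0) #> x"
    by (rule N.group_hom_rcos)
  let ?r = "\<lambda>x. upper_central G (Suc 0) #> x"
  case (Suc i)
  interpret M: normal "upper_central G (Suc i)" G by (rule upper_central_normal)
  have sub: "upper_central G (Suc 0) \<subseteq> upper_central G (Suc i)" by (rule upper_central_mono) simp
  have *: "?r x \<in> upper_central (G Mod upper_central G (Suc 0)) i \<longleftrightarrow> x \<in> upper_central G (Suc i)"
    if x: "x \<in> carrier G" for x
  proof
    assume "?r x \<in> upper_central (G Mod upper_central G (Suc 0)) i"
    then obtain y where y: "y \<in> upper_central G (Suc i)" "?r x = ?r y"
      unfolding Suc by blast
    then have "inv y \<otimes> x \<in> upper_central G (Suc i)"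
      using x M.mem_carrier N.rcos_eq_iff[of x y] sub by blast
    then have "y \<otimes> (inv y \<otimes> x) \<in> upper_central G (Suc i)" using y(1) by (rule M.m_closed[rotated])
    then show "x \<in> upper_central G (Suc i)" using x y(1) M.mem_carrier by (simp flip: m_assoc del: upper_central.simps)
  qed (simp add: Suc del: upper_central.simps)
  have c: "carrier (G Mod upper_central G (Suc 0)) = ?r ` carrier G" by (rule carrier_FactGroup)
  have "?r g \<in> upper_central (G Mod upper_central G (Suc 0)) (Suc i) \<longleftrightarrow> g \<in> upper_central G (Suc (Suc i))"
    if g: "g \<in> carrier G" for g
    unfolding r.H.mem_upper_central_Suc mem_upper_central_Suc[of g "Suc i"] c
    using g by (simp add: * flip: r.hom_group_comm del: upper_central.simps)
  then show ?case
    using upper_central_subset[of "Suc (Suc i)"] r.H.upper_central_subset[of "Suc i"]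
    unfolding c by (auto simp del: upper_central.simps)
qed

text \<open>Surjections in both directions make the orders equal, so the homomorphism is injective
  and no kernel has to be computed.\<close>

lemma finite_iso_of_surj_homs:
  assumes "finite (carrier G)" "finite (carrier H)"
    and f: "f \<in> hom G H" "f ` carrier G = carrier H" and g: "g ` carrier H = carrier G"
  shows "G \<cong> H"
proof -
  have "card (carrier H) \<le> card (carrier G)" using f(2) assms(1) by (metis card_image_le)
  moreover have "card (carrier G) \<le> card (carrier H)" using g assms(2) by (metis card_image_le)
  ultimately have "inj_on f (carrier G)" using f(2) assms(1) by (intro eq_card_imp_inj_on) auto
  then show ?thesis using f by (auto simp: is_iso_def iso_def bij_betw_def)
qed

text \<open>Here g is a complete invariant. As f may produce the same group from several indices, a
  class is described as the image under f of a fibre of g in the index set.\<close>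

lemma card_iso_classes:
  assumes "\<And>a. a \<in> I \<Longrightarrow> group (f a)"
    and iso: "\<And>a b. a \<in> I \<Longrightarrow> b \<in> I \<Longrightarrow> f a \<cong> f b \<longleftrightarrow> g a = g b"
  shows "card (iso_classes (f ` I)) = card (g ` I)"
proof -
  let ?S = "f ` I"
  let ?R = "{(G, H). G \<in> ?S \<and> H \<in> ?S \<and> G \<cong> H}"
  have cls: "?R `` {f a} = f ` {b \<in> I. g a = g b}" if "a \<in> I" for a
    using that iso by auto
  have "bij_betw (\<lambda>c. f ` {b \<in> I. c = g b}) (g ` I) (?S // ?R)"
  proof (rule bij_betwI')
    fix c d assume "c \<in> g ` I" "d \<in> g ` I"
    then obtain a b where ab: "a \<in> I" "b \<in> I" "c = g a" "d = g b" by blast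
    show "f ` {b \<in> I. c = g b} = f ` {b \<in> I. d = g b} \<longleftrightarrow> c = d"
    proof
      assume "f ` {b \<in> I. c = g b} = f ` {b \<in> I. d = g b}"
      then have "f a \<in> f ` {b \<in> I. d = g b}" using ab by blast
      then obtain a' where a': "a' \<in> I" "d = g a'" "f a = f a'" by blast
      then have "f a \<cong> f a'" by simp
      then have "g a = g a'" using a' ab iso by blast
      then show "c = d" using a' ab by simp
    qed simp
  next
    fix c assume "c \<in> g ` I"
    then obtain a where a: "a \<in> I" "c = g a" by blast
    show "f ` {b \<in> I. c = g b} \<in> ?S // ?R"
      using cls[OF a(1)] a by (auto simp: quotient_def)
  next
    fix E assume E: "E \<in> (f ` I) // {(G, H). G \<in> f ` I \<and> H \<in> f ` I \<and> G \<cong> H}"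
    then obtain a where a: "a \<in> I" "E = ?R `` {f a}" by (auto simp: quotient_def)
    have "E = f ` {b \<in> I. g a = g b}" unfolding a(2) by (rule cls[OF a(1)])
    with a(1) show "\<exists>c\<in>g ` I. E = f ` {b \<in> I. c = g b}" by (intro bexI[of _ "g a"] imageI)
  qed
  then show ?thesis unfolding iso_classes_def by (rule bij_betw_same_card[symmetric])
qed

declare upper_central.simps(2) [simp del]

lemma (in group) rcos_mem_upper_central_Mod:
  assumes x: "x \<in> carrier G"
  shows "upper_central G (Suc 0) #> x \<in> upper_central (G Mod upper_central G (Suc 0)) i \<longleftrightarrow> x \<in> upper_central G (Suc i)"
proof
  interpret N: normal "upper_central G (Suc 0)" G by (rule upper_central_normal)
  interpret M: normal "upper_central G (Suc i)" G by (rule upper_central_normal)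
  assume "upper_central G (Suc 0) #> x \<in> upper_central (G Mod upper_central G (Suc 0)) i"
  then obtain y where y: "y \<in> upper_central G (Suc i)" "upper_central G (Suc 0) #> x = upper_central G (Suc 0) #> y"
    unfolding upper_central_Mod[of i, simplified One_nat_def] by blast
  have "inv y \<otimes> x \<in> upper_central G (Suc 0)"
    using N.rcos_eq_iff[OF x M.mem_carrier[OF y(1)]] y(2) by blast
  then have "inv y \<otimes> x \<in> upper_central G (Suc i)"
    using upper_central_mono[of "Suc 0" "Suc i"] by blast
  then have "y \<otimes> (inv y \<otimes> x) \<in> upper_central G (Suc i)" using y(1) by (rule M.m_closed[rotated])
  then show "x \<in> upper_central G (Suc i)" using x M.mem_carrier[OF y(1)] by (simp flip: m_assoc)
qed (simp add: upper_central_Mod[simplified One_nat_def])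

text \<open>Meant for the factors beyond the end of the series, which the quantifier over all i
  includes.\<close>

lemma trivial_Mod_iso:
  assumes G: "group G" and H: "group H"
  shows "G Mod carrier G \<cong> H Mod carrier H"
proof (rule FactGroup_iso_of_hom[OF G])
  interpret G: group G by fact
  interpret H: group H by fact
  interpret N: normal "carrier H" H using H.normal_self .
  show "group (H Mod carrier H)" by (rule N.factorgroup_is_group)
  interpret Q: group "H Mod carrier H" by (rule N.factorgroup_is_group)
  have c: "carrier (H Mod carrier H) = {carrier H}"
    unfolding carrier_FactGroup using N.rcos_eq_self_iff H.one_closed by blast
  show "(\<lambda>_. carrier H) \<in> hom G (H Mod carrier H)"
    using Q.l_one[of "carrier H"] by (intro homI) (simp_all add: c del: mult_FactGroup)
  show "(\<lambda>_. carrier H) ` carrier G = carrier (H Mod carrier H)"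
    unfolding c by (rule image_constant[OF G.one_closed])
qed auto

lemma (in group) upper_central_factor_group:
  "i \<le> j \<Longrightarrow> upper_central G i \<lhd> G\<lparr>carrier := upper_central G j\<rparr>"
  using normal_restrict_supergroup[OF normal_imp_subgroup[OF upper_central_normal] upper_central_normal upper_central_mono] .

lemma (in group) subgroup_upper_central: "subgroup (upper_central G i) G"
  by (rule normal_imp_subgroup[OF upper_central_normal])

lemma iso_restrict_carrier:
  assumes f: "f \<in> iso (G\<lparr>carrier := A\<rparr>) (H\<lparr>carrier := B\<rparr>)" and "A' \<subseteq> A" "f ` A' = B'"
  shows "f \<in> iso (G\<lparr>carrier := A'\<rparr>) (H\<lparr>carrier := B'\<rparr>)"
proof -
  have "inj_on f A'" using f assms(2) by (auto simp: iso_def bij_betw_def intro: inj_on_subset)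
  then show ?thesis using f assms(2,3) by (auto simp: iso_def bij_betw_def hom_def subset_iff)
qed

text \<open>One isomorphism of the last proper terms that matches all smaller terms settles every
  term and every factor but the last nontrivial one. That one is supplied by \<open>quot\<close>, so
  f need not extend to the whole group.\<close>

lemma isomorphic_upper_central_seriesI:
  assumes G: "group G" and H: "group H"
    and f: "f \<in> iso (G\<lparr>carrier := upper_central G n\<rparr>) (H\<lparr>carrier := upper_central H n\<rparr>)"
    and fi: "\<And>i. i \<le> n \<Longrightarrow> f ` upper_central G i = upper_central H i"
    and proper: "upper_central G n \<noteq> carrier G" "upper_central H n \<noteq> carrier H"
    and top: "upper_central G (Suc n) = carrier G" "upper_central H (Suc n) = carrier H"
    and quot: "G Mod upper_central G n \<cong> H Mod upper_central H n"
  shows "isomorphic_upper_central_series G H"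
proof -
  interpret G: group G by fact
  interpret H: group H by fact
  have small: "upper_central G i \<noteq> carrier G" "upper_central H i \<noteq> carrier H" if "i \<le> n" for i
    using G.upper_central_mono[OF that] H.upper_central_mono[OF that] proper
      G.upper_central_subset[of n] H.upper_central_subset[of n] by auto
  have large: "upper_central G i = carrier G" "upper_central H i = carrier H" if "i > n" for i
    using G.upper_central_mono[of "Suc n" i] H.upper_central_mono[of "Suc n" i] that top
      G.upper_central_subset[of i] H.upper_central_subset[of i] by auto
  have restrict: "f \<in> iso (G\<lparr>carrier := upper_central G i\<rparr>) (H\<lparr>carrier := upper_central H i\<rparr>)" if "i \<le> n" for i
    by (rule iso_restrict_carrier[OF f G.upper_central_mono[OF that] fi[OF that]])
  have factor: "upper_central_factor G i \<cong> upper_central_factor H i" for i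
  proof (cases i n rule: linorder_cases)
    case less
    have "G\<lparr>carrier := upper_central G (Suc i)\<rparr> Mod upper_central G i \<cong>
      H\<lparr>carrier := upper_central H (Suc i)\<rparr> Mod (f ` upper_central G i)"
    proof (rule iso_Mod_iso)
      show "group (G\<lparr>carrier := upper_central G (Suc i)\<rparr>)" "group (H\<lparr>carrier := upper_central H (Suc i)\<rparr>)"
        by (simp_all add: G.subgroup_upper_central H.subgroup_upper_central G.subgroup_imp_group H.subgroup_imp_group)
      show "f \<in> iso (G\<lparr>carrier := upper_central G (Suc i)\<rparr>) (H\<lparr>carrier := upper_central H (Suc i)\<rparr>)"
        using less by (intro restrict) simp
      show "upper_central G i \<lhd> G\<lparr>carrier := upper_central G (Suc i)\<rparr>"
        by (rule G.upper_central_factor_group) simp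
      show "f ` upper_central G i \<lhd> H\<lparr>carrier := upper_central H (Suc i)\<rparr>"
        unfolding fi[OF less_imp_le[OF less]] by (rule H.upper_central_factor_group) simp
    qed
    then show ?thesis using fi[of i] less by (simp add: upper_central_factor_def)
  next
    case equal
    then show ?thesis using quot by (simp add: upper_central_factor_def top)
  next
    case greater
    then show ?thesis using trivial_Mod_iso[OF G H] by (simp add: upper_central_factor_def large)
  qed
  show ?thesis
    unfolding isomorphic_upper_central_series_def
  proof (intro conjI allI impI factor)
    fix i
    show "upper_central G i \<noteq> carrier G \<longleftrightarrow> upper_central H i \<noteq> carrier H"
      using small[of i] large[of i] by (cases "i \<le> n") auto
    assume "upper_central G i \<noteq> carrier G"
    then have "i \<le> n" using large(1)[of i] by (cases "i \<le> n") auto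
    then show "G\<lparr>carrier := upper_central G i\<rparr> \<cong> H\<lparr>carrier := upper_central H i\<rparr>"
      using restrict by (auto simp: is_iso_def)
  qed
qed

text \<open>An instance of the third isomorphism theorem; it identifies the last factor of the
  shifted series.\<close>

lemma (in group) Mod_upper_central_Mod_iso:
  "G Mod upper_central G (Suc n) \<cong>
   (G Mod upper_central G (Suc 0)) Mod upper_central (G Mod upper_central G (Suc 0)) n"
proof -
  let ?Z = "upper_central G (Suc 0)"
  interpret N: normal ?Z G by (rule upper_central_normal)
  interpret r: group_hom G "G Mod ?Z" "\<lambda>x. ?Z #> x" by (rule N.group_hom_rcos)
  interpret M: normal "upper_central (G Mod ?Z) n" "G Mod ?Z" by (rule r.H.upper_central_normal)
  interpret s: group_hom "G Mod ?Z" "(G Mod ?Z) Mod upper_central (G Mod ?Z) n"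
    "\<lambda>x. upper_central (G Mod ?Z) n #>\<^bsub>G Mod ?Z\<^esub> x" by (rule M.group_hom_rcos)
  let ?h = "\<lambda>x. upper_central (G Mod ?Z) n #>\<^bsub>G Mod ?Z\<^esub> (?Z #> x)"
  show ?thesis
  proof (rule FactGroup_iso_of_hom)
    show "?h \<in> hom G ((G Mod ?Z) Mod upper_central (G Mod ?Z) n)"
      by (rule homI) (simp_all only: r.hom_mult s.hom_mult r.hom_closed s.hom_closed)
    show "?h ` carrier G = carrier ((G Mod ?Z) Mod upper_central (G Mod ?Z) n)"
      by (simp only: carrier_FactGroup image_image)
    show "upper_central G (Suc n) = {x \<in> carrier G. ?h x = \<one>\<^bsub>(G Mod ?Z) Mod upper_central (G Mod ?Z) n\<^esub>}"
      using upper_central_subset[of "Suc n"] M.rcos_eq_self_iff[OF r.hom_closed] rcos_mem_upper_central_Mod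
      by auto
  qed (rule is_group s.H.is_group)+
qed

lemma (in group) upper_central_Mod_proper:
  assumes "upper_central G (Suc n) \<noteq> carrier G"
  shows "upper_central (G Mod upper_central G (Suc 0)) n \<noteq> carrier (G Mod upper_central G (Suc 0))"
proof -
  obtain g where g: "g \<in> carrier G" "g \<notin> upper_central G (Suc n)"
    using assms upper_central_subset[of "Suc n"] by blast
  then have "upper_central G (Suc 0) #> g \<notin> upper_central (G Mod upper_central G (Suc 0)) n"
    using rcos_mem_upper_central_Mod[OF g(1)] by simp
  moreover have "upper_central G (Suc 0) #> g \<in> carrier (G Mod upper_central G (Suc 0))"
    unfolding carrier_FactGroup using g(1) by (rule imageI)
  ultimately show ?thesis by metis
qed

text \<open>The preceding criterion, moved to the quotients by the centres. Since f matches the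
  centres, it takes cosets to cosets, and the induced isomorphism is simply the formation of images
  under f.\<close>

lemma isomorphic_upper_central_series_ModI:
  assumes G: "group G" and H: "group H"
    and f: "f \<in> iso (G\<lparr>carrier := upper_central G (Suc n)\<rparr>) (H\<lparr>carrier := upper_central H (Suc n)\<rparr>)"
    and fi: "\<And>i. i \<le> Suc n \<Longrightarrow> f ` upper_central G i = upper_central H i"
    and proper: "upper_central G (Suc n) \<noteq> carrier G" "upper_central H (Suc n) \<noteq> carrier H"
    and top: "upper_central G (Suc (Suc n)) = carrier G" "upper_central H (Suc (Suc n)) = carrier H"
    and quot: "G Mod upper_central G (Suc n) \<cong> H Mod upper_central H (Suc n)"
  shows "isomorphic_upper_central_series (G Mod upper_central G (Suc 0)) (H Mod upper_central H (Suc 0))"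
proof -
  interpret G: group G by fact
  interpret H: group H by fact
  let ?Y = "upper_central G (Suc 0)" and ?Z = "upper_central H (Suc 0)"
  interpret Y: normal ?Y G by (rule G.upper_central_normal)
  interpret Z: normal ?Z H by (rule H.upper_central_normal)
  interpret r: group_hom G "G Mod ?Y" "\<lambda>x. ?Y #>\<^bsub>G\<^esub> x" by (rule Y.group_hom_rcos)
  interpret s: group_hom H "H Mod ?Z" "\<lambda>x. ?Z #>\<^bsub>H\<^esub> x" by (rule Z.group_hom_rcos)
  let ?A = "upper_central G (Suc n)" and ?B = "upper_central H (Suc n)"
  interpret A: subgroup ?A G by (rule G.subgroup_upper_central)
  interpret B: subgroup ?B H by (rule H.subgroup_upper_central)
  have fmult: "f (x \<otimes>\<^bsub>G\<^esub> y) = f x \<otimes>\<^bsub>H\<^esub> f y" if "x \<in> ?A" "y \<in> ?A" for x y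
    using f that by (auto simp: iso_def hom_def)
  have inj: "inj_on f ?A" using f by (auto simp: iso_def bij_betw_def)
  have fB: "f x \<in> ?B" if "x \<in> ?A" for x using fi[of "Suc n"] that by blast
  have YA: "?Y \<subseteq> ?A" by (rule G.upper_central_mono) simp
  have img: "f ` (?Y #>\<^bsub>G\<^esub> x) = ?Z #>\<^bsub>H\<^esub> f x" if x: "x \<in> ?A" for x
  proof -
    have "f ` (?Y #>\<^bsub>G\<^esub> x) = (\<lambda>y. f (y \<otimes>\<^bsub>G\<^esub> x)) ` ?Y" unfolding r_coset_def by blast
    also have "\<dots> = (\<lambda>y. f y \<otimes>\<^bsub>H\<^esub> f x) ` ?Y"
      using fmult x YA by (intro image_cong HOL.refl) blast
    also have "\<dots> = (\<lambda>z. z \<otimes>\<^bsub>H\<^esub> f x) ` (f ` ?Y)" by (simp only: image_image)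
    also have "\<dots> = ?Z #>\<^bsub>H\<^esub> f x" using fi[of "Suc 0"] unfolding r_coset_def by auto
    finally show ?thesis .
  qed
  have Un: "upper_central (G Mod ?Y) i = (\<lambda>x. ?Y #>\<^bsub>G\<^esub> x) ` upper_central G (Suc i)"
    "upper_central (H Mod ?Z) i = (\<lambda>x. ?Z #>\<^bsub>H\<^esub> x) ` upper_central H (Suc i)" for i
    by (rule G.upper_central_Mod[simplified One_nat_def] H.upper_central_Mod[simplified One_nat_def])+
  have fU: "(`) f ` upper_central (G Mod ?Y) i = upper_central (H Mod ?Z) i" if "i \<le> n" for i
  proof -
    have sub: "upper_central G (Suc i) \<subseteq> ?A" using that by (intro G.upper_central_mono) simp
    have "(`) f ` upper_central (G Mod ?Y) i = (\<lambda>x. ?Z #>\<^bsub>H\<^esub> f x) ` upper_central G (Suc i)"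
      unfolding Un image_image using img sub by (intro image_cong HOL.refl) blast
    also have "\<dots> = (\<lambda>x. ?Z #>\<^bsub>H\<^esub> x) ` (f ` upper_central G (Suc i))" by (simp only: image_image)
    also have "\<dots> = upper_central (H Mod ?Z) i" using fi[of "Suc i"] that unfolding Un by simp
    finally show ?thesis .
  qed
  have mult: "f ` (S \<otimes>\<^bsub>G Mod ?Y\<^esub> T) = f ` S \<otimes>\<^bsub>H Mod ?Z\<^esub> f ` T"
    if "S \<in> upper_central (G Mod ?Y) n" "T \<in> upper_central (G Mod ?Y) n" for S T
  proof -
    obtain x y where xy: "x \<in> ?A" "y \<in> ?A" "S = ?Y #>\<^bsub>G\<^esub> x" "T = ?Y #>\<^bsub>G\<^esub> y"
      using \<open>S \<in> _\<close> \<open>T \<in> _\<close> unfolding Un by blast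
    have "f ` (S \<otimes>\<^bsub>G Mod ?Y\<^esub> T) = f ` (?Y #>\<^bsub>G\<^esub> (x \<otimes>\<^bsub>G\<^esub> y))"
      unfolding xy(3,4) using xy(1,2) A.mem_carrier by (simp only: Y.rcos_mult)
    also have "\<dots> = ?Z #>\<^bsub>H\<^esub> (f x \<otimes>\<^bsub>H\<^esub> f y)" using img[OF A.m_closed[OF xy(1,2)]] fmult[OF xy(1,2)] by simp
    also have "\<dots> = (?Z #>\<^bsub>H\<^esub> f x) \<otimes>\<^bsub>H Mod ?Z\<^esub> (?Z #>\<^bsub>H\<^esub> f y)"
      by (rule Z.rcos_mult[symmetric]) (intro B.mem_carrier fB xy)+
    also have "\<dots> = f ` S \<otimes>\<^bsub>H Mod ?Z\<^esub> f ` T" unfolding xy(3,4) img[OF xy(1)] img[OF xy(2)] ..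
    finally show ?thesis .
  qed
  have inj': "inj_on ((`) f) (upper_central (G Mod ?Y) n)"
  proof (rule inj_onI)
    fix S T assume "S \<in> upper_central (G Mod ?Y) n" "T \<in> upper_central (G Mod ?Y) n" and eq: "f ` S = f ` T"
    then have ST: "S \<in> (\<lambda>x. ?Y #>\<^bsub>G\<^esub> x) ` ?A" "T \<in> (\<lambda>x. ?Y #>\<^bsub>G\<^esub> x) ` ?A" unfolding Un by blast+
    \<comment> \<open>Both cosets lie in the set on which f is injective, so equal images force
      equal cosets.\<close>
    have "S \<subseteq> ?A" "T \<subseteq> ?A"
      using ST YA A.m_closed unfolding r_coset_def by blast+
    then show "S = T" using eq inj_on_image_eq_iff[OF inj] by blast
  qed
  show ?thesis
  proof (rule isomorphic_upper_central_seriesI)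
    show "(`) f \<in> iso ((G Mod ?Y)\<lparr>carrier := upper_central (G Mod ?Y) n\<rparr>) ((H Mod ?Z)\<lparr>carrier := upper_central (H Mod ?Z) n\<rparr>)"
    proof (rule isoI)
      show "(`) f \<in> hom ((G Mod ?Y)\<lparr>carrier := upper_central (G Mod ?Y) n\<rparr>) ((H Mod ?Z)\<lparr>carrier := upper_central (H Mod ?Z) n\<rparr>)"
      proof (rule homI)
        fix S assume "S \<in> carrier ((G Mod ?Y)\<lparr>carrier := upper_central (G Mod ?Y) n\<rparr>)"
        then show "f ` S \<in> carrier ((H Mod ?Z)\<lparr>carrier := upper_central (H Mod ?Z) n\<rparr>)"
          using fU[of n] by auto
      next
        fix S T assume "S \<in> carrier ((G Mod ?Y)\<lparr>carrier := upper_central (G Mod ?Y) n\<rparr>)"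
          "T \<in> carrier ((G Mod ?Y)\<lparr>carrier := upper_central (G Mod ?Y) n\<rparr>)"
        then show "f ` (S \<otimes>\<^bsub>(G Mod ?Y)\<lparr>carrier := upper_central (G Mod ?Y) n\<rparr>\<^esub> T) =
           f ` S \<otimes>\<^bsub>(H Mod ?Z)\<lparr>carrier := upper_central (H Mod ?Z) n\<rparr>\<^esub> f ` T"
          using mult[of S T] by simp
      qed
      show "bij_betw ((`) f) (carrier ((G Mod ?Y)\<lparr>carrier := upper_central (G Mod ?Y) n\<rparr>))
        (carrier ((H Mod ?Z)\<lparr>carrier := upper_central (H Mod ?Z) n\<rparr>))"
        using inj' fU[of n] by (simp add: bij_betw_def)
    qed
    show "(`) f ` upper_central (G Mod ?Y) i = upper_central (H Mod ?Z) i" if "i \<le> n" for i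
      using fU[OF that] .
    show "upper_central (G Mod ?Y) n \<noteq> carrier (G Mod ?Y)" "upper_central (H Mod ?Z) n \<noteq> carrier (H Mod ?Z)"
      by (rule G.upper_central_Mod_proper[OF proper(1)] H.upper_central_Mod_proper[OF proper(2)])+
    show "upper_central (G Mod ?Y) (Suc n) = carrier (G Mod ?Y)" "upper_central (H Mod ?Z) (Suc n) = carrier (H Mod ?Z)"
      unfolding carrier_FactGroup Un top by (rule HOL.refl)+
    show "(G Mod ?Y) Mod upper_central (G Mod ?Y) n \<cong> (H Mod ?Z) Mod upper_central (H Mod ?Z) n"
    proof -
      interpret Qn: normal "upper_central G (Suc n)" G by (rule G.upper_central_normal)
      have "(G Mod ?Y) Mod upper_central (G Mod ?Y) n \<cong> G Mod upper_central G (Suc n)"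
        by (rule group.iso_sym[OF Qn.factorgroup_is_group G.Mod_upper_central_Mod_iso])
      also have "\<dots> \<cong> H Mod upper_central H (Suc n)" by (rule quot)
      also have "\<dots> \<cong> (H Mod ?Z) Mod upper_central (H Mod ?Z) n" by (rule H.Mod_upper_central_Mod_iso)
      finally show ?thesis .
    qed
  qed (rule r.H.is_group s.H.is_group)+
qed

section \<open>Arithmetic modulo the cube of a prime power\<close>

definition tri :: "int \<Rightarrow> int" where "tri j = j * (j + 1) div 2"

text \<open>The binomial coefficient of j + 1 over 3, indexed so that
  \<open>tet (j + 1) = tet j + tri j\<close>. Being polynomials, both functions also serve negative
  exponents.\<close>

definition tet :: "int \<Rightarrow> int" where "tet j = (j - 1) * j * (j + 1) div 6"

lemma two_tri: "2 * tri j = j * (j + 1)"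
  by (simp add: tri_def)

lemma six_tet: "6 * tet j = (j - 1) * j * (j + 1)"
proof -
  have "3 dvd (j - 1) * j * (j + 1)"
  proof -
    have "j mod 3 = 0 \<or> j mod 3 = 1 \<or> j mod 3 = 2" by presburger
    then have "3 dvd j \<or> 3 dvd j - 1 \<or> 3 dvd j + 1" by presburger
    then show ?thesis by (auto intro: dvd_mult dvd_mult2)
  qed
  moreover have "2 dvd (j - 1) * j * (j + 1)" by simp
  ultimately have "2 * 3 dvd (j - 1) * j * (j + 1)" by (intro divides_mult) auto
  then show ?thesis by (simp add: tet_def)
qed

lemma tri_0 [simp]: "tri 0 = 0" "tri (-1) = 0" and tri_1 [simp]: "tri 1 = 1" "tri (-2) = 1"
  by (simp_all add: tri_def)

lemma tet_0 [simp]: "tet 0 = 0" "tet (-1) = 0" "tet 1 = 0"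
  by (simp_all add: tet_def)

lemma tri_plus1: "tri (j + 1) = tri j + j + 1"
  using two_tri[of j] two_tri[of "j + 1"] by (simp add: algebra_simps)

lemma tri_add: "tri (i + j) = tri i + tri j + i * j"
  using two_tri[of i] two_tri[of j] two_tri[of "i + j"] by (simp add: algebra_simps)

lemma tet_plus1: "tet (j + 1) = tet j + tri j"
  using six_tet[of j] six_tet[of "j + 1"] two_tri[of j] by (simp add: algebra_simps)

locale macdonald_numbers =
  fixes p m :: nat and l :: int
  assumes prime_p: "Factorial_Ring.prime p" and odd_p: "odd p" and m_pos: "m \<ge> 1"
    and adm: "admissible p m l"
begin

text \<open>Modulo \<open>q ^ 3\<close>, \<open>be\<close> is the inverse of \<open>al\<close>, and \<open>ee k\<close> and \<open>T j\<close> are polynomial forms of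
  \<open>al ^ k\<close> and of \<open>al + al ^ 2 + \<dots> + al ^ j\<close>.\<close>

definition q :: int where "q = int p ^ m"
definition w :: int where "w = q * l"
definition al :: int where "al = 1 + w"
definition be :: int where "be = 1 - w + w\<^sup>2"
definition ee :: "int \<Rightarrow> int" where "ee k = 1 + k * w + tri (k - 1) * w\<^sup>2"
definition T :: "int \<Rightarrow> int" where "T j = j + w * tri j + w\<^sup>2 * tet j"

lemma prime_ip: "Factorial_Ring.prime (int p)"
  using prime_p by simp

lemma not_dvd_l: "\<not> int p dvd l"
  using adm by (simp add: admissible_def)

lemma p_dvd_q: "int p dvd q"
  using m_pos by (simp add: q_def dvd_power)

lemma q_pos: "q > 0"
  using prime_p by (simp add: q_def prime_gt_0_nat)

lemma q_nz: "q \<noteq> 0" using q_pos by simp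

lemma coprime_q_iff: "coprime q x \<longleftrightarrow> \<not> int p dvd x"
proof -
  have "coprime q x \<longleftrightarrow> coprime (int p) x" using m_pos by (simp add: q_def)
  also have "\<dots> \<longleftrightarrow> \<not> int p dvd x"
    using prime_ip by (meson coprime_absorb_left not_prime_unit prime_imp_coprime)
  finally show ?thesis .
qed

lemma coprime_q_l: "coprime q l"
  using not_dvd_l coprime_q_iff by simp

lemma coprime_q_2: "coprime q 2"
proof -
  have "\<not> p dvd 2" using primes_dvd_imp_eq[of p 2] odd_p prime_p two_is_prime_nat by auto
  then have "\<not> int p dvd 2" using int_dvd_int_iff[of p 2] by simp
  then show ?thesis using coprime_q_iff by blast
qed

lemma coprime_q_3: "p \<noteq> 3 \<Longrightarrow> coprime q 3"
proof -
  assume "p \<noteq> 3"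
  then have "\<not> p dvd 3" using primes_dvd_imp_eq[of p 3] prime_p by auto
  then have "\<not> int p dvd 3" using int_dvd_int_iff[of p 3] by simp
  then show ?thesis using coprime_q_iff by blast
qed

lemma cancel2: "q ^ k dvd 2 * x \<Longrightarrow> q ^ k dvd x"
  using coprime_dvd_mult_right_iff[of "q ^ k" 2 x] coprime_q_2 coprime_power_left_iff by blast

lemma w_cube: "w ^ 3 = q ^ 3 * l ^ 3"
  by (simp add: w_def power_mult_distrib)

lemma w_sq: "w\<^sup>2 = q\<^sup>2 * l\<^sup>2"
  by (simp add: w_def power_mult_distrib)

text \<open>Cancelling the denominators of \<open>tri\<close> and \<open>tet\<close>: for \<open>p = 3\<close> the factor \<open>w\<close> makes up for the 3.\<close>

lemma cancel6:
  assumes "6 * d = 3 * q ^ k * x + w * q ^ k * y"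
  shows "q ^ k dvd d"
proof (cases "p = 3")
  case True
  have "int p dvd w" using p_dvd_q unfolding w_def by simp
  then have "3 dvd w" using True by simp
  then obtain z where z: "w = 3 * z" by blast
  have "2 * d = q ^ k * (x + z * y)" using assms by (simp add: z algebra_simps)
  then have "q ^ k dvd 2 * d" by simp
  then show ?thesis by (rule cancel2)
next
  case False
  have "6 * d = q ^ k * (3 * x + w * y)" using assms by (simp add: algebra_simps)
  then have "q ^ k dvd 2 * (3 * d)" by simp
  then have "q ^ k dvd 3 * d" by (rule cancel2)
  then show ?thesis
    using coprime_dvd_mult_right_iff[of "q ^ k" 3 d] coprime_q_3[OF False] coprime_power_left_iff by blast
qed

lemma ee_0 [simp]: "ee 0 = 1" and ee_1: "ee 1 = al" and ee_m1: "ee (-1) = be"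
  by (simp_all add: ee_def al_def be_def)

text \<open>\<open>ee k\<close> is the binomial expansion of (1 + w)^k cut off after the quadratic
  term, so the two sides differ by an exact multiple of \<open>w ^ 3\<close>.\<close>

lemma ee_add: "[ee (j + k) = ee j * ee k] (mod q ^ 3)"
proof -
  have tri: "tri (j + k - 1) = tri (j - 1) + tri (k - 1) + j * k"
    using two_tri[of "j + k - 1"] two_tri[of "j - 1"] two_tri[of "k - 1"] by (simp add: algebra_simps)
  have "ee j * ee k - ee (j + k) = w ^ 3 * (j * tri (k - 1) + k * tri (j - 1) + w * tri (j - 1) * tri (k - 1))"
    unfolding ee_def tri by (simp add: algebra_simps power2_eq_square power3_eq_cube)
  then have "q ^ 3 dvd ee j * ee k - ee (j + k)" unfolding w_cube by simp
  then show ?thesis by (simp add: cong_iff_dvd_diff dvd_diff_commute)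
qed

lemma ee_inv: "[ee k * ee (- k) = 1] (mod q ^ 3)"
  using ee_add[of k "-k"] by (simp add: cong_sym)

lemma T_0 [simp]: "T 0 = 0" and T_m1: "T (-1) = -1"
  by (simp_all add: T_def)

lemma T_step: "[T (j + 1) = (T j + 1) * al] (mod q ^ 3)"
proof -
  have "(T j + 1) * al - T (j + 1) = w ^ 3 * tet j"
    unfolding T_def al_def tri_plus1 tet_plus1 by (simp add: algebra_simps power2_eq_square power3_eq_cube)
  then have "q ^ 3 dvd (T j + 1) * al - T (j + 1)" unfolding w_cube by simp
  then show ?thesis by (simp add: cong_iff_dvd_diff dvd_diff_commute)
qed

lemma al_be: "[al * be = 1] (mod q ^ 3)"
  using ee_inv[of 1] by (simp add: ee_1 ee_m1)

text \<open>The exponent left on A when A^al is moved past B in two ways; see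
  \<open>a_kap_b_kap\<close>.\<close>

definition kap :: int where "kap = al * ee al - T al"

text \<open>Multiplication by 6 clears the denominators of \<open>tri\<close> and \<open>tet\<close>
  and makes \<open>kap\<close> an exact polynomial in \<open>w\<close>, with no congruence
  involved.\<close>

lemma kap_6: "6 * kap = w\<^sup>2 * (3 + 4 * w + 3 * w\<^sup>2 + 2 * w ^ 3)"
proof -
  have "6 * kap = 6 * al + 6 * al * al * w + 3 * al * (2 * tri (al - 1)) * w\<^sup>2 - 6 * al - 3 * w * (2 * tri al) - w\<^sup>2 * (6 * tet al)"
    unfolding kap_def ee_def T_def by (simp add: algebra_simps)
  also have "\<dots> = w\<^sup>2 * (3 + 4 * w + 3 * w\<^sup>2 + 2 * w ^ 3)"
    unfolding two_tri six_tet al_def by (simp add: algebra_simps power2_eq_square power3_eq_cube)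
  finally show ?thesis .
qed

text \<open>In the same comparison B receives this differently shaped exponent. Both expressions
  have the leading term w^2 / 2, and what separates them is a multiple of q^3.\<close>

lemma kap_swap: "[be * (T (- al) + al) = kap] (mod q ^ 3)"
proof -
  have "6 * (T (- al) + al) = 3 * w * (2 * tri (- al)) + w\<^sup>2 * (6 * tet (- al))"
    unfolding T_def by (simp add: algebra_simps)
  also have "\<dots> = 3 * w\<^sup>2 + w ^ 3 - 3 * w ^ 4 - w ^ 5"
    unfolding two_tri six_tet al_def by (simp add: algebra_simps power2_eq_square power3_eq_cube eval_nat_numeral)
  finally have *: "6 * (T (- al) + al) = 3 * w\<^sup>2 + w ^ 3 - 3 * w ^ 4 - w ^ 5" .
  have "6 * (be * (T (- al) + al) - kap) = be * (6 * (T (- al) + al)) - 6 * kap" by (simp add: algebra_simps)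
  also have "\<dots> = w ^ 3 * (- 6) + w * w ^ 3 * (- 4 + w - 2 * w\<^sup>2 - w * w\<^sup>2)"
    unfolding * kap_6 be_def by (simp add: algebra_simps power2_eq_square power3_eq_cube eval_nat_numeral)
  also have "\<dots> = 3 * q ^ 3 * (- 2 * l ^ 3) + w * q ^ 3 * (l ^ 3 * (- 4 + w - 2 * w\<^sup>2 - w * w\<^sup>2))"
    unfolding w_cube by (simp add: algebra_simps)
  finally have "q ^ 3 dvd be * (T (- al) + al) - kap" by (rule cancel6)
  then show ?thesis by (simp add: cong_iff_dvd_diff)
qed

text \<open>Admissibility enters here. With kap = q^2 x, the integer x is l^2 / 2 modulo p if p > 3.
  For p = 3 the term 4 w counts as well after division by 3, and the condition on l keeps x prime to
  3 when m = 1.\<close>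

lemma kap_unit: obtains Y where "[kap * Y = q\<^sup>2] (mod q ^ 3)"
proof -
  have "q ^ 2 dvd kap"
  proof (rule cancel6)
    have "6 * kap = 3 * w\<^sup>2 + w * w\<^sup>2 * (4 + 3 * w + 2 * (w * w))"
      unfolding kap_6 by (simp add: algebra_simps power2_eq_square power3_eq_cube)
    then show "6 * kap = 3 * q ^ 2 * l\<^sup>2 + w * q ^ 2 * (l\<^sup>2 * (4 + 3 * w + 2 * (w * w)))"
      unfolding w_sq by (simp only: mult.assoc)
  qed
  then obtain x where x: "kap = q\<^sup>2 * x" by blast
  have x6: "6 * x = l\<^sup>2 * (3 + 4 * w + 3 * w\<^sup>2 + 2 * w ^ 3)"
  proof -
    have "q\<^sup>2 * (6 * x) = q\<^sup>2 * (l\<^sup>2 * (3 + 4 * w + 3 * w\<^sup>2 + 2 * w ^ 3))"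
      using kap_6 by (simp add: x w_sq)
    then show ?thesis using q_nz by simp
  qed
  have "\<not> int p dvd x"
  proof
    assume px: "int p dvd x"
    have pw: "int p dvd w" using p_dvd_q by (simp add: w_def)
    show False
    proof (cases "p = 3")
      case False
      have "int p dvd l\<^sup>2 * 3 + w * (l\<^sup>2 * (4 + 3 * w + 2 * w\<^sup>2))"
        using dvd_mult[OF px, of 6] unfolding x6 by (simp add: algebra_simps power2_eq_square power3_eq_cube)
      then have "int p dvd l\<^sup>2 * 3" using pw by (metis dvd_add_left_iff dvd_mult2)
      moreover have "\<not> int p dvd 3" using coprime_q_3[OF False] coprime_q_iff by simp
      ultimately have "int p dvd l" using prime_ip by (metis prime_dvd_mult_iff prime_dvd_power)
      then show False using not_dvd_l by simp
    next
      case True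
      then obtain z where z: "w = 3 * z" using pw by (auto simp: True)
      have "2 * x = l\<^sup>2 * (1 + 4 * z + 3 * (3 * z\<^sup>2 + 6 * z ^ 3))"
        using x6 by (simp add: z algebra_simps power2_eq_square power3_eq_cube)
      moreover have "3 dvd x" using px True by simp
      ultimately have "3 dvd l\<^sup>2 * (1 + 4 * z + 3 * (3 * z\<^sup>2 + 6 * z ^ 3))" by (metis dvd_mult)
      then have or: "3 dvd l\<^sup>2 \<or> 3 dvd (1 + 4 * z + 3 * (3 * z\<^sup>2 + 6 * z ^ 3))"
        using prime_ip True by (simp add: prime_dvd_mult_iff)
      have "\<not> 3 dvd l" using not_dvd_l True by simp
      moreover have "Factorial_Ring.prime (3 :: int)" using prime_ip True by simp
      ultimately have "\<not> 3 dvd l\<^sup>2" using prime_dvd_power by blast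
      with or have *: "3 dvd (1 + 4 * z + 3 * (3 * z\<^sup>2 + 6 * z ^ 3))" by simp
      then have **: "3 dvd 1 + 4 * z" by (metis dvd_add_left_iff dvd_triv_left)
      \<comment> \<open>For m = 1 one has z = l, and 1 + 4 l vanishes modulo 3 only for l = 2, the
        excluded residue; for m > 1 the number z is itself divisible by 3.\<close>
      show False
      proof (cases "m = 1")
        case m1: True
        have "3 * z = int p ^ m * l" using z by (simp only: w_def q_def)
        then have "z = l" using m1 True by simp
        moreover have "[l = 1] (mod 3)" using adm True m1 by (simp add: admissible_def)
        ultimately show False using ** by (simp add: cong_def) presburger
      next
        case False
        then have "9 dvd q" using m_pos True le_imp_power_dvd[of 2 m "3::int"] unfolding q_def by simp
        then have "9 dvd w" by (simp add: w_def)
        then have "3 dvd z" using z by presburger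
        then show False using ** by presburger
      qed
    qed
  qed
  then have "coprime q x" by (simp add: coprime_q_iff)
  \<comment> \<open>An inverse modulo q is enough, since \<open>kap\<close> already carries the
    factor q^2.\<close>
  then obtain y where "[x * y = 1] (mod q)" by (metis cong_solve_coprime_int coprime_commute)
  then have "q dvd x * y - 1" by (simp add: cong_iff_dvd_diff)
  then have "q\<^sup>2 * q dvd q\<^sup>2 * (x * y - 1)" by (rule mult_dvd_mono[OF dvd_refl])
  then have "[kap * y = q\<^sup>2] (mod q ^ 3)"
    by (simp add: x cong_iff_dvd_diff power2_eq_square power3_eq_cube algebra_simps)
  then show thesis by (rule that)
qed

lemma T_q2: "[T (q\<^sup>2 * j) = q\<^sup>2 * j] (mod q ^ 3)"
proof -
  have "6 * (T (q\<^sup>2 * j) - q\<^sup>2 * j) = 3 * w * (2 * tri (q\<^sup>2 * j)) + w\<^sup>2 * (6 * tet (q\<^sup>2 * j))"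
    unfolding T_def by (simp add: algebra_simps)
  also have "\<dots> = 3 * q ^ 3 * (l * j * (q\<^sup>2 * j + 1)) + w * q ^ 3 * (l * j * ((q\<^sup>2 * j - 1) * (q\<^sup>2 * j + 1)))"
    unfolding two_tri six_tet by (simp add: w_def algebra_simps power2_eq_square power3_eq_cube)
  finally have "q ^ 3 dvd T (q\<^sup>2 * j) - q\<^sup>2 * j" by (rule cancel6)
  then show ?thesis by (simp add: cong_iff_dvd_diff)
qed

lemma ee_q2: "[ee (q\<^sup>2 * j) = 1] (mod q ^ 3)"
proof -
  have "2 * (ee (q\<^sup>2 * j) - 1) = 2 * q\<^sup>2 * j * w + (2 * tri (q\<^sup>2 * j - 1)) * w\<^sup>2"
    unfolding ee_def by (simp add: algebra_simps)
  also have "\<dots> = q ^ 3 * (2 * j * l + (q\<^sup>2 * j - 1) * q * j * l\<^sup>2)"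
    unfolding two_tri w_def by (simp add: algebra_simps power2_eq_square power3_eq_cube)
  finally have "q ^ 3 dvd 2 * (ee (q\<^sup>2 * j) - 1)" by simp
  then have "q ^ 3 dvd ee (q\<^sup>2 * j) - 1" by (rule cancel2)
  then show ?thesis by (simp add: cong_iff_dvd_diff)
qed

end

section \<open>Normal forms\<close>

context group
begin

lemma int_pow_cong:
  assumes x: "x \<in> carrier G" and n: "x [^] (n :: int) = \<one>" and ij: "[i = j] (mod n)"
  shows "x [^] i = x [^] j"
proof -
  obtain k where "i - j = n * k" using ij unfolding cong_iff_dvd_diff by (elim dvdE)
  then have k: "i = j + n * k" by simp
  have "x [^] (n * k) = \<one>" using int_pow_pow[OF x, of n k] n by simp
  then show ?thesis using x by (simp add: k int_pow_mult)
qed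

lemma int_pow_conj:
  assumes "x \<in> carrier G" "g \<in> carrier G"
  shows "(inv g \<otimes> x \<otimes> g) [^] (i :: int) = inv g \<otimes> x [^] i \<otimes> g"
proof -
  interpret c: group_hom G G "\<lambda>x. inv g \<otimes> x \<otimes> g"
    by unfold_locales (use assms(2) in \<open>auto intro!: homI simp: m_assoc simp flip: m_assoc[of g "inv g"]\<close>)
  show ?thesis using c.hom_int_pow[OF assms(1)] by simp
qed

lemma int_pow_shift:
  assumes "x \<in> carrier G" "y \<in> carrier G" "g \<in> carrier G" "x \<otimes> g = g \<otimes> y"
  shows "x [^] (i :: int) \<otimes> g = g \<otimes> y [^] i"
proof -
  have y: "y = inv g \<otimes> x \<otimes> g" using assms by (simp add: m_assoc inv_solve_left)
  show ?thesis using assms unfolding y int_pow_conj[OF assms(1,3)] by (simp flip: m_assoc)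
qed

end

text \<open>Any group generated by two elements with these relations, not just J1: quotients of J1,
  and the same group with A and B exchanged, are instances too.\<close>

locale macdonald = macdonald_numbers p m l + group G
  for p m :: nat and l :: int and G :: "('a, 'b) monoid_scheme" (structure) +
  fixes A B :: 'a
  assumes A_closed [simp]: "A \<in> carrier G" and B_closed [simp]: "B \<in> carrier G"
    and rel_A: "group_conj G A (group_comm G A B) = A [^] (1 + int p ^ m * l)"
    and rel_B: "group_conj G B (group_comm G B A) = B [^] (1 + int p ^ m * l)"
    and pow_A: "A [^] (p ^ (3 * m)) = \<one>" and pow_B: "B [^] (p ^ (3 * m)) = \<one>"
    and gen: "generate G {A, B} = carrier G"
begin

text \<open>The relations are symmetric in A and B, and the exchange inverts the commutator. Each
  statement about powers of A therefore yields one about powers of B.\<close>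

lemma swap: "macdonald p m l G B A"
  by unfold_locales (simp_all add: rel_A rel_B pow_A pow_B gen insert_commute)

definition a :: "int \<Rightarrow> 'a" where "a i = A [^] i"
definition b :: "int \<Rightarrow> 'a" where "b i = B [^] i"
definition c :: "int \<Rightarrow> 'a" where "c i = group_comm G A B [^] i"

lemma closed [simp]: "a i \<in> carrier G" "b i \<in> carrier G" "c i \<in> carrier G"
  by (simp_all add: a_def b_def c_def)

lemma zero [simp]: "a 0 = \<one>" "b 0 = \<one>" "c 0 = \<one>"
  by (simp_all add: a_def b_def c_def)

lemma a_1: "a 1 = A" and b_1: "b 1 = B" and c_1: "c 1 = group_comm G A B"
  by (simp_all add: a_def b_def c_def)

lemma add: "a i \<otimes> a j = a (i + j)" "b i \<otimes> b j = b (i + j)" "c i \<otimes> c j = c (i + j)"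
  by (simp_all add: a_def b_def c_def int_pow_mult)

lemma add_assoc: "x \<in> carrier G \<Longrightarrow> a i \<otimes> (a j \<otimes> x) = a (i + j) \<otimes> x"
  "x \<in> carrier G \<Longrightarrow> b i \<otimes> (b j \<otimes> x) = b (i + j) \<otimes> x"
  "x \<in> carrier G \<Longrightarrow> c i \<otimes> (c j \<otimes> x) = c (i + j) \<otimes> x"
  by (simp_all add: add flip: m_assoc)

lemma int_pow_abc: "a i [^] (j :: int) = a (i * j)" "b i [^] j = b (i * j)" "c i [^] j = c (i * j)"
  by (simp_all add: a_def b_def c_def int_pow_pow)

lemma pow_q: "q ^ 3 = int (p ^ (3 * m))"
  by (simp add: q_def flip: power_mult) (simp add: mult.commute)

lemma a_cong: "[i = j] (mod q ^ 3) \<Longrightarrow> a i = a j"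
  unfolding a_def by (rule int_pow_cong[of A "q ^ 3"]) (simp_all only: pow_q int_pow_int pow_A A_closed)

lemma b_cong: "[i = j] (mod q ^ 3) \<Longrightarrow> b i = b j"
  unfolding b_def by (rule int_pow_cong[of B "q ^ 3"]) (simp_all only: pow_q int_pow_int pow_B B_closed)

lemma comm_swap: "group_comm G B A [^] k = c (- k)"
proof -
  have "group_comm G B A = inv (group_comm G A B)" by (simp add: group_comm_def inv_mult_group m_assoc)
  then show ?thesis by (simp add: c_def int_pow_inv int_pow_neg)
qed

lemma a_c_1: "a i \<otimes> c 1 = c 1 \<otimes> a (i * al)"
proof -
  have "A \<otimes> c 1 = c 1 \<otimes> a al"
    using rel_A by (simp add: group_conj_def c_1 a_def al_def w_def q_def inv_solve_left' m_assoc)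
  then show ?thesis
    using int_pow_shift[of A "a al" "c 1" i] by (simp add: int_pow_abc mult.commute) (simp add: a_def)
qed

lemma a_c: "a i \<otimes> c k = c k \<otimes> a (i * ee k)"
proof (induction k rule: int_induct[of _ 0])
  case base
  show ?case by simp
next
  case (step1 k)
  have "a i \<otimes> c (k + 1) = (a i \<otimes> c k) \<otimes> c 1" by (simp add: m_assoc add)
  also have "\<dots> = c k \<otimes> (a (i * ee k) \<otimes> c 1)" unfolding step1 by (simp add: m_assoc)
  also have "\<dots> = c (k + 1) \<otimes> a (i * ee k * al)" unfolding a_c_1 by (simp add: add_assoc)
  also have "a (i * ee k * al) = a (i * ee (k + 1))"
    unfolding mult.assoc by (intro a_cong cong_mult cong_refl) (use ee_add[of k 1] in \<open>simp add: ee_1 cong_sym\<close>)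
  finally show ?case .
next
  case (step2 k)
  have *: "a j \<otimes> c (- 1) = c (- 1) \<otimes> a (j * be)" for j
  proof -
    have "a j = a (j * be * al)"
      by (rule a_cong) (use cong_mult[OF cong_refl al_be, of j] in \<open>simp add: ac_simps cong_sym\<close>)
    then have "c (- 1) \<otimes> (a (j * be) \<otimes> c 1) \<otimes> c (- 1) = a j \<otimes> c (- 1)"
      unfolding a_c_1 by (simp add: add_assoc)
    then show ?thesis by (simp add: m_assoc add)
  qed
  have "a i \<otimes> c (k - 1) = (a i \<otimes> c k) \<otimes> c (- 1)" by (simp add: m_assoc add)
  also have "\<dots> = c k \<otimes> (a (i * ee k) \<otimes> c (- 1))" unfolding step2 by (simp add: m_assoc)
  also have "\<dots> = c (k - 1) \<otimes> a (i * ee k * be)" unfolding * by (simp add: add_assoc)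
  also have "a (i * ee k * be) = a (i * ee (k - 1))"
    unfolding mult.assoc by (intro a_cong cong_mult cong_refl) (use ee_add[of k "-1"] in \<open>simp add: ee_m1 cong_sym\<close>)
  finally show ?case .
qed

text \<open>Conjugation by B sends A to A C, and (A C)^i collects to C^i times A to the exponent al
  + ... + al^i because A C = C A^al.\<close>

lemma a_b_1: "a i \<otimes> b 1 = b 1 \<otimes> (c i \<otimes> a (T i))"
proof (induction i rule: int_induct[of _ 0])
  case base
  show ?case by simp
next
  have AB: "a 1 \<otimes> b 1 = b 1 \<otimes> (a 1 \<otimes> c 1)"
    using mult_group_comm[of A B] by (simp add: a_1 b_1 c_1 m_assoc)
  have *: "a (T k) \<otimes> (a 1 \<otimes> c 1) = c 1 \<otimes> a (T (k + 1))" for k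
  proof -
    have "a (T k) \<otimes> (a 1 \<otimes> c 1) = a (T k + 1) \<otimes> c 1" by (simp add: add_assoc)
    also have "\<dots> = c 1 \<otimes> a ((T k + 1) * al)" by (rule a_c_1)
    also have "a ((T k + 1) * al) = a (T (k + 1))" by (rule a_cong) (rule cong_sym[OF T_step])
    finally show ?thesis .
  qed
  {
    case (step1 i)
    have "a (i + 1) \<otimes> b 1 = a i \<otimes> (a 1 \<otimes> b 1)" by (simp add: add_assoc)
    also have "\<dots> = (a i \<otimes> b 1) \<otimes> (a 1 \<otimes> c 1)" unfolding AB by (simp add: m_assoc)
    also have "\<dots> = b 1 \<otimes> (c i \<otimes> (a (T i) \<otimes> (a 1 \<otimes> c 1)))" unfolding step1 by (simp add: m_assoc)
    also have "\<dots> = b 1 \<otimes> (c (i + 1) \<otimes> a (T (i + 1)))" unfolding * by (simp add: add_assoc)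
    finally show ?case .
  next
    case (step2 i)
    have "a i \<otimes> b 1 = a (i - 1) \<otimes> (a 1 \<otimes> b 1)" by (simp add: add_assoc)
    also have "\<dots> = (a (i - 1) \<otimes> b 1) \<otimes> (a 1 \<otimes> c 1)" unfolding AB by (simp add: m_assoc)
    finally have "(a (i - 1) \<otimes> b 1) \<otimes> (a 1 \<otimes> c 1) = b 1 \<otimes> (c i \<otimes> a (T i))" unfolding step2 by simp
    also have "\<dots> = b 1 \<otimes> (c (i - 1) \<otimes> (c 1 \<otimes> a (T (i - 1 + 1))))" by (simp add: add_assoc)
    also have "\<dots> = b 1 \<otimes> (c (i - 1) \<otimes> a (T (i - 1))) \<otimes> (a 1 \<otimes> c 1)" unfolding *[symmetric] by (simp add: m_assoc)
    finally show ?case by (simp del: add)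
  }
qed

interpretation S: macdonald p m l G B A by (rule swap)

lemma swap_abc: "S.a = b" "S.b = a" "S.c k = c (- k)"
  by (simp_all add: S.a_def S.b_def a_def b_def fun_eq_iff S.c_def comm_swap)

lemma b_c: "b j \<otimes> c k = c k \<otimes> b (j * ee (- k))"
  using S.a_c[of j "-k"] by (simp add: swap_abc)

lemma b_a_1: "b j \<otimes> a 1 = a 1 \<otimes> (c (- j) \<otimes> b (T j))"
  using S.a_b_1[of j] by (simp add: swap_abc)

lemma b_a_1': "b j \<otimes> a 1 = c (- j) \<otimes> (a (ee (- j)) \<otimes> b (T j))"
  unfolding b_a_1 using a_c[of 1 "-j"] by (simp flip: m_assoc)

text \<open>Computing \<open>a al b 1 = c (-1) a 1 c 1 b 1\<close> in two ways is what makes the group finite.\<close>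

lemma a_kap_b_kap: "a kap \<otimes> b kap = \<one>"
proof -
  have 1: "a al \<otimes> b 1 = b 1 \<otimes> (c al \<otimes> a (T al))" by (rule a_b_1)
  \<comment> \<open>In the second relation the conjugating element is the inverse of C, so it reads
    C B = B^al C.\<close>
  have cb: "c 1 \<otimes> b 1 = b al \<otimes> c 1"
  proof -
    have "b al \<otimes> c 1 = c 1 \<otimes> b (al * be)" by (simp add: b_c ee_m1)
    also have "b (al * be) = b 1" by (rule b_cong[OF al_be])
    finally show ?thesis ..
  qed
  have bc: "c (- 1) \<otimes> b al = b 1 \<otimes> c (- 1)"
    by (simp add: b_c[of 1] ee_1)
  have ab: "a 1 \<otimes> b al = b al \<otimes> (a 1 \<otimes> (c al \<otimes> b (T (- al) + al)))"
  proof -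
    have "b al \<otimes> (b (- al) \<otimes> a 1) \<otimes> b al = b al \<otimes> (a 1 \<otimes> (c al \<otimes> b (T (- al)))) \<otimes> b al"
      unfolding b_a_1 by simp
    then show ?thesis by (simp add: m_assoc add add_assoc)
  qed
  have "a al = c (- 1) \<otimes> (a 1 \<otimes> c 1)" unfolding a_c_1 by (simp add: add_assoc)
  then have "a al \<otimes> b 1 = c (- 1) \<otimes> (a 1 \<otimes> (c 1 \<otimes> b 1))" by (simp add: m_assoc)
  also have "\<dots> = c (- 1) \<otimes> ((a 1 \<otimes> b al) \<otimes> c 1)" unfolding cb by (simp add: m_assoc)
  also have "\<dots> = (c (- 1) \<otimes> b al) \<otimes> (a 1 \<otimes> (c al \<otimes> b (T (- al) + al))) \<otimes> c 1"
    unfolding ab by (simp add: m_assoc)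
  also have "\<dots> = b 1 \<otimes> (c (- 1) \<otimes> ((a 1 \<otimes> c al) \<otimes> (b (T (- al) + al) \<otimes> c 1)))"
    unfolding bc by (simp add: m_assoc)
  also have "\<dots> = b 1 \<otimes> (c (al - 1) \<otimes> ((a (ee al) \<otimes> c 1) \<otimes> b ((T (- al) + al) * be)))"
    unfolding a_c[of 1] b_c by (simp add: m_assoc add_assoc ee_m1)
  also have "\<dots> = b 1 \<otimes> (c al \<otimes> (a (ee al * al) \<otimes> b ((T (- al) + al) * be)))"
    unfolding a_c_1 by (simp add: m_assoc add_assoc)
  finally have "c al \<otimes> a (T al) = c al \<otimes> (a (ee al * al) \<otimes> b ((T (- al) + al) * be))"
    unfolding 1 by simp
  then have "a (T al) = a (ee al * al) \<otimes> b ((T (- al) + al) * be)" by simp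
  then have "a (- T al) \<otimes> a (T al) = a (- T al) \<otimes> (a (ee al * al) \<otimes> b ((T (- al) + al) * be))" by simp
  then have "\<one> = a kap \<otimes> b ((T (- al) + al) * be)"
    by (simp add: add add_assoc kap_def ac_simps)
  also have "b ((T (- al) + al) * be) = b kap"
    by (rule b_cong) (use kap_swap in \<open>simp add: mult.commute\<close>)
  finally show ?thesis by simp
qed

text \<open>The multiplier Y of \<open>kap_unit\<close> turns the exponent in A^kap = B^(-kap) into
  q^2 modulo q^3.\<close>

lemma a_q2_b_q2: "a (q\<^sup>2 * k) = b (- (q\<^sup>2 * k))"
proof -
  obtain Y where Y: "[kap * Y = q\<^sup>2] (mod q ^ 3)" by (rule kap_unit)
  have "a kap \<otimes> b kap \<otimes> b (- kap) = b (- kap)" unfolding a_kap_b_kap by simp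
  then have "a kap = b (- kap)" by (simp add: m_assoc add)
  then have "a (kap * (Y * k)) = b (- kap * (Y * k))" by (simp only: flip: int_pow_abc)
  moreover have "[kap * (Y * k) = q\<^sup>2 * k] (mod q ^ 3)"
    using cong_mult[OF Y cong_refl, of k] by (simp add: mult.assoc)
  moreover from this have "[- kap * (Y * k) = - (q\<^sup>2 * k)] (mod q ^ 3)"
    by (simp add: cong_minus_minus_iff)
  ultimately show ?thesis using a_cong b_cong by metis
qed

lemma central_iff:
  assumes z: "z \<in> carrier G" "z \<otimes> A = A \<otimes> z" "z \<otimes> B = B \<otimes> z" and g: "g \<in> carrier G"
  shows "z \<otimes> g = g \<otimes> z"
proof -
  have "g \<in> generate G {A, B}" using g gen by simp
  then show ?thesis
  proof (induction g rule: generate.induct)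
    case (inv h)
    then show ?case using z by (intro commute_inv) auto
  next
    case (eng h1 h2)
    then have "h1 \<in> carrier G" "h2 \<in> carrier G" using gen by simp_all
    with eng z show ?case by (intro commute_mult) auto
  qed (use z in auto)
qed

text \<open>As a power of A the element commutes with A, as a power of B it commutes with B.\<close>

lemma a_q2_central: "g \<in> carrier G \<Longrightarrow> a (q\<^sup>2 * k) \<otimes> g = g \<otimes> a (q\<^sup>2 * k)"
proof (rule central_iff)
  have "a (q\<^sup>2 * k) \<otimes> a 1 = a 1 \<otimes> a (q\<^sup>2 * k)" by (simp add: add add.commute)
  then show "a (q\<^sup>2 * k) \<otimes> A = A \<otimes> a (q\<^sup>2 * k)" by (simp only: a_1)
  have "a (q\<^sup>2 * k) \<otimes> b 1 = b 1 \<otimes> a (q\<^sup>2 * k)" unfolding a_q2_b_q2 by (simp add: add add.commute)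
  then show "a (q\<^sup>2 * k) \<otimes> B = B \<otimes> a (q\<^sup>2 * k)" by (simp only: b_1)
qed simp_all

text \<open>Moving a central power of A past B by \<open>a_b_1\<close> leaves C^(q^2 k) behind,
  because T fixes multiples of q^2 modulo q^3.\<close>

lemma c_q2: "c (q\<^sup>2 * k) = \<one>"
proof -
  have "b 1 \<otimes> a (q\<^sup>2 * k) = b 1 \<otimes> (c (q\<^sup>2 * k) \<otimes> a (T (q\<^sup>2 * k)))"
    using a_b_1[of "q\<^sup>2 * k"] a_q2_central[of "b 1" k] by simp
  also have "a (T (q\<^sup>2 * k)) = a (q\<^sup>2 * k)" by (rule a_cong[OF T_q2])
  finally have "\<one> \<otimes> a (q\<^sup>2 * k) = c (q\<^sup>2 * k) \<otimes> a (q\<^sup>2 * k)" by simp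
  then show ?thesis by (metis closed(1,3) one_closed r_cancel)
qed

lemma c_cong: "[i = j] (mod q\<^sup>2) \<Longrightarrow> c i = c j"
  unfolding c_def by (rule int_pow_cong[of _ "q\<^sup>2"]) (use c_q2[of 1] in \<open>simp_all add: c_def\<close>)

definition nf :: "int \<Rightarrow> int \<Rightarrow> int \<Rightarrow> 'a" where "nf k i j = c k \<otimes> a i \<otimes> b j"

lemma nf_closed [simp]: "nf k i j \<in> carrier G"
  by (simp add: nf_def)

lemma nf_b: "nf k i j \<otimes> b s = nf k i (j + s)"
  by (simp add: nf_def m_assoc add)

lemma nf_c: "nf k i j \<otimes> c s = nf (k + s) (i * ee s) (j * ee (- s))"
proof -
  have "nf k i j \<otimes> c s = c k \<otimes> (a i \<otimes> c s) \<otimes> b (j * ee (- s))"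
    by (simp add: nf_def m_assoc b_c)
  then show ?thesis by (simp add: nf_def a_c m_assoc add_assoc)
qed

lemma nf_a_1: "nf k i j \<otimes> a 1 = nf (k - j) ((i + 1) * ee (- j)) (T j)"
proof -
  have "nf k i j \<otimes> a 1 = c k \<otimes> ((a i \<otimes> c (- j)) \<otimes> (a (ee (- j)) \<otimes> b (T j)))"
    by (simp add: nf_def m_assoc b_a_1')
  then show ?thesis by (simp add: nf_def a_c m_assoc add_assoc algebra_simps)
qed

text \<open>The set of normal forms is closed under right multiplication by A and B. Since both have
  finite order, their inverses are positive powers and need no rule of their own.\<close>

lemma nf_surj:
  assumes "g \<in> carrier G"
  obtains k i j where "g = nf k i j"
proof -
  let ?S = "{nf k i j | k i j. True}"
  have A: "s \<otimes> A \<in> ?S" and B: "s \<otimes> B \<in> ?S" if s: "s \<in> ?S" for s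
  proof -
    obtain k i j where s: "s = nf k i j" using s by blast
    have "s \<otimes> A = nf (k - j) ((i + 1) * ee (- j)) (T j)" "s \<otimes> B = nf k i (j + 1)"
      using nf_a_1[of k i j] nf_b[of k i j 1] by (simp_all add: s a_1 b_1)
    then show "s \<otimes> A \<in> ?S" "s \<otimes> B \<in> ?S" by blast+
  qed
  have An: "s \<otimes> A [^] n \<in> ?S" and Bn: "s \<otimes> B [^] n \<in> ?S" if "s \<in> ?S" for s and n :: nat
  proof -
    have sc: "s \<in> carrier G" using that by auto
    show "s \<otimes> A [^] n \<in> ?S"
      by (induction n) (use that sc A in \<open>simp_all flip: m_assoc\<close>)
    show "s \<otimes> B [^] n \<in> ?S"
      by (induction n) (use that sc B in \<open>simp_all flip: m_assoc\<close>)
  qed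
  have pos: "p ^ (3 * m) = Suc (p ^ (3 * m) - 1)"
    using prime_p by (simp add: prime_gt_0_nat)
  have inv_A: "inv A = A [^] (p ^ (3 * m) - 1)" and inv_B: "inv B = B [^] (p ^ (3 * m) - 1)"
    using pow_A pow_B by (metis pos A_closed B_closed inv_equality nat_pow_Suc nat_pow_closed)+
  have "h \<in> generate G {A, B} \<Longrightarrow> s \<in> ?S \<Longrightarrow> s \<otimes> h \<in> ?S" for s h
  proof (induction h arbitrary: s rule: generate.induct)
    case one
    then have "s \<in> carrier G" by auto
    with one show ?case by simp
  next
    case (incl h)
    then consider "h = A" | "h = B" by blast
    then show ?case by cases (use incl(2) A B in \<open>simp_all only:\<close>)
  next
    case (inv h)
    then consider "h = A" | "h = B" by blast
    then show ?case by cases (use inv(2) An Bn in \<open>simp_all only: inv_A inv_B\<close>)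
  next
    case (eng h1 h2)
    have c: "h1 \<in> carrier G" "h2 \<in> carrier G" "s \<in> carrier G" using eng gen by auto
    have "s \<otimes> h1 \<otimes> h2 \<in> ?S" using eng by blast
    then show ?case using c by (simp add: m_assoc)
  qed
  note step = this
  have "nf 0 0 0 \<in> ?S" by blast
  then have "\<one> \<in> ?S" by (simp add: nf_def del: mem_Collect_eq)
  with step[of g "\<one>"] have "\<one> \<otimes> g \<in> ?S" using assms unfolding gen by blast
  then have "g \<in> ?S" using assms by (simp del: mem_Collect_eq)
  then obtain k i j where "g = nf k i j" by blast
  then show thesis by (rule that)
qed

end

section \<open>A permutation model\<close>

context macdonald_numbers
begin

text \<open>The analogue of \<open>cancel6\<close> for products of two such fractions: each missing
  factor 3 is made up for by a factor \<open>w\<close>.\<close>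

lemma cancel36:
  assumes "36 * d = 9 * q ^ k * x + 3 * w * q ^ k * y + w\<^sup>2 * q ^ k * z"
  shows "q ^ k dvd d"
proof (cases "p = 3")
  case True
  have "int p dvd w" using p_dvd_q unfolding w_def by simp
  then have "3 dvd w" using True by simp
  then obtain v where v: "w = 3 * v" by blast
  have "4 * d = q ^ k * (x + v * y + v\<^sup>2 * z)" using assms by (simp add: v algebra_simps power2_eq_square)
  then have "q ^ k dvd 2 * (2 * d)" by simp
  then show ?thesis by (rule cancel2[OF cancel2])
next
  case False
  have "36 * d = q ^ k * (9 * x + 3 * w * y + w\<^sup>2 * z)" using assms by (simp add: algebra_simps)
  then have "q ^ k dvd 2 * (2 * (3 * (3 * d)))" by simp
  then have "q ^ k dvd 3 * (3 * d)" by (rule cancel2[OF cancel2])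
  then show ?thesis
    using coprime_dvd_mult_right_iff[of "q ^ k" 3] coprime_q_3[OF False] coprime_power_left_iff by blast
qed

lemma tri_shift: "2 * (tri (x + t) - tri x) = t * (2 * x + 1 + t)"
  using two_tri[of "x + t"] two_tri[of x] by (simp add: algebra_simps)

lemma tet_shift: "6 * (tet (x + t) - tet x) = t * (3 * x\<^sup>2 - 1 + 3 * x * t + t\<^sup>2)"
  using six_tet[of "x + t"] six_tet[of x] by (simp add: algebra_simps power2_eq_square)

lemma T_shift:
  "6 * (T (x + t) - T x - t) = 3 * w * t * (2 * x + 1 + t) + w\<^sup>2 * t * (3 * x\<^sup>2 - 1 + 3 * x * t + t\<^sup>2)"
proof -
  have "6 * (T (x + t) - T x - t) = 3 * w * (2 * (tri (x + t) - tri x)) + w\<^sup>2 * (6 * (tet (x + t) - tet x))"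
    unfolding T_def by (simp add: algebra_simps)
  then show ?thesis unfolding tri_shift tet_shift by (simp add: mult.assoc)
qed

text \<open>A translation by a multiple of q^2 passes through T unchanged modulo q^3. This lets the
  action on pairs respect \<open>pt_eq\<close>.\<close>

lemma T_cong_q2: "q\<^sup>2 dvd t \<Longrightarrow> q ^ 3 dvd T (x + t) - T x - t"
proof -
  assume "q\<^sup>2 dvd t"
  then obtain s where s: "t = q\<^sup>2 * s" by blast
  have "6 * (T (x + t) - T x - t) = 3 * q ^ 3 * (l * s * (2 * x + 1 + t)) + w * q ^ 3 * (l * s * (3 * x\<^sup>2 - 1 + 3 * x * t + t\<^sup>2))"
    unfolding T_shift unfolding w_def by (simp add: s algebra_simps power2_eq_square power3_eq_cube)
  then show ?thesis by (rule cancel6)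
qed

lemma ee_minus: "ee (- x) = 1 - w * x + w\<^sup>2 * tri x"
proof -
  have "tri (- x - 1) = tri x" using two_tri[of "- x - 1"] two_tri[of x] by (simp add: algebra_simps)
  then show ?thesis by (simp add: ee_def)
qed

lemma ee_minus_cong_q2: "q\<^sup>2 dvd t \<Longrightarrow> q ^ 3 dvd ee (- (x + t)) - ee (- x)"
proof -
  assume "q\<^sup>2 dvd t"
  then obtain s where s: "t = q\<^sup>2 * s" by blast
  have "2 * (ee (- (x + t)) - ee (- x)) = - 2 * w * t + w\<^sup>2 * (2 * (tri (x + t) - tri x))"
    unfolding ee_minus by (simp add: algebra_simps)
  also have "\<dots> = q ^ 3 * (l * s * (q * l * (2 * x + 1 + t) - 2))"
    unfolding tri_shift unfolding w_def by (simp add: s algebra_simps power2_eq_square power3_eq_cube)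
  finally have "q ^ 3 dvd 2 * (ee (- (x + t)) - ee (- x))" by simp
  then show ?thesis by (rule cancel2)
qed

text \<open>First and second differences of the iterates of \<open>T\<close>; the third ones vanish modulo \<open>q ^ 3\<close>.\<close>

definition D1 :: "int \<Rightarrow> int" where "D1 x = T x - x"
definition D2 :: "int \<Rightarrow> int" where "D2 x = D1 (T x) - D1 x"

lemma D1_eq: "D1 x = w * (tri x + w * tet x)"
  by (simp add: D1_def T_def algebra_simps power2_eq_square)

lemma D2_6:
  assumes "y = tri x + w * tet x"
  shows "6 * D2 x = w\<^sup>2 * y * (3 * (2 * x + 1 + w * y) + w * (3 * x\<^sup>2 - 1 + 3 * x * (w * y) + (w * y)\<^sup>2))"
proof -
  have "T x = x + w * y" using D1_eq[of x] assms by (simp add: D1_def)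
  then have "6 * D2 x = 6 * (T (x + w * y) - T x - w * y)" unfolding D2_def D1_def by simp
  then show ?thesis unfolding T_shift by (simp add: algebra_simps power2_eq_square)
qed

lemma D2_q2: "q\<^sup>2 dvd D2 x"
proof (rule cancel6)
  define y where "y = tri x + w * tet x"
  show "6 * D2 x = 3 * q ^ 2 * (l\<^sup>2 * y * (2 * x + 1 + w * y)) + w * q ^ 2 * (l\<^sup>2 * y * (3 * x\<^sup>2 - 1 + 3 * x * (w * y) + (w * y)\<^sup>2))"
    unfolding D2_6[OF y_def] unfolding w_sq by (simp add: algebra_simps)
qed

lemma w_nz: "w \<noteq> 0"
  using q_nz not_dvd_l by (auto simp: w_def)

lemma D2_T: "q ^ 3 dvd D2 (T x) - D2 x"
proof -
  define y where "y = tri x + w * tet x"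
  define z where "z = tri (T x) + w * tet (T x)"
  have Tx: "T x = x + w * y" using D1_eq[of x] by (simp add: D1_def y_def)
  define r s where "r = 2 * x + 1 + w * y" and "s = 3 * x\<^sup>2 - 1 + 3 * x * (w * y) + (w * y)\<^sup>2"
  define r' s' where "r' = 2 * (x + w * y) + 1 + w * z"
    and "s' = 3 * (x + w * y)\<^sup>2 - 1 + 3 * (x + w * y) * (w * z) + (w * z)\<^sup>2"
  have 1: "6 * D2 x = w\<^sup>2 * y * (3 * r + w * s)" unfolding r_def s_def by (rule D2_6[OF y_def])
  have 2: "6 * D2 (T x) = w\<^sup>2 * z * (3 * r' + w * s')" unfolding r'_def s'_def Tx[symmetric] by (rule D2_6[OF z_def])
  have 3: "D2 x = w * (z - y)" unfolding D2_def D1_eq y_def z_def by (simp add: algebra_simps)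
  \<comment> \<open>Two formulas for \<open>D2 x\<close> meet here. Dividing by w yields z - y with
    a factor w, the one that completes \<open>w ^ 3\<close> below.\<close>
  have "w * (6 * (z - y)) = w * (w * y * (3 * r + w * s))" using 1 unfolding 3 by (simp add: algebra_simps power2_eq_square)
  then have 4: "6 * (z - y) = w * y * (3 * r + w * s)" using w_nz by simp
  have 5: "r' - r = w * (y + z)" unfolding r_def r'_def by (simp add: algebra_simps)
  have 6: "s' - s = 3 * w * (2 * x * y + w * y\<^sup>2 + (x + w * y) * z - x * y) + w\<^sup>2 * (z\<^sup>2 - y\<^sup>2)"
    unfolding s_def s'_def by (simp add: algebra_simps power2_eq_square)
  have "36 * (D2 (T x) - D2 x) = 6 * (w\<^sup>2 * z * (3 * r' + w * s')) - 6 * (w\<^sup>2 * y * (3 * r + w * s))"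
    using 1 2 by simp
  also have "\<dots> = w\<^sup>2 * (6 * (z - y)) * (3 * r' + w * s') + 6 * w\<^sup>2 * y * (3 * (r' - r) + w * (s' - s))"
    by (simp add: algebra_simps)
  also have "\<dots> = w\<^sup>2 * (w * y * (3 * r + w * s)) * (3 * r' + w * s') + 6 * w\<^sup>2 * y * (3 * (w * (y + z)) +
      w * (3 * w * (2 * x * y + w * y\<^sup>2 + (x + w * y) * z - x * y) + w\<^sup>2 * (z\<^sup>2 - y\<^sup>2)))"
    unfolding 4 5 6 ..
  also have "\<dots> = 9 * w ^ 3 * (y * r * r' + 2 * y * (y + z)) +
      3 * w * w ^ 3 * (y * (r * s' + s * r') + 6 * y * (2 * x * y + w * y\<^sup>2 + (x + w * y) * z - x * y)) +
      w\<^sup>2 * w ^ 3 * (y * s * s' + 6 * y * (z\<^sup>2 - y\<^sup>2))"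
    by (simp add: algebra_simps power2_eq_square power3_eq_cube)
  also have "\<dots> = 9 * q ^ 3 * (l ^ 3 * (y * r * r' + 2 * y * (y + z))) +
      3 * w * q ^ 3 * (l ^ 3 * (y * (r * s' + s * r') + 6 * y * (2 * x * y + w * y\<^sup>2 + (x + w * y) * z - x * y))) +
      w\<^sup>2 * q ^ 3 * (l ^ 3 * (y * s * s' + 6 * y * (z\<^sup>2 - y\<^sup>2)))"
    unfolding w_cube by (simp only: mult.assoc)
  finally show ?thesis by (rule cancel36)
qed

text \<open>Newton's forward difference formula, broken off after the second difference;
  \<open>tri (int n - 1)\<close> is the binomial coefficient of n over 2.\<close>

lemma T_iter: "q ^ 3 dvd (T ^^ n) x - (x + int n * D1 x + tri (int n - 1) * D2 x)"
proof -
  have 2: "q ^ 3 dvd D2 ((T ^^ n) x) - D2 x" for n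
  proof (induction n)
    case (Suc n)
    then show ?case using dvd_add[OF D2_T[of "(T ^^ n) x"] Suc] by simp
  qed simp
  have 1: "q ^ 3 dvd D1 ((T ^^ n) x) - (D1 x + int n * D2 x)" for n
  proof (induction n)
    case (Suc n)
    have eq: "D1 ((T ^^ Suc n) x) - (D1 x + int (Suc n) * D2 x)
        = (D1 ((T ^^ n) x) - (D1 x + int n * D2 x)) + (D2 ((T ^^ n) x) - D2 x)"
      by (simp add: D2_def algebra_simps)
    show ?case unfolding eq by (rule dvd_add[OF Suc 2])
  qed simp
  show ?thesis
  proof (induction n)
    case (Suc n)
    have eq: "(T ^^ Suc n) x - (x + int (Suc n) * D1 x + tri (int (Suc n) - 1) * D2 x)
        = ((T ^^ n) x - (x + int n * D1 x + tri (int n - 1) * D2 x)) + (D1 ((T ^^ n) x) - (D1 x + int n * D2 x))"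
      using tri_plus1[of "int n - 1"] by (simp add: D1_def[of "(T ^^ n) x"] algebra_simps)
    show ?case unfolding eq by (rule dvd_add[OF Suc 1])
  qed simp
qed

text \<open>The right action of \<open>A\<close>, \<open>B\<close> and their commutator on the cosets \<open>\<langle>C\<rangle> A\<^sup>i B\<^sup>j\<close>. Since
  \<open>A\<close> and \<open>B\<close> satisfy \<open>A ^ q\<^sup>2 = B ^ (- q\<^sup>2)\<close>, the pairs \<open>(i, j)\<close> are taken up to \<open>pt_eq\<close>.\<close>

definition pt_eq :: "int \<times> int \<Rightarrow> int \<times> int \<Rightarrow> bool" where
  "pt_eq x y \<longleftrightarrow> q\<^sup>2 dvd fst y - fst x \<and> q ^ 3 dvd (fst y - fst x) - (snd y - snd x)"

definition fA :: "int \<times> int \<Rightarrow> int \<times> int" where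
  "fA x = ((fst x + 1) * ee (- snd x), T (snd x))"

definition fB :: "int \<Rightarrow> int \<times> int \<Rightarrow> int \<times> int" where
  "fB k x = (fst x, snd x + k)"

definition fC :: "int \<times> int \<Rightarrow> int \<times> int" where
  "fC x = (fst x * al, snd x * be)"

definition fC' :: "int \<times> int \<Rightarrow> int \<times> int" where
  "fC' x = (fst x * be, snd x * al)"

lemma pt_eq_refl [simp]: "pt_eq x x"
  by (simp add: pt_eq_def)

lemma pt_eq_sym: "pt_eq x y \<Longrightarrow> pt_eq y x"
proof -
  assume xy: "pt_eq x y"
  have "q\<^sup>2 dvd - (fst y - fst x)" using xy by (simp only: dvd_minus_iff pt_eq_def)
  moreover have "q ^ 3 dvd - ((fst y - fst x) - (snd y - snd x))" using xy by (simp only: dvd_minus_iff pt_eq_def)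
  ultimately show ?thesis by (simp add: pt_eq_def algebra_simps)
qed

lemma q2_dvd_q3: "q\<^sup>2 dvd q ^ 3"
  by (rule le_imp_power_dvd) simp

lemma pt_eqI: "q ^ 3 dvd i' - i \<Longrightarrow> q ^ 3 dvd j' - j \<Longrightarrow> pt_eq (i, j) (i', j')"
  unfolding pt_eq_def using q2_dvd_q3 dvd_trans by (auto intro: dvd_diff)

lemma fB_respect: "pt_eq x y \<Longrightarrow> pt_eq (fB k x) (fB k y)"
  by (simp add: pt_eq_def fB_def)

lemma q_dvd_al: "q dvd al - 1" and q_dvd_be: "q dvd be - 1"
  by (simp_all add: al_def be_def w_def power2_eq_square)

lemma mult_respect:
  assumes "pt_eq x y" "q dvd s - 1" "q dvd t - 1"
  shows "pt_eq (fst x * s, snd x * t) (fst y * s, snd y * t)"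
proof -
  obtain u where u: "fst y - fst x = q\<^sup>2 * u" using assms(1) by (auto simp: pt_eq_def)
  obtain v where v: "(fst y - fst x) - (snd y - snd x) = q ^ 3 * v" using assms(1) by (auto simp: pt_eq_def)
  obtain s' where s: "s - 1 = q * s'" using assms(2) by blast
  obtain t' where t: "t - 1 = q * t'" using assms(3) by blast
  have "fst y * s - fst x * s = q\<^sup>2 * (u * s)" using u by (simp flip: left_diff_distrib)
  moreover have "(fst y * s - fst x * s) - (snd y * t - snd x * t)
      = (fst y - fst x) * (s - 1) - (fst y - fst x) * (t - 1) + ((fst y - fst x) - (snd y - snd x)) * t"
    by (simp add: algebra_simps)
  then have "(fst y * s - fst x * s) - (snd y * t - snd x * t) = q ^ 3 * (u * s' - u * t' + v * t)"
    unfolding u s t v[unfolded u] by (simp add: algebra_simps power2_eq_square power3_eq_cube)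
  ultimately show ?thesis by (simp add: pt_eq_def)
qed

lemma fC_respect: "pt_eq x y \<Longrightarrow> pt_eq (fC x) (fC y)" "pt_eq x y \<Longrightarrow> pt_eq (fC' x) (fC' y)"
  unfolding fC_def fC'_def by (intro mult_respect q_dvd_al q_dvd_be; assumption)+

text \<open>Both coordinates of the image move by t modulo q^3: the first because its factor
  \<open>ee\<close> is 1 modulo q, the second by \<open>T_cong_q2\<close>.\<close>

lemma fA_respect: "pt_eq x y \<Longrightarrow> pt_eq (fA x) (fA y)"
proof -
  assume xy: "pt_eq x y"
  define t where "t = snd y - snd x"
  have f1: "q ^ 3 dvd (fst y - fst x) - t" and "q\<^sup>2 dvd fst y - fst x" using xy by (simp_all add: pt_eq_def t_def)
  then have "q\<^sup>2 dvd (fst y - fst x) - ((fst y - fst x) - t)"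
    using dvd_diff[OF _ dvd_trans[OF q2_dvd_q3]] by blast
  then have t: "q\<^sup>2 dvd t" by simp
  obtain u where u: "fst y - fst x = q\<^sup>2 * u" using xy by (auto simp: pt_eq_def)
  have snd: "snd y = snd x + t" by (simp add: t_def)
  have ee: "q ^ 3 dvd ee (- snd y) - ee (- snd x)" unfolding snd by (rule ee_minus_cong_q2[OF t])
  have "q dvd ee (- snd x) - 1" unfolding ee_minus by (simp add: w_def power2_eq_square)
  then obtain v where v: "ee (- snd x) - 1 = q * v" by blast
  have *: "fst (fA y) - fst (fA x) = (fst y - fst x) + ((fst y + 1) * (ee (- snd y) - ee (- snd x)) + q ^ 3 * (u * v))"
  proof -
    have "fst (fA y) - fst (fA x) = (fst y + 1) * (ee (- snd y) - ee (- snd x)) + (fst y - fst x) + (fst y - fst x) * (ee (- snd x) - 1)"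
      by (simp add: fA_def algebra_simps)
    then show ?thesis unfolding v u by (simp add: power2_eq_square power3_eq_cube)
  qed
  have 3: "q ^ 3 dvd (fst y + 1) * (ee (- snd y) - ee (- snd x)) + q ^ 3 * (u * v)"
    by (rule dvd_add[OF dvd_mult[OF ee] dvd_triv_left])
  have "q\<^sup>2 dvd fst (fA y) - fst (fA x)" unfolding *
    using u 3 q2_dvd_q3 by (intro dvd_add[OF _ dvd_trans[OF q2_dvd_q3 3]]) simp
  moreover have "q ^ 3 dvd (fst (fA y) - fst (fA x)) - (snd (fA y) - snd (fA x))"
  proof -
    have "(fst (fA y) - fst (fA x)) - (snd (fA y) - snd (fA x))
       = ((fst y - fst x) - t) + ((fst y + 1) * (ee (- snd y) - ee (- snd x)) + q ^ 3 * (u * v)) - (T (snd x + t) - T (snd x) - t)"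
      unfolding * by (simp add: fA_def snd)
    also have "q ^ 3 dvd \<dots>"
      by (rule dvd_diff[OF dvd_add[OF f1 3] T_cong_q2[OF t]])
    finally show ?thesis .
  qed
  ultimately show ?thesis by (simp add: pt_eq_def)
qed

text \<open>Closed forms: the first coordinate of the \<open>n\<close>-th iterate of \<open>fA\<close> at \<open>(i, j)\<close> is \<open>i * GG n j + HH n j\<close>.\<close>

definition EE :: "int \<Rightarrow> int \<Rightarrow> int" where "EE n j = 1 - w * j + w\<^sup>2 * (tri j * (1 - n))"
definition GG :: "int \<Rightarrow> int \<Rightarrow> int" where
  "GG n j = 1 - n * w * j + w\<^sup>2 * (tri j * (n - tri (n - 1)) + j\<^sup>2 * tri (n - 1))"
definition HH :: "int \<Rightarrow> int \<Rightarrow> int" where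
  "HH n j = n - w * j * tri n + w\<^sup>2 * (j\<^sup>2 * tet n + tri j * (n - (2 * tet (n - 1) + tri (n - 1))))"

text \<open>The iterate of T enters \<open>ee\<close> only multiplied by w, so it matters only
  modulo q^2, where it is j + n w tri j.\<close>

lemma EE_iter: "q ^ 3 dvd ee (- (T ^^ n) j) - EE (int n) j"
proof -
  define t where "t = (T ^^ n) j - (j + int n * w * tri j)"
  have "q\<^sup>2 dvd ((T ^^ n) j - (j + int n * D1 j + tri (int n - 1) * D2 j)) + (int n * (w\<^sup>2 * tet j) + tri (int n - 1) * D2 j)"
    by (rule dvd_add[OF dvd_trans[OF q2_dvd_q3 T_iter] dvd_add[OF dvd_mult[OF dvd_mult2] dvd_mult[OF D2_q2]]])
      (simp add: w_sq)
  also have "\<dots> = t" unfolding t_def D1_eq by (simp add: algebra_simps power2_eq_square)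
  finally have t: "q\<^sup>2 dvd t" .
  have Tn: "(T ^^ n) j = (j + int n * w * tri j) + t" by (simp add: t_def)
  have 1: "q ^ 3 dvd ee (- (T ^^ n) j) - ee (- (j + int n * w * tri j))"
    unfolding Tn by (rule ee_minus_cong_q2[OF t])
  have "2 * (ee (- (j + int n * w * tri j)) - EE (int n) j) = w\<^sup>2 * (2 * (tri (j + int n * w * tri j) - tri j))"
    unfolding ee_minus EE_def by (simp add: algebra_simps power2_eq_square)
  also have "\<dots> = q ^ 3 * (l ^ 3 * (int n * tri j * (2 * j + 1 + int n * w * tri j)))"
    unfolding tri_shift using w_cube by (simp add: algebra_simps power2_eq_square power3_eq_cube)
  finally have "q ^ 3 dvd 2 * (ee (- (j + int n * w * tri j)) - EE (int n) j)" by simp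
  then have 2: "q ^ 3 dvd ee (- (j + int n * w * tri j)) - EE (int n) j" by (rule cancel2)
  show ?thesis using dvd_add[OF 1 2] by simp
qed

lemma q3_dvd_w3: "q ^ 3 dvd w ^ 3 * x"
  unfolding w_cube by simp

lemma GG_step: "q ^ 3 dvd GG n j * EE n j - GG (n + 1) j"
proof -
  define t where "t = tri (n - 1)"
  have tn: "tri n = t + n" using tri_plus1[of "n - 1"] by (simp add: t_def)
  have "GG n j * EE n j - GG (n + 1) j = w ^ 3 * (- n * j * tri j * (1 - n) - j * (tri j * (n - t) + j\<^sup>2 * t)
      + w * (tri j * (n - t) + j\<^sup>2 * t) * tri j * (1 - n))"
    unfolding GG_def EE_def by (simp add: tn flip: t_def) (simp add: algebra_simps power2_eq_square power3_eq_cube)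
  then show ?thesis by (simp only: q3_dvd_w3)
qed

lemma HH_step: "q ^ 3 dvd (HH n j + 1) * EE n j - HH (n + 1) j"
proof -
  define t where "t = tri (n - 1)"
  define s where "s = tet (n - 1)"
  have tn: "tri n = t + n" using tri_plus1[of "n - 1"] by (simp add: t_def)
  have tn1: "tri (n + 1) = t + n + n + 1" using tri_plus1[of n] by (simp add: tn)
  have sn: "tet n = s + t" using tet_plus1[of "n - 1"] by (simp add: t_def s_def)
  have sn1: "tet (n + 1) = s + t + t + n" using tet_plus1[of n] by (simp add: tn sn)
  \<comment> \<open>This identity removes the remaining w^2 term; everything else has the factor
    w^3.\<close>
  have nn: "n * n = 2 * t + n" using two_tri[of "n - 1"] by (simp add: t_def algebra_simps)
  have "(HH n j + 1) * EE n j - HH (n + 1) j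
     = w ^ 3 * (- j * (t + n) * tri j * (1 - n) - j * (j\<^sup>2 * (s + t) + tri j * (n - (2 * s + t)))
        + w * (j\<^sup>2 * (s + t) + tri j * (n - (2 * s + t))) * tri j * (1 - n)) + w\<^sup>2 * tri j * (2 * t + n - n * n)"
    unfolding HH_def EE_def by (simp add: tn tn1 sn sn1 flip: t_def s_def)
      (simp add: algebra_simps power2_eq_square power3_eq_cube)
  then have "(HH n j + 1) * EE n j - HH (n + 1) j
     = w ^ 3 * (- j * (t + n) * tri j * (1 - n) - j * (j\<^sup>2 * (s + t) + tri j * (n - (2 * s + t)))
        + w * (j\<^sup>2 * (s + t) + tri j * (n - (2 * s + t))) * tri j * (1 - n))"
    unfolding nn by simp
  then show ?thesis by (simp only: q3_dvd_w3)
qed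

lemma fA_iter_snd: "snd ((fA ^^ n) x) = (T ^^ n) (snd x)"
  by (induction n) (simp_all add: fA_def)

lemma fA_iter_fst: "q ^ 3 dvd fst ((fA ^^ n) x) - (fst x * GG (int n) (snd x) + HH (int n) (snd x))"
proof (induction n)
  case 0
  show ?case by (simp add: GG_def HH_def tri_def tet_def)
next
  case (Suc n)
  let ?F = "fst ((fA ^^ n) x)" and ?i = "fst x" and ?j = "snd x" and ?n = "int n"
  have "q ^ 3 dvd (?F - (?i * GG ?n ?j + HH ?n ?j)) * ee (- (T ^^ n) ?j)
     + (?i * GG ?n ?j + HH ?n ?j + 1) * (ee (- (T ^^ n) ?j) - EE ?n ?j)
     + ?i * (GG ?n ?j * EE ?n ?j - GG (?n + 1) ?j) + ((HH ?n ?j + 1) * EE ?n ?j - HH (?n + 1) ?j)"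
    by (intro dvd_add dvd_mult2[OF Suc] dvd_mult[OF EE_iter] dvd_mult[OF GG_step] HH_step)
  also have "\<dots> = (?F + 1) * ee (- (T ^^ n) ?j) - (?i * GG (?n + 1) ?j + HH (?n + 1) ?j)"
    by (simp add: algebra_simps)
  also have "(?F + 1) * ee (- (T ^^ n) ?j) = fst ((fA ^^ Suc n) x)"
    by (simp add: fA_def[of "(fA ^^ n) x"] fA_iter_snd)
  finally show ?case by (simp add: add.commute)
qed

text \<open>At n = q^3 the numbers n, tri n and tri (n - 1) are divisible by q^3. For
  \<open>tet\<close> this holds only after multiplication by w, a factor that it always carries in
  \<open>HH\<close>.\<close>

lemma fA_pow_q3: "pt_eq x ((fA ^^ (p ^ (3 * m))) x)"
proof -
  define n where "n = p ^ (3 * m)"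
  have n: "int n = q ^ 3" by (simp add: n_def q_def flip: power_mult) (simp add: mult.commute)
  let ?i = "fst x" and ?j = "snd x"
  have tri: "q ^ 3 dvd tri (q ^ 3)"
    by (rule cancel2) (simp add: two_tri)
  have tri': "q ^ 3 dvd tri (q ^ 3 - 1)"
    by (rule cancel2) (simp add: two_tri)
  have "6 * (w * tet (q ^ 3)) = 3 * q ^ 3 * 0 + w * q ^ 3 * ((q ^ 3 - 1) * (q ^ 3 + 1))"
  proof -
    have "6 * (w * tet (q ^ 3)) = w * (6 * tet (q ^ 3))" by simp
    then show ?thesis unfolding six_tet by (simp add: algebra_simps)
  qed
  from cancel6[OF this] have tet: "q ^ 3 dvd w * tet (q ^ 3)" .
  have "6 * (w * tet (q ^ 3 - 1)) = 3 * q ^ 3 * 0 + w * q ^ 3 * ((q ^ 3 - 1) * (q ^ 3 - 2))"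
  proof -
    have "6 * (w * tet (q ^ 3 - 1)) = w * (6 * tet (q ^ 3 - 1))" by simp
    then show ?thesis unfolding six_tet by (simp add: algebra_simps)
  qed
  from cancel6[OF this] have tet': "q ^ 3 dvd w * tet (q ^ 3 - 1)" .
  have "GG (q ^ 3) ?j - 1 = q ^ 3 * (- w * ?j + w\<^sup>2 * tri ?j) + tri (q ^ 3 - 1) * (w\<^sup>2 * (?j\<^sup>2 - tri ?j))"
    unfolding GG_def by (simp add: algebra_simps)
  then have G: "q ^ 3 dvd GG (q ^ 3) ?j - 1"
    using dvd_add[OF dvd_triv_left dvd_mult2[OF tri']] by metis
  have "HH (q ^ 3) ?j = q ^ 3 * (1 + w\<^sup>2 * tri ?j) + (tri (q ^ 3) * (- w * ?j) + ((w * tet (q ^ 3)) * (w * ?j\<^sup>2)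
      + ((w * tet (q ^ 3 - 1)) * (- 2 * w * tri ?j) + tri (q ^ 3 - 1) * (- w\<^sup>2 * tri ?j))))"
    unfolding HH_def by (simp add: algebra_simps power2_eq_square)
  moreover have "q ^ 3 dvd \<dots>"
    by (intro dvd_add dvd_mult2[OF tri] dvd_mult2[OF tri'] dvd_mult2[OF tet] dvd_mult2[OF tet'] dvd_triv_left)
  ultimately have H: "q ^ 3 dvd HH (q ^ 3) ?j" by metis
  have "q ^ 3 dvd (fst ((fA ^^ n) x) - (?i * GG (q ^ 3) ?j + HH (q ^ 3) ?j)) + (?i * (GG (q ^ 3) ?j - 1) + HH (q ^ 3) ?j)"
    using fA_iter_fst[of n x] unfolding n by (intro dvd_add dvd_mult G H)
  then have 1: "q ^ 3 dvd fst ((fA ^^ n) x) - fst x" by (simp add: algebra_simps)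
  have "q ^ 3 dvd ((T ^^ n) ?j - (?j + q ^ 3 * D1 ?j + tri (q ^ 3 - 1) * D2 ?j)) + (q ^ 3 * D1 ?j + tri (q ^ 3 - 1) * D2 ?j)"
    using T_iter[of n ?j] unfolding n by (intro dvd_add dvd_mult2[OF tri'] dvd_triv_left)
  then have 2: "q ^ 3 dvd snd ((fA ^^ n) x) - snd x" by (simp add: fA_iter_snd)
  show ?thesis using pt_eqI[OF 1 2] by (simp add: n_def)
qed

text \<open>The coordinates of the two sides differ by \<open>d1\<close> and \<open>d2\<close>,
  whose leading term - w^2 j / 2 does not vanish modulo q^3 in general. But \<open>d1\<close> and
  \<open>d2\<close> agree modulo q^3, and that is what \<open>pt_eq\<close> forgives: without
  identifying A^(q^2) with B^(-q^2) the relation would fail in the model.\<close>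

lemma fA_rel:
  assumes al: "al \<ge> 0"
  shows "pt_eq ((fA ^^ nat al) x) (fC (fA (fC' x)))"
proof -
  let ?i = "fst x" and ?j = "snd x"
  have n: "int (nat al) = al" using al by simp
  have nm: "al - 1 = w" by (simp add: al_def)
  define E where "E = ee (- (?j * al))"
  have GE: "q ^ 3 dvd E - GG al ?j"
  proof -
    have "2 * (2 * (E - GG al ?j)) = 4 * (- w * (?j * al) + al * w * ?j) + w\<^sup>2 * (2 * (2 * tri (?j * al)) - 2 * al * (2 * tri ?j)
       + (2 * tri ?j) * (2 * tri w) - 2 * ?j\<^sup>2 * (2 * tri w))"
      unfolding E_def GG_def ee_minus nm by (simp add: algebra_simps)
    also have "\<dots> = w ^ 3 * (2 * al * ?j\<^sup>2 + (?j\<^sup>2 + ?j) * (w + 1) - 2 * ?j\<^sup>2 * (w + 1))"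
      unfolding two_tri al_def by (simp add: algebra_simps power2_eq_square power3_eq_cube)
    finally have "q ^ 3 dvd 2 * (2 * (E - GG al ?j))" by (simp only: q3_dvd_w3)
    then show ?thesis by (rule cancel2[OF cancel2])
  qed
  define d1 where "d1 = al * E - HH al ?j"
  define d2 where "d2 = T (?j * al) * be - (?j + al * D1 ?j)"
  have d1: "12 * d1 = w\<^sup>2 * (- 6 * ?j) + w ^ 3 * (?j + 9 * ?j ^ 2 + 9 * w * ?j + 15 * w * ?j ^ 2 + 2 * w ^ 2 * ?j + 6 * w ^ 2 * ?j ^ 2)"
  proof -
    have "12 * d1 = al * (12 - 12 * w * (?j * al) + 6 * w\<^sup>2 * (2 * tri (?j * al))) - 12 * al + 6 * w * ?j * (2 * tri al)
        - w\<^sup>2 * (2 * ?j\<^sup>2 * (6 * tet al) + (2 * tri ?j) * (6 * al - 2 * (6 * tet w) - 3 * (2 * tri w)))"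
      unfolding d1_def E_def HH_def ee_minus nm by (simp add: algebra_simps)
    also have "\<dots> = w\<^sup>2 * (- 6 * ?j) + w ^ 3 * (?j + 9 * ?j ^ 2 + 9 * w * ?j + 15 * w * ?j ^ 2 + 2 * w ^ 2 * ?j + 6 * w ^ 2 * ?j ^ 2)"
      unfolding two_tri six_tet al_def by (simp add: algebra_simps power2_eq_square power3_eq_cube)
    finally show ?thesis .
  qed
  have d2: "12 * (d1 - d2) = w ^ 3 * (- 13 * ?j + 9 * ?j ^ 2 - 2 * ?j ^ 3) + w * w ^ 3 * (3 * ?j + 9 * ?j ^ 2 + (-2) * ?j ^ 3
       + 4 * w * ?j + (-2) * w * ?j ^ 3 + (-4) * w ^ 2 * ?j ^ 3 + (-2) * w ^ 3 * ?j ^ 3)"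
  proof -
    have "12 * d2 = be * (12 * (?j * al) + 6 * w * (2 * tri (?j * al)) + 2 * w\<^sup>2 * (6 * tet (?j * al)))
       - 12 * ?j - al * (6 * w * (2 * tri ?j) + 2 * w\<^sup>2 * (6 * tet ?j))"
      unfolding d2_def D1_def T_def by (simp add: algebra_simps)
    then show ?thesis using d1 unfolding two_tri six_tet al_def be_def
      by (simp add: algebra_simps power2_eq_square power3_eq_cube)
  qed
  have q2: "q\<^sup>2 dvd d1"
  proof (rule cancel2, rule cancel6)
    have "6 * (2 * d1) = 12 * d1" by simp
    also have "\<dots> = 3 * w\<^sup>2 * (- 2 * ?j) + w * w\<^sup>2 * (?j + 9 * ?j ^ 2 + 9 * w * ?j + 15 * w * ?j ^ 2 + 2 * (w * w) * ?j + 6 * (w * w) * ?j ^ 2)"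
      unfolding d1 by (simp add: algebra_simps power2_eq_square power3_eq_cube)
    finally show "6 * (2 * d1) = 3 * q ^ 2 * (l\<^sup>2 * (- 2 * ?j)) + w * q ^ 2 * (l\<^sup>2 * (?j + 9 * ?j ^ 2 + 9 * w * ?j + 15 * w * ?j ^ 2 + 2 * (w * w) * ?j + 6 * (w * w) * ?j ^ 2))"
      unfolding w_sq by (simp only: mult.assoc)
  qed
  have q3: "q ^ 3 dvd d1 - d2"
  proof (rule cancel2, rule cancel6)
    \<comment> \<open>\<open>tet\<close> shows the cubic in j to be 3 times an integer, as
      \<open>cancel6\<close> demands.\<close>
    have j: "- 13 * ?j + 9 * ?j ^ 2 - 2 * ?j ^ 3 = 3 * (- 5 * ?j + 3 * ?j\<^sup>2 - 4 * tet ?j)"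
      using six_tet[of ?j] by (simp add: algebra_simps power2_eq_square power3_eq_cube)
    have "6 * (2 * (d1 - d2)) = 12 * (d1 - d2)" by simp
    then show "6 * (2 * (d1 - d2)) = 3 * q ^ 3 * (l ^ 3 * (- 5 * ?j + 3 * ?j\<^sup>2 - 4 * tet ?j))
      + w * q ^ 3 * (l ^ 3 * (3 * ?j + 9 * ?j ^ 2 + (-2) * ?j ^ 3
       + 4 * w * ?j + (-2) * w * ?j ^ 3 + (-4) * w ^ 2 * ?j ^ 3 + (-2) * w ^ 3 * ?j ^ 3))"
      unfolding d2 j unfolding w_cube by (simp only: mult.assoc mult.left_commute[of 3])
  qed
  have albe: "q ^ 3 dvd be * al - 1" using al_be by (simp add: cong_iff_dvd_diff mult.commute)
  define e1 where "e1 = fst (fC (fA (fC' x))) - fst ((fA ^^ nat al) x) - d1"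
  have "q ^ 3 dvd ?i * E * (be * al - 1) + (?i * (E - GG al ?j) - (fst ((fA ^^ nat al) x) - (?i * GG al ?j + HH al ?j)))"
    using fA_iter_fst[of "nat al" x] unfolding n
    by (rule dvd_add[OF dvd_mult[OF albe] dvd_diff[OF dvd_mult[OF GE]]])
  also have "\<dots> = e1" unfolding e1_def d1_def
    by (simp add: fC_def fA_def fC'_def E_def algebra_simps)
  finally have e1: "q ^ 3 dvd e1" .
  define e2 where "e2 = snd (fC (fA (fC' x))) - snd ((fA ^^ nat al) x) - d2"
  have wD: "q ^ 3 dvd tri w * D2 ?j"
  proof (rule cancel2)
    obtain r where "D2 ?j = q\<^sup>2 * r" using D2_q2 by blast
    then have "2 * (tri w * D2 ?j) = (2 * tri w) * (q\<^sup>2 * r)" by simp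
    also have "\<dots> = q ^ 3 * (l * (w + 1) * r)"
      unfolding two_tri by (simp add: w_def power2_eq_square power3_eq_cube algebra_simps)
    finally have "2 * (tri w * D2 ?j) = \<dots>" .
    then show "q ^ 3 dvd 2 * (tri w * D2 ?j)" by simp
  qed
  have "q ^ 3 dvd - ((T ^^ nat al) ?j - (?j + al * D1 ?j + tri w * D2 ?j)) - tri w * D2 ?j"
    using T_iter[of "nat al" ?j] unfolding n nm by (intro dvd_diff wD) (simp only: dvd_minus_iff)
  also have "\<dots> = e2" unfolding e2_def d2_def
    by (simp add: fC_def fA_def fC'_def fA_iter_snd)
  finally have e2: "q ^ 3 dvd e2" .
  have "fst (fC (fA (fC' x))) - fst ((fA ^^ nat al) x) = d1 + e1" by (simp add: e1_def)
  moreover have "q\<^sup>2 dvd d1 + e1" by (rule dvd_add[OF q2 dvd_trans[OF q2_dvd_q3 e1]])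
  moreover have "snd (fC (fA (fC' x))) - snd ((fA ^^ nat al) x) = d2 + e2" by (simp add: e2_def)
  moreover have "q ^ 3 dvd d1 - d2 + e1 - e2" by (rule dvd_diff[OF dvd_add[OF q3 e1] e2])
  then have "q ^ 3 dvd d1 + e1 - (d2 + e2)" by (simp add: algebra_simps)
  ultimately show ?thesis unfolding pt_eq_def by metis
qed

lemma fC_inverse: "pt_eq (fC (fC' x)) x" "pt_eq (fC' (fC x)) x"
proof -
  have *: "q ^ 3 dvd k - k * (al * be)" for k
  proof -
    have "q ^ 3 dvd 1 - al * be" using cong_sym[OF al_be] by (simp add: cong_iff_dvd_diff)
    then have "q ^ 3 dvd k * (1 - al * be)" by (rule dvd_mult)
    then show ?thesis by (simp add: algebra_simps)
  qed
  show "pt_eq (fC (fC' x)) x" "pt_eq (fC' (fC x)) x"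
    using pt_eqI[OF *[of "fst x"] *[of "snd x"]] by (simp_all add: fC_def fC'_def ac_simps)
qed

text \<open>The commutator relation B A C = A B: a right action applies B first, which makes it the
  innermost function.\<close>

lemma fC_fA_fB: "pt_eq (fC (fA (fB 1 x))) (fB 1 (fA x))"
proof -
  let ?i = "fst x" and ?j = "snd x"
  have "[ee (- (?j + 1)) * al = ee (- ?j)] (mod q ^ 3)"
    using ee_add[of "- (?j + 1)" 1] by (simp add: ee_1 cong_sym)
  then have c1: "[(?i + 1) * (ee (- (?j + 1)) * al) = (?i + 1) * ee (- ?j)] (mod q ^ 3)"
    by (intro cong_mult cong_refl)
  have 1: "q ^ 3 dvd (?i + 1) * ee (- ?j) - (?i + 1) * ee (- (?j + 1)) * al"
    using cong_sym[OF c1] unfolding cong_iff_dvd_diff by (simp only: mult.assoc)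
  have "[T (?j + 1) * be = (T ?j + 1) * al * be] (mod q ^ 3)"
    by (intro cong_mult cong_refl T_step)
  also have "[(T ?j + 1) * al * be = T ?j + 1] (mod q ^ 3)"
    using cong_mult[OF cong_refl al_be, of "T ?j + 1"] by (simp add: mult.assoc)
  finally have 2: "q ^ 3 dvd (T ?j + 1) - T (?j + 1) * be"
    unfolding cong_iff_dvd_diff[of "T ?j + 1", symmetric] by (rule cong_sym)
  show ?thesis using pt_eqI[OF 1 2] by (simp add: fC_def fA_def fB_def algebra_simps)
qed

lemma fC_fB: "pt_eq (fC' (fB 1 (fC x))) (fB al x)"
  using fC_inverse(2)[of x] by (simp add: pt_eq_def fC_def fB_def fC'_def algebra_simps)

text \<open>The canonical point of a \<open>pt_eq\<close> class: the same multiple of q^2 is taken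
  off both coordinates. With canonical points the classes form a plain set, whose bijections form a
  \<open>BijGroup\<close>.\<close>

definition red :: "int \<times> int \<Rightarrow> int \<times> int" where
  "red x = (fst x mod q\<^sup>2, (snd x - (fst x - fst x mod q\<^sup>2)) mod q ^ 3)"

lemma red_eq_iff: "red x = red y \<longleftrightarrow> pt_eq x y"
proof -
  have "fst x mod q\<^sup>2 = fst y mod q\<^sup>2 \<longleftrightarrow> q\<^sup>2 dvd fst y - fst x"
    using mod_eq_dvd_iff[of "fst x" "q\<^sup>2" "fst y"] dvd_diff_commute[of "q\<^sup>2"] by blast
  moreover have "(snd x - (fst x - fst x mod q\<^sup>2)) mod q ^ 3 = (snd y - (fst y - fst y mod q\<^sup>2)) mod q ^ 3
      \<longleftrightarrow> q ^ 3 dvd (fst y - fst x) - (snd y - snd x)" if "fst x mod q\<^sup>2 = fst y mod q\<^sup>2"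
  proof -
    have "(snd x - (fst x - fst x mod q\<^sup>2)) - (snd y - (fst y - fst y mod q\<^sup>2)) = (fst y - fst x) - (snd y - snd x)"
      using that by simp
    then show ?thesis unfolding mod_eq_dvd_iff by (rule arg_cong)
  qed
  ultimately show ?thesis unfolding red_def pt_eq_def prod.inject by blast
qed

definition pts :: "(int \<times> int) set" where "pts = range red"

definition lift :: "(int \<times> int \<Rightarrow> int \<times> int) \<Rightarrow> int \<times> int \<Rightarrow> int \<times> int" where
  "lift f = restrict (\<lambda>x. red (f x)) pts"

definition pt_resp :: "(int \<times> int \<Rightarrow> int \<times> int) \<Rightarrow> bool" where
  "pt_resp f \<longleftrightarrow> (\<forall>x y. pt_eq x y \<longrightarrow> pt_eq (f x) (f y))"

lemma red_red: "pt_eq (red x) x"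
proof -
  have "(fst x mod q\<^sup>2) mod q\<^sup>2 = fst x mod q\<^sup>2" by simp
  then have "red (red x) = red x" by (simp add: red_def)
  then show ?thesis by (simp add: red_eq_iff)
qed

lemma lift_red: "pt_resp f \<Longrightarrow> lift f (red x) = red (f x)"
  using red_red[of x] rangeI[of red x]
  by (simp add: lift_def pts_def red_eq_iff pt_resp_def del: split_paired_All rangeI)

lemma compose_lift: "pt_resp f \<Longrightarrow> compose pts (lift f) (lift g) = lift (\<lambda>x. f (g x))"
proof (rule ext)
  fix x assume f: "pt_resp f"
  have "lift g x = red (g x)" if "x \<in> pts" using that by (simp add: lift_def)
  then show "compose pts (lift f) (lift g) x = lift (\<lambda>x. f (g x)) x"
    using lift_red[OF f, of "g x"] by (auto simp: compose_def lift_def)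
qed

lemma lift_cong: "(\<And>x. pt_eq (f x) (g x)) \<Longrightarrow> lift f = lift g"
  unfolding lift_def by (intro restrict_ext) (simp add: red_eq_iff)

lemma lift_id: "lift (\<lambda>x. x) = (\<lambda>x\<in>pts. x)"
proof (unfold lift_def, rule restrict_ext)
  fix x assume "x \<in> pts"
  then obtain y where "x = red y" by (auto simp: pts_def)
  then show "red x = x" using red_red[of y] by (simp add: red_eq_iff)
qed

lemma lift_Bij:
  assumes "pt_resp f" "pt_resp g" "\<And>x. pt_eq (f (g x)) x" "\<And>x. pt_eq (g (f x)) x"
  shows "lift f \<in> Bij pts"
proof -
  have "bij_betw (lift f) pts pts"
  proof (rule bij_betw_byWitness[where f' = "lift g"])
    show "\<forall>x\<in>pts. lift g (lift f x) = x"
      using assms(2,4) by (auto simp: pts_def lift_red assms(1) red_eq_iff)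
    show "\<forall>x\<in>pts. lift f (lift g x) = x"
      using assms(1,3) by (auto simp: pts_def lift_red assms(2) red_eq_iff)
    show "lift f ` pts \<subseteq> pts" "lift g ` pts \<subseteq> pts" by (auto simp: lift_def pts_def)
  qed
  then show ?thesis by (simp add: Bij_def lift_def)
qed

lemma pt_resp_iter: "pt_resp f \<Longrightarrow> pt_resp (f ^^ n)"
  by (induction n) (simp_all add: pt_resp_def del: split_paired_All)

lemma pt_resp_f: "pt_resp fA" "pt_resp (fB k)" "pt_resp fC" "pt_resp fC'"
  using fA_respect fB_respect fC_respect by (auto simp: pt_resp_def)

section \<open>The permutation group and its relations\<close>

abbreviation Pts where "Pts \<equiv> BijGroup pts"

lemma lift_in_Pts:
  "lift fA \<in> carrier Pts" "lift (fB k) \<in> carrier Pts" "lift fC \<in> carrier Pts" "lift fC' \<in> carrier Pts"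
proof -
  \<comment> \<open>The inverse of the permutation of A is its power with exponent q^3 - 1.\<close>
  obtain n where n: "p ^ (3 * m) = Suc n"
    using prime_p by (metis not0_implies_Suc power_not_zero not_prime_0)
  have 1: "pt_eq (fA ((fA ^^ n) x)) x" for x using fA_pow_q3[of x] by (simp add: n pt_eq_sym)
  have 2: "pt_eq ((fA ^^ n) (fA x)) x" for x using 1[of x] by (metis funpow_swap1)
  show "lift fA \<in> carrier Pts"
    using lift_Bij[OF pt_resp_f(1) pt_resp_iter[OF pt_resp_f(1)] 1 2] by (simp add: BijGroup_def)
  show "lift (fB k) \<in> carrier Pts"
    using lift_Bij[OF pt_resp_f(2,2), of k "- k"] by (simp add: BijGroup_def fB_def)
  show "lift fC \<in> carrier Pts" "lift fC' \<in> carrier Pts"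
    using lift_Bij[OF pt_resp_f(3,4)] lift_Bij[OF pt_resp_f(4,3)] fC_inverse by (simp_all add: BijGroup_def)
qed

lemma mult_Pts: "pt_resp f \<Longrightarrow> lift f \<in> carrier Pts \<Longrightarrow> lift g \<in> carrier Pts \<Longrightarrow>
    lift f \<otimes>\<^bsub>Pts\<^esub> lift g = lift (\<lambda>x. f (g x))"
  using compose_lift[of f g] by (simp add: BijGroup_def)

lemma one_Pts: "\<one>\<^bsub>Pts\<^esub> = lift (\<lambda>x. x)"
  by (simp add: BijGroup_def lift_id)

lemma pow_Pts: "pt_resp f \<Longrightarrow> lift f \<in> carrier Pts \<Longrightarrow> lift f [^]\<^bsub>Pts\<^esub> n = lift (f ^^ n)"
proof (induction n)
  case 0
  show ?case by (simp add: one_Pts id_def)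
next
  case (Suc n)
  interpret P: group Pts by (rule group_BijGroup)
  have "lift (f ^^ n) \<in> carrier Pts" using Suc P.nat_pow_closed[of "lift f" n] by simp
  then show ?case using Suc by (simp add: mult_Pts pt_resp_iter) (simp add: funpow_swap1 comp_def)
qed

lemma fB_iter: "(fB k ^^ n) x = fB (int n * k) x"
  by (induction n) (auto simp: fB_def algebra_simps)

text \<open>Composition of functions is opposite to the right action, hence the inverses.\<close>

lemma Pts_relations:
  assumes al: "al \<ge> 0"
  defines "x \<equiv> inv\<^bsub>Pts\<^esub> (lift fA)" and "y \<equiv> inv\<^bsub>Pts\<^esub> (lift (fB 1))"
  shows "x \<in> carrier Pts" "y \<in> carrier Pts" "group_comm Pts x y = inv\<^bsub>Pts\<^esub> (lift fC)"
    "group_conj Pts x (group_comm Pts x y) = x [^]\<^bsub>Pts\<^esub> al"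
    "group_conj Pts y (group_comm Pts y x) = y [^]\<^bsub>Pts\<^esub> al"
    "x [^]\<^bsub>Pts\<^esub> (p ^ (3 * m)) = \<one>\<^bsub>Pts\<^esub>" "y [^]\<^bsub>Pts\<^esub> (p ^ (3 * m)) = \<one>\<^bsub>Pts\<^esub>"
proof -
  interpret P: group Pts by (rule group_BijGroup)
  note [simp] = lift_in_Pts
  let ?A = "lift fA" and ?B = "lift (fB 1)" and ?C = "lift fC"
  show x: "x \<in> carrier Pts" and y: "y \<in> carrier Pts" by (simp_all add: x_def y_def)
  have AB_c: "lift (\<lambda>x. fA (fB 1 x)) \<in> carrier Pts"
    using P.m_closed[of ?A ?B] by (simp add: mult_Pts pt_resp_f)
  have CAB: "?C \<otimes>\<^bsub>Pts\<^esub> (?A \<otimes>\<^bsub>Pts\<^esub> ?B) = ?B \<otimes>\<^bsub>Pts\<^esub> ?A"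
    using fC_fA_fB AB_c by (simp add: mult_Pts pt_resp_f) (rule lift_cong)
  have C': "inv\<^bsub>Pts\<^esub> ?C = lift fC'"
    by (rule P.inv_equality) (auto simp: mult_Pts pt_resp_f one_Pts intro!: lift_cong fC_inverse)
  have CA: "?C \<otimes>\<^bsub>Pts\<^esub> (?A \<otimes>\<^bsub>Pts\<^esub> inv\<^bsub>Pts\<^esub> ?C) = ?A [^]\<^bsub>Pts\<^esub> (nat al)"
  proof -
    have "lift (\<lambda>x. fA (fC' x)) \<in> carrier Pts"
      using P.m_closed[of ?A "lift fC'"] by (simp add: mult_Pts pt_resp_f)
    then have "?C \<otimes>\<^bsub>Pts\<^esub> (?A \<otimes>\<^bsub>Pts\<^esub> inv\<^bsub>Pts\<^esub> ?C) = lift (\<lambda>x. fC (fA (fC' x)))"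
      unfolding C' by (simp add: mult_Pts pt_resp_f)
    also have "\<dots> = lift (fA ^^ nat al)" by (rule lift_cong) (rule pt_eq_sym[OF fA_rel[OF al]])
    finally show ?thesis by (simp add: pow_Pts pt_resp_f)
  qed
  have CB: "inv\<^bsub>Pts\<^esub> ?C \<otimes>\<^bsub>Pts\<^esub> (?B \<otimes>\<^bsub>Pts\<^esub> ?C) = ?B [^]\<^bsub>Pts\<^esub> (nat al)"
  proof -
    have "lift (\<lambda>x. fB 1 (fC x)) \<in> carrier Pts"
      using P.m_closed[of ?B ?C] by (simp add: mult_Pts pt_resp_f)
    then have "inv\<^bsub>Pts\<^esub> ?C \<otimes>\<^bsub>Pts\<^esub> (?B \<otimes>\<^bsub>Pts\<^esub> ?C) = lift (\<lambda>x. fC' (fB 1 (fC x)))"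
      unfolding C' by (simp add: mult_Pts pt_resp_f)
    also have "\<dots> = lift (fB 1 ^^ nat al)" by (rule lift_cong) (simp add: fB_iter fC_fB al)
    finally show ?thesis by (simp add: pow_Pts pt_resp_f)
  qed
  have C: "?C = ?B \<otimes>\<^bsub>Pts\<^esub> ?A \<otimes>\<^bsub>Pts\<^esub> inv\<^bsub>Pts\<^esub> (?A \<otimes>\<^bsub>Pts\<^esub> ?B)"
    unfolding CAB[symmetric] by (simp add: P.m_assoc)
  show comm: "group_comm Pts x y = inv\<^bsub>Pts\<^esub> ?C"
    unfolding C by (simp add: group_comm_def x_def y_def P.inv_mult_group P.m_assoc)
  have comm': "group_comm Pts y x = ?C"
    unfolding C by (simp add: group_comm_def x_def y_def P.inv_mult_group P.m_assoc)
  have pow: "z [^]\<^bsub>Pts\<^esub> al = z [^]\<^bsub>Pts\<^esub> (nat al)" for z :: "int \<times> int \<Rightarrow> int \<times> int"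
    using al int_pow_int[of Pts z "nat al"] by simp
  show "group_conj Pts x (group_comm Pts x y) = x [^]\<^bsub>Pts\<^esub> al"
  proof -
    have "group_conj Pts x (group_comm Pts x y) = inv\<^bsub>Pts\<^esub> (?C \<otimes>\<^bsub>Pts\<^esub> (?A \<otimes>\<^bsub>Pts\<^esub> inv\<^bsub>Pts\<^esub> ?C))"
      unfolding comm by (simp add: group_conj_def x_def P.inv_mult_group P.m_assoc)
    then show ?thesis unfolding CA pow by (simp add: x_def P.nat_pow_inv)
  qed
  show "group_conj Pts y (group_comm Pts y x) = y [^]\<^bsub>Pts\<^esub> al"
  proof -
    have "group_conj Pts y (group_comm Pts y x) = inv\<^bsub>Pts\<^esub> (inv\<^bsub>Pts\<^esub> ?C \<otimes>\<^bsub>Pts\<^esub> (?B \<otimes>\<^bsub>Pts\<^esub> ?C))"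
      unfolding comm' by (simp add: group_conj_def y_def P.inv_mult_group P.m_assoc)
    then show ?thesis unfolding CB pow by (simp add: y_def P.nat_pow_inv)
  qed
  have "?A [^]\<^bsub>Pts\<^esub> (p ^ (3 * m)) = \<one>\<^bsub>Pts\<^esub>"
    unfolding pow_Pts[OF pt_resp_f(1) lift_in_Pts(1)] one_Pts by (rule lift_cong) (rule pt_eq_sym[OF fA_pow_q3])
  then show "x [^]\<^bsub>Pts\<^esub> (p ^ (3 * m)) = \<one>\<^bsub>Pts\<^esub>" by (simp add: x_def P.nat_pow_inv)
  have q3: "int (p ^ (3 * m)) = q ^ 3" by (simp add: q_def flip: power_mult) (simp add: mult.commute)
  have "?B [^]\<^bsub>Pts\<^esub> (p ^ (3 * m)) = \<one>\<^bsub>Pts\<^esub>"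
    unfolding pow_Pts[OF pt_resp_f(2) lift_in_Pts(2)] one_Pts
    by (rule lift_cong) (simp only: fB_iter q3 mult_1_right, simp add: fB_def pt_eq_def)
  then show "y [^]\<^bsub>Pts\<^esub> (p ^ (3 * m)) = \<one>\<^bsub>Pts\<^esub>" by (simp add: y_def P.nat_pow_inv)
qed

text \<open>The base point (0, 0) is the subgroup generated by C and hence fixed by C, while A^i B^j
  takes it to (i, j).\<close>

lemma Pts_nf_eq_one:
  fixes i j k :: nat
  assumes "(inv\<^bsub>Pts\<^esub> (lift fC)) [^]\<^bsub>Pts\<^esub> k \<otimes>\<^bsub>Pts\<^esub> (inv\<^bsub>Pts\<^esub> (lift fA)) [^]\<^bsub>Pts\<^esub> i
      \<otimes>\<^bsub>Pts\<^esub> (inv\<^bsub>Pts\<^esub> (lift (fB 1))) [^]\<^bsub>Pts\<^esub> j = \<one>\<^bsub>Pts\<^esub>"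
  shows "q\<^sup>2 dvd int i \<and> q ^ 3 dvd int i - int j"
proof -
  interpret P: group Pts by (rule group_BijGroup)
  note [simp] = lift_in_Pts
  let ?A = "lift fA" and ?B = "lift (fB 1)" and ?C = "lift fC"
  \<comment> \<open>Inverting the word gives a composition that applies C first, then A, then
    B.\<close>
  have "?B [^]\<^bsub>Pts\<^esub> j \<otimes>\<^bsub>Pts\<^esub> (?A [^]\<^bsub>Pts\<^esub> i \<otimes>\<^bsub>Pts\<^esub> ?C [^]\<^bsub>Pts\<^esub> k) = inv\<^bsub>Pts\<^esub> \<one>\<^bsub>Pts\<^esub>"
    unfolding assms[symmetric] by (simp add: P.nat_pow_inv P.inv_mult_group P.m_assoc)
  moreover have pow: "lift (fA ^^ i) \<in> carrier Pts" "lift (fC ^^ k) \<in> carrier Pts" "lift (fB 1 ^^ j) \<in> carrier Pts"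
    using P.nat_pow_closed[of ?A i] P.nat_pow_closed[of ?C k] P.nat_pow_closed[of ?B j]
    by (simp_all add: pow_Pts pt_resp_f)
  moreover have "lift (\<lambda>x. (fA ^^ i) ((fC ^^ k) x)) \<in> carrier Pts"
    using P.m_closed[OF pow(1,2)] pow by (simp add: mult_Pts pt_resp_f pt_resp_iter)
  ultimately have eq: "lift (\<lambda>x. (fB 1 ^^ j) ((fA ^^ i) ((fC ^^ k) x))) = lift (\<lambda>x. x)"
    by (simp add: mult_Pts pt_resp_f pt_resp_iter pow_Pts one_Pts[symmetric])
  have C: "(fC ^^ k) (0, 0) = (0, 0)" by (induction k) (auto simp: fC_def)
  have A: "(fA ^^ i) (0, 0) = (int i, 0)" by (induction i) (auto simp: fA_def)
  have 0: "(0, 0) \<in> pts" using red_def[of "(0, 0)"] by (auto simp: pts_def intro!: image_eqI[of _ _ "(0, 0)"])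
  have "red ((fB 1 ^^ j) ((fA ^^ i) ((fC ^^ k) (0, 0)))) = red (0, 0)"
    using fun_cong[OF eq, of "(0, 0)"] 0 by (simp add: lift_def)
  then have "pt_eq (0, 0) (int i, int j)" unfolding C A fB_iter red_eq_iff by (simp add: fB_def pt_eq_sym)
  then show ?thesis by (simp add: pt_eq_def)
qed

end

section \<open>The presented groups as instances\<close>

definition J1_rels :: "nat \<Rightarrow> nat \<Rightarrow> int \<Rightarrow> (gen letters set \<times> gen letters set) set" where
  "J1_rels p m \<alpha> = (let F = free_group; x = free_gen GenX; y = free_gen GenY in
       {(group_conj F x (group_comm F x y), x [^]\<^bsub>F\<^esub> \<alpha>),
        (group_conj F y (group_comm F y x), y [^]\<^bsub>F\<^esub> \<alpha>),
        (x [^]\<^bsub>F\<^esub> (p ^ (3 * m)), \<one>\<^bsub>F\<^esub>),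
        (y [^]\<^bsub>F\<^esub> (p ^ (3 * m)), \<one>\<^bsub>F\<^esub>)})"

definition J1_gen :: "nat \<Rightarrow> nat \<Rightarrow> int \<Rightarrow> gen \<Rightarrow> gen letters set set" where
  "J1_gen p m \<alpha> = presented_gen (J1_rels p m \<alpha>)"

lemma J1_eq: "J1 p m \<alpha> = presented_group (J1_rels p m \<alpha>)"
  by (simp add: J1_def J1_rels_def Let_def)

lemma J1_rels_closed: "J1_rels p m \<alpha> \<subseteq> carrier free_group \<times> carrier free_group"
proof -
  interpret F: group "free_group :: gen letters set monoid" by (rule group_free_group)
  show ?thesis unfolding J1_rels_def Let_def group_conj_def group_comm_def by auto
qed

lemma J1_gen_closed [simp]: "J1_gen p m \<alpha> a \<in> carrier (J1 p m \<alpha>)"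
  unfolding J1_gen_def J1_eq presented_gen_def presented_map_surj[OF J1_rels_closed, symmetric]
  by (rule imageI) simp

lemma UNIV_gen: "UNIV = {GenX, GenY}"
  using gen.exhaust by auto

lemma J1_macdonald:
  assumes "macdonald_numbers p m l"
  shows "macdonald p m l (J1 p m (1 + int p ^ m * l)) (J1_gen p m (1 + int p ^ m * l) GenX) (J1_gen p m (1 + int p ^ m * l) GenY)"
proof -
  interpret macdonald_numbers p m l by fact
  interpret F: group "free_group :: gen letters set monoid" by (rule group_free_group)
  let ?\<alpha> = "1 + int p ^ m * l"
  let ?h = "presented_map (J1_rels p m ?\<alpha>)"
  interpret h: group_hom free_group "J1 p m ?\<alpha>" ?h
    using presented_map_hom[OF J1_rels_closed]
    by (simp add: group_hom_def group_hom_axioms_def group_free_group group_J1 flip: J1_eq)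
  have rel: "(u, v) \<in> J1_rels p m ?\<alpha> \<Longrightarrow> ?h u = ?h v" for u v
    by (rule presented_map_rel[OF J1_rels_closed])
  have g: "J1_gen p m ?\<alpha> a = ?h (free_gen a)" for a by (simp add: J1_gen_def presented_gen_def)
  show ?thesis
  proof (unfold_locales)
    show "group_conj (J1 p m ?\<alpha>) (J1_gen p m ?\<alpha> GenX) (group_comm (J1 p m ?\<alpha>) (J1_gen p m ?\<alpha> GenX) (J1_gen p m ?\<alpha> GenY))
      = J1_gen p m ?\<alpha> GenX [^]\<^bsub>J1 p m ?\<alpha>\<^esub> ?\<alpha>"
    proof -
      have "?h (group_conj free_group (free_gen GenX) (group_comm free_group (free_gen GenX) (free_gen GenY))) = ?h (free_gen GenX [^]\<^bsub>free_group\<^esub> ?\<alpha>)"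
        by (rule rel) (simp add: J1_rels_def Let_def)
      then show ?thesis by (simp add: g group_conj_def group_comm_def h.hom_int_pow)
    qed
    show "group_conj (J1 p m ?\<alpha>) (J1_gen p m ?\<alpha> GenY) (group_comm (J1 p m ?\<alpha>) (J1_gen p m ?\<alpha> GenY) (J1_gen p m ?\<alpha> GenX))
      = J1_gen p m ?\<alpha> GenY [^]\<^bsub>J1 p m ?\<alpha>\<^esub> ?\<alpha>"
    proof -
      have "?h (group_conj free_group (free_gen GenY) (group_comm free_group (free_gen GenY) (free_gen GenX))) = ?h (free_gen GenY [^]\<^bsub>free_group\<^esub> ?\<alpha>)"
        by (rule rel) (simp add: J1_rels_def Let_def)
      then show ?thesis by (simp add: g group_conj_def group_comm_def h.hom_int_pow)
    qed
    show "J1_gen p m ?\<alpha> GenX [^]\<^bsub>J1 p m ?\<alpha>\<^esub> (p ^ (3 * m)) = \<one>\<^bsub>J1 p m ?\<alpha>\<^esub>"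
    proof -
      have "?h (free_gen GenX [^]\<^bsub>free_group\<^esub> (p ^ (3 * m))) = ?h (\<one>\<^bsub>free_group\<^esub>)"
        by (rule rel) (simp add: J1_rels_def Let_def)
      then show ?thesis by (simp add: g h.hom_nat_pow)
    qed
    show "J1_gen p m ?\<alpha> GenY [^]\<^bsub>J1 p m ?\<alpha>\<^esub> (p ^ (3 * m)) = \<one>\<^bsub>J1 p m ?\<alpha>\<^esub>"
    proof -
      have "?h (free_gen GenY [^]\<^bsub>free_group\<^esub> (p ^ (3 * m))) = ?h (\<one>\<^bsub>free_group\<^esub>)"
        by (rule rel) (simp add: J1_rels_def Let_def)
      then show ?thesis by (simp add: g h.hom_nat_pow)
    qed
    show "generate (J1 p m ?\<alpha>) {J1_gen p m ?\<alpha> GenX, J1_gen p m ?\<alpha> GenY} = carrier (J1 p m ?\<alpha>)"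
      using generate_presented_group[OF J1_rels_closed, of p m ?\<alpha>] by (simp add: J1_eq J1_gen_def UNIV_gen)
  qed simp_all
qed

lemma J1_universal:
  assumes G: "group G" and x: "x \<in> carrier G" and y: "y \<in> carrier G"
    and rel: "group_conj G x (group_comm G x y) = x [^]\<^bsub>G\<^esub> (\<alpha> :: int)"
      "group_conj G y (group_comm G y x) = y [^]\<^bsub>G\<^esub> \<alpha>"
      "x [^]\<^bsub>G\<^esub> (p ^ (3 * m)) = \<one>\<^bsub>G\<^esub>" "y [^]\<^bsub>G\<^esub> (p ^ (3 * m)) = \<one>\<^bsub>G\<^esub>"
  obtains g where "g \<in> hom (J1 p m \<alpha>) G" "g (J1_gen p m \<alpha> GenX) = x" "g (J1_gen p m \<alpha> GenY) = y"
proof -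
  define f where "f = case_gen x y"
  have f: "f a \<in> carrier G" for a using x y by (cases a) (simp_all add: f_def)
  have rels: "h u = h v" if h: "h \<in> hom free_group G" "\<And>a. h (free_gen a) = f a" and uv: "(u, v) \<in> J1_rels p m \<alpha>" for h u v
  proof -
    interpret h: group_hom free_group G h
      by (simp add: group_hom_def group_hom_axioms_def group_free_group h(1) G)
    have "h (free_gen GenX) = x" "h (free_gen GenY) = y" by (simp_all add: h(2) f_def)
    then show ?thesis
      using uv rel by (auto simp: J1_rels_def Let_def group_conj_def group_comm_def h.hom_int_pow h.hom_nat_pow)
  qed
  show thesis
  proof (rule presented_group_universal[OF J1_rels_closed G, of f p m \<alpha>])
    show "f a \<in> carrier G" for a by (rule f)
    show "h u = h v" if "h \<in> hom free_group G" "\<And>a. h (free_gen a) = f a" "(u, v) \<in> J1_rels p m \<alpha>" for h u v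
      using rels that by blast
    fix g assume "g \<in> hom (presented_group (J1_rels p m \<alpha>)) G" "\<And>a. g (presented_gen (J1_rels p m \<alpha>) a) = f a"
    then show thesis using that[of g] by (simp add: J1_eq J1_gen_def f_def)
  qed
qed

section \<open>Multiplication of normal forms\<close>

context macdonald_numbers
begin

lemma q3_eq: "q ^ 3 = q\<^sup>2 * q"
  by (simp add: power2_eq_square power3_eq_cube)

lemma q_dvd_tri: "q dvd j \<Longrightarrow> q dvd tri j"
  using cancel2[of 1 "tri j"] by (simp add: two_tri)

lemma q_dvd_tri': "q dvd j \<Longrightarrow> q dvd tri (j - 1)"
  using cancel2[of 1 "tri (j - 1)"] by (simp add: two_tri)

lemma q_dvd_T: "q dvd T j - j" "q dvd ee j - 1"
  by (simp_all add: T_def ee_def w_def power2_eq_square)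

lemma q2_dvd_T: "q dvd j \<Longrightarrow> q\<^sup>2 dvd T j - j"
proof -
  assume "q dvd j"
  then obtain t where t: "tri j = q * t" using q_dvd_tri by blast
  show ?thesis by (simp add: T_def w_def t power2_eq_square)
qed

lemma q2_dvd_ee: "q dvd j \<Longrightarrow> q\<^sup>2 dvd ee j - 1"
proof -
  assume "q dvd j"
  then obtain t where t: "j = q * t" by blast
  show ?thesis by (simp add: ee_def w_def t power2_eq_square)
qed

lemma q3_dvd_ee: "q\<^sup>2 dvd j \<Longrightarrow> q ^ 3 dvd ee j - 1"
  using ee_q2 by (auto simp: cong_iff_dvd_diff)

lemma q3_dvd_T: "q\<^sup>2 dvd j \<Longrightarrow> q ^ 3 dvd T j - j"
  using T_q2 by (auto simp: cong_iff_dvd_diff)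

lemma ee_factor: "2 * (ee k - 1) = q * (l * (k * (2 + (k - 1) * w)))"
proof -
  have "2 * (ee k - 1) = 2 * k * w + (2 * tri (k - 1)) * w\<^sup>2" by (simp add: ee_def algebra_simps)
  then show ?thesis unfolding two_tri w_def by (simp add: algebra_simps power2_eq_square)
qed

lemma p_dvd_w: "int p dvd w"
  using p_dvd_q by (simp add: w_def)

lemma coprime_unit: "coprime q (2 + k * w)"
proof -
  have "\<not> int p dvd 2" using coprime_q_2 coprime_q_iff by blast
  then have "\<not> int p dvd 2 + k * w"
    using p_dvd_w dvd_add_left_iff[of "int p" "k * w" 2] by simp
  then show ?thesis using coprime_q_iff by blast
qed

lemma cancel_l: "q ^ k dvd l * x \<Longrightarrow> q ^ k dvd x"
  using coprime_dvd_mult_right_iff[of "q ^ k" l x] coprime_q_l coprime_power_left_iff by blast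

lemma cancel_w: "q ^ Suc k dvd x * w \<Longrightarrow> q ^ k dvd x"
  using cancel_l[of k x] q_nz by (simp add: w_def ac_simps)

text \<open>Up to units \<open>ee j - 1\<close> is q times j: in \<open>ee_factor\<close> the
  numbers 2, l and 2 + (j - 1) w are all prime to p.\<close>

lemma ee_dvd: "q ^ Suc k dvd ee j - 1 \<Longrightarrow> q ^ k dvd j"
proof -
  assume "q ^ Suc k dvd ee j - 1"
  then have "q ^ Suc k dvd 2 * (ee j - 1)" by (rule dvd_mult)
  then have "q ^ k dvd l * (j * (2 + (j - 1) * w))" unfolding ee_factor using q_nz by simp
  then have "q ^ k dvd j * (2 + (j - 1) * w)" by (rule cancel_l)
  then have "q ^ k dvd (2 + (j - 1) * w) * j" by (simp only: mult.commute)
  then show ?thesis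
    using coprime_dvd_mult_right_iff[of "q ^ k" "2 + (j - 1) * w" j] coprime_unit coprime_power_left_iff by blast
qed

end

context macdonald
begin

lemma q_dvd_pow: "q dvd q\<^sup>2" "q\<^sup>2 dvd q ^ 3" "q dvd q ^ 3"
  by (simp_all add: power2_eq_square power3_eq_cube)

lemma b_q2: "q\<^sup>2 dvd j \<Longrightarrow> b j = a (- j)"
proof -
  assume "q\<^sup>2 dvd j"
  then obtain k where "j = q\<^sup>2 * k" by blast
  then show ?thesis using a_q2_b_q2[of "- k"] by simp
qed

lemma a_central: "q\<^sup>2 dvd i \<Longrightarrow> g \<in> carrier G \<Longrightarrow> a i \<otimes> g = g \<otimes> a i"
  using a_q2_central by (auto elim: dvdE)

lemma nf_a_central: "q\<^sup>2 dvd s \<Longrightarrow> nf k i j \<otimes> a s = nf k (i + s) j"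
proof -
  assume s: "q\<^sup>2 dvd s"
  have "nf k i j \<otimes> a s = c k \<otimes> (a i \<otimes> (b j \<otimes> a s))" by (simp add: nf_def m_assoc)
  also have "b j \<otimes> a s = a s \<otimes> b j" using a_central[OF s, of "b j"] by simp
  finally show ?thesis by (simp add: nf_def m_assoc add_assoc)
qed

lemma nf_shift: "q\<^sup>2 dvd j - j' \<Longrightarrow> nf k i j = nf k (i - (j - j')) j'"
proof -
  assume j: "q\<^sup>2 dvd j - j'"
  have "nf k i j = nf k i j' \<otimes> b (j - j')" by (simp add: nf_b)
  also have "\<dots> = nf k i j' \<otimes> a (- (j - j'))" by (simp only: b_q2[OF j])
  also have "\<dots> = nf k (i + - (j - j')) j'"
    by (rule nf_a_central) (simp only: dvd_minus_iff j)
  finally show ?thesis by (simp only: add_uminus_conv_diff)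
qed
text \<open>The conditions on i and j are those of \<open>pt_eq\<close>, realised in the group by
  shifting multiples of q^2 from B to A.\<close>

lemma nf_cong:
  assumes "q\<^sup>2 dvd k - k'" "q\<^sup>2 dvd i - i'" "q ^ 3 dvd (i - i') - (j - j')"
  shows "nf k i j = nf k' i' j'"
proof -
  have "q\<^sup>2 dvd (i - i') - ((i - i') - (j - j'))"
    by (rule dvd_diff[OF assms(2) dvd_trans[OF q2_dvd_q3 assms(3)]])
  then have j: "q\<^sup>2 dvd j - j'" by simp
  have "nf k i j = nf k (i - (j - j')) j'" by (rule nf_shift[OF j])
  also have "\<dots> = nf k' i' j'"
  proof -
    have "c k = c k'" by (rule c_cong) (simp add: cong_iff_dvd_diff assms)
    moreover have "a (i - (j - j')) = a i'"
      using assms(3) by (intro a_cong) (simp add: cong_iff_dvd_diff algebra_simps)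
    ultimately show ?thesis by (simp add: nf_def)
  qed
  finally show ?thesis .
qed

lemma a_1_nf: "a 1 \<otimes> nf k i j = nf k (ee k + i) j"
proof -
  have "a 1 \<otimes> nf k i j = (a 1 \<otimes> c k) \<otimes> (a i \<otimes> b j)" by (simp add: nf_def m_assoc)
  then show ?thesis unfolding a_c by (simp add: nf_def m_assoc add_assoc)
qed

lemma c_nf: "c s \<otimes> nf k i j = nf (s + k) i j"
  by (simp add: nf_def m_assoc add_assoc)

text \<open>Exponents of A and B matter modulo q^3, so they may be taken natural and treated by
  induction.\<close>

lemma nat_rep: obtains n :: nat where "[x = int n] (mod q ^ 3)"
proof
  have "x mod q ^ 3 \<ge> 0" using q_pos by simp
  then show "[x = int (nat (x mod q ^ 3))] (mod q ^ 3)" by (simp add: cong_def)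
qed

lemma q_dvd_of_q3: "[x = y] (mod q ^ 3) \<Longrightarrow> q dvd x - y" "[x = y] (mod q ^ 3) \<Longrightarrow> q\<^sup>2 dvd x - y"
  using q_dvd_pow dvd_trans by (auto simp: cong_iff_dvd_diff)

lemma nf_a_mod_q:
  "\<exists>k' i' j'. nf k i j \<otimes> a n = nf k' i' j' \<and> q dvd k' - (k - n * j) \<and> q dvd i' - (i + n) \<and> q dvd j' - j"
proof -
  obtain n' where n: "[n = int n'] (mod q ^ 3)" by (rule nat_rep)
  have "\<exists>k' i' j'. nf k i j \<otimes> a (int n') = nf k' i' j' \<and> q dvd k' - (k - int n' * j) \<and> q dvd i' - (i + int n') \<and> q dvd j' - j"
  proof (induction n')
    case 0
    show ?case by (intro exI[of _ k] exI[of _ i] exI[of _ j]) simp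
  next
    case (Suc n')
    then obtain k' i' j' where *: "nf k i j \<otimes> a (int n') = nf k' i' j'"
      "q dvd k' - (k - int n' * j)" "q dvd i' - (i + int n')" "q dvd j' - j" by blast
    have "nf k i j \<otimes> a (int (Suc n')) = (nf k i j \<otimes> a (int n')) \<otimes> a 1"
      by (simp add: m_assoc add add.commute)
    also have "\<dots> = nf (k' - j') ((i' + 1) * ee (- j')) (T j')" unfolding * nf_a_1 ..
    finally have "nf k i j \<otimes> a (int (Suc n')) = nf (k' - j') ((i' + 1) * ee (- j')) (T j')" .
    moreover have "q dvd (k' - (k - int n' * j)) - (j' - j)" by (rule dvd_diff[OF *(2) *(4)])
    then have "q dvd (k' - j') - (k - int (Suc n') * j)" by (simp add: algebra_simps)
    moreover have "q dvd (i' - (i + int n')) + (i' + 1) * (ee (- j') - 1)" by (rule dvd_add[OF *(3) dvd_mult[OF q_dvd_T(2)]])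
    then have "q dvd (i' + 1) * ee (- j') - (i + int (Suc n'))" by (simp add: algebra_simps)
    moreover have "q dvd (T j' - j') + (j' - j)" by (rule dvd_add[OF q_dvd_T(1) *(4)])
    then have "q dvd T j' - j" by simp
    ultimately show ?case by blast
  qed
  then obtain k' i' j' where *: "nf k i j \<otimes> a (int n') = nf k' i' j'"
      "q dvd k' - (k - int n' * j)" "q dvd i' - (i + int n')" "q dvd j' - j" by blast
  obtain d where d: "n - int n' = q * d" using q_dvd_of_q3(1)[OF n] by blast
  have "nf k i j \<otimes> a n = nf k' i' j'" using a_cong[OF n] * by simp
  moreover have "q dvd (k' - (k - int n' * j)) + q * (d * j)" by (rule dvd_add[OF *(2) dvd_triv_left])
  then have "q dvd k' - (k - n * j)" using d by (simp add: algebra_simps flip: mult.assoc)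
  moreover have "q dvd (i' - (i + int n')) - (n - int n')" by (rule dvd_diff[OF *(3) q_dvd_of_q3(1)[OF n]])
  then have "q dvd i' - (i + n)" by (simp add: algebra_simps)
  ultimately show ?thesis using *(4) by blast
qed

text \<open>Modulo q the exponents multiply as in the Heisenberg group over the integers modulo q;
  all corrections carry a factor q.\<close>

lemma nf_mult_mod_q:
  "\<exists>k'' i'' j''. nf k i j \<otimes> nf k' i' j' = nf k'' i'' j'' \<and>
     q dvd k'' - (k + k' - i' * j) \<and> q dvd i'' - (i + i') \<and> q dvd j'' - (j + j')"
proof -
  have "nf k i j \<otimes> nf k' i' j' = (nf k i j \<otimes> c k') \<otimes> a i' \<otimes> b j'"
    by (simp add: nf_def[of k'] m_assoc)
  also have "\<dots> = nf (k + k') (i * ee k') (j * ee (- k')) \<otimes> a i' \<otimes> b j'" by (simp only: nf_c)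
  finally have 1: "nf k i j \<otimes> nf k' i' j' = nf (k + k') (i * ee k') (j * ee (- k')) \<otimes> a i' \<otimes> b j'" .
  obtain k'' i'' j'' where *: "nf (k + k') (i * ee k') (j * ee (- k')) \<otimes> a i' = nf k'' i'' j''"
    "q dvd k'' - (k + k' - i' * (j * ee (- k')))" "q dvd i'' - (i * ee k' + i')" "q dvd j'' - j * ee (- k')"
    using nf_a_mod_q by blast
  have "nf k i j \<otimes> nf k' i' j' = nf k'' i'' (j'' + j')" unfolding 1 * nf_b ..
  moreover have "q dvd (k'' - (k + k' - i' * (j * ee (- k')))) - (i' * j) * (ee (- k') - 1)"
    by (rule dvd_diff[OF *(2) dvd_mult[OF q_dvd_T(2)]])
  then have "q dvd k'' - (k + k' - i' * j)" by (simp add: algebra_simps)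
  moreover have "q dvd (i'' - (i * ee k' + i')) + i * (ee k' - 1)" by (rule dvd_add[OF *(3) dvd_mult[OF q_dvd_T(2)]])
  then have "q dvd i'' - (i + i')" by (simp add: algebra_simps)
  moreover have "q dvd (j'' - j * ee (- k')) + j * (ee (- k') - 1)" by (rule dvd_add[OF *(4) dvd_mult[OF q_dvd_T(2)]])
  then have "q dvd (j'' + j') - (j + j')" by (simp add: algebra_simps)
  ultimately show ?thesis by blast
qed

text \<open>Each B that is passed adds \<open>T i - i\<close> to the exponent of A. Moving the
  accumulated C^(n i) past the next B costs n i w, and these costs sum to w i tri (n - 1). All of
  them are multiples of q^2 and hence give central factors.\<close>

lemma a_b_pow:
  assumes i: "q dvd i"
  shows "a i \<otimes> b (int n) = b (int n) \<otimes> (c (int n * i) \<otimes> a (i + int n * (T i - i) - w * i * tri (int n - 1)))"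
proof (induction n)
  case 0
  show ?case by (simp add: tri_def)
next
  case (Suc n)
  obtain i' where i': "i = q * i'" using i by blast
  define x where "x = int n * (T i - i) - w * i * tri (int n - 1)"
  have x: "q\<^sup>2 dvd x" unfolding x_def
    by (rule dvd_diff[OF dvd_mult[OF q2_dvd_T[OF i]]]) (simp add: i' w_def power2_eq_square)
  have cb: "c (int n * i) \<otimes> b 1 = b 1 \<otimes> (c (int n * i) \<otimes> a (- (int n * i * w)))"
  proof -
    have "b (ee (int n * i)) \<otimes> c (int n * i) = c (int n * i) \<otimes> b (ee (int n * i) * ee (- (int n * i)))"
      by (rule b_c)
    also have "b (ee (int n * i) * ee (- (int n * i))) = b 1" by (rule b_cong[OF ee_inv])
    finally have "c (int n * i) \<otimes> b 1 = b (ee (int n * i)) \<otimes> c (int n * i)" ..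
    also have "b (ee (int n * i)) = b (1 + int n * i * w)"
    proof (rule b_cong)
      have "q dvd tri (int n * i - 1)" by (rule q_dvd_tri') (simp add: i)
      then obtain t where t: "tri (int n * i - 1) = q * t" by blast
      show "[ee (int n * i) = 1 + int n * i * w] (mod q ^ 3)"
        by (simp add: cong_iff_dvd_diff ee_def t w_def power2_eq_square power3_eq_cube)
    qed
    also have "b (1 + int n * i * w) = b 1 \<otimes> a (- (int n * i * w))"
      by (simp flip: add) (simp add: b_q2 i' w_def power2_eq_square)
    also have "b 1 \<otimes> a (- (int n * i * w)) \<otimes> c (int n * i) = b 1 \<otimes> (a (- (int n * i * w)) \<otimes> c (int n * i))"
      by (simp add: m_assoc)
    also have "a (- (int n * i * w)) \<otimes> c (int n * i) = c (int n * i) \<otimes> a (- (int n * i * w))"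
      by (rule a_central) (simp_all add: i' w_def power2_eq_square)
    finally show ?thesis .
  qed
  have ab: "a (i + x) \<otimes> b 1 = b 1 \<otimes> (c i \<otimes> a (T i + x))"
  proof -
    have "a (i + x) \<otimes> b 1 = b 1 \<otimes> (c (i + x) \<otimes> a (T (i + x)))" by (rule a_b_1)
    also have "c (i + x) = c i" by (rule c_cong) (simp add: cong_iff_dvd_diff x)
    also have "a (T (i + x)) = a (T i + x)"
      by (rule a_cong) (use T_cong_q2[OF x, of i] in \<open>simp add: cong_iff_dvd_diff algebra_simps\<close>)
    finally show ?thesis .
  qed
  have "a i \<otimes> b (int (Suc n)) = (a i \<otimes> b (int n)) \<otimes> b 1" by (simp add: m_assoc add add.commute)
  also have "\<dots> = b (int n) \<otimes> (c (int n * i) \<otimes> (a (i + x) \<otimes> b 1))"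
    unfolding Suc x_def by (simp add: m_assoc algebra_simps)
  also have "\<dots> = b (int n) \<otimes> ((c (int n * i) \<otimes> b 1) \<otimes> (c i \<otimes> a (T i + x)))"
    unfolding ab by (simp add: m_assoc)
  also have "\<dots> = b (int n + 1) \<otimes> (c (int n * i) \<otimes> ((a (- (int n * i * w)) \<otimes> c i) \<otimes> a (T i + x)))"
    unfolding cb by (simp add: m_assoc add_assoc)
  also have "a (- (int n * i * w)) \<otimes> c i = c i \<otimes> a (- (int n * i * w))"
    by (rule a_central) (simp_all add: i' w_def power2_eq_square)
  also have "b (int n + 1) \<otimes> (c (int n * i) \<otimes> (c i \<otimes> a (- (int n * i * w)) \<otimes> a (T i + x)))
     = b (int (Suc n)) \<otimes> (c (int n * i + i) \<otimes> a (T i + x - int n * i * w))"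
    by (simp add: m_assoc add add_assoc add.commute)
  also have "T i + x - int n * i * w = i + int (Suc n) * (T i - i) - w * i * tri (int (Suc n) - 1)"
    using tri_plus1[of "int n - 1"] by (simp add: x_def algebra_simps)
  also have "int n * i + i = int (Suc n) * i" by (simp add: algebra_simps)
  finally show ?case .
qed

text \<open>With both exponents divisible by q the corrections of \<open>a_b_pow\<close> vanish: the
  C-part modulo q^2, the A-part modulo q^3.\<close>

lemma a_b_commute:
  assumes i: "q dvd i" and j: "q dvd j"
  shows "a i \<otimes> b j = b j \<otimes> a i"
proof -
  obtain n where n: "[j = int n] (mod q ^ 3)" by (rule nat_rep)
  have "q dvd j - (j - int n)" by (rule dvd_diff[OF j q_dvd_of_q3(1)[OF n]])
  then have qn: "q dvd int n" by simp
  obtain i' where i': "i = q * i'" using i by blast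
  obtain n' where n': "int n = q * n'" using qn by blast
  have "a i \<otimes> b j = b j \<otimes> (c (int n * i) \<otimes> a (i + int n * (T i - i) - w * i * tri (int n - 1)))"
    using a_b_pow[OF i, of n] by (simp add: b_cong[OF n])
  also have "c (int n * i) = c 0" by (rule c_cong) (simp add: cong_iff_dvd_diff i' n' power2_eq_square)
  also have "a (i + int n * (T i - i) - w * i * tri (int n - 1)) = a i"
  proof (rule a_cong)
    obtain t where t: "T i - i = q\<^sup>2 * t" using q2_dvd_T[OF i] by blast
    obtain s where s: "tri (int n - 1) = q * s" using q_dvd_tri'[OF qn] by blast
    have "int n * (T i - i) - w * i * tri (int n - 1) = q ^ 3 * (n' * t - l * i' * s)"
      unfolding t s by (simp add: w_def i' n' power2_eq_square power3_eq_cube algebra_simps)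
    then have "(i + int n * (T i - i) - w * i * tri (int n - 1)) - i = q ^ 3 * (n' * t - l * i' * s)" by simp
    then show "[i + int n * (T i - i) - w * i * tri (int n - 1) = i] (mod q ^ 3)"
      unfolding cong_iff_dvd_diff by (metis dvd_triv_left)
  qed
  finally show ?thesis by simp
qed

lemma nf_a_nf_b: "q dvd j \<Longrightarrow> q dvd n \<Longrightarrow> nf k i j \<otimes> a n = nf k (i + n) j"
proof -
  assume jn: "q dvd j" "q dvd n"
  have "nf k i j \<otimes> a n = c k \<otimes> (a i \<otimes> (b j \<otimes> a n))" by (simp add: nf_def m_assoc)
  also have "\<dots> = nf k (i + n) j" unfolding a_b_commute[OF jn(2,1), symmetric] by (simp add: nf_def m_assoc add_assoc)
  finally show ?thesis .
qed

end

section \<open>The upper central series of the Macdonald groups\<close>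

text \<open>Faithfulness of the normal form, as far as the action on the cosets of C shows it. The
  statement about k is recovered in \<open>c_eq_one\<close>.\<close>

locale macdonald_J = macdonald +
  assumes nf_one: "nf k i j = \<one> \<Longrightarrow> q\<^sup>2 dvd i \<and> q ^ 3 dvd i - j"

context macdonald_numbers
begin

text \<open>The relations of the model iterate functions, so \<open>al\<close> must not be negative.
  Reducing l modulo q^2 changes \<open>al\<close> only by a multiple of q^3.\<close>

lemma nonneg_numbers: "macdonald_numbers p m (l mod q\<^sup>2)" "l mod q\<^sup>2 \<ge> 0"
proof -
  have pq: "int p dvd q\<^sup>2" using p_dvd_q by (simp add: power2_eq_square)
  have p: "\<not> int p dvd l mod q\<^sup>2" using not_dvd_l pq by (simp add: dvd_mod_iff)
  have "[l mod q\<^sup>2 = 1] (mod 3)" if "p = 3" "m = 1"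
  proof -
    have "[l = 1] (mod 3)" using adm that by (simp add: admissible_def)
    moreover have "(3 :: int) dvd q\<^sup>2" using pq that(1) by simp
    ultimately show ?thesis by (simp add: cong_def mod_mod_cancel)
  qed
  with p show "macdonald_numbers p m (l mod q\<^sup>2)"
    using prime_p odd_p m_pos by (simp add: macdonald_numbers_def admissible_def)
  show "l mod q\<^sup>2 \<ge> 0" using q_pos by simp
qed

lemma J1_macdonald_J:
  "macdonald_J p m l (J1 p m (1 + int p ^ m * l)) (J1_gen p m (1 + int p ^ m * l) GenX) (J1_gen p m (1 + int p ^ m * l) GenY)"
proof -
  let ?J = "J1 p m (1 + int p ^ m * l)"
  interpret J: macdonald p m l ?J "J1_gen p m (1 + int p ^ m * l) GenX" "J1_gen p m (1 + int p ^ m * l) GenY"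
    by (rule J1_macdonald) (rule macdonald_numbers_axioms)
  interpret N: macdonald_numbers p m "l mod q\<^sup>2" by (rule nonneg_numbers)
  interpret P: group N.Pts by (rule group_BijGroup)
  let ?x = "inv\<^bsub>N.Pts\<^esub> (N.lift N.fA)" and ?y = "inv\<^bsub>N.Pts\<^esub> (N.lift (N.fB 1))" and ?z = "inv\<^bsub>N.Pts\<^esub> (N.lift N.fC)"
  have al: "N.al \<ge> 0" using nonneg_numbers(2) q_pos by (simp add: N.al_def N.w_def)
  note rel = N.Pts_relations[OF al]
  have pow: "z [^]\<^bsub>N.Pts\<^esub> N.al = z [^]\<^bsub>N.Pts\<^esub> (1 + int p ^ m * l)"
    if z: "z \<in> carrier N.Pts" "z [^]\<^bsub>N.Pts\<^esub> (p ^ (3 * m)) = \<one>\<^bsub>N.Pts\<^esub>" for z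
  proof (rule P.int_pow_cong)
    show "z [^]\<^bsub>N.Pts\<^esub> int (p ^ (3 * m)) = \<one>\<^bsub>N.Pts\<^esub>" using z(2) by (simp only: int_pow_int)
    have "N.al - (1 + int p ^ m * l) = q * (l mod q\<^sup>2 - l)"
      by (simp add: N.al_def N.w_def right_diff_distrib flip: q_def)
    also have "l mod q\<^sup>2 - l = q\<^sup>2 * (- (l div q\<^sup>2))" by (simp add: minus_mult_div_eq_mod[symmetric])
    also have "q * (q\<^sup>2 * (- (l div q\<^sup>2))) = q ^ 3 * (- (l div q\<^sup>2))" unfolding q3_eq by (simp only: mult_ac)
    finally show "[N.al = 1 + int p ^ m * l] (mod int (p ^ (3 * m)))"
      unfolding cong_iff_dvd_diff J.pow_q[symmetric] by (simp only: dvd_triv_left)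
  qed fact
  \<comment> \<open>The model satisfies the relations with the reduced exponent; \<open>pow\<close>
    restates them with the original one.\<close>
  obtain g where g: "g \<in> hom ?J N.Pts" "g (J1_gen p m (1 + int p ^ m * l) GenX) = ?x" "g (J1_gen p m (1 + int p ^ m * l) GenY) = ?y"
    using J1_universal[OF P.is_group rel(1,2) rel(4)[unfolded pow[OF rel(1,6)]] rel(5)[unfolded pow[OF rel(2,7)]] rel(6,7)]
    by blast
  interpret g: group_hom ?J N.Pts g
    using g(1) by (simp add: group_hom_def group_hom_axioms_def J.is_group P.is_group)
  show ?thesis
  proof unfold_locales
    fix k i j assume one: "J.nf k i j = \<one>\<^bsub>?J\<^esub>"
    obtain k' where k': "[k = int k'] (mod q ^ 3)" by (rule J.nat_rep)
    obtain i' where i': "[i = int i'] (mod q ^ 3)" by (rule J.nat_rep)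
    obtain j' where j': "[j = int j'] (mod q ^ 3)" by (rule J.nat_rep)
    have "[k = int k'] (mod q\<^sup>2)" using J.q_dvd_of_q3(2)[OF k'] by (simp add: cong_iff_dvd_diff)
    then have "J.nf (int k') (int i') (int j') = \<one>\<^bsub>?J\<^esub>"
      using one J.c_cong J.a_cong[OF i'] J.b_cong[OF j'] by (simp add: J.nf_def)
    then have "g (J.nf (int k') (int i') (int j')) = \<one>\<^bsub>N.Pts\<^esub>" by simp
    moreover have "g (J.c (int k')) = ?z [^]\<^bsub>N.Pts\<^esub> k'"
      by (simp add: J.c_def int_pow_int g.hom_nat_pow g.hom_group_comm g rel(3))
    ultimately have "?z [^]\<^bsub>N.Pts\<^esub> k' \<otimes>\<^bsub>N.Pts\<^esub> ?x [^]\<^bsub>N.Pts\<^esub> i' \<otimes>\<^bsub>N.Pts\<^esub> ?y [^]\<^bsub>N.Pts\<^esub> j' = \<one>\<^bsub>N.Pts\<^esub>"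
      by (simp add: J.nf_def J.a_def J.b_def int_pow_int g.hom_nat_pow g)
    then have "q\<^sup>2 dvd int i'" "q ^ 3 dvd int i' - int j'"
      using N.Pts_nf_eq_one by blast+
    moreover have "q\<^sup>2 dvd i - int i'" "q ^ 3 dvd i - int i'" "q ^ 3 dvd j - int j'"
      using J.q_dvd_of_q3(2)[OF i'] i' j' by (simp_all add: cong_iff_dvd_diff)
    ultimately have "q\<^sup>2 dvd (i - int i') + int i'" "q ^ 3 dvd (i - int i') - (j - int j') + (int i' - int j')"
      by (blast intro: dvd_add dvd_diff)+
    then show "q\<^sup>2 dvd i \<and> q ^ 3 dvd i - j" by simp
  qed
qed

end

context macdonald_J
begin

lemma a_eq_one: "a i = \<one> \<Longrightarrow> q ^ 3 dvd i"
  using nf_one[of 0 i 0] by (simp add: nf_def)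

text \<open>If C^k is trivial, so is its action on A, that is, A^(ee k) = A. Since A has order q^3,
  this bounds k through \<open>ee_dvd\<close>.\<close>

lemma c_eq_one: "c k = \<one> \<Longrightarrow> q\<^sup>2 dvd k"
proof -
  assume "c k = \<one>"
  then have "a 1 = a (ee k)" using a_c[of 1 k] by simp
  then have "a (ee k) \<otimes> a (- 1) = \<one>" by (metis add(1) add.right_inverse zero(1))
  then have "a (ee k - 1) = \<one>" by (simp add: add)
  then have "q ^ Suc 2 dvd ee k - 1" using a_eq_one by (simp add: eval_nat_numeral)
  then show ?thesis by (rule ee_dvd)
qed

lemma nf_eq_one_iff: "nf k i j = \<one> \<longleftrightarrow> q\<^sup>2 dvd k \<and> q\<^sup>2 dvd i \<and> q ^ 3 dvd i - j"
proof
  assume one: "nf k i j = \<one>"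
  then have ij: "q\<^sup>2 dvd i" "q ^ 3 dvd i - j" using nf_one by blast+
  then have "nf k i j = nf k 0 0" by (intro nf_cong) simp_all
  then have "c k = \<one>" using one by (simp add: nf_def)
  then show "q\<^sup>2 dvd k \<and> q\<^sup>2 dvd i \<and> q ^ 3 dvd i - j" using ij c_eq_one by blast
next
  assume "q\<^sup>2 dvd k \<and> q\<^sup>2 dvd i \<and> q ^ 3 dvd i - j"
  then have "nf k i j = nf 0 0 0" by (intro nf_cong) simp_all
  then show "nf k i j = \<one>" by (simp add: nf_def)
qed

text \<open>An equality of two normal forms is rewritten as one normal form being 1. Counting
  residues, the group has q^7 elements.\<close>

lemma nf_eq_iff: "nf k i j = nf k' i' j' \<longleftrightarrow> q\<^sup>2 dvd k - k' \<and> q\<^sup>2 dvd i - i' \<and> q ^ 3 dvd (i - i') - (j - j')"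
proof
  assume eq: "nf k i j = nf k' i' j'"
  have "c (- k') \<otimes> nf k i j \<otimes> b (- j') = c (- k') \<otimes> nf k' i' j' \<otimes> b (- j')" using eq by simp
  then have "nf (k - k') i (j - j') = nf 0 i' 0" by (simp add: c_nf nf_b)
  then have "a (- i') \<otimes> nf (k - k') i (j - j') = \<one>" by (simp add: nf_def add)
  moreover have "a (- i') \<otimes> nf (k - k') i (j - j') = nf (k - k') (- i' * ee (k - k') + i) (j - j')"
  proof -
    have "a (- i') \<otimes> nf (k - k') i (j - j') = (a (- i') \<otimes> c (k - k')) \<otimes> (a i \<otimes> b (j - j'))"
      by (simp add: nf_def m_assoc)
    then show ?thesis unfolding a_c by (simp add: nf_def m_assoc add_assoc)
  qed
  ultimately have *: "q\<^sup>2 dvd k - k'" "q\<^sup>2 dvd - i' * ee (k - k') + i" "q ^ 3 dvd (- i' * ee (k - k') + i) - (j - j')"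
    using nf_eq_one_iff by metis+
  have "q ^ 3 dvd i' * (ee (k - k') - 1)" using q3_dvd_ee[OF *(1)] by (rule dvd_mult)
  then have 1: "q ^ 3 dvd i' * ee (k - k') - i'" by (simp add: algebra_simps)
  have "q\<^sup>2 dvd (- i' * ee (k - k') + i) + (i' * ee (k - k') - i')"
    by (rule dvd_add[OF *(2) dvd_trans[OF q2_dvd_q3 1]])
  moreover have "q ^ 3 dvd ((- i' * ee (k - k') + i) - (j - j')) + (i' * ee (k - k') - i')"
    by (rule dvd_add[OF *(3) 1])
  ultimately show "q\<^sup>2 dvd k - k' \<and> q\<^sup>2 dvd i - i' \<and> q ^ 3 dvd (i - i') - (j - j')"
    using *(1) by (simp add: algebra_simps)
qed (simp add: nf_cong)

lemma finite_carrier: "finite (carrier G)"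
proof -
  have "carrier G \<subseteq> (\<lambda>(k, i, j). nf k i j) ` ({0..<q\<^sup>2} \<times> {0..<q ^ 3} \<times> {0..<q ^ 3})"
  proof
    fix g assume "g \<in> carrier G"
    then obtain k i j where g: "g = nf k i j" by (rule nf_surj)
    have "g = nf (k mod q\<^sup>2) (i mod q ^ 3) (j mod q ^ 3)"
      unfolding g nf_def
      using c_cong[of k "k mod q\<^sup>2"] a_cong[of i "i mod q ^ 3"] b_cong[of j "j mod q ^ 3"] by (simp add: cong_def)
    then show "g \<in> (\<lambda>(k, i, j). nf k i j) ` ({0..<q\<^sup>2} \<times> {0..<q ^ 3} \<times> {0..<q ^ 3})"
      using q_pos by (intro image_eqI[of _ _ "(k mod q\<^sup>2, i mod q ^ 3, j mod q ^ 3)"]) auto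
  qed
  then show ?thesis by (rule finite_subset) simp
qed

end

section \<open>Elements of the terms of the upper central series\<close>

context macdonald
begin

text \<open>One formula for the terms 1 to 4. Going down from 4, the condition on k is sharpened
  first, then those on i and j, then the one on k again.\<close>

definition Zset :: "nat \<Rightarrow> 'a set" where
  "Zset n = {nf k i j | k i j. (n < 4 \<longrightarrow> q dvd k) \<and> q dvd i \<and> q dvd j \<and>
      (n < 3 \<longrightarrow> q\<^sup>2 dvd i \<and> q\<^sup>2 dvd j) \<and> (n < 2 \<longrightarrow> q\<^sup>2 dvd k)}"

lemma upper_central_SucI': 
  assumes "g \<in> carrier G" "z \<in> upper_central G n" "z' \<in> upper_central G n"
    "g \<otimes> a 1 = a 1 \<otimes> g \<otimes> z" "g \<otimes> b 1 = b 1 \<otimes> g \<otimes> z'"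
  shows "g \<in> upper_central G (Suc n)"
  by (rule upper_central_SucI[OF gen]) (use assms in \<open>auto simp: a_1 b_1\<close>)

lemma a_in_Z1: "q\<^sup>2 dvd i \<Longrightarrow> a i \<in> upper_central G 1"
  using upper_central_SucI'[of "a i" "\<one>" 0 "\<one>"] a_central[of i "b 1"] by (simp add: add add.commute)

lemma b_in_Z1: "q\<^sup>2 dvd j \<Longrightarrow> b j \<in> upper_central G 1"
  using a_in_Z1[of "- j"] by (simp add: b_q2)

text \<open>[C^k, A] is A^(1 - ee k), whose exponent is a multiple of q^2 when q divides k; the same
  holds for B.\<close>

lemma c_in_Z2: "q dvd k \<Longrightarrow> c k \<in> upper_central G 2"
  unfolding numeral_2_eq_2
proof (rule upper_central_SucI')
  assume k: "q dvd k"
  have e: "q\<^sup>2 dvd 1 - ee k" "q\<^sup>2 dvd 1 - ee (- k)"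
    using q2_dvd_ee[of k] q2_dvd_ee[of "- k"] k by (simp_all add: dvd_diff_commute)
  show "a (1 - ee k) \<in> upper_central G (Suc 0)" using a_in_Z1[OF e(1)] by simp
  show "b (1 - ee (- k)) \<in> upper_central G (Suc 0)" using b_in_Z1[OF e(2)] by simp
  show "c k \<otimes> a 1 = a 1 \<otimes> c k \<otimes> a (1 - ee k)" by (simp add: a_c m_assoc add)
  show "c k \<otimes> b 1 = b 1 \<otimes> c k \<otimes> b (1 - ee (- k))" by (simp add: b_c m_assoc add)
qed simp

lemma Z_mult: "x \<in> upper_central G n \<Longrightarrow> y \<in> upper_central G n \<Longrightarrow> x \<otimes> y \<in> upper_central G n"
  using subgroup_upper_central by (rule subgroup.m_closed)

lemma Z_mono: "x \<in> upper_central G i \<Longrightarrow> i \<le> j \<Longrightarrow> x \<in> upper_central G j"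
  using upper_central_mono by blast

text \<open>[A^i, B] is C^i times a power of A with exponent divisible by q^2, and both factors are
  known to lie in the second term.\<close>

lemma a_in_Z3: "q dvd i \<Longrightarrow> a i \<in> upper_central G 3"
  unfolding numeral_3_eq_3
proof (rule upper_central_SucI'[where z = "\<one>" and z' = "c i \<otimes> a (T i - i * ee i)"])
  assume i: "q dvd i"
  have "q\<^sup>2 dvd (T i - i) - i * (ee i - 1)"
    by (rule dvd_diff[OF q2_dvd_T[OF i] dvd_mult[OF q2_dvd_ee[OF i]]])
  then have x: "q\<^sup>2 dvd T i - i * ee i" by (simp add: algebra_simps)
  show "c i \<otimes> a (T i - i * ee i) \<in> upper_central G (Suc (Suc 0))"
    using c_in_Z2[OF i] a_in_Z1[OF x] Z_mono[of _ "Suc 0" "Suc (Suc 0)"] by (intro Z_mult) (simp_all add: numeral_2_eq_2)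
  show "a i \<otimes> b 1 = b 1 \<otimes> a i \<otimes> (c i \<otimes> a (T i - i * ee i))"
  proof -
    have "b 1 \<otimes> a i \<otimes> (c i \<otimes> a (T i - i * ee i)) = b 1 \<otimes> ((a i \<otimes> c i) \<otimes> a (T i - i * ee i))"
      by (simp add: m_assoc)
    also have "\<dots> = b 1 \<otimes> (c i \<otimes> a (T i))" unfolding a_c by (simp add: m_assoc add)
    finally show ?thesis by (simp add: a_b_1)
  qed
  show "\<one> \<in> upper_central G (Suc (Suc 0))" by (rule subgroup.one_closed[OF subgroup_upper_central])
  show "a i \<otimes> a 1 = a 1 \<otimes> a i \<otimes> \<one>" by (simp add: add add.commute)
qed simp

interpretation S: macdonald p m l G B A by (rule swap)

lemma b_in_Z3: "q dvd j \<Longrightarrow> b j \<in> upper_central G 3"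
  using S.a_in_Z3[of j] by (simp add: swap_abc)

lemma c_in_Z4: "c k \<in> upper_central G 4"
proof -
  have "c k \<in> upper_central G (Suc 3)"
  proof (rule upper_central_SucI')
    have e: "q dvd 1 - ee k" "q dvd 1 - ee (- k)"
      using q_dvd_T(2)[of k] q_dvd_T(2)[of "- k"] by (simp_all add: dvd_diff_commute)
    show "a (1 - ee k) \<in> upper_central G 3" by (rule a_in_Z3[OF e(1)])
    show "b (1 - ee (- k)) \<in> upper_central G 3" by (rule b_in_Z3[OF e(2)])
    show "c k \<otimes> a 1 = a 1 \<otimes> c k \<otimes> a (1 - ee k)" by (simp add: a_c m_assoc add)
    show "c k \<otimes> b 1 = b 1 \<otimes> c k \<otimes> b (1 - ee (- k))" by (simp add: b_c m_assoc add)
  qed simp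
  then show ?thesis by simp
qed

text \<open>C lies in the fourth term, so the generators commute modulo it.\<close>

lemma upper_central_5: "upper_central G 5 = carrier G"
proof -
  have AB: "a 1 \<otimes> b 1 = b 1 \<otimes> a 1 \<otimes> c 1" using mult_group_comm[of A B] by (simp add: a_1 b_1 c_1)
  have BA: "b 1 \<otimes> a 1 = a 1 \<otimes> b 1 \<otimes> c (- 1)" unfolding AB by (simp add: m_assoc add)
  have one: "\<one> \<in> upper_central G 4" by (rule subgroup.one_closed[OF subgroup_upper_central])
  have "a 1 \<in> upper_central G (Suc 4)"
    by (rule upper_central_SucI'[OF _ one c_in_Z4[of 1]]) (simp_all add: AB)
  moreover have "b 1 \<in> upper_central G (Suc 4)"
    by (rule upper_central_SucI'[OF _ c_in_Z4[of "- 1"] one]) (simp_all add: BA)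
  ultimately have "{A, B} \<subseteq> upper_central G (Suc 4)" by (simp add: a_1 b_1)
  then have "generate G {A, B} \<subseteq> upper_central G (Suc 4)"
    by (rule generate_subgroup_incl[OF _ subgroup_upper_central])
  then show ?thesis using gen upper_central_subset[of "Suc 4"] by simp
qed

lemma Zset_subset:
  assumes "1 \<le> n" "n \<le> 4"
  shows "Zset n \<subseteq> upper_central G n"
proof
  fix g assume "g \<in> Zset n"
  then obtain k i j where g: "g = nf k i j" and kij: "n < 4 \<Longrightarrow> q dvd k" "q dvd i" "q dvd j"
    "n < 3 \<Longrightarrow> q\<^sup>2 dvd i" "n < 3 \<Longrightarrow> q\<^sup>2 dvd j" "n < 2 \<Longrightarrow> q\<^sup>2 dvd k" by (auto simp: Zset_def)
  have one: "\<one> \<in> upper_central G n" by (rule subgroup.one_closed[OF subgroup_upper_central])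
  have "c k \<in> upper_central G n"
  proof (cases "n < 2")
    case True
    then have "c k = c 0" by (intro c_cong) (simp add: cong_iff_dvd_diff kij)
    then show ?thesis using one by simp
  next
    case False
    show ?thesis
    proof (cases "n < 4")
      case True
      then show ?thesis using c_in_Z2[OF kij(1)] False by (intro Z_mono[of _ 2 n]) auto
    next
      case False
      then show ?thesis using c_in_Z4 assms by simp
    qed
  qed
  moreover have "a i \<in> upper_central G n" "b j \<in> upper_central G n"
  proof -
    show "a i \<in> upper_central G n"
    proof (cases "n < 3")
      case True
      then show ?thesis using a_in_Z1[OF kij(4)] assms by (intro Z_mono[of _ 1 n]) auto
    next
      case False
      then show ?thesis using a_in_Z3[OF kij(2)] by (intro Z_mono[of _ 3 n]) auto
    qed
    show "b j \<in> upper_central G n"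
    proof (cases "n < 3")
      case True
      then show ?thesis using b_in_Z1[OF kij(5)] assms by (intro Z_mono[of _ 1 n]) auto
    next
      case False
      then show ?thesis using b_in_Z3[OF kij(3)] by (intro Z_mono[of _ 3 n]) auto
    qed
  qed
  ultimately show "g \<in> upper_central G n" by (simp add: g nf_def Z_mult)
qed

lemma upper_central_commute':
  assumes "g \<in> upper_central G (Suc n)"
  obtains z z' z'' where "z \<in> upper_central G n" "g \<otimes> a 1 = a 1 \<otimes> g \<otimes> z"
    "z' \<in> upper_central G n" "g \<otimes> b 1 = b 1 \<otimes> g \<otimes> z'"
    "z'' \<in> upper_central G n" "g \<otimes> c 1 = c 1 \<otimes> g \<otimes> z''"
  using upper_central_commute[OF assms, of "a 1"] upper_central_commute[OF assms, of "b 1"]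
    upper_central_commute[OF assms, of "c 1"] by (metis closed)

text \<open>Brings B to the front of a normal form. Because q divides k, the stray power of B that
  arises has exponent divisible by q^2 and merges with the A-part.\<close>

lemma conj_b: "q dvd k \<Longrightarrow> nf k i j \<otimes> b 1 = b 1 \<otimes> nf (k + i) (T i - (1 - ee (- k)) * ee (- i)) j"
proof -
  assume k: "q dvd k"
  define y where "y = (1 - ee (- k)) * ee (- i)"
  have y: "q\<^sup>2 dvd y"
    using dvd_mult2[OF q2_dvd_ee[of "- k"], of "- ee (- i)"] k by (simp add: y_def algebra_simps)
  have "nf k i j \<otimes> b 1 = c k \<otimes> ((a i \<otimes> b 1) \<otimes> b j)" by (simp add: nf_def m_assoc add add.commute)
  also have "\<dots> = c k \<otimes> (b 1 \<otimes> (c i \<otimes> (a (T i) \<otimes> b j)))" by (simp only: a_b_1) (simp add: m_assoc)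
  also have "\<dots> = b 1 \<otimes> ((b (- 1) \<otimes> c k) \<otimes> (b 1 \<otimes> (c i \<otimes> (a (T i) \<otimes> b j))))"
    by (simp add: m_assoc add_assoc)
  also have "\<dots> = b 1 \<otimes> (c k \<otimes> ((b (1 - ee (- k)) \<otimes> c i) \<otimes> (a (T i) \<otimes> b j)))"
    by (simp only: b_c[of "- 1"]) (simp add: m_assoc add_assoc)
  also have "\<dots> = b 1 \<otimes> (c k \<otimes> (c i \<otimes> (b y \<otimes> (a (T i) \<otimes> b j))))"
    by (simp only: b_c[of "1 - ee (- k)"] y_def) (simp add: m_assoc)
  also have "\<dots> = b 1 \<otimes> nf (k + i) (T i - y) j"
    by (simp add: b_q2[OF y] nf_def m_assoc add_assoc)
  finally show ?thesis by (simp only: y_def)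
qed

lemma nf_0: "nf 0 0 1 = b 1" "nf 0 1 0 = a 1" "nf k 0 0 = c k" "nf 0 i 0 = a i" "nf 0 0 j = b j"
  by (simp_all add: nf_def)

end

section \<open>The terms contain nothing else\<close>

context macdonald_J
begin

text \<open>Commuting with A determines first j and then k. Commuting with C multiplies i by 1 + w,
  which determines i.\<close>

lemma upper_central_1:
  assumes "nf k i j \<in> upper_central G 1"
  shows "q\<^sup>2 dvd k \<and> q\<^sup>2 dvd i \<and> q\<^sup>2 dvd j"
proof -
  have "nf k i j \<in> upper_central G (Suc 0)" using assms by simp
  then obtain z z' z'' where z: "z \<in> upper_central G 0" "nf k i j \<otimes> a 1 = a 1 \<otimes> nf k i j \<otimes> z"
    "z' \<in> upper_central G 0" "nf k i j \<otimes> b 1 = b 1 \<otimes> nf k i j \<otimes> z'"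
    "z'' \<in> upper_central G 0" "nf k i j \<otimes> c 1 = c 1 \<otimes> nf k i j \<otimes> z''"
    by (rule upper_central_commute')
  have "nf (k - j) ((i + 1) * ee (- j)) (T j) = nf k (ee k + i) j"
    using z(1,2) by (simp add: nf_a_1 a_1_nf)
  then have A: "q\<^sup>2 dvd (k - j) - k" "q ^ 3 dvd ((i + 1) * ee (- j) - (ee k + i)) - (T j - j)"
    unfolding nf_eq_iff by blast+
  have j: "q\<^sup>2 dvd j" using A(1) by simp
  have "q ^ 3 dvd (((i + 1) * ee (- j) - (ee k + i)) - (T j - j)) + (T j - j) - (i + 1) * (ee (- j) - 1)"
    using j by (intro dvd_diff[OF dvd_add[OF A(2) q3_dvd_T[OF j]]] dvd_mult q3_dvd_ee) simp
  then have "q ^ 3 dvd - (ee k - 1)" by (simp add: algebra_simps)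
  then have "q ^ Suc 2 dvd ee k - 1" by (simp only: dvd_minus_iff) (simp add: eval_nat_numeral)
  then have k: "q\<^sup>2 dvd k" by (rule ee_dvd)
  have "nf (k + 1) (i * ee 1) (j * ee (- 1)) = nf (1 + k) i j"
    using z(5,6) by (simp add: nf_c c_nf)
  then have C: "q ^ 3 dvd (i * ee 1 - i) - (j * ee (- 1) - j)" unfolding nf_eq_iff by blast
  have "q\<^sup>2 * q dvd j * (ee (- 1) - 1)" by (rule mult_dvd_mono[OF j q_dvd_T(2)])
  then have "q ^ 3 dvd j * ee (- 1) - j" by (simp add: q3_eq algebra_simps)
  from dvd_add[OF C this] have "q ^ Suc 2 dvd i * w" by (simp add: ee_1 al_def algebra_simps eval_nat_numeral)
  then have "q\<^sup>2 dvd i" by (rule cancel_w)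
  with j k show ?thesis by blast
qed

lemma upper_central_1_form:
  assumes "z \<in> upper_central G 1"
  obtains s where "q\<^sup>2 dvd s" "z = a s"
proof -
  obtain k i j where z: "z = nf k i j" using upper_central_closed[OF assms] by (rule nf_surj)
  have kij: "q\<^sup>2 dvd k" "q\<^sup>2 dvd i" "q\<^sup>2 dvd j" using upper_central_1 assms z by blast+
  have "nf k i j = nf 0 (i - j) 0" by (rule nf_cong) (use kij in simp_all)
  then have "z = a (i - j)" by (simp add: z nf_0)
  then show thesis using that[of "i - j"] dvd_diff[OF kij(2,3)] by blast
qed

text \<open>Commutation now holds up to a central A^s. Again A yields j and k; i comes from B, since
  passing B adds i to the exponent of C modulo q^2.\<close>

lemma upper_central_2:
  assumes "nf k i j \<in> upper_central G 2"
  shows "q dvd k \<and> q\<^sup>2 dvd i \<and> q\<^sup>2 dvd j"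
proof -
  have "nf k i j \<in> upper_central G (Suc 1)" using assms by (simp add: numeral_2_eq_2)
  then obtain z z' z'' where z: "z \<in> upper_central G 1" "nf k i j \<otimes> a 1 = a 1 \<otimes> nf k i j \<otimes> z"
    "z' \<in> upper_central G 1" "nf k i j \<otimes> b 1 = b 1 \<otimes> nf k i j \<otimes> z'"
    "z'' \<in> upper_central G 1" "nf k i j \<otimes> c 1 = c 1 \<otimes> nf k i j \<otimes> z''"
    by (rule upper_central_commute')
  obtain s where s: "q\<^sup>2 dvd s" "z = a s" using z(1) by (rule upper_central_1_form)
  obtain s' where s': "q\<^sup>2 dvd s'" "z' = a s'" using z(3) by (rule upper_central_1_form)
  obtain s'' where s'': "q\<^sup>2 dvd s''" "z'' = a s''" using z(5) by (rule upper_central_1_form)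
  have "nf (k - j) ((i + 1) * ee (- j)) (T j) = nf k (ee k + i + s) j"
    using z(2) nf_a_central[OF s(1)] by (simp add: s nf_a_1 a_1_nf)
  then have A: "q\<^sup>2 dvd (k - j) - k" "q\<^sup>2 dvd (i + 1) * ee (- j) - (ee k + i + s)"
    unfolding nf_eq_iff by blast+
  have j: "q\<^sup>2 dvd j" using A(1) by simp
  have e: "q\<^sup>2 dvd ee (- j) - 1" using q2_dvd_ee[of "- j"] dvd_trans[OF q_dvd_pow(1) j] by simp
  have "q\<^sup>2 dvd ((i + 1) * ee (- j) - (ee k + i + s)) - (i + 1) * (ee (- j) - 1) + s"
    by (rule dvd_add[OF dvd_diff[OF A(2) dvd_mult[OF e]] s(1)])
  then have "q\<^sup>2 dvd - (ee k - 1)" by (simp add: algebra_simps)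
  then have "q ^ Suc 1 dvd ee k - 1" by (simp only: dvd_minus_iff) (simp add: numeral_2_eq_2)
  from ee_dvd[OF this] have k: "q dvd k" by simp
  have "b 1 \<otimes> nf (k + i) (T i - (1 - ee (- k)) * ee (- i)) j = b 1 \<otimes> nf k (i + s') j"
    using z(4) nf_a_central[OF s'(1)] by (simp add: s' conj_b[OF k] m_assoc)
  then have "nf (k + i) (T i - (1 - ee (- k)) * ee (- i)) j = nf k (i + s') j" by simp
  then have "q\<^sup>2 dvd (k + i) - k" unfolding nf_eq_iff by blast
  with j k show ?thesis by simp
qed

lemma upper_central_2_form:
  assumes "z \<in> upper_central G 2"
  obtains k s where "q dvd k" "q\<^sup>2 dvd s" "z = nf k s 0"
proof -
  obtain k i j where z: "z = nf k i j" using upper_central_closed[OF assms] by (rule nf_surj)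
  have kij: "q dvd k" "q\<^sup>2 dvd i" "q\<^sup>2 dvd j" using upper_central_2 assms z by blast+
  have "nf k i j = nf k (i - j) 0" by (rule nf_cong) (use kij in simp_all)
  then show thesis using that[of k "i - j"] dvd_diff[OF kij(2,3)] kij(1) z by blast
qed

text \<open>The correction C^k0 A^s spoils the C-exponent modulo q^2. Hence i is read off from
  commuting with C, where it acquires the factor w and needs only be compared modulo q^2.\<close>

lemma upper_central_3:
  assumes "nf k i j \<in> upper_central G 3"
  shows "q dvd k \<and> q dvd i \<and> q dvd j"
proof -
  have "nf k i j \<in> upper_central G (Suc 2)" using assms by simp
  then obtain z z' z'' where z: "z \<in> upper_central G 2" "nf k i j \<otimes> a 1 = a 1 \<otimes> nf k i j \<otimes> z"
    "z' \<in> upper_central G 2" "nf k i j \<otimes> b 1 = b 1 \<otimes> nf k i j \<otimes> z'"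
    "z'' \<in> upper_central G 2" "nf k i j \<otimes> c 1 = c 1 \<otimes> nf k i j \<otimes> z''"
    by (rule upper_central_commute')
  have mult: "nf x y z \<otimes> nf k0 s 0 = nf (x + k0) (y * ee k0 + s) (z * ee (- k0))" if "q\<^sup>2 dvd s" for x y z k0 s
  proof -
    have "nf x y z \<otimes> nf k0 s 0 = (nf x y z \<otimes> c k0) \<otimes> a s" by (simp add: nf_def[of k0] m_assoc)
    then show ?thesis by (simp add: nf_c nf_a_central[OF that])
  qed
  obtain k0 s where s: "q dvd k0" "q\<^sup>2 dvd s" "z = nf k0 s 0" using z(1) by (rule upper_central_2_form)
  obtain k1 t where t: "q dvd k1" "q\<^sup>2 dvd t" "z'' = nf k1 t 0" using z(5) by (rule upper_central_2_form)
  have "nf (k - j) ((i + 1) * ee (- j)) (T j) = nf (k + k0) ((ee k + i) * ee k0 + s) (j * ee (- k0))"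
    using z(2) by (simp add: s mult nf_a_1 a_1_nf)
  then have A: "q\<^sup>2 dvd (k - j) - (k + k0)" "q\<^sup>2 dvd (i + 1) * ee (- j) - ((ee k + i) * ee k0 + s)"
    unfolding nf_eq_iff by blast+
  have "q dvd - ((k - j) - (k + k0)) - k0"
    using dvd_trans[OF q_dvd_pow(1) A(1)] s(1) by (intro dvd_diff) (simp only: dvd_minus_iff)
  then have j: "q dvd j" by simp
  have "q\<^sup>2 dvd ((i + 1) * ee (- j) - ((ee k + i) * ee k0 + s)) - (i + 1) * (ee (- j) - 1) + s + (ee k + i) * (ee k0 - 1)"
    using j by (intro dvd_add[OF dvd_add[OF dvd_diff[OF A(2) dvd_mult] s(2)] dvd_mult[OF q2_dvd_ee[OF s(1)]]] q2_dvd_ee) simp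
  then have "q\<^sup>2 dvd - (ee k - 1)" by (simp add: algebra_simps)
  then have "q ^ Suc 1 dvd ee k - 1" by (simp only: dvd_minus_iff) (simp add: numeral_2_eq_2)
  from ee_dvd[OF this] have k: "q dvd k" by simp
  have "nf (k + 1) (i * ee 1) (j * ee (- 1)) = nf (1 + k + k1) (i * ee k1 + t) (j * ee (- k1))"
    using z(6) by (simp add: t mult nf_c c_nf)
  then have C: "q\<^sup>2 dvd i * ee 1 - (i * ee k1 + t)" unfolding nf_eq_iff by blast
  have "q\<^sup>2 dvd (i * ee 1 - (i * ee k1 + t)) + t + i * (ee k1 - 1)"
    by (rule dvd_add[OF dvd_add[OF C t(2)] dvd_mult[OF q2_dvd_ee[OF t(1)]]])
  then have "q ^ Suc 1 dvd i * w" by (simp add: ee_1 al_def algebra_simps numeral_2_eq_2)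
  from cancel_w[OF this] have "q dvd i" by simp
  with j k show ?thesis by blast
qed

text \<open>Only the Heisenberg law modulo q is left: A determines j and B determines i, while k is
  unrestricted.\<close>

lemma upper_central_4:
  assumes "nf k i j \<in> upper_central G 4"
  shows "q dvd i \<and> q dvd j"
proof -
  have "nf k i j \<in> upper_central G (Suc 3)" using assms by simp
  then obtain z z' z'' where z: "z \<in> upper_central G 3" "nf k i j \<otimes> a 1 = a 1 \<otimes> nf k i j \<otimes> z"
    "z' \<in> upper_central G 3" "nf k i j \<otimes> b 1 = b 1 \<otimes> nf k i j \<otimes> z'"
    "z'' \<in> upper_central G 3" "nf k i j \<otimes> c 1 = c 1 \<otimes> nf k i j \<otimes> z''"
    by (rule upper_central_commute')
  obtain k0 i0 j0 where z0: "z = nf k0 i0 j0" using upper_central_closed[OF z(1)] by (rule nf_surj)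
  obtain k1 i1 j1 where z1: "z' = nf k1 i1 j1" using upper_central_closed[OF z(3)] by (rule nf_surj)
  have 0: "q dvd k0" "q dvd i0" using upper_central_3 z(1) z0 by blast+
  have 1: "q dvd k1" "q dvd i1" using upper_central_3 z(3) z1 by blast+
  obtain x y u where x: "nf k (ee k + i) j \<otimes> nf k0 i0 j0 = nf x y u" "q dvd x - (k + k0 - i0 * j)"
    using nf_mult_mod_q by blast
  have "nf (k - j) ((i + 1) * ee (- j)) (T j) = nf x y u"
    using z(2) x(1) by (simp add: z0 nf_a_1 a_1_nf)
  then have A: "q\<^sup>2 dvd (k - j) - x" unfolding nf_eq_iff by blast
  have "q dvd ((k - j) - x) + (x - (k + k0 - i0 * j)) + (k0 - i0 * j)"
    by (rule dvd_add[OF dvd_add[OF dvd_trans[OF q_dvd_pow(1) A] x(2)] dvd_diff[OF 0(1) dvd_mult2[OF 0(2)]]])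
  then have j: "q dvd j" by simp
  obtain x1 y1 u1 where x1: "nf 0 0 1 \<otimes> nf k i j = nf x1 y1 u1" "q dvd x1 - (0 + k - i * 1)"
    using nf_mult_mod_q by blast
  obtain x2 y2 u2 where x2: "nf x1 y1 u1 \<otimes> nf k1 i1 j1 = nf x2 y2 u2" "q dvd x2 - (x1 + k1 - i1 * u1)"
    using nf_mult_mod_q by blast
  have "nf k i (j + 1) = nf x2 y2 u2"
    using z(4) x1(1) x2(1) by (simp add: z1 nf_b nf_0)
  then have B: "q\<^sup>2 dvd k - x2" unfolding nf_eq_iff by blast
  have "q dvd (k - x2) + (x2 - (x1 + k1 - i1 * u1)) + (x1 - (0 + k - i * 1)) + (k1 - i1 * u1)"
    by (rule dvd_add[OF dvd_add[OF dvd_add[OF dvd_trans[OF q_dvd_pow(1) B] x2(2)] x1(2)] dvd_diff[OF 1(1) dvd_mult2[OF 1(2)]]])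
  then have "q dvd i" by simp
  with j show ?thesis by blast
qed

lemma upper_central_Zset:
  assumes "1 \<le> n" "n \<le> 4"
  shows "upper_central G n = Zset n"
proof
  show "upper_central G n \<subseteq> Zset n"
  proof
    fix g assume g: "g \<in> upper_central G n"
    obtain k i j where kij: "g = nf k i j" using upper_central_closed[OF g] by (rule nf_surj)
    have "n = 1 \<or> n = 2 \<or> n = 3 \<or> n = 4" using assms by presburger
    moreover have d: "q dvd x" if "q\<^sup>2 dvd x" for x by (rule dvd_trans[OF q_dvd_pow(1) that])
    ultimately have "(n < 4 \<longrightarrow> q dvd k) \<and> q dvd i \<and> q dvd j \<and>
      (n < 3 \<longrightarrow> q\<^sup>2 dvd i \<and> q\<^sup>2 dvd j) \<and> (n < 2 \<longrightarrow> q\<^sup>2 dvd k)"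
    proof (elim disjE)
      assume n: "n = 1"
      show ?thesis using upper_central_1[OF g[unfolded kij n]] d by (simp add: n)
    next
      assume n: "n = 2"
      show ?thesis using upper_central_2[OF g[unfolded kij n]] d by (simp add: n)
    next
      assume n: "n = 3"
      show ?thesis using upper_central_3[OF g[unfolded kij n]] by (simp add: n)
    next
      assume n: "n = 4"
      show ?thesis using upper_central_4[OF g[unfolded kij n]] by (simp add: n)
    qed
    then show "g \<in> Zset n" unfolding kij Zset_def by blast
  qed
qed (rule Zset_subset[OF assms])

lemma upper_central_4_proper: "upper_central G 4 \<noteq> carrier G"
proof
  assume "upper_central G 4 = carrier G"
  then have "nf 0 1 0 \<in> upper_central G 4" by simp
  then have "q dvd 1" using upper_central_4 by blast
  then show False using p_dvd_q prime_ip by (meson dvd_trans not_prime_unit)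
qed

end

section \<open>Isomorphisms between Macdonald groups\<close>

context macdonald_numbers
begin

text \<open>Solves for s = q r in the condition under which A B^s satisfies the first relation with
  exponent n. It is linear in r with coefficient \<open>U\<close>. Modulo p this is 2 l if p > 3,
  and 2 l (1 + q' l) with q = 3 q' if p = 3, where admissibility is used once more.\<close>

lemma numbers_cong:
  assumes "macdonald_numbers p m l'" "q dvd l' - l" "n = 1 + q * l''" "q\<^sup>2 dvd l'' - l'"
  obtains r where "q ^ 3 dvd (al - n + 2 * w * (q * r) * tet n) - q * r * (be - n)"
proof -
  obtain d where d: "l' - l = q * d" using assms(2) by blast
  obtain t where t: "l'' - l' = q\<^sup>2 * t" using assms(4) by blast
  have l'': "l'' = l + q * (d + q * t)" using d t by (simp add: algebra_simps power2_eq_square)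
  define U where "U = l + l'' - q * l\<^sup>2 + 2 * l * tet n"
  have t6: "6 * tet n = q * l'' * (1 + q * l'') * (2 + q * l'')"
    unfolding six_tet assms(3) by (simp add: algebra_simps)
  have "\<not> int p dvd U"
  proof
    assume U: "int p dvd U"
    obtain q' where q': "q = int p * q'" using p_dvd_q by blast
    show False
    proof (cases "p = 3")
      case False
      have "q dvd 2 * (3 * tet n)" using t6 by simp
      then have "q dvd 3 * tet n" using coprime_dvd_mult_right_iff[OF coprime_q_2] by blast
      then have "q dvd tet n" using coprime_dvd_mult_right_iff[OF coprime_q_3[OF False]] by blast
      then obtain s where s: "tet n = q * s" by blast
      have "U - int p * (q' * ((d + q * t) - l\<^sup>2 + 2 * l * s)) = 2 * l"
        unfolding U_def s l'' q' by (simp add: algebra_simps)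
      with dvd_diff[OF U dvd_triv_left] have "int p dvd 2 * l" by metis
      moreover have "\<not> int p dvd 2" using coprime_q_2 coprime_q_iff by blast
      ultimately show False using not_dvd_l prime_ip by (simp add: prime_dvd_mult_iff)
    next
      case True
      have q3: "q = 3 * q'" using q' True by simp
      have "2 * tet n = q' * l'' * (1 + q * l'') * (2 + q * l'')"
        using t6 unfolding q3 by simp
      then have "l * (2 * tet n) = l * (q' * l'' * (1 + q * l'') * (2 + q * l''))" by simp
      then have "U - 3 * (q' * (d + q * t) - q' * l\<^sup>2 + l * q' * (2 * q' * (d + q * t) + q' * l'' * l'' * (3 + q * l''))) = 2 * (l * (1 + q' * l))"
        unfolding U_def unfolding l'' q3 by (simp add: algebra_simps power2_eq_square)
      moreover have "3 dvd U" using U True by simp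
      ultimately have "3 dvd 2 * (l * (1 + q' * l))" using dvd_diff[of 3 U] by (metis dvd_triv_left)
      moreover have p3: "Factorial_Ring.prime (3 :: int)" using prime_ip True by simp
      ultimately have "3 dvd l \<or> 3 dvd 1 + q' * l" by (simp add: prime_dvd_mult_iff)
      moreover have "\<not> 3 dvd l" using not_dvd_l True by simp
      ultimately have *: "3 dvd 1 + q' * l" by blast
      show False
      proof (cases "m = 1")
        case m1: True
        have "q = 3" unfolding q_def using m1 True by simp
        then have "q' = 1" using q3 by simp
        moreover have "[l = 1] (mod 3)" using adm True m1 by (simp add: admissible_def)
        ultimately show False using * by (simp add: cong_def) presburger
      next
        case False
        then have "9 dvd q" using m_pos True le_imp_power_dvd[of 2 m "3::int"] unfolding q_def by simp
        then have "3 dvd q'" using q3 by presburger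
        then have "3 dvd q' * l" by simp
        then have "(3 :: int) dvd 1" using * dvd_add_left_iff[of 3 "q' * l" 1] by simp
        then show False by simp
      qed
    qed
  qed
  then have "coprime q U" using coprime_q_iff by blast
  then obtain x where x: "[U * x = 1] (mod q)" by (metis cong_solve_coprime_int coprime_commute)
  then obtain y where y: "U * x - 1 = q * y" by (auto simp: cong_iff_dvd_diff)
  \<comment> \<open>Here d measures the distance of l' from l, and x inverts \<open>U\<close> modulo
    q.\<close>
  define r where "r = x * d"
  have "(al - n + 2 * w * (q * r) * tet n) - q * r * (be - n) = q\<^sup>2 * (r * U - d) - q ^ 3 * t"
    unfolding al_def be_def assms(3) U_def w_def l'' by (simp add: algebra_simps power2_eq_square power3_eq_cube)
  also have "r * U - d = d * (U * x - 1)" by (simp add: r_def algebra_simps)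
  also have "q\<^sup>2 * (d * (U * x - 1)) - q ^ 3 * t = q ^ 3 * (d * y - t)"
    unfolding y by (simp add: algebra_simps power2_eq_square power3_eq_cube)
  finally have "q ^ 3 dvd (al - n + 2 * w * (q * r) * tet n) - q * r * (be - n)" by (simp only: dvd_triv_left)
  then show thesis by (rule that)
qed

end

context macdonald
begin

text \<open>The \<open>tri\<close> and \<open>tet\<close> terms are the summed corrections of
  \<open>nf_a_1\<close>. The drift \<open>T s - s\<close> of the B-exponent is a multiple of q^2 and
  is therefore booked on A, with opposite sign.\<close>

lemma pow_ab:
  assumes s: "q dvd s"
  shows "(a 1 \<otimes> b s) [^] n =
    nf (- s * tri (int n - 1)) (int n - 2 * w * s * tet (int n) - (T s - s) * tri (int n - 1)) (int n * s)"
proof (induction n)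
  case 0
  show ?case by (simp add: nf_def tri_def tet_def)
next
  case (Suc n)
  define k where "k = int n"
  obtain r where r: "s = q * r" using s by blast
  define \<mu> where "\<mu> = T s - s"
  have mu: "q\<^sup>2 dvd \<mu>" unfolding \<mu>_def by (rule q2_dvd_T[OF s])
  define i where "i = k - 2 * w * s * tet k - \<mu> * tri (k - 1)"
  have ks: "q dvd k * s" using s by simp
  \<comment> \<open>Modulo q^3 the drift \<open>T j - j\<close> is linear on the multiples of
    s.\<close>
  have 1: "q ^ 3 dvd (T (k * s) - k * s) - k * \<mu>"
  proof (rule cancel6)
    have "6 * ((T (k * s) - k * s) - k * \<mu>) = 3 * w * (2 * tri (k * s)) + w\<^sup>2 * (6 * tet (k * s))
       - k * (3 * w * (2 * tri s) + w\<^sup>2 * (6 * tet s))"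
      unfolding \<mu>_def T_def by (simp add: algebra_simps)
    also have "\<dots> = 3 * w * k * s\<^sup>2 * (k - 1) + w * w * k * s * s\<^sup>2 * (k\<^sup>2 - 1)"
      unfolding two_tri six_tet by (simp add: algebra_simps power2_eq_square)
    also have "\<dots> = 3 * q ^ 3 * (l * k * r\<^sup>2 * (k - 1)) + w * q ^ 3 * (q * l * k * r * r\<^sup>2 * (k\<^sup>2 - 1))"
      by (simp add: r w_def algebra_simps power2_eq_square power3_eq_cube)
    finally show "6 * ((T (k * s) - k * s) - k * \<mu>) = \<dots>" .
  qed
  have 2: "q ^ 3 dvd (i + 1) * ee (- (k * s)) - (i + 1 - w * s * k * (k + 1))"
  proof -
    obtain t where t: "tri (k * s) = q * t" using q_dvd_tri[OF ks] by blast
    obtain u where u: "\<mu> = q\<^sup>2 * u" using mu by blast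
    have "(i + 1) * ee (- (k * s)) - (i + 1 - w * s * k * (k + 1))
       = (i - k) * (- w * s * k) + (i + 1) * (w\<^sup>2 * tri (k * s))"
      unfolding ee_minus by (simp add: algebra_simps)
    also have "\<dots> = q ^ 3 * ((- 2 * l * r * tet k - u * tri (k - 1)) * (- l * q * r * k) + (i + 1) * (l\<^sup>2 * t))"
      unfolding i_def t by (simp add: r u w_def algebra_simps power2_eq_square power3_eq_cube)
    finally show ?thesis by simp
  qed
  have "(a 1 \<otimes> b s) [^] Suc n = (nf (- s * tri (k - 1)) i (k * s) \<otimes> a 1) \<otimes> b s"
    using Suc by (simp add: i_def k_def \<mu>_def m_assoc)
  also have "\<dots> = nf (- s * tri (k - 1) - k * s) ((i + 1) * ee (- (k * s))) (T (k * s) + s)"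
    by (simp add: nf_a_1 nf_b)
  also have "\<dots> = nf (- s * tri k) (k + 1 - 2 * w * s * tet (k + 1) - \<mu> * tri k) ((k + 1) * s)"
  proof (rule nf_cong)
    have tk: "tri k = tri (k - 1) + k" using tri_plus1[of "k - 1"] by simp
    show "q\<^sup>2 dvd (- s * tri (k - 1) - k * s) - - s * tri k" unfolding tk by (simp add: algebra_simps)
    have eq: "(i + 1 - w * s * k * (k + 1)) - (k + 1 - 2 * w * s * tet (k + 1) - \<mu> * tri k) = k * \<mu>"
    proof -
      have "(i + 1 - w * s * k * (k + 1)) - (k + 1 - 2 * w * s * tet (k + 1) - \<mu> * tri k)
         = w * s * (2 * tri k) - w * s * (k * (k + 1)) + \<mu> * (tri k - tri (k - 1))"
        unfolding i_def tet_plus1 by (simp add: algebra_simps)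
      then show ?thesis unfolding two_tri using tk by simp
    qed
    have 3: "q ^ 3 dvd ((i + 1) * ee (- (k * s)) - (k + 1 - 2 * w * s * tet (k + 1) - \<mu> * tri k)) - k * \<mu>"
      using 2 unfolding eq[symmetric] by (simp add: algebra_simps)
    have "q\<^sup>2 dvd (((i + 1) * ee (- (k * s)) - (k + 1 - 2 * w * s * tet (k + 1) - \<mu> * tri k)) - k * \<mu>) + k * \<mu>"
      by (rule dvd_add[OF dvd_trans[OF q2_dvd_q3 3] dvd_mult[OF mu]])
    then show "q\<^sup>2 dvd (i + 1) * ee (- (k * s)) - (k + 1 - 2 * w * s * tet (k + 1) - \<mu> * tri k)" by simp
    have "q ^ 3 dvd (((i + 1) * ee (- (k * s)) - (k + 1 - 2 * w * s * tet (k + 1) - \<mu> * tri k)) - k * \<mu>)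
       - ((T (k * s) - k * s) - k * \<mu>)" by (rule dvd_diff[OF 3 1])
    then show "q ^ 3 dvd ((i + 1) * ee (- (k * s)) - (k + 1 - 2 * w * s * tet (k + 1) - \<mu> * tri k)) - ((T (k * s) + s) - (k + 1) * s)"
      by (simp add: algebra_simps)
  qed
  finally show ?case by (simp add: k_def \<mu>_def add.commute)
qed

lemma pow_ab_q3:
  assumes s: "q dvd s"
  shows "(a 1 \<otimes> b s) [^] (p ^ (3 * m)) = \<one>"
proof -
  obtain r where r: "s = q * r" using s by blast
  have t: "q dvd tri (q ^ 3 - 1)" by (rule q_dvd_tri'[OF q_dvd_pow(3)])
  obtain t' where t': "tri (q ^ 3 - 1) = q * t'" using t by blast
  obtain u where u: "T s - s = q\<^sup>2 * u" using q2_dvd_T[OF s] by blast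
  have "q ^ 3 dvd 2 * w * s * tet (q ^ 3)"
  proof (rule cancel6)
    have "6 * (2 * w * s * tet (q ^ 3)) = 2 * w * s * (6 * tet (q ^ 3))" by simp
    then show "6 * (2 * w * s * tet (q ^ 3)) = 3 * q ^ 3 * 0 + w * q ^ 3 * (2 * s * (q ^ 3 - 1) * (q ^ 3 + 1))"
      unfolding six_tet by (simp add: algebra_simps)
  qed
  then obtain v where v: "2 * w * s * tet (q ^ 3) = q ^ 3 * v" by blast
  have "nf (- s * tri (q ^ 3 - 1)) (q ^ 3 - 2 * w * s * tet (q ^ 3) - (T s - s) * tri (q ^ 3 - 1)) (q ^ 3 * s) = nf 0 0 0"
  proof (rule nf_cong)
    have i: "q ^ 3 - 2 * w * s * tet (q ^ 3) - (T s - s) * tri (q ^ 3 - 1) = q ^ 3 * (1 - v - u * t')"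
      unfolding v u t' by (simp add: algebra_simps power2_eq_square power3_eq_cube)
    show "q\<^sup>2 dvd - s * tri (q ^ 3 - 1) - 0" unfolding t' r by (simp add: power2_eq_square)
    show "q\<^sup>2 dvd q ^ 3 - 2 * w * s * tet (q ^ 3) - (T s - s) * tri (q ^ 3 - 1) - 0"
      unfolding i using q2_dvd_q3 by simp
    show "q ^ 3 dvd q ^ 3 - 2 * w * s * tet (q ^ 3) - (T s - s) * tri (q ^ 3 - 1) - 0 - (q ^ 3 * s - 0)"
      unfolding i by simp
  qed
  then show ?thesis unfolding pow_ab[OF s] pow_q[symmetric] by (simp add: nf_def)
qed

text \<open>The B-exponent q s is divisible by q^2 and turns into a power of A, so the new
  generators recover pure powers of the old ones.\<close>

lemma pow_ab_q:
  assumes s: "q dvd s"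
  obtains x where "(a 1 \<otimes> b s) [^] (p ^ m) = a (q + q\<^sup>2 * x)"
proof -
  obtain r where r: "s = q * r" using s by blast
  obtain t' where t': "tri (q - 1) = q * t'" using q_dvd_tri'[of q] by auto
  obtain u where u: "T s - s = q\<^sup>2 * u" using q2_dvd_T[OF s] by blast
  have "nf (- s * tri (q - 1)) (q - 2 * w * s * tet q - (T s - s) * tri (q - 1)) (q * s)
     = nf 0 (q + q\<^sup>2 * (- 2 * l * r * tet q - u * tri (q - 1) - r)) 0"
  proof (rule nf_cong)
    have i: "q - 2 * w * s * tet q - (T s - s) * tri (q - 1) - (q + q\<^sup>2 * (- 2 * l * r * tet q - u * tri (q - 1) - r)) = q\<^sup>2 * r"
      unfolding u unfolding r w_def by (simp add: algebra_simps power2_eq_square)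
    show "q\<^sup>2 dvd - s * tri (q - 1) - 0" unfolding t' r by (simp add: power2_eq_square)
    show "q\<^sup>2 dvd q - 2 * w * s * tet q - (T s - s) * tri (q - 1) - (q + q\<^sup>2 * (- 2 * l * r * tet q - u * tri (q - 1) - r))"
      unfolding i by simp
    show "q ^ 3 dvd q - 2 * w * s * tet q - (T s - s) * tri (q - 1) - (q + q\<^sup>2 * (- 2 * l * r * tet q - u * tri (q - 1) - r)) - (q * s - 0)"
      unfolding i unfolding r by (simp add: power2_eq_square)
  qed
  then have "(a 1 \<otimes> b s) [^] (p ^ m) = a (q + q\<^sup>2 * (- 2 * l * r * tet q - u * tri (q - 1) - r))"
    using pow_ab[OF s, of "p ^ m"] by (simp add: nf_0 flip: q_def)
  then show thesis by (rule that)
qed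

text \<open>Up to a central factor the new generators have the old commutator, so conjugation by
  either is the same.\<close>

lemma comm_ab:
  assumes s: "q dvd s"
  shows "\<exists>z\<in>carrier G. (\<forall>g\<in>carrier G. z \<otimes> g = g \<otimes> z) \<and> group_comm G (a 1 \<otimes> b s) (b 1 \<otimes> a s) = c 1 \<otimes> z"
proof -
  obtain r where r: "s = q * r" using s by blast
  have q2: "q\<^sup>2 dvd s * w" "q\<^sup>2 dvd s * (1 - be)" by (simp_all add: r w_def be_def power2_eq_square algebra_simps)
  define z where "z = a (- (s * w)) \<otimes> b (s * (1 - be))"
  have bc: "b x = a (- x)" if "q\<^sup>2 dvd x" for x by (rule b_q2[OF that])
  have z: "z = a (- (s * w) - s * (1 - be))" by (simp add: z_def bc[OF q2(2)] add)
  have zc: "\<forall>g\<in>carrier G. z \<otimes> g = g \<otimes> z" unfolding z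
    using a_central[OF dvd_diff[OF _ q2(2), of "- (s * w)"]] q2(1) by (simp only: dvd_minus_iff) simp
  have eq: "a s \<otimes> b s = b s \<otimes> a s" by (rule a_b_commute[OF s s])
  have AB: "a 1 \<otimes> b 1 = b 1 \<otimes> (a 1 \<otimes> c 1)" using mult_group_comm[of A B] by (simp add: a_1 b_1 c_1 m_assoc)
  have 1: "a 1 \<otimes> b s \<otimes> (b 1 \<otimes> a s) = b 1 \<otimes> (a 1 \<otimes> (c 1 \<otimes> (a s \<otimes> b s)))"
  proof -
    have "a 1 \<otimes> b s \<otimes> (b 1 \<otimes> a s) = (a 1 \<otimes> b 1) \<otimes> (b s \<otimes> a s)" by (simp add: m_assoc add_assoc add.commute)
    then show ?thesis unfolding AB eq by (simp add: m_assoc)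
  qed
  have "a s \<otimes> (b s \<otimes> c 1) = a s \<otimes> (c 1 \<otimes> b (s * be))" by (simp only: b_c ee_m1)
  also have "\<dots> = c 1 \<otimes> (a (s * al) \<otimes> b (s * be))"
    using a_c_1[of s] by (simp flip: m_assoc)
  finally have 2: "a s \<otimes> (b s \<otimes> c 1) = c 1 \<otimes> (a (s * al) \<otimes> b (s * be))" .
  have "b 1 \<otimes> a s \<otimes> (a 1 \<otimes> b s) \<otimes> (c 1 \<otimes> z) = b 1 \<otimes> (a 1 \<otimes> ((a s \<otimes> (b s \<otimes> c 1)) \<otimes> z))"
    by (simp add: m_assoc add_assoc z add.commute)
  also have "\<dots> = b 1 \<otimes> (a 1 \<otimes> (c 1 \<otimes> (a (s * al) \<otimes> (b (s * be) \<otimes> a (- (s * w))) \<otimes> b (s * (1 - be)))))"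
    unfolding 2 z_def by (simp add: m_assoc)
  also have "b (s * be) \<otimes> a (- (s * w)) = a (- (s * w)) \<otimes> b (s * be)"
    using a_central[of "- (s * w)" "b (s * be)"] q2(1) by simp
  also have "a (s * al) \<otimes> (a (- (s * w)) \<otimes> b (s * be)) \<otimes> b (s * (1 - be)) = a s \<otimes> b s"
    by (simp add: m_assoc add add_assoc al_def algebra_simps)
  finally have "b 1 \<otimes> a s \<otimes> (a 1 \<otimes> b s) \<otimes> (c 1 \<otimes> z) = a 1 \<otimes> b s \<otimes> (b 1 \<otimes> a s)"
    unfolding 1 .
  then have "group_comm G (a 1 \<otimes> b s) (b 1 \<otimes> a s) = c 1 \<otimes> z"
    by (intro group_comm_eqI) (simp_all add: z)
  then show ?thesis using zc by (intro bexI[of _ z]) (simp_all add: z)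
qed

text \<open>Conjugation by C takes A B^s to A^al B^(s be); the other side is given by
  \<open>pow_ab\<close>. The congruence on r expresses their equality. The natural number n stands
  for 1 + q l' modulo q^3, as \<open>pow_ab\<close> needs a natural exponent.\<close>

lemma conj_ab:
  assumes l': "macdonald_numbers p m l'" "q dvd l' - l" and s: "q dvd s" "s = q * r"
    and n: "n = 1 + q * l''" "q\<^sup>2 dvd l'' - l'" "n = int n'"
    and r: "q ^ 3 dvd (al - n + 2 * w * (q * r) * tet n) - q * r * (be - n)"
  shows "group_conj G (a 1 \<otimes> b s) (group_comm G (a 1 \<otimes> b s) (b 1 \<otimes> a s)) = (a 1 \<otimes> b s) [^] (1 + q * l')"
proof -
  obtain z where z: "z \<in> carrier G" "\<And>g. g \<in> carrier G \<Longrightarrow> z \<otimes> g = g \<otimes> z"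
    "group_comm G (a 1 \<otimes> b s) (b 1 \<otimes> a s) = c 1 \<otimes> z" using comm_ab[OF s(1)] by blast
  have "(a 1 \<otimes> b s) \<otimes> (c 1 \<otimes> z) = (c 1 \<otimes> z) \<otimes> nf 0 al (s * be)"
  proof -
    have "(a 1 \<otimes> b s) \<otimes> (c 1 \<otimes> z) = (nf 0 1 s \<otimes> c 1) \<otimes> z" using z(1) by (simp add: nf_def m_assoc)
    also have "\<dots> = z \<otimes> (c 1 \<otimes> nf 0 al (s * be))" using z(2)[of "nf 1 al (s * be)"]
      by (simp add: nf_c c_nf ee_1 ee_m1)
    also have "\<dots> = (c 1 \<otimes> z) \<otimes> nf 0 al (s * be)" using z(2)[of "c 1"] z(1) by (simp flip: m_assoc)
    finally show ?thesis .
  qed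
  then have conj: "group_conj G (a 1 \<otimes> b s) (c 1 \<otimes> z) = nf 0 al (s * be)"
    using z(1) by (simp add: group_conj_def m_assoc inv_solve_left')
  have "(a 1 \<otimes> b s) [^] (1 + q * l') = (a 1 \<otimes> b s) [^] (int n')"
  proof (rule int_pow_cong)
    show "(a 1 \<otimes> b s) [^] (q ^ 3) = \<one>" unfolding pow_q int_pow_int by (rule pow_ab_q3[OF s(1)])
    obtain t where "l'' - l' = q\<^sup>2 * t" using n(2) by blast
    then have "1 + q * l' - int n' = q ^ 3 * (- t)"
      by (simp add: n(1) flip: n(3)) (simp add: power2_eq_square power3_eq_cube algebra_simps)
    then show "[1 + q * l' = int n'] (mod q ^ 3)" unfolding cong_iff_dvd_diff by simp
  qed simp
  also have "\<dots> = nf (- s * tri (n - 1)) (n - 2 * w * s * tet n - (T s - s) * tri (n - 1)) (n * s)"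
    unfolding int_pow_int pow_ab[OF s(1)] n(3) ..
  also have "\<dots> = nf 0 al (s * be)"
  proof (rule nf_cong)
    obtain t where t: "tri (n - 1) = q * t" using q_dvd_tri[of "n - 1"] n(1) by auto
    obtain u where u: "T s - s = q\<^sup>2 * u" using q2_dvd_T[OF s(1)] by blast
    obtain v where v: "(al - n + 2 * w * (q * r) * tet n) - q * r * (be - n) = q ^ 3 * v" using r by blast
    show "q\<^sup>2 dvd - s * tri (n - 1) - 0" by (simp add: t s(2) power2_eq_square)
    obtain d where d: "l' - l = q * d" using l'(2) by blast
    obtain t' where t': "l'' - l' = q\<^sup>2 * t'" using n(2) by blast
    have l'': "l'' = l + q * (d + q * t')" using d t' by (simp add: algebra_simps power2_eq_square)
    have "n - 2 * w * s * tet n - (T s - s) * tri (n - 1) - al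
       = q\<^sup>2 * ((d + q * t') - 2 * l * r * tet n - u * tri (n - 1))"
      unfolding u by (simp add: n(1) l'' al_def w_def s(2) algebra_simps power2_eq_square)
    then show "q\<^sup>2 dvd n - 2 * w * s * tet n - (T s - s) * tri (n - 1) - al" by simp
    have "(n - 2 * w * s * tet n - (T s - s) * tri (n - 1) - al) - (n * s - s * be)
      = - ((al - n + 2 * w * (q * r) * tet n) - q * r * (be - n)) - q\<^sup>2 * u * (q * t)"
      unfolding u t unfolding s(2) by (simp add: algebra_simps)
    also have "\<dots> = q ^ 3 * (- v - u * t)" unfolding v by (simp add: algebra_simps power2_eq_square power3_eq_cube)
    finally show "q ^ 3 dvd (n - 2 * w * s * tet n - (T s - s) * tri (n - 1) - al) - (n * s - s * be)" by simp
  qed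
  finally show ?thesis unfolding z(3) conj by simp
qed

interpretation S: macdonald p m l G B A by (rule swap)

text \<open>The q-th powers of the new generators are A^q and B^q up to powers of A^(q^2) and
  B^(q^2), and these come from taking the q-th power once more. So B^s and A^s can be divided
  out.\<close>

lemma generate_ab:
  assumes s: "q dvd s"
  shows "generate G {a 1 \<otimes> b s, b 1 \<otimes> a s} = carrier G"
proof
  let ?D = "generate G {a 1 \<otimes> b s, b 1 \<otimes> a s}"
  show "?D \<subseteq> carrier G" by (rule generate_incl) auto
  have D: "subgroup ?D G" by (rule generate_is_subgroup) auto
  interpret D: subgroup ?D G by (rule D)
  have pow: "x [^] k \<in> ?D" if "x \<in> ?D" for x and k :: int
    using subgroup_int_pow_closed[OF D that] .
  have npow: "x [^] k \<in> ?D" if "x \<in> ?D" for x and k :: nat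
    using pow[OF that, of "int k"] by (simp add: int_pow_int)
  have x: "a 1 \<otimes> b s \<in> ?D" and y: "b 1 \<otimes> a s \<in> ?D" by (auto intro: generate.incl)
  obtain r where r: "s = q * r" using s by blast
  obtain u where "(a 1 \<otimes> b s) [^] (p ^ m) = a (q + q\<^sup>2 * u)" by (rule pow_ab_q[OF s])
  then have u: "a (q + q\<^sup>2 * u) \<in> ?D" using npow[OF x, of "p ^ m"] by simp
  obtain v where "(S.a 1 \<otimes> S.b s) [^] (p ^ m) = S.a (q + q\<^sup>2 * v)" by (rule S.pow_ab_q[OF s])
  then have v: "b (q + q\<^sup>2 * v) \<in> ?D" using npow[OF y, of "p ^ m"] by (simp add: swap_abc)
  have aq: "a (q\<^sup>2 * k) \<in> ?D" for k
  proof -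
    have "a (q + q\<^sup>2 * u) [^] (q * k) = a (q\<^sup>2 * k)"
      unfolding int_pow_abc by (rule a_cong) (simp add: cong_iff_dvd_diff power2_eq_square power3_eq_cube algebra_simps)
    then show ?thesis using pow[OF u, of "q * k"] by simp
  qed
  have bq: "b (q\<^sup>2 * k) \<in> ?D" for k using aq[of "- k"] b_q2[of "q\<^sup>2 * k"] by simp
  have "b (q + q\<^sup>2 * v) \<otimes> b (q\<^sup>2 * (- v)) \<in> ?D" by (intro D.m_closed v bq)
  then have "b q \<in> ?D" by (simp add: add)
  from pow[OF this, of "- r"] have bs: "b (- s) \<in> ?D" by (simp add: int_pow_abc r)
  have "a (q + q\<^sup>2 * u) \<otimes> a (q\<^sup>2 * (- u)) \<in> ?D" by (intro D.m_closed u aq)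
  then have "a q \<in> ?D" by (simp add: add)
  from pow[OF this, of "- r"] have as: "a (- s) \<in> ?D" by (simp add: int_pow_abc r)
  have "a 1 \<otimes> b s \<otimes> b (- s) \<in> ?D" "b 1 \<otimes> a s \<otimes> a (- s) \<in> ?D" by (intro D.m_closed x y as bs)+
  then have "{A, B} \<subseteq> ?D" by (simp add: m_assoc add) (simp add: a_1 b_1)
  then show "carrier G \<subseteq> ?D" using generate_subgroup_incl[OF _ D] gen by metis
qed

lemma other_generators:
  assumes l': "macdonald_numbers p m l'" "q dvd l' - l"
  obtains x y where "x \<in> carrier G" "y \<in> carrier G" "generate G {x, y} = carrier G"
    "group_conj G x (group_comm G x y) = x [^] (1 + int p ^ m * l')"
    "group_conj G y (group_comm G y x) = y [^] (1 + int p ^ m * l')"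
    "x [^] (p ^ (3 * m)) = \<one>" "y [^] (p ^ (3 * m)) = \<one>"
proof -
  define l'' where "l'' = l' mod q\<^sup>2"
  have "q\<^sup>2 dvd l' - l''" by (simp add: l''_def)
  then have l'': "q\<^sup>2 dvd l'' - l'" by (simp only: dvd_diff_commute)
  have nn: "1 + q * l'' = int (nat (1 + q * l''))" using q_pos by (simp add: l''_def)
  obtain r where r: "q ^ 3 dvd (al - (1 + q * l'') + 2 * w * (q * r) * tet (1 + q * l'')) - q * r * (be - (1 + q * l''))"
    using numbers_cong[OF l' HOL.refl l''] by blast
  have s: "q dvd q * r" by simp
  note 1 = conj_ab[OF l' s HOL.refl HOL.refl l'' nn r]
  note 2 = S.conj_ab[OF l' s HOL.refl HOL.refl l'' nn r, unfolded swap_abc]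
  show thesis
    by (rule that[OF _ _ generate_ab[OF s]])
      (use 1 2 pow_ab_q3[OF s] S.pow_ab_q3[OF s] in \<open>simp_all add: q_def swap_abc\<close>)
qed

end

lemma J1_surj_hom:
  assumes "macdonald_numbers p m l" "macdonald_numbers p m l'" "int p ^ m dvd l' - l"
  obtains g where "g \<in> hom (J1 p m (1 + int p ^ m * l')) (J1 p m (1 + int p ^ m * l))"
    "g ` carrier (J1 p m (1 + int p ^ m * l')) = carrier (J1 p m (1 + int p ^ m * l))"
proof -
  interpret J: macdonald p m l "J1 p m (1 + int p ^ m * l)" "J1_gen p m (1 + int p ^ m * l) GenX" "J1_gen p m (1 + int p ^ m * l) GenY"
    by (rule J1_macdonald[OF assms(1)])
  interpret J': macdonald p m l' "J1 p m (1 + int p ^ m * l')" "J1_gen p m (1 + int p ^ m * l') GenX" "J1_gen p m (1 + int p ^ m * l') GenY"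
    by (rule J1_macdonald[OF assms(2)])
  let ?G = "J1 p m (1 + int p ^ m * l)"
  obtain x y where xy: "x \<in> carrier ?G" "y \<in> carrier ?G" "generate ?G {x, y} = carrier ?G"
    "group_conj ?G x (group_comm ?G x y) = x [^]\<^bsub>?G\<^esub> (1 + int p ^ m * l')"
    "group_conj ?G y (group_comm ?G y x) = y [^]\<^bsub>?G\<^esub> (1 + int p ^ m * l')"
    "x [^]\<^bsub>?G\<^esub> (p ^ (3 * m)) = \<one>\<^bsub>?G\<^esub>" "y [^]\<^bsub>?G\<^esub> (p ^ (3 * m)) = \<one>\<^bsub>?G\<^esub>"
    by (rule J.other_generators[OF assms(2)]) (use assms(3) J.q_def in auto)
  obtain g where g: "g \<in> hom (J1 p m (1 + int p ^ m * l')) ?G" "g (J1_gen p m (1 + int p ^ m * l') GenX) = x"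
    "g (J1_gen p m (1 + int p ^ m * l') GenY) = y"
    by (rule J1_universal[OF J.is_group xy(1,2,4-7)])
  interpret g: group_hom "J1 p m (1 + int p ^ m * l')" ?G g
    by (simp add: group_hom_def group_hom_axioms_def g(1) J.is_group J'.is_group)
  have "g ` carrier (J1 p m (1 + int p ^ m * l')) = carrier ?G"
    using g.generate_img[of "{J1_gen p m (1 + int p ^ m * l') GenX, J1_gen p m (1 + int p ^ m * l') GenY}"]
    by (simp add: J'.gen xy(3) g(2,3))
  then show thesis using that g(1) by blast
qed

lemma J1_iso:
  assumes "macdonald_numbers p m l" "macdonald_numbers p m l'" "int p ^ m dvd l' - l"
  shows "J1 p m (1 + int p ^ m * l) \<cong> J1 p m (1 + int p ^ m * l')"
proof -
  have d: "int p ^ m dvd l - l'" using assms(3) by (simp only: dvd_diff_commute)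
  interpret N: macdonald_numbers p m l by fact
  interpret N': macdonald_numbers p m l' by fact
  obtain f where f: "f \<in> hom (J1 p m (1 + int p ^ m * l)) (J1 p m (1 + int p ^ m * l'))"
    "f ` carrier (J1 p m (1 + int p ^ m * l)) = carrier (J1 p m (1 + int p ^ m * l'))"
    by (rule J1_surj_hom[OF assms(2,1) d])
  obtain g where g: "g \<in> hom (J1 p m (1 + int p ^ m * l')) (J1 p m (1 + int p ^ m * l))"
    "g ` carrier (J1 p m (1 + int p ^ m * l')) = carrier (J1 p m (1 + int p ^ m * l))"
    by (rule J1_surj_hom[OF assms])
  show ?thesis
    by (rule finite_iso_of_surj_homs[OF macdonald_J.finite_carrier[OF N.J1_macdonald_J]
          macdonald_J.finite_carrier[OF N'.J1_macdonald_J] f g(2)])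
qed

section \<open>The fourth term of the upper central series\<close>

context macdonald
begin

text \<open>Among such elements powers of A and B commute, but C still acts: [A^q, C] = A^(q^2 l),
  which is not trivial in J1. The product depends on l only through \<open>ee\<close>.\<close>

lemma nf_mult_Z4:
  assumes "q dvd i" "q dvd j" "q dvd i'" "q dvd j'"
  shows "nf k i j \<otimes> nf k' i' j' = nf (k + k') (i * ee k' + i') (j * ee (- k') + j')"
proof -
  have "nf k i j \<otimes> nf k' i' j' = (nf k i j \<otimes> c k') \<otimes> a i' \<otimes> b j'"
    by (simp add: nf_def[of k'] m_assoc)
  then show ?thesis using assms by (simp add: nf_c nf_a_nf_b nf_b)
qed

lemma Zset_4: "Zset 4 = {nf k i j | k i j. q dvd i \<and> q dvd j}"
  by (simp add: Zset_def)

end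

context macdonald_J
begin

lemma upper_central_4_eq: "upper_central G 4 = {nf k i j | k i j. q dvd i \<and> q dvd j}"
  using upper_central_Zset[of 4] by (simp add: Zset_4)

lemma Z4_coset_eq:
  assumes i: "q dvd i - i'" and j: "q dvd j - j'"
  shows "upper_central G 4 #> nf k i j = upper_central G 4 #> nf k' i' j'"
proof -
  interpret N: normal "upper_central G 4" G by (rule upper_central_normal)
  define u where "u = inv (nf k' i' j') \<otimes> nf k i j"
  have u: "u \<in> carrier G" "nf k' i' j' \<otimes> u = nf k i j" by (simp_all add: u_def flip: m_assoc)
  obtain x y z where xyz: "u = nf x y z" using u(1) by (rule nf_surj)
  obtain x' y' z' where m: "nf k' i' j' \<otimes> nf x y z = nf x' y' z'" "q dvd y' - (i' + y)" "q dvd z' - (j' + z)"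
    using nf_mult_mod_q by blast
  have "nf x' y' z' = nf k i j" using u(2) m(1) by (simp add: xyz)
  then have e: "q\<^sup>2 dvd y' - i" "q ^ 3 dvd (y' - i) - (z' - j)" unfolding nf_eq_iff by blast+
  have y'i: "q dvd y' - i" by (rule dvd_trans[OF q_dvd_pow(1) e(1)])
  have "q dvd (y' - i) - ((y' - i) - (z' - j))" by (rule dvd_diff[OF y'i dvd_trans[OF q_dvd_pow(3) e(2)]])
  then have z'j: "q dvd z' - j" by simp
  have "q dvd (y' - i) - (y' - (i' + y)) + (i - i')" by (rule dvd_add[OF dvd_diff[OF y'i m(2)] i])
  moreover have "q dvd (z' - j) - (z' - (j' + z)) + (j - j')" by (rule dvd_add[OF dvd_diff[OF z'j m(3)] j])
  ultimately have "q dvd y" "q dvd z" by simp_all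
  then have "u \<in> upper_central G 4" unfolding xyz upper_central_4_eq by blast
  then show ?thesis by (simp add: N.rcos_eq_iff u_def)
qed

lemma nf_in_Z4_iff: "nf k i j \<in> upper_central G 4 \<longleftrightarrow> q dvd i \<and> q dvd j"
proof
  assume "q dvd i \<and> q dvd j"
  then show "nf k i j \<in> upper_central G 4" unfolding upper_central_4_eq by blast
qed (rule upper_central_4)

end

text \<open>Both quotients are products of two cyclic groups of order q with coordinates i and j
  modulo q, and the coordinates are carried over.\<close>

lemma macdonald_Z4_quotient_iso:
  assumes "macdonald_J p m l G A B" "macdonald_J p m l' G' A' B'"
  shows "G Mod upper_central G 4 \<cong> G' Mod upper_central G' 4"
proof -
  interpret J: macdonald_J p m l G A B by fact
  interpret J': macdonald_J p m l' G' A' B' by fact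
  interpret N: normal "upper_central G' 4" G' by (rule J'.upper_central_normal)
  let ?r = "\<lambda>x. upper_central G' 4 #>\<^bsub>G'\<^esub> x"
  define h where "h g = (SOME y. \<exists>k i j. g = J.nf k i j \<and> y = ?r (J'.nf 0 i j))" for g
  have h: "h (J.nf k i j) = ?r (J'.nf 0 i j)" for k i j
    unfolding h_def
  proof (rule someI2)
    show "\<exists>k' i' j'. J.nf k i j = J.nf k' i' j' \<and> ?r (J'.nf 0 i j) = ?r (J'.nf 0 i' j')" by blast
    fix y assume "\<exists>k' i' j'. J.nf k i j = J.nf k' i' j' \<and> y = ?r (J'.nf 0 i' j')"
    then obtain k' i' j' where eq: "J.nf k i j = J.nf k' i' j'" and y: "y = ?r (J'.nf 0 i' j')" by blast
    have e: "J.q\<^sup>2 dvd i - i'" "J.q ^ 3 dvd (i - i') - (j - j')" using eq unfolding J.nf_eq_iff by blast+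
    have i: "J.q dvd i - i'" by (rule dvd_trans[OF J.q_dvd_pow(1) e(1)])
    have "J.q dvd (i - i') - ((i - i') - (j - j'))" by (rule dvd_diff[OF i dvd_trans[OF J.q_dvd_pow(3) e(2)]])
    then have j: "J.q dvd j - j'" by simp
    show "y = ?r (J'.nf 0 i j)" unfolding y by (rule J'.Z4_coset_eq[OF i j, symmetric])
  qed
  show ?thesis
  proof (rule FactGroup_iso_of_hom)
    show "h \<in> hom G (G' Mod upper_central G' 4)"
    proof (rule homI)
      fix x assume "x \<in> carrier G"
      then obtain k i j where "x = J.nf k i j" by (rule J.nf_surj)
      then show "h x \<in> carrier (G' Mod upper_central G' 4)" by (simp add: h carrier_FactGroup)
    next
      fix x y assume xy: "x \<in> carrier G" "y \<in> carrier G"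
      obtain k i j where x: "x = J.nf k i j" using xy(1) by (rule J.nf_surj)
      obtain k' i' j' where y: "y = J.nf k' i' j'" using xy(2) by (rule J.nf_surj)
      obtain k1 i1 j1 where 1: "J.nf k i j \<otimes>\<^bsub>G\<^esub> J.nf k' i' j' = J.nf k1 i1 j1" "J.q dvd i1 - (i + i')" "J.q dvd j1 - (j + j')"
        using J.nf_mult_mod_q by blast
      obtain k2 i2 j2 where 2: "J'.nf 0 i j \<otimes>\<^bsub>G'\<^esub> J'.nf 0 i' j' = J'.nf k2 i2 j2" "J.q dvd i2 - (i + i')" "J.q dvd j2 - (j + j')"
        using J'.nf_mult_mod_q by blast
      have d: "J.q dvd i1 - i2" "J.q dvd j1 - j2"
        using dvd_diff[OF 1(2) 2(2)] dvd_diff[OF 1(3) 2(3)] by simp_all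
      have "h (x \<otimes>\<^bsub>G\<^esub> y) = ?r (J'.nf 0 i1 j1)" by (simp add: x y 1(1) h)
      also have "\<dots> = ?r (J'.nf k2 i2 j2)" by (rule J'.Z4_coset_eq[OF d])
      also have "\<dots> = h x \<otimes>\<^bsub>G' Mod upper_central G' 4\<^esub> h y"
        unfolding 2(1)[symmetric] x y h by (rule N.rcos_mult[symmetric]) simp_all
      finally show "h (x \<otimes>\<^bsub>G\<^esub> y) = h x \<otimes>\<^bsub>G' Mod upper_central G' 4\<^esub> h y" .
    qed
    show "h ` carrier G = carrier (G' Mod upper_central G' 4)"
    proof
      show "h ` carrier G \<subseteq> carrier (G' Mod upper_central G' 4)"
      proof clarify
        fix x assume "x \<in> carrier G"
        then obtain k i j where "x = J.nf k i j" by (rule J.nf_surj)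
        then show "h x \<in> carrier (G' Mod upper_central G' 4)" by (simp add: h carrier_FactGroup)
      qed
      show "carrier (G' Mod upper_central G' 4) \<subseteq> h ` carrier G"
      proof
        fix Y assume "Y \<in> carrier (G' Mod upper_central G' 4)"
        then obtain y where y: "y \<in> carrier G'" "Y = ?r y" by (auto simp: carrier_FactGroup)
        obtain k i j where "y = J'.nf k i j" using y(1) by (rule J'.nf_surj)
        then have "Y = h (J.nf 0 i j)" using y(2) J'.Z4_coset_eq[of i i j j k 0] by (simp add: h)
        then show "Y \<in> h ` carrier G" by simp
      qed
    qed
    show "upper_central G 4 = {x \<in> carrier G. h x = \<one>\<^bsub>G' Mod upper_central G' 4\<^esub>}"
    proof -
      have "h x = \<one>\<^bsub>G' Mod upper_central G' 4\<^esub> \<longleftrightarrow> x \<in> upper_central G 4" if x: "x \<in> carrier G" for x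
      proof -
        obtain k i j where "x = J.nf k i j" using x by (rule J.nf_surj)
        then show ?thesis by (simp add: h N.rcos_eq_self_iff J.nf_in_Z4_iff J'.nf_in_Z4_iff)
      qed
      then show ?thesis using J.upper_central_subset by auto
    qed
  qed (rule J.is_group N.factorgroup_is_group)+
qed

text \<open>The map takes C^k A^i B^j to C^(t k) A^i B^j. With t l' = l modulo q, C^t acts on A^q
  and B^q in the second group as C does in the first.\<close>

lemma macdonald_Z4_iso:
  assumes "macdonald_J p m l G A B" "macdonald_J p m l' G' A' B'"
  obtains f where "f \<in> iso (G\<lparr>carrier := upper_central G 4\<rparr>) (G'\<lparr>carrier := upper_central G' 4\<rparr>)"
    "\<And>i. i \<le> 4 \<Longrightarrow> f ` upper_central G i = upper_central G' i"
proof -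
  interpret J: macdonald_J p m l G A B by fact
  interpret J': macdonald_J p m l' G' A' B' by fact
  let ?q = "J.q"
  obtain u where "[l' * u = 1] (mod ?q)" using J'.coprime_q_l by (metis cong_solve_coprime_int coprime_commute)
  then obtain v where v: "l' * u - 1 = ?q * v" by (auto simp: cong_iff_dvd_diff)
  \<comment> \<open>As u inverts l' modulo q, t is the quotient of l by l' there.\<close>
  define t where "t = u * l"
  have tl: "t * l' - l = ?q * (v * l)"
  proof -
    have "t * l' - l = (l' * u - 1) * l" by (simp add: t_def algebra_simps)
    then show ?thesis unfolding v by simp
  qed
  have "coprime ?q t"
  proof -
    have "coprime ?q u"
    proof (rule coprimeI)
      fix x assume "x dvd ?q" "x dvd u"
      then have "x dvd l' * u - ?q * v" by (intro dvd_diff dvd_mult dvd_mult2)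
      moreover have "l' * u - ?q * v = 1" using v by simp
      ultimately show "is_unit x" by (simp only:)
    qed
    then show ?thesis using J.coprime_q_l by (simp add: t_def)
  qed
  then have ct: "coprime (?q ^ n) t" for n by (simp add: coprime_power_left_iff)
  have dvd_t: "?q ^ n dvd t * x \<longleftrightarrow> ?q ^ n dvd x" for n x
    using coprime_dvd_mult_right_iff[OF ct] by blast
  have solve: "\<exists>k0. ?q\<^sup>2 dvd t * k0 - k" for k
  proof -
    obtain y where "[t * y = 1] (mod ?q\<^sup>2)" using ct[of 2] by (metis cong_solve_coprime_int coprime_commute)
    then have "?q\<^sup>2 dvd k * (t * y - 1)" by (simp add: cong_iff_dvd_diff)
    then have "?q\<^sup>2 dvd t * (y * k) - k" by (simp add: algebra_simps)
    then show ?thesis by blast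
  qed
  \<comment> \<open>Any representation with i and j divisible by q may be chosen;
    \<open>J.nf_eq_iff\<close> makes the value independent of it.\<close>
  define f where "f g = (SOME h. \<exists>k i j. ?q dvd i \<and> ?q dvd j \<and> g = J.nf k i j \<and> h = J'.nf (t * k) i j)" for g
  have f: "f (J.nf k i j) = J'.nf (t * k) i j" if ij: "?q dvd i" "?q dvd j" for k i j
    unfolding f_def
  proof (rule someI2)
    show "\<exists>k' i' j'. ?q dvd i' \<and> ?q dvd j' \<and> J.nf k i j = J.nf k' i' j' \<and> J'.nf (t * k) i j = J'.nf (t * k') i' j'"
      using ij by blast
    fix h assume "\<exists>k' i' j'. ?q dvd i' \<and> ?q dvd j' \<and> J.nf k i j = J.nf k' i' j' \<and> h = J'.nf (t * k') i' j'"
    then obtain k' i' j' where eq: "J.nf k i j = J.nf k' i' j'" and h: "h = J'.nf (t * k') i' j'" by blast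
    have e: "?q\<^sup>2 dvd k - k'" "?q\<^sup>2 dvd i - i'" "?q ^ 3 dvd (i - i') - (j - j')" using eq unfolding J.nf_eq_iff by blast+
    have "?q\<^sup>2 dvd t * k - t * k'" using dvd_mult[OF e(1), of t] by (simp add: algebra_simps)
    then show "h = J'.nf (t * k) i j" unfolding h using J'.nf_cong[OF _ e(2,3)] by simp
  qed
  have Z4: "upper_central G 4 = {J.nf k i j | k i j. ?q dvd i \<and> ?q dvd j}"
    "upper_central G' 4 = {J'.nf k i j | k i j. ?q dvd i \<and> ?q dvd j}"
    by (rule J.upper_central_4_eq J'.upper_central_4_eq)+
  have img: "f ` upper_central G i = upper_central G' i" if i4: "i \<le> 4" for i
  proof (cases "i = 0")
    case True
    have "f \<one>\<^bsub>G\<^esub> = \<one>\<^bsub>G'\<^esub>" using f[of 0 0 0] by (simp add: J.nf_def J'.nf_def)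
    then show ?thesis by (simp add: True)
  next
    case False
    let ?P = "\<lambda>k i' j. (i < 4 \<longrightarrow> ?q dvd k) \<and> ?q dvd i' \<and> ?q dvd j \<and> (i < 3 \<longrightarrow> ?q\<^sup>2 dvd i' \<and> ?q\<^sup>2 dvd j) \<and> (i < 2 \<longrightarrow> ?q\<^sup>2 dvd k)"
    have Z: "upper_central G i = {J.nf k i' j | k i' j. ?P k i' j}" "upper_central G' i = {J'.nf k i' j | k i' j. ?P k i' j}"
      using J.upper_central_Zset[of i] J'.upper_central_Zset[of i] False i4 by (simp_all add: J.Zset_def J'.Zset_def)
    show ?thesis
    proof
      show "f ` upper_central G i \<subseteq> upper_central G' i"
      proof clarify
        fix g assume "g \<in> upper_central G i"
        then obtain k i' j where g: "g = J.nf k i' j" and P: "?P k i' j" unfolding Z by blast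
        have "f g = J'.nf (t * k) i' j" unfolding g using P by (intro f) blast+
        moreover have "?P (t * k) i' j" using P dvd_mult[of _ k t] by blast
        ultimately show "f g \<in> upper_central G' i" unfolding Z by blast
      qed
      show "upper_central G' i \<subseteq> f ` upper_central G i"
      proof
        fix g assume "g \<in> upper_central G' i"
        then obtain k i' j where g: "g = J'.nf k i' j" and P: "?P k i' j" unfolding Z by blast
        obtain k0 where k0: "?q\<^sup>2 dvd t * k0 - k" using solve by blast
        have "?q dvd t * k0 - k" by (rule dvd_trans[OF J.q_dvd_pow(1) k0])
        have "?P k0 i' j"
        proof (intro conjI impI)
          assume "i < 4"
          then have "?q dvd (t * k0 - k) + k" using P \<open>?q dvd t * k0 - k\<close> by (intro dvd_add) blast+
          then show "?q dvd k0" using dvd_t[of 1] by simp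
        next
          assume "i < 2"
          then have "?q\<^sup>2 dvd (t * k0 - k) + k" using P k0 by (intro dvd_add) blast+
          then show "?q\<^sup>2 dvd k0" using dvd_t[of 2] by simp
        qed (use P in blast)+
        moreover have "f (J.nf k0 i' j) = g"
        proof -
          have "f (J.nf k0 i' j) = J'.nf (t * k0) i' j" using P by (intro f) blast+
          also have "\<dots> = g" unfolding g by (rule J'.nf_cong) (use k0 in simp_all)
          finally show ?thesis .
        qed
        ultimately show "g \<in> f ` upper_central G i" unfolding Z by blast
      qed
    qed
  qed
  have hom: "f (x \<otimes>\<^bsub>G\<^esub> y) = f x \<otimes>\<^bsub>G'\<^esub> f y" if xy: "x \<in> upper_central G 4" "y \<in> upper_central G 4" for x y
  proof -
    obtain k i j where x: "x = J.nf k i j" "?q dvd i" "?q dvd j" using xy(1) unfolding Z4 by blast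
    obtain k' i' j' where y: "y = J.nf k' i' j'" "?q dvd i'" "?q dvd j'" using xy(2) unfolding Z4 by blast
    \<comment> \<open>The value s = 1 serves the A-part and s = - 1 the B-part, on which C acts with
      inverse factors. Agreement modulo q^2 suffices because i and j contribute a further q.\<close>
    have e: "?q\<^sup>2 dvd J.ee (s * k') - J'.ee (s * (t * k'))" for s
    proof -
      have "J.ee (s * k') - J'.ee (s * (t * k')) = ?q\<^sup>2 * (s * k' * - (v * l) + tri (s * k' - 1) * l\<^sup>2 - tri (s * (t * k') - 1) * l'\<^sup>2)
          + s * k' * (?q * (l - t * l') + ?q * (?q * (v * l)))"
        by (simp add: J.ee_def J'.ee_def J.w_def J'.w_def algebra_simps power2_eq_square)
      also have "l - t * l' = - (?q * (v * l))" using tl by simp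
      finally have "J.ee (s * k') - J'.ee (s * (t * k')) = ?q\<^sup>2 * (s * k' * - (v * l) + tri (s * k' - 1) * l\<^sup>2 - tri (s * (t * k') - 1) * l'\<^sup>2)"
        by simp
      then show ?thesis by simp
    qed
    have e3: "?q ^ 3 dvd i0 * J.ee (s * k') - i0 * J'.ee (s * (t * k'))" if "?q dvd i0" for i0 s
      using mult_dvd_mono[OF that e[of s]] by (simp add: power2_eq_square power3_eq_cube algebra_simps)
    have "f (x \<otimes>\<^bsub>G\<^esub> y) = f (J.nf (k + k') (i * J.ee k' + i') (j * J.ee (- k') + j'))"
      unfolding x(1) y(1) by (simp only: J.nf_mult_Z4[OF x(2,3) y(2,3)])
    also have "\<dots> = J'.nf (t * (k + k')) (i * J.ee k' + i') (j * J.ee (- k') + j')"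
      using x y by (intro f dvd_add dvd_mult2)
    also have "\<dots> = J'.nf (t * k + t * k') (i * J'.ee (t * k') + i') (j * J'.ee (- (t * k')) + j')"
    proof (rule J'.nf_cong)
      have 1: "?q ^ 3 dvd i * J.ee k' - i * J'.ee (t * k')" using e3[OF x(2), of 1] by simp
      have 2: "?q ^ 3 dvd j * J.ee (- k') - j * J'.ee (- (t * k'))" using e3[OF x(3), of "- 1"] by simp
      show "?q\<^sup>2 dvd t * (k + k') - (t * k + t * k')" by (simp add: algebra_simps)
      show "?q\<^sup>2 dvd i * J.ee k' + i' - (i * J'.ee (t * k') + i')"
        using dvd_trans[OF J.q_dvd_pow(2) 1] by simp
      show "?q ^ 3 dvd i * J.ee k' + i' - (i * J'.ee (t * k') + i') - (j * J.ee (- k') + j' - (j * J'.ee (- (t * k')) + j'))"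
        using dvd_diff[OF 1 2] by simp
    qed
    also have "\<dots> = f x \<otimes>\<^bsub>G'\<^esub> f y"
      unfolding x(1) y(1) f[OF x(2,3)] f[OF y(2,3)] by (rule J'.nf_mult_Z4[OF x(2,3) y(2,3), symmetric])
    finally show ?thesis .
  qed
  have inj: "inj_on f (upper_central G 4)"
  proof (rule inj_onI)
    fix x y assume xy: "x \<in> upper_central G 4" "y \<in> upper_central G 4" and eq: "f x = f y"
    obtain k i j where x: "x = J.nf k i j" "?q dvd i" "?q dvd j" using xy(1) unfolding Z4 by blast
    obtain k' i' j' where y: "y = J.nf k' i' j'" "?q dvd i'" "?q dvd j'" using xy(2) unfolding Z4 by blast
    have "J'.nf (t * k) i j = J'.nf (t * k') i' j'" using eq unfolding x(1) y(1) f[OF x(2,3)] f[OF y(2,3)] .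
    then have e: "?q\<^sup>2 dvd t * k - t * k'" "?q\<^sup>2 dvd i - i'" "?q ^ 3 dvd (i - i') - (j - j')"
      unfolding J'.nf_eq_iff by blast+
    have "?q\<^sup>2 dvd t * (k - k')" using e(1) by (simp add: algebra_simps)
    then have "?q\<^sup>2 dvd k - k'" using dvd_t by blast
    then show "x = y" unfolding x(1) y(1) by (rule J.nf_cong[OF _ e(2,3)])
  qed
  show thesis
  proof (rule that)
    show "f \<in> iso (G\<lparr>carrier := upper_central G 4\<rparr>) (G'\<lparr>carrier := upper_central G' 4\<rparr>)"
    proof (rule isoI)
      show "f \<in> hom (G\<lparr>carrier := upper_central G 4\<rparr>) (G'\<lparr>carrier := upper_central G' 4\<rparr>)"
        using hom img[of 4] by (intro homI) auto
      show "bij_betw f (carrier (G\<lparr>carrier := upper_central G 4\<rparr>)) (carrier (G'\<lparr>carrier := upper_central G' 4\<rparr>))"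
        using inj img[of 4] by (simp add: bij_betw_def)
    qed
  qed (rule img)
qed

lemma macdonald_isomorphic_series:
  assumes J: "macdonald_J p m l G A B" and J': "macdonald_J p m l' G' A' B'"
  shows "isomorphic_upper_central_series G G'"
    "isomorphic_upper_central_series (G Mod upper_central G 1) (G' Mod upper_central G' 1)"
proof -
  interpret J: macdonald_J p m l G A B by fact
  interpret J': macdonald_J p m l' G' A' B' by fact
  obtain f where f: "f \<in> iso (G\<lparr>carrier := upper_central G 4\<rparr>) (G'\<lparr>carrier := upper_central G' 4\<rparr>)"
    "\<And>i. i \<le> 4 \<Longrightarrow> f ` upper_central G i = upper_central G' i"
    using macdonald_Z4_iso[OF J J'] by blast
  have 4: "(4 :: nat) = Suc 3" and 5: "Suc 4 = (5 :: nat)" by simp_all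
  show "isomorphic_upper_central_series G G'"
    by (rule isomorphic_upper_central_seriesI[OF J.is_group J'.is_group f J.upper_central_4_proper J'.upper_central_4_proper])
      (simp_all add: 5 J.upper_central_5 J'.upper_central_5 macdonald_Z4_quotient_iso[OF J J'])
  have "isomorphic_upper_central_series (G Mod upper_central G (Suc 0)) (G' Mod upper_central G' (Suc 0))"
    by (rule isomorphic_upper_central_series_ModI[OF J.is_group J'.is_group, of f 3])
      (use f J.upper_central_4_proper J'.upper_central_4_proper J.upper_central_5 J'.upper_central_5
        macdonald_Z4_quotient_iso[OF J J'] in \<open>simp_all flip: 4 add: 5\<close>)
  then show "isomorphic_upper_central_series (G Mod upper_central G 1) (G' Mod upper_central G' 1)" by simp
qed

section \<open>Quotients by the first two terms of the upper central series\<close>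

text \<open>Everything derived from the relations alone thereby becomes available in H1 and
  K1.\<close>

lemma macdonald_image:
  assumes M: "macdonald p m l G A B" and H: "group H" and h: "h \<in> hom G H" "h ` carrier G = carrier H"
  shows "macdonald p m l H (h A) (h B)"
    "\<And>k i j. h (macdonald.nf G A B k i j) = macdonald.nf H (h A) (h B) k i j"
proof -
  interpret M: macdonald p m l G A B by fact
  interpret h: group_hom G H h by (simp add: group_hom_def group_hom_axioms_def M.is_group H h(1))
  show M': "macdonald p m l H (h A) (h B)"
  proof unfold_locales
    show "group_conj H (h A) (group_comm H (h A) (h B)) = h A [^]\<^bsub>H\<^esub> (1 + int p ^ m * l)"
      by (rule h.hom_relation[OF M.A_closed M.B_closed M.rel_A])
    show "group_conj H (h B) (group_comm H (h B) (h A)) = h B [^]\<^bsub>H\<^esub> (1 + int p ^ m * l)"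
      by (rule h.hom_relation[OF M.B_closed M.A_closed M.rel_B])
    show "h A [^]\<^bsub>H\<^esub> (p ^ (3 * m)) = \<one>\<^bsub>H\<^esub>" "h B [^]\<^bsub>H\<^esub> (p ^ (3 * m)) = \<one>\<^bsub>H\<^esub>"
      using M.pow_A M.pow_B by (simp_all flip: h.hom_nat_pow)
    show "generate H {h A, h B} = carrier H"
      using h.generate_img[of "{A, B}"] M.gen h(2) by simp
  qed simp_all
  interpret M': macdonald p m l H "h A" "h B" by (rule M')
  fix k i j
  show "h (M.nf k i j) = M'.nf k i j"
    by (simp add: M.nf_def M'.nf_def M.a_def M'.a_def M.b_def M'.b_def M.c_def M'.c_def h.hom_int_pow h.hom_group_comm)
qed

context macdonald
begin

text \<open>Uses the relations only and no faithfulness, so that each quotient can combine it with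
  its own criterion for a normal form to be 1.\<close>

lemma nf_eq_imp_one:
  assumes eq: "nf k i j = nf k' i' j'"
  shows "nf (k - k') (- i' * ee (k - k') + i) (j - j') = \<one>"
proof -
  have "c (- k') \<otimes> nf k i j \<otimes> b (- j') = c (- k') \<otimes> nf k' i' j' \<otimes> b (- j')" using eq by simp
  then have "nf (k - k') i (j - j') = nf 0 i' 0" by (simp add: c_nf nf_b)
  then have "a (- i') \<otimes> nf (k - k') i (j - j') = \<one>" by (simp add: nf_def add)
  moreover have "a (- i') \<otimes> nf (k - k') i (j - j') = (a (- i') \<otimes> c (k - k')) \<otimes> (a i \<otimes> b (j - j'))"
    by (simp add: nf_def m_assoc)
  ultimately show ?thesis unfolding a_c by (simp add: nf_def m_assoc add_assoc)
qed

end

text \<open>The quotients by the first and the second centre both satisfy \<open>A ^ q\<^sup>2 = 1\<close>.\<close>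

locale macdonald_sq = macdonald +
  assumes a_q2: "a (q\<^sup>2) = \<one>"
begin

lemma a_triv: "q\<^sup>2 dvd i \<Longrightarrow> a i = \<one>"
proof -
  assume "q\<^sup>2 dvd i"
  then obtain k where "i = q\<^sup>2 * k" by blast
  then show ?thesis using int_pow_abc(1)[of "q\<^sup>2" k] by (simp add: a_q2)
qed

lemma nf_cong_sq:
  assumes "q\<^sup>2 dvd k - k'" "q\<^sup>2 dvd i - i'" "q\<^sup>2 dvd j - j'"
  shows "nf k i j = nf k' i' j'"
proof -
  have a: "a x = a y" if "q\<^sup>2 dvd x - y" for x y
  proof -
    have "a x = a (x - y) \<otimes> a y" by (simp add: add)
    then show ?thesis by (simp add: a_triv[OF that])
  qed
  have b: "b x = b y" if "q\<^sup>2 dvd x - y" for x y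
  proof -
    have "b x = b (x - y) \<otimes> b y" by (simp add: add)
    moreover have "b (x - y) = \<one>" unfolding b_q2[OF that] by (rule a_triv) (simp only: dvd_minus_iff that)
    ultimately show ?thesis by simp
  qed
  have c: "c k = c k'" by (rule c_cong) (simp add: cong_iff_dvd_diff assms)
  show ?thesis unfolding nf_def a[OF assms(2)] b[OF assms(3)] c ..
qed

text \<open>For q dividing k the factors \<open>ee k\<close> and \<open>ee (- k)\<close> are 1
  modulo q^2, and exponents of A and B now count only modulo q^2.\<close>

lemma c_central_sq: "q dvd k \<Longrightarrow> g \<in> carrier G \<Longrightarrow> c k \<otimes> g = g \<otimes> c k"
proof (rule central_iff)
  assume k: "q dvd k"
  have "q\<^sup>2 dvd ee k - 1" "q\<^sup>2 dvd ee (- k) - 1" using k by (intro q2_dvd_ee; simp)+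
  then have "nf 0 (ee k) 0 = nf 0 1 0" "nf 0 0 (ee (- k)) = nf 0 0 1" by (intro nf_cong_sq; simp)+
  then have "a (ee k) = a 1" "b (ee (- k)) = b 1" by (simp_all add: nf_0)
  then have "a 1 \<otimes> c k = c k \<otimes> a 1" "b 1 \<otimes> c k = c k \<otimes> b 1" using a_c[of 1 k] b_c[of 1 k] by simp_all
  then show "c k \<otimes> A = A \<otimes> c k" "c k \<otimes> B = B \<otimes> c k" by (simp_all add: a_1 b_1)
qed simp_all

text \<open>Under either divisibility C^(n j) is central, so no correction arises apart from its
  exponent.\<close>

lemma nf_a_sq:
  assumes "q dvd j \<or> q dvd n"
  shows "nf k i j \<otimes> a n = nf (k - n * j) (i + n) j"
proof -
  have ba: "b j \<otimes> a n = c (- (n * j)) \<otimes> (a n \<otimes> b j)"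
    using assms
  proof
    assume j: "q dvd j"
    obtain n' where n': "[n = int n'] (mod q ^ 3)" by (rule nat_rep)
    have "nf 0 0 j \<otimes> a (int n') = nf (- (int n' * j)) (int n') j"
    proof (induction n')
      case 0
      show ?case by simp
    next
      case (Suc n')
      have "nf 0 0 j \<otimes> a (int (Suc n')) = nf 0 0 j \<otimes> a (int n') \<otimes> a 1" by (simp add: m_assoc add add.commute)
      also have "\<dots> = nf (- (int n' * j) - j) ((int n' + 1) * ee (- j)) (T j)" unfolding Suc nf_a_1 ..
      also have "\<dots> = nf (- (int (Suc n') * j)) (int (Suc n')) j"
      proof (rule nf_cong_sq)
        have "q\<^sup>2 dvd (int n' + 1) * (ee (- j) - 1)" using j by (intro dvd_mult q2_dvd_ee) simp
        then show "q\<^sup>2 dvd (int n' + 1) * ee (- j) - int (Suc n')" by (simp add: algebra_simps)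
      qed (simp_all add: q2_dvd_T[OF j] algebra_simps)
      finally show ?case .
    qed
    moreover have "nf (- (int n' * j)) (int n') j = nf (- (n * j)) n j"
    proof (rule nf_cong_sq)
      have 1: "q\<^sup>2 dvd n - int n'" by (rule q_dvd_of_q3(2)[OF n'])
      then have "q\<^sup>2 dvd (n - int n') * j" by (rule dvd_mult2)
      then show "q\<^sup>2 dvd - (int n' * j) - - (n * j)" by (simp add: algebra_simps)
      show "q\<^sup>2 dvd int n' - n" using 1 by (simp only: dvd_diff_commute)
    qed simp
    ultimately have "nf 0 0 j \<otimes> a n = nf (- (n * j)) n j" using a_cong[OF n'] by simp
    then show ?thesis by (simp add: nf_0) (simp add: nf_def m_assoc)
  next
    assume n: "q dvd n"
    obtain j' where j': "[j = int j'] (mod q ^ 3)" by (rule nat_rep)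
    have "q\<^sup>2 dvd (int j' * (T n - n)) - w * n * tri (int j' - 1)"
      by (rule dvd_diff[OF dvd_mult[OF q2_dvd_T[OF n]]]) (use n in \<open>auto simp: w_def power2_eq_square\<close>)
    then have "nf 0 (n + int j' * (T n - n) - w * n * tri (int j' - 1)) 0 = nf 0 n 0"
      by (intro nf_cong_sq) (simp_all add: algebra_simps)
    then have "a n \<otimes> b (int j') = b (int j') \<otimes> (c (int j' * n) \<otimes> a n)"
      using a_b_pow[OF n, of j'] by (simp add: nf_0)
    moreover have "c (int j' * n) = c (n * j)"
    proof (rule c_cong)
      have "q\<^sup>2 dvd (j - int j') * n" by (rule dvd_mult2[OF q_dvd_of_q3(2)[OF j']])
      then have "q\<^sup>2 dvd - ((j - int j') * n)" by (simp only: dvd_minus_iff)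
      then show "[int j' * n = n * j] (mod q\<^sup>2)" by (simp add: cong_iff_dvd_diff algebra_simps)
    qed
    ultimately have "a n \<otimes> b j = b j \<otimes> (c (n * j) \<otimes> a n)" using b_cong[OF j'] by simp
    also have "\<dots> = c (n * j) \<otimes> (b j \<otimes> a n)"
      using c_central_sq[of "n * j" "b j"] n by (simp flip: m_assoc)
    finally show ?thesis by (simp add: add_assoc)
  qed
  have "nf k i j \<otimes> a n = c k \<otimes> ((a i \<otimes> c (- (n * j))) \<otimes> (a n \<otimes> b j))"
    by (simp add: nf_def m_assoc ba)
  also have "a i \<otimes> c (- (n * j)) = c (- (n * j)) \<otimes> a i"
    using assms by (intro c_central_sq[symmetric]) auto
  finally show ?thesis by (simp add: nf_def m_assoc add_assoc)
qed

text \<open>Modulo q^2 the factor \<open>ee x\<close> is 1 + w x, linear in x.\<close>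

lemma nf_mult_sq:
  assumes "q dvd j \<or> q dvd i'"
  shows "nf k i j \<otimes> nf k' i' j' = nf (k + k' - i' * j) (i + i' + w * (i * k')) (j + j' - w * (j * k'))"
proof -
  have e: "q\<^sup>2 dvd ee x - (1 + w * x)" for x by (simp add: ee_def w_sq mult.commute)
  have q: "q dvd j * ee (- k') \<or> q dvd i'" using assms by auto
  have "nf k i j \<otimes> nf k' i' j' = (nf k i j \<otimes> c k') \<otimes> a i' \<otimes> b j'" by (simp add: nf_def[of k'] m_assoc)
  also have "\<dots> = nf (k + k' - i' * (j * ee (- k'))) (i * ee k' + i') (j * ee (- k') + j')"
    by (simp add: nf_c nf_a_sq[OF q] nf_b)
  also have "\<dots> = nf (k + k' - i' * j) (i + i' + w * (i * k')) (j + j' - w * (j * k'))"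
  proof (rule nf_cong_sq)
    have "q * q dvd (i' * j) * (ee (- k') - 1)" using assms q_dvd_T(2)[of "- k'"] by (intro mult_dvd_mono) auto
    then have "q\<^sup>2 dvd - ((i' * j) * (ee (- k') - 1))" by (simp only: dvd_minus_iff power2_eq_square)
    then show "q\<^sup>2 dvd k + k' - i' * (j * ee (- k')) - (k + k' - i' * j)" by (simp add: algebra_simps)
    show "q\<^sup>2 dvd i * ee k' + i' - (i + i' + w * (i * k'))"
      using dvd_mult[OF e[of k'], of i] by (simp add: algebra_simps)
    show "q\<^sup>2 dvd j * ee (- k') + j' - (j + j' - w * (j * k'))"
      using dvd_mult[OF e[of "- k'"], of j] by (simp add: algebra_simps)
  qed
  finally show ?thesis .
qed

end

text \<open>The abstract form of H1, where all three exponents count modulo q^2. In the next locale,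
  for K1, the exponent of C counts modulo q.\<close>

locale macdonald_H = macdonald_sq +
  assumes nf_one_H: "nf k i j = \<one> \<Longrightarrow> q\<^sup>2 dvd k \<and> q\<^sup>2 dvd i \<and> q\<^sup>2 dvd j"

locale macdonald_K = macdonald_sq +
  assumes c_q: "c q = \<one>"
    and nf_one_K: "nf k i j = \<one> \<Longrightarrow> q dvd k \<and> q\<^sup>2 dvd i \<and> q\<^sup>2 dvd j"

context macdonald_numbers
begin

text \<open>The sum of the squares below \<open>q\<close>: the case \<open>p = 3\<close>, \<open>m = 1\<close> is exceptional because \<open>p\<close> does not divide it.\<close>

definition S :: int where "S = 2 * tet (q - 1) + tri (q - 1)"

lemma sum_tri: "q dvd tri (q - 1)"
  by (rule q_dvd_tri') simp

lemma six_S: "6 * S = (q - 1) * q * (2 * q - 1)"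
proof -
  have "6 * S = 2 * (6 * tet (q - 1)) + 3 * (2 * tri (q - 1))" by (simp add: S_def)
  then show ?thesis unfolding six_tet two_tri by (simp add: algebra_simps)
qed

text \<open>q divides 6 S, and 6 costs at most one factor 3, which q can spare when p = 3 and m >
  1.\<close>

lemma p_dvd_S: "\<not> (p = 3 \<and> m = 1) \<Longrightarrow> int p dvd S"
proof (cases "p = 3")
  case False
  have "q dvd 2 * (3 * S)" using six_S by simp
  then have "q dvd 3 * S" using coprime_dvd_mult_right_iff[OF coprime_q_2] by blast
  then have "q dvd S" using coprime_dvd_mult_right_iff[OF coprime_q_3[OF False]] by blast
  then show ?thesis using p_dvd_q dvd_trans by blast
next
  case True
  assume "\<not> (p = 3 \<and> m = 1)"
  then have m: "m \<ge> 2" using True m_pos by simp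
  then have "9 dvd q" using True le_imp_power_dvd[of 2 m "3::int"] unfolding q_def by simp
  then obtain z where z: "q = 9 * z" by blast
  have "2 * S = 3 * (z * (q - 1) * (2 * q - 1))" using six_S by (simp add: z)
  then have "3 dvd 2 * S" by simp
  moreover have "coprime (3 :: int) 2" by simp
  ultimately have "3 dvd S" by (simp only: coprime_dvd_mult_right_iff)
  then show ?thesis using True by simp
qed

end

context macdonald_sq
begin

text \<open>For the image of the first generator, whose B-exponent will turn out to be divisible by
  q; the mirrored version serves the second generator.\<close>

lemma nf_pow_right:
  assumes "q dvd y"
  shows "nf k x y [^] n = nf (int n * k - x * y * tri (int n - 1)) (int n * x + w * (x * k * tri (int n - 1))) (int n * y)"
proof (induction n)
  case 0
  show ?case by (simp add: nf_def tri_def)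
next
  case (Suc n)
  define N where "N = int n"
  obtain y' where y': "y = q * y'" using assms by blast
  have t: "tri N = tri (N - 1) + N" using tri_plus1[of "N - 1"] by simp
  have "nf k x y [^] Suc n = nf (N * k - x * y * tri (N - 1)) (N * x + w * (x * k * tri (N - 1))) (N * y) \<otimes> nf k x y"
    using Suc by (simp add: N_def)
  also have "\<dots> = nf (N * k - x * y * tri (N - 1) + k - x * (N * y))
      (N * x + w * (x * k * tri (N - 1)) + x + w * ((N * x + w * (x * k * tri (N - 1))) * k)) (N * y + y - w * (N * y * k))"
    by (rule nf_mult_sq) (use assms in simp)
  also have "\<dots> = nf ((N + 1) * k - x * y * tri N) ((N + 1) * x + w * (x * k * tri N)) ((N + 1) * y)"
  proof (rule nf_cong_sq)
    show "q\<^sup>2 dvd N * k - x * y * tri (N - 1) + k - x * (N * y) - ((N + 1) * k - x * y * tri N)"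
      unfolding t by (simp add: algebra_simps)
    have "N * x + w * (x * k * tri (N - 1)) + x + w * ((N * x + w * (x * k * tri (N - 1))) * k) - ((N + 1) * x + w * (x * k * tri N))
      = q\<^sup>2 * (l\<^sup>2 * (x * k * tri (N - 1)) * k)"
      unfolding t by (simp add: w_def algebra_simps power2_eq_square)
    then show "q\<^sup>2 dvd N * x + w * (x * k * tri (N - 1)) + x + w * ((N * x + w * (x * k * tri (N - 1))) * k) - ((N + 1) * x + w * (x * k * tri N))"
      by simp
    show "q\<^sup>2 dvd N * y + y - w * (N * y * k) - (N + 1) * y" by (simp add: y' w_def algebra_simps power2_eq_square)
  qed
  finally show ?case by (simp add: N_def add.commute)
qed

lemma nf_pow_left:
  assumes "q dvd x"
  shows "nf k x y [^] n = nf (int n * k - x * y * tri (int n - 1)) (int n * x) (int n * y - w * (y * k * tri (int n - 1)))"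
proof (induction n)
  case 0
  show ?case by (simp add: nf_def tri_def)
next
  case (Suc n)
  define N where "N = int n"
  obtain x' where x': "x = q * x'" using assms by blast
  have t: "tri N = tri (N - 1) + N" using tri_plus1[of "N - 1"] by simp
  have "nf k x y [^] Suc n = nf (N * k - x * y * tri (N - 1)) (N * x) (N * y - w * (y * k * tri (N - 1))) \<otimes> nf k x y"
    using Suc by (simp add: N_def)
  also have "\<dots> = nf (N * k - x * y * tri (N - 1) + k - x * (N * y - w * (y * k * tri (N - 1))))
      (N * x + x + w * (N * x * k)) (N * y - w * (y * k * tri (N - 1)) + y - w * ((N * y - w * (y * k * tri (N - 1))) * k))"
    by (rule nf_mult_sq) (use assms in simp)
  also have "\<dots> = nf ((N + 1) * k - x * y * tri N) ((N + 1) * x) ((N + 1) * y - w * (y * k * tri N))"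
  proof (rule nf_cong_sq)
    have "N * k - x * y * tri (N - 1) + k - x * (N * y - w * (y * k * tri (N - 1))) - ((N + 1) * k - x * y * tri N)
       = q\<^sup>2 * (x' * l * (y * k * tri (N - 1)))"
      unfolding t by (simp add: x' w_def algebra_simps power2_eq_square)
    then show "q\<^sup>2 dvd N * k - x * y * tri (N - 1) + k - x * (N * y - w * (y * k * tri (N - 1))) - ((N + 1) * k - x * y * tri N)"
      by simp
    show "q\<^sup>2 dvd N * x + x + w * (N * x * k) - (N + 1) * x" by (simp add: x' w_def algebra_simps power2_eq_square)
    have "N * y - w * (y * k * tri (N - 1)) + y - w * ((N * y - w * (y * k * tri (N - 1))) * k) - ((N + 1) * y - w * (y * k * tri N))
       = q\<^sup>2 * (l\<^sup>2 * (y * k * tri (N - 1) * k))"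
      unfolding t by (simp add: w_def algebra_simps power2_eq_square)
    then show "q\<^sup>2 dvd N * y - w * (y * k * tri (N - 1)) + y - w * ((N * y - w * (y * k * tri (N - 1))) * k) - ((N + 1) * y - w * (y * k * tri N))"
      by simp
  qed
  finally show ?case by (simp add: N_def add.commute)
qed

end

section \<open>Products and powers modulo the second term of the series\<close>

context macdonald_K
begin

lemma c_triv: "q dvd k \<Longrightarrow> c k = \<one>"
proof -
  assume "q dvd k"
  then obtain r where "k = q * r" by blast
  then show ?thesis using int_pow_abc(3)[of q r] by (simp add: c_q)
qed

lemma nf_cong_K:
  assumes "q dvd k - k'" "q\<^sup>2 dvd i - i'" "q\<^sup>2 dvd j - j'"
  shows "nf k i j = nf k' i' j'"
proof -
  have "c k = c (k - k') \<otimes> c k'" by (simp add: add)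
  then have "c k = c k'" by (simp add: c_triv[OF assms(1)])
  then have "nf k i j = nf k' i j" by (simp add: nf_def)
  also have "\<dots> = nf k' i' j'" by (rule nf_cong_sq) (use assms in simp_all)
  finally show ?thesis .
qed

lemma nf_eq_K:
  assumes eq: "nf k i j = nf k' i' j'"
  shows "q dvd k - k' \<and> q\<^sup>2 dvd i - i' \<and> q\<^sup>2 dvd j - j'"
proof -
  from nf_one_K[OF nf_eq_imp_one[OF eq]] have *: "q dvd k - k'" "q\<^sup>2 dvd - i' * ee (k - k') + i" "q\<^sup>2 dvd j - j'" by blast+
  have "q\<^sup>2 dvd (- i' * ee (k - k') + i) + i' * (ee (k - k') - 1)"
    by (rule dvd_add[OF *(2) dvd_mult[OF q2_dvd_ee[OF *(1)]]])
  then show ?thesis using * by (simp add: algebra_simps)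
qed

text \<open>Iterates \<open>nf_a_1\<close> modulo q^2, where T j is just j + w tri j, while the
  exponent of C matters only modulo q.\<close>

lemma nf_a_K: "nf k i j \<otimes> a (int n) =
    nf (k - int n * j) (i + int n - w * (i * int n * j + j * tri (int n))) (j + w * (int n * tri j))"
proof (induction n)
  case 0
  show ?case by simp
next
  case (Suc n)
  define N where "N = int n"
  let ?I = "i + N - w * (i * N * j + j * tri N)" and ?J = "j + w * (N * tri j)"
  have q: "q dvd ?J - j" "q dvd ?I - (i + N)" by (simp_all add: w_def)
  have "nf k i j \<otimes> a (int (Suc n)) = (nf k i j \<otimes> a N) \<otimes> a 1" by (simp add: N_def m_assoc add add.commute)
  also have "\<dots> = nf (k - N * j - ?J) ((?I + 1) * ee (- ?J)) (T ?J)"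
    unfolding N_def Suc nf_a_1 ..
  also have "\<dots> = nf (k - (N + 1) * j) (i + (N + 1) - w * (i * (N + 1) * j + j * tri (N + 1))) (j + w * ((N + 1) * tri j))"
  proof (rule nf_cong_K)
    have "q dvd - (?J - j)" using q(1) by (simp only: dvd_minus_iff)
    then show "q dvd k - N * j - ?J - (k - (N + 1) * j)" by (simp add: algebra_simps)
    have "(?I + 1) * ee (- ?J) - (i + (N + 1) - w * (i * (N + 1) * j + j * tri (N + 1)))
      = w\<^sup>2 * ((i * N * j + j * tri N) * j - (?I + 1) * N * tri j + (?I + 1) * tri ?J)"
      unfolding ee_minus tri_plus1 by (simp add: algebra_simps power2_eq_square)
    then show "q\<^sup>2 dvd (?I + 1) * ee (- ?J) - (i + (N + 1) - w * (i * (N + 1) * j + j * tri (N + 1)))"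
      unfolding w_sq by simp
    have "2 * (T ?J - (j + w * ((N + 1) * tri j))) = w * (2 * (tri (j + w * (N * tri j)) - tri j)) + 2 * w\<^sup>2 * tet ?J"
      unfolding T_def by (simp add: algebra_simps)
    also have "\<dots> = q ^ 2 * (l\<^sup>2 * (N * tri j * (2 * j + 1 + w * (N * tri j)) + 2 * tet ?J))"
      unfolding tri_shift by (simp add: w_def algebra_simps power2_eq_square)
    finally have "q ^ 2 dvd 2 * (T ?J - (j + w * ((N + 1) * tri j)))" by simp
    then show "q\<^sup>2 dvd T ?J - (j + w * ((N + 1) * tri j))" by (rule cancel2)
  qed
  finally show ?case by (simp add: N_def add.commute)
qed

text \<open>In contrast to \<open>nf_mult_sq\<close> no exponent has to be divisible by q: as C^q =
  1, the corrections stay polynomial of first order in w.\<close>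

lemma nf_mult_K: "nf k i j \<otimes> nf k' i' j' =
    nf (k + k' - i' * j) (i + i' + w * (i * k' - i * i' * j - j * tri i')) (j + j' + w * (- (j * k') + i' * tri j))"
proof -
  obtain n where n: "[i' = int n] (mod q ^ 3)" by (rule nat_rep)
  define N where "N = int n"
  obtain d where d: "i' = N + q\<^sup>2 * d" using q_dvd_of_q3(2)[OF n] by (metis N_def diff_add_cancel add.commute dvdE)
  have e: "\<exists>t. ee x = 1 + w * x + q\<^sup>2 * t" for x by (intro exI[of _ "l\<^sup>2 * tri (x - 1)"]) (simp add: ee_def w_sq)
  obtain t where t: "ee k' = 1 + w * k' + q\<^sup>2 * t" using e by blast
  obtain u where u: "ee (- k') = 1 + w * (- k') + q\<^sup>2 * u" using e by blast
  let ?i = "i * ee k'" and ?j = "j * ee (- k')"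
  have "nf k i j \<otimes> nf k' i' j' = (nf k i j \<otimes> c k') \<otimes> a N \<otimes> b j'"
    using a_cong[OF n] by (simp add: nf_def[of k'] m_assoc N_def)
  also have "\<dots> = nf (k + k' - N * ?j) (?i + N - w * (?i * N * ?j + ?j * tri N)) (?j + w * (N * tri ?j) + j')"
    unfolding N_def nf_c nf_a_K nf_b ..
  also have "\<dots> = nf (k + k' - i' * j) (i + i' + w * (i * k' - i * i' * j - j * tri i')) (j + j' + w * (- (j * k') + i' * tri j))"
  proof (rule nf_cong_K)
    have "k + k' - N * ?j - (k + k' - i' * j) = q * (j * (q * d - N * (q * u - l * k')))"
      unfolding u d w_def by (simp add: algebra_simps power2_eq_square)
    then show "q dvd k + k' - N * ?j - (k + k' - i' * j)" by simp
    obtain s0 where s0: "tri (q\<^sup>2 * d) = q * s0" using q_dvd_tri[of "q\<^sup>2 * d"] by (auto simp: power2_eq_square)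
    define s where "s = s0 + N * (q * d)"
    have s: "tri i' = tri N + q * s" unfolding d tri_add s0 s_def by (simp add: algebra_simps power2_eq_square)
    have "?i + N - w * (?i * N * ?j + ?j * tri N) - (i + i' + w * (i * k' - i * i' * j - j * tri i'))
      = q\<^sup>2 * (i * t - d - l * (i * N * j * (l * - k' + q * u + (l * k' + q * t) * (1 + w * (- k') + q\<^sup>2 * u)) + j * (l * - k' + q * u) * tri N)
          + l * (i * j * (q * d)) + l * j * s)"
      unfolding t u s unfolding d w_def by (simp add: algebra_simps power2_eq_square)
    then show "q\<^sup>2 dvd ?i + N - w * (?i * N * ?j + ?j * tri N) - (i + i' + w * (i * k' - i * i' * j - j * tri i'))" by simp
    have j: "?j = j + q * (j * (l * - k' + q * u))" unfolding u w_def by (simp add: algebra_simps power2_eq_square)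
    have "2 * (tri ?j - tri j) = q * (j * (l * - k' + q * u) * (2 * j + 1 + q * (j * (l * - k' + q * u))))"
      unfolding j tri_shift by simp
    then have "q ^ 1 dvd 2 * (tri ?j - tri j)" by simp
    then have "q ^ 1 dvd tri ?j - tri j" by (rule cancel2)
    then have "q dvd tri ?j - tri j" by simp
    then obtain v where "tri ?j - tri j = q * v" by blast
    then have v: "tri ?j = tri j + q * v" by simp
    have "?j + w * (N * tri ?j) + j' - (j + j' + w * (- (j * k') + i' * tri j))
       = q\<^sup>2 * (j * u + l * (N * v) - l * (q * d * tri j))"
      unfolding v unfolding u d w_def by (simp add: algebra_simps power2_eq_square)
    then show "q\<^sup>2 dvd ?j + w * (N * tri ?j) + j' - (j + j' + w * (- (j * k') + i' * tri j))" by simp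
  qed
  finally show ?thesis .
qed

text \<open>V is the sum of \<open>tri (i * y)\<close> over i below n; only its double has a formula
  without division, hence the existential form. The expression
  \<open>2 * tet (int n - 1) + tri (int n - 1)\<close> is the sum of the squares below n.\<close>

lemma nf_pow_K:
  "\<exists>V. 2 * V = y * (y * (2 * tet (int n - 1) + tri (int n - 1)) + tri (int n - 1)) \<and>
    nf k x y [^] n = nf (int n * k - x * y * tri (int n - 1))
     (int n * x + w * (x * k * tri (int n - 1) - x * x * y * (2 * tet (int n - 1) + tri (int n - 1)) - y * tri x * tri (int n - 1)))
     (int n * y + w * (- (y * k * tri (int n - 1)) + x * V))"
proof (induction n)
  case 0
  show ?case by (intro exI[of _ 0]) (simp add: nf_def tri_def tet_def)
next
  case (Suc n)
  define N where "N = int n"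
  define t where "t = tri (N - 1)"
  define s where "s = 2 * tet (N - 1) + t"
  obtain V where V: "2 * V = y * (y * s + t)"
    "nf k x y [^] n = nf (N * k - x * y * t) (N * x + w * (x * k * t - x * x * y * s - y * tri x * t)) (N * y + w * (- (y * k * t) + x * V))"
    using Suc unfolding N_def[symmetric] t_def[symmetric] s_def[symmetric] by blast
  have t': "tri N = t + N" using tri_plus1[of "N - 1"] by (simp add: t_def)
  have s': "2 * tet N + tri N = s + N * N"
    using tet_plus1[of "N - 1"] two_tri[of "N - 1"] by (simp add: s_def t_def t' algebra_simps)
  let ?i = "N * x + w * (x * k * t - x * x * y * s - y * tri x * t)" and ?j = "N * y + w * (- (y * k * t) + x * V)"
  have "nf k x y [^] Suc n = nf (N * k - x * y * t) ?i ?j \<otimes> nf k x y"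
    by (simp add: V(2))
  also have "\<dots> = nf (N * k - x * y * t + k - x * ?j) (?i + x + w * (?i * k - ?i * x * ?j - ?j * tri x)) (?j + y + w * (- (?j * k) + x * tri ?j))"
    by (rule nf_mult_K)
  also have "\<dots> = nf ((N + 1) * k - x * y * (t + N))
      ((N + 1) * x + w * (x * k * (t + N) - x * x * y * (s + N * N) - y * tri x * (t + N)))
      ((N + 1) * y + w * (- (y * k * (t + N)) + x * (V + tri (N * y))))"
  proof (rule nf_cong_K)
    define u where "u = x * k * t - x * x * y * s - y * tri x * t"
    define v where "v = - (y * k * t) + x * V"
    have i: "?i = N * x + w * u" and j: "?j = N * y + w * v" by (simp_all add: u_def v_def)
    have "N * k - x * y * t + k - x * ?j - ((N + 1) * k - x * y * (t + N)) = q * (- x * l * v)"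
      unfolding j by (simp add: w_def algebra_simps)
    then show "q dvd N * k - x * y * t + k - x * ?j - ((N + 1) * k - x * y * (t + N))" by simp
    have tgt': "(N + 1) * x + w * (x * k * (t + N) - x * x * y * (s + N * N) - y * tri x * (t + N))
       = N * x + x + w * (u + x * k * N - x * x * y * (N * N) - y * tri x * N)"
      by (simp add: u_def algebra_simps)
    have "?i + x + w * (?i * k - ?i * x * ?j - ?j * tri x)
       - ((N + 1) * x + w * (x * k * (t + N) - x * x * y * (s + N * N) - y * tri x * (t + N)))
       = w\<^sup>2 * (u * k - u * x * (N * y + w * v) - N * x * x * v - v * tri x)"
      unfolding i j tgt' by (simp add: algebra_simps power2_eq_square)
    then show "q\<^sup>2 dvd ?i + x + w * (?i * k - ?i * x * ?j - ?j * tri x)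
       - ((N + 1) * x + w * (x * k * (t + N) - x * x * y * (s + N * N) - y * tri x * (t + N)))"
      unfolding w_sq by simp
    have tgt: "(N + 1) * y + w * (- (y * k * (t + N)) + x * (V + tri (N * y))) = N * y + y + w * (v - y * k * N + x * tri (N * y))"
      by (simp add: v_def algebra_simps)
    have "2 * (?j + y + w * (- (?j * k) + x * tri ?j) - ((N + 1) * y + w * (- (y * k * (t + N)) + x * (V + tri (N * y)))))
       = w * (- 2 * (w * v * k) + x * (2 * (tri (N * y + w * v) - tri (N * y))))"
      unfolding j tgt by (simp add: algebra_simps)
    also have "2 * (tri (N * y + w * v) - tri (N * y)) = w * v * (2 * (N * y) + 1 + w * v)"
      using two_tri[of "N * y + w * v"] two_tri[of "N * y"] by (simp add: algebra_simps)
    also have "w * (- 2 * (w * v * k) + x * (w * v * (2 * (N * y) + 1 + w * v)))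
       = q ^ 2 * (l\<^sup>2 * (- 2 * v * k + x * v * (2 * (N * y) + 1 + w * v)))"
      by (simp add: w_def algebra_simps power2_eq_square)
    finally have "q ^ 2 dvd 2 * (?j + y + w * (- (?j * k) + x * tri ?j) - ((N + 1) * y + w * (- (y * k * (t + N)) + x * (V + tri (N * y)))))"
      by simp
    then show "q\<^sup>2 dvd ?j + y + w * (- (?j * k) + x * tri ?j) - ((N + 1) * y + w * (- (y * k * (t + N)) + x * (V + tri (N * y))))"
      by (rule cancel2)
  qed
  finally have eq: "nf k x y [^] Suc n = \<dots>" .
  have "2 * (V + tri (N * y)) = y * (y * (s + N * N) + (t + N))"
    using V(1) two_tri[of "N * y"] by (simp add: algebra_simps)
  then show ?case using eq
    by (intro exI[of _ "V + tri (N * y)"]) (simp add: N_def[symmetric] add.commute[of 1 N] t' s'[unfolded t'])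
qed

text \<open>At n = q the C-part vanishes and the explicit terms with \<open>tri (q - 1)\<close> drop
  out modulo q^2; the corrections by \<open>S\<close> and V survive.\<close>

lemma nf_pow_q_K:
  obtains V where "2 * V = y * (y * S + tri (q - 1))"
    "nf k x y [^] (p ^ m) = nf 0 (q * (x - l * (x * x * y * S))) (q * (y + l * (x * V)))"
proof -
  obtain V where V: "2 * V = y * (y * S + tri (q - 1))"
    "nf k x y [^] (p ^ m) = nf (q * k - x * y * tri (q - 1))
     (q * x + w * (x * k * tri (q - 1) - x * x * y * S - y * tri x * tri (q - 1)))
     (q * y + w * (- (y * k * tri (q - 1)) + x * V))"
    using nf_pow_K[where n = "p ^ m" and k = k and x = x and y = y]
    unfolding q_def[symmetric] of_nat_power S_def[symmetric] by blast
  obtain t where t: "tri (q - 1) = q * t" using sum_tri by blast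
  have "nf k x y [^] (p ^ m) = nf 0 (q * (x - l * (x * x * y * S))) (q * (y + l * (x * V)))"
    unfolding V(2)
  proof (rule nf_cong_K)
    show "q dvd q * k - x * y * tri (q - 1) - 0" unfolding t by simp
    have "q * x + w * (x * k * tri (q - 1) - x * x * y * S - y * tri x * tri (q - 1)) - q * (x - l * (x * x * y * S))
       = q\<^sup>2 * (l * (x * k * t - y * tri x * t))"
      unfolding t w_def by (simp add: algebra_simps power2_eq_square)
    then show "q\<^sup>2 dvd q * x + w * (x * k * tri (q - 1) - x * x * y * S - y * tri x * tri (q - 1)) - q * (x - l * (x * x * y * S))"
      by simp
    have "q * y + w * (- (y * k * tri (q - 1)) + x * V) - q * (y + l * (x * V)) = q\<^sup>2 * (- l * y * k * t)"
      unfolding t w_def by (simp add: algebra_simps power2_eq_square)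
    then show "q\<^sup>2 dvd q * y + w * (- (y * k * tri (q - 1)) + x * V) - q * (y + l * (x * V))" by simp
  qed
  with V(1) show thesis by (rule that)
qed

lemma central_pow_K: "nf 0 (q * f) (q * g) [^] (z :: int) = nf 0 (q * (f * z)) (q * (g * z))"
proof -
  have "nf 0 (q * f) (q * g) = a (q * f) \<otimes> b (q * g)" by (simp add: nf_def)
  moreover have "a (q * f) \<otimes> b (q * g) = b (q * g) \<otimes> a (q * f)" by (rule a_b_commute) simp_all
  then have "(a (q * f) \<otimes> b (q * g)) [^] z = a (q * f) [^] z \<otimes> b (q * g) [^] z" by (intro int_pow_mult_distrib) simp_all
  ultimately show ?thesis by (simp add: int_pow_abc nf_def mult.assoc)
qed

end

lemma (in group) conj_eq_iff:
  assumes "x \<in> carrier G" "z \<in> carrier G" "y \<in> carrier G"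
  shows "group_conj G x z = y \<longleftrightarrow> x \<otimes> z = z \<otimes> y"
proof
  assume "group_conj G x z = y"
  then have "z \<otimes> y = z \<otimes> (inv z \<otimes> x \<otimes> z)" by (simp add: group_conj_def)
  also have "\<dots> = x \<otimes> z" using assms by (simp flip: m_assoc)
  finally show "x \<otimes> z = z \<otimes> y" ..
next
  assume "x \<otimes> z = z \<otimes> y"
  then have "group_conj G x z = inv z \<otimes> (z \<otimes> y)" using assms by (simp add: group_conj_def m_assoc)
  then show "group_conj G x z = y" using assms by (simp flip: m_assoc)
qed

lemma (in group) group_comm_inv:
  "x \<in> carrier G \<Longrightarrow> y \<in> carrier G \<Longrightarrow> group_comm G y x = inv (group_comm G x y)"
  by (simp add: group_comm_def inv_mult_group m_assoc)

text \<open>Splitting the power as x times (x^n)^z means that for n = q only q-th powers have to be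
  computed. The second relation is rewritten with the same commutator instead of its
  inverse.\<close>

lemma (in group) pow_relations:
  assumes x: "x \<in> carrier G" and y: "y \<in> carrier G"
    and rel: "group_conj G x (group_comm G x y) = x [^] (1 + int n * z)"
      "group_conj G y (group_comm G y x) = y [^] (1 + int n * z)"
  shows "x \<otimes> group_comm G x y = group_comm G x y \<otimes> (x \<otimes> (x [^] n) [^] z)"
    "group_comm G x y \<otimes> y = y \<otimes> (y [^] n) [^] z \<otimes> group_comm G x y"
proof -
  have pow: "u [^] (1 + int n * z) = u \<otimes> (u [^] n) [^] z" if "u \<in> carrier G" for u
    using that int_pow_pow[OF that, of "int n" z] by (simp add: int_pow_mult int_pow_int)
  show "x \<otimes> group_comm G x y = group_comm G x y \<otimes> (x \<otimes> (x [^] n) [^] z)"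
    using rel(1) x y unfolding pow[OF x] by (subst (asm) conj_eq_iff) simp_all
  let ?c = "group_comm G x y"
  have "y \<otimes> inv ?c = inv ?c \<otimes> (y \<otimes> (y [^] n) [^] z)"
    using rel(2) x y unfolding pow[OF y] group_comm_inv[OF x y] by (subst (asm) conj_eq_iff) simp_all
  then have "?c \<otimes> (y \<otimes> inv ?c) \<otimes> ?c = ?c \<otimes> (inv ?c \<otimes> (y \<otimes> (y [^] n) [^] z)) \<otimes> ?c" by simp
  moreover have "d \<otimes> (u \<otimes> inv d) \<otimes> d = d \<otimes> u" "d \<otimes> (inv d \<otimes> u) \<otimes> d = u \<otimes> d"
    if "d \<in> carrier G" "u \<in> carrier G" for d u
    using that by (simp_all add: m_assoc) (simp flip: m_assoc)
  ultimately show "?c \<otimes> y = y \<otimes> (y [^] n) [^] z \<otimes> ?c" using x y by simp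
qed

section \<open>The defining relations modulo the second term of the series\<close>

context macdonald_K
begin

text \<open>As in the Heisenberg group, the exponent of C in a commutator is the determinant of the
  exponents modulo q.\<close>

lemma comm_K:
  assumes "group_comm G (nf x3 x1 x2) (nf y3 y1 y2) = nf D r s"
  shows "q dvd r" "q dvd s" "q dvd D - (x1 * y2 - x2 * y1)"
proof -
  have "nf y3 y1 y2 \<otimes> nf x3 x1 x2 \<otimes> nf D r s = nf x3 x1 x2 \<otimes> nf y3 y1 y2"
    unfolding assms[symmetric] by (rule mult_group_comm) simp_all
  note eq = nf_eq_K[OF this[unfolded nf_mult_K]]
  let ?i = "y1 + x1 + w * (y1 * x3 - y1 * x1 * y2 - y2 * tri x1)" and ?j = "y2 + x2 + w * (- (y2 * x3) + x1 * tri y2)"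
  have 1: "q dvd y3 + x3 - x1 * y2 + D - r * ?j - (x3 + y3 - y1 * x2)" using eq by blast
  have 2: "q dvd ?i + r + w * (?i * D - ?i * r * ?j - ?j * tri r) - (x1 + y1 + w * (x1 * y3 - x1 * y1 * x2 - x2 * tri y1))"
    using eq dvd_trans[OF q_dvd_pow(1)] by blast
  have 3: "q dvd ?j + s + w * (- (?j * D) + r * tri ?j) - (x2 + y2 + w * (- (x2 * y3) + y1 * tri x2))"
    using eq dvd_trans[OF q_dvd_pow(1)] by blast
  have qw: "q dvd w * z" for z by (simp add: w_def)
  have "q dvd (?i + r + w * (?i * D - ?i * r * ?j - ?j * tri r) - (x1 + y1 + w * (x1 * y3 - x1 * y1 * x2 - x2 * tri y1)))
     - w * ((y1 * x3 - y1 * x1 * y2 - y2 * tri x1) + (?i * D - ?i * r * ?j - ?j * tri r) - (x1 * y3 - x1 * y1 * x2 - x2 * tri y1))"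
    by (rule dvd_diff[OF 2 qw])
  then show r: "q dvd r" by (simp add: algebra_simps)
  have "q dvd (?j + s + w * (- (?j * D) + r * tri ?j) - (x2 + y2 + w * (- (x2 * y3) + y1 * tri x2)))
     - w * ((- (y2 * x3) + x1 * tri y2) + (- (?j * D) + r * tri ?j) - (- (x2 * y3) + y1 * tri x2))"
    by (rule dvd_diff[OF 3 qw])
  then show "q dvd s" by (simp add: algebra_simps)
  have "q dvd (y3 + x3 - x1 * y2 + D - r * ?j - (x3 + y3 - y1 * x2)) + r * ?j" by (rule dvd_add[OF 1 dvd_mult2[OF r]])
  then show "q dvd D - (x1 * y2 - x2 * y1)" by (simp add: algebra_simps)
qed

text \<open>The relations yield three congruences modulo q, the facts \<open>A\<close>,
  \<open>B\<close> and \<open>C\<close>. The first, with x1 a unit and p dividing \<open>S\<close>,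
  gives l D = l' modulo p. Then the cofactor of x2 in the doubled second one is 4 l' modulo p and
  that of y1 in the third is 2 l', both units, so x2 and y1 vanish modulo q.\<close>

lemma relations_K:
  assumes rel: "group_conj G (nf x3 x1 x2) (group_comm G (nf x3 x1 x2) (nf y3 y1 y2)) = nf x3 x1 x2 [^] (1 + int p ^ m * l')"
      "group_conj G (nf y3 y1 y2) (group_comm G (nf y3 y1 y2) (nf x3 x1 x2)) = nf y3 y1 y2 [^] (1 + int p ^ m * l')"
    and D: "group_comm G (nf x3 x1 x2) (nf y3 y1 y2) = nf D r s"
    and x1: "\<not> int p dvd x1" and l': "\<not> int p dvd l'" and S: "int p dvd S"
  shows "q dvd x2" "q dvd y1" "q dvd l * D - l'"
proof -
  note rs = comm_K[OF D]
  note rel' = pow_relations[of "nf x3 x1 x2" "nf y3 y1 y2" "p ^ m" l', unfolded of_nat_power, OF nf_closed nf_closed rel, unfolded D]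
  obtain V where V: "2 * V = x2 * (x2 * S + tri (q - 1))"
    "nf x3 x1 x2 [^] (p ^ m) = nf 0 (q * (x1 - l * (x1 * x1 * x2 * S))) (q * (x2 + l * (x1 * V)))"
    by (rule nf_pow_q_K)
  obtain W where W: "2 * W = y2 * (y2 * S + tri (q - 1))"
    "nf y3 y1 y2 [^] (p ^ m) = nf 0 (q * (y1 - l * (y1 * y1 * y2 * S))) (q * (y2 + l * (y1 * W)))"
    by (rule nf_pow_q_K)
  obtain r' where r': "r = q * r'" using rs(1) by blast
  obtain s' where s': "s = q * s'" using rs(2) by blast
  obtain tr where tr: "tri r = q * tr" using q_dvd_tri[OF rs(1)] by blast
  obtain ts where ts: "tri s = q * ts" using q_dvd_tri[OF rs(2)] by blast
  define f g where "f = (x1 - l * (x1 * x1 * x2 * S)) * l'" and "g = (x2 + l * (x1 * V)) * l'"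
  have "nf x3 x1 x2 \<otimes> nf D r s = nf D r s \<otimes> (nf x3 x1 x2 \<otimes> nf 0 (q * f) (q * g))"
    using rel'(1) unfolding V(2) central_pow_K f_def g_def .
  then have "nf x3 x1 x2 \<otimes> nf D r s = nf D r s \<otimes> nf x3 x1 x2 \<otimes> nf 0 (q * f) (q * g)" by (simp add: m_assoc)
  note eq = nf_eq_K[OF this[unfolded nf_mult_K]]
  let ?i = "r + x1 + w * (r * x3 - r * x1 * s - s * tri x1)" and ?j = "s + x2 + w * (- (s * x3) + x1 * tri s)"
  obtain tf where tf: "tri (q * f) = q * tf" using q_dvd_tri[of "q * f"] by auto
  have 1: "q\<^sup>2 dvd x1 + r + w * (x1 * D - x1 * r * x2 - x2 * tri r) - (?i + q * f + w * (?i * 0 - ?i * (q * f) * ?j - ?j * tri (q * f)))"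
    using eq by blast
  have 2: "q\<^sup>2 dvd x2 + s + w * (- (x2 * D) + r * tri x2) - (?j + q * g + w * (- (?j * 0) + q * f * tri ?j))"
    using eq by blast
  have "x1 + r + w * (x1 * D - x1 * r * x2 - x2 * tri r) - (?i + q * f + w * (?i * 0 - ?i * (q * f) * ?j - ?j * tri (q * f)))
     = q * (l * x1 * D - f) + q\<^sup>2 * (l * (- x1 * r' * x2 - x2 * tr - r' * x3 + r' * x1 * s + s' * tri x1 + ?i * f * ?j + ?j * tf))"
    unfolding tf tr by (simp add: r' s' w_def algebra_simps power2_eq_square)
  then have "q\<^sup>2 dvd q * (l * x1 * D - f)" using 1 by (metis dvd_add_left_iff dvd_triv_left)
  then have A: "q dvd l * x1 * D - f" using q_nz by (simp add: power2_eq_square)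
  have "x2 + s + w * (- (x2 * D) + r * tri x2) - (?j + q * g + w * (- (?j * 0) + q * f * tri ?j))
     = - (q * (l * x2 * D + g)) + q\<^sup>2 * (l * (r' * tri x2 + s' * x3 - x1 * ts - f * tri ?j))"
    unfolding ts by (simp add: r' s' w_def algebra_simps power2_eq_square)
  then have "q\<^sup>2 dvd - (q * (l * x2 * D + g))" using 2 by (metis dvd_add_left_iff dvd_triv_left)
  then have "q\<^sup>2 dvd q * (l * x2 * D + g)" by (simp only: dvd_minus_iff)
  then have B: "q dvd l * x2 * D + g" using q_nz by (simp add: power2_eq_square)
  define f' where "f' = (y1 - l * (y1 * y1 * y2 * S)) * l'"
  define g' where "g' = (y2 + l * (y1 * W)) * l'"
  have "nf D r s \<otimes> nf y3 y1 y2 = nf y3 y1 y2 \<otimes> nf 0 (q * f') (q * g') \<otimes> nf D r s"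
    using rel'(2) unfolding W(2) central_pow_K f'_def g'_def .
  note eq' = nf_eq_K[OF this[unfolded nf_mult_K]]
  let ?k = "y1 + q * f' + w * (y1 * 0 - y1 * (q * f') * y2 - y2 * tri (q * f'))" and ?n = "y2 + q * g' + w * (- (y2 * 0) + q * f' * tri y2)"
  obtain tf' where tf': "tri (q * f') = q * tf'" using q_dvd_tri[of "q * f'"] by auto
  have 3: "q\<^sup>2 dvd r + y1 + w * (r * y3 - r * y1 * s - s * tri y1) - (?k + r + w * (?k * D - ?k * r * ?n - ?n * tri r))"
    using eq' by blast
  have k: "?k = y1 + q * (f' - w * (y1 * f' * y2) - w * (y2 * tf'))" unfolding tf' by (simp add: algebra_simps)
  define kk where "kk = f' - w * (y1 * f' * y2) - w * (y2 * tf')"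
  have "r + y1 + w * (r * y3 - r * y1 * s - s * tri y1) - (?k + r + w * (?k * D - ?k * r * ?n - ?n * tri r))
     = - (q * (l * y1 * D + f')) + q\<^sup>2 * (l * (r' * y3 - r' * y1 * s - s' * tri y1 + y1 * f' * y2 + y2 * tf' - kk * D + ?k * r' * ?n + ?n * tr))"
    unfolding k kk_def[symmetric] tr
    by (simp add: r' s' w_def algebra_simps power2_eq_square) (simp add: kk_def w_def algebra_simps power2_eq_square)
  then have "q\<^sup>2 dvd - (q * (l * y1 * D + f'))" using 3 by (metis dvd_add_left_iff dvd_triv_left)
  then have "q\<^sup>2 dvd q * (l * y1 * D + f')" by (simp only: dvd_minus_iff)
  then have C: "q dvd l * y1 * D + f'" using q_nz by (simp add: power2_eq_square)
  obtain S' where S': "S = int p * S'" using S by blast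
  have cancel: "q dvd x" if "q dvd u * x" "\<not> int p dvd u" for u x
    using coprime_dvd_mult_right_iff[of q u x] coprime_q_iff that by blast
  have A': "q dvd x1 * (l * D - l' + l * l' * x1 * x2 * S)" using A by (simp add: f_def algebra_simps)
  then have A1: "q dvd l * D - l' + l * l' * x1 * x2 * S" using cancel x1 by blast
  have "int p dvd (l * D - l' + l * l' * x1 * x2 * S) - int p * (l * l' * x1 * x2 * S')"
    by (rule dvd_diff[OF dvd_trans[OF p_dvd_q A1] dvd_triv_left])
  then have lD: "int p dvd l * D - l'" by (simp add: S' algebra_simps)
  then obtain e where e: "l * D - l' = int p * e" by blast
  obtain t' where t': "tri (q - 1) = int p * t'" using sum_tri dvd_trans[OF p_dvd_q] by blast
  have np2: "\<not> int p dvd 2" using coprime_q_2 coprime_q_iff by blast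
  have np4: "\<not> int p dvd 4 * l'"
  proof
    assume "int p dvd 4 * l'"
    then have "int p dvd 2 * (2 * l')" by simp
    then show False using np2 l' prime_ip prime_dvd_mult_iff by blast
  qed
  \<comment> \<open>V is known only through 2 V, so the congruence is doubled; since p is odd
    nothing is lost.\<close>
  have "q dvd 2 * (l * x2 * D + g)" using B by (rule dvd_mult)
  also have "2 * (l * x2 * D + g) = (2 * (l * D + l') + l * l' * x1 * (x2 * S + tri (q - 1))) * x2"
  proof -
    have "2 * (l * x2 * D + g) = 2 * l * x2 * D + 2 * x2 * l' + l * x1 * l' * (2 * V)" by (simp add: g_def algebra_simps)
    then show ?thesis unfolding V(1) by (simp add: algebra_simps)
  qed
  finally have B1: "q dvd (2 * (l * D + l') + l * l' * x1 * (x2 * S + tri (q - 1))) * x2" .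
  show x2: "q dvd x2"
  proof (rule cancel[OF B1])
    have eq: "2 * (l * D + l') + l * l' * x1 * (x2 * S + tri (q - 1)) = 4 * l' + int p * (2 * e + l * l' * x1 * (x2 * S' + t'))"
      using e by (simp add: S' t' algebra_simps)
    show "\<not> int p dvd 2 * (l * D + l') + l * l' * x1 * (x2 * S + tri (q - 1))"
      unfolding eq using np4 dvd_add_left_iff[of "int p" "int p * (2 * e + l * l' * x1 * (x2 * S' + t'))" "4 * l'"] by simp
  qed
  have "q dvd (l * D - l' + l * l' * x1 * x2 * S) - (l * l' * x1 * S) * x2"
    by (rule dvd_diff[OF A1 dvd_mult[OF x2]])
  then show "q dvd l * D - l'" by (simp add: algebra_simps)
  have "q dvd (l * D + l' - l * l' * y1 * y2 * S) * y1" using C by (simp add: f'_def algebra_simps)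
  then show "q dvd y1"
  proof (rule cancel)
    have np: "\<not> int p dvd 2 * l'" using np2 l' prime_ip prime_dvd_mult_iff by blast
    have eq: "l * D + l' - l * l' * y1 * y2 * S = 2 * l' + int p * (e - l * l' * y1 * y2 * S')"
      using e by (simp add: S' algebra_simps)
    show "\<not> int p dvd l * D + l' - l * l' * y1 * y2 * S"
      unfolding eq using np dvd_add_left_iff[of "int p" "int p * (e - l * l' * y1 * y2 * S')" "2 * l'"] by simp
  qed
qed

text \<open>The A- and B-parts of the commutator to second order. They enter the C-exponents of the
  relations in H1.\<close>

lemma comm_K':
  assumes D: "group_comm G (nf x3 x1 x2) (nf y3 y1 y2) = nf D r s" and x2: "q dvd x2" and y1: "q dvd y1"
  shows "q\<^sup>2 dvd r - w * (x1 * y3 + y2 * tri x1 - x1 * D)" "q\<^sup>2 dvd s - w * (y2 * x3 - x1 * tri y2 + y2 * D)"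
proof -
  note rs = comm_K[OF D]
  have "nf y3 y1 y2 \<otimes> nf x3 x1 x2 \<otimes> nf D r s = nf x3 x1 x2 \<otimes> nf y3 y1 y2"
    unfolding D[symmetric] by (rule mult_group_comm) simp_all
  note eq = nf_eq_K[OF this[unfolded nf_mult_K]]
  let ?u = "y1 * x3 - y1 * x1 * y2 - y2 * tri x1" and ?v = "- (y2 * x3) + x1 * tri y2"
  let ?i = "y1 + x1 + w * ?u" and ?j = "y2 + x2 + w * ?v"
  have 2: "q\<^sup>2 dvd ?i + r + w * (?i * D - ?i * r * ?j - ?j * tri r) - (x1 + y1 + w * (x1 * y3 - x1 * y1 * x2 - x2 * tri y1))"
    using eq by blast
  have 3: "q\<^sup>2 dvd ?j + s + w * (- (?j * D) + r * tri ?j) - (x2 + y2 + w * (- (x2 * y3) + y1 * tri x2))"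
    using eq by blast
  obtain r' where r': "r = q * r'" using rs(1) by blast
  obtain tr where tr: "tri r = q * tr" using q_dvd_tri[OF rs(1)] by blast
  obtain x' where x': "x2 = q * x'" using x2 by blast
  obtain y' where y': "y1 = q * y'" using y1 by blast
  define T1 where "T1 = l * (y' * x3 - y' * x1 * y2 + (y' + l * ?u) * D - ?i * r' * ?j - ?j * tr + x1 * y1 * x' + x' * tri y1)"
  have "?i + r + w * (?i * D - ?i * r * ?j - ?j * tri r) - (x1 + y1 + w * (x1 * y3 - x1 * y1 * x2 - x2 * tri y1))
     = r - w * (x1 * y3 + y2 * tri x1 - x1 * D) + q\<^sup>2 * T1"
  proof -
    have "w * ?u = q * (l * ?u)" by (simp add: w_def)
    moreover have "?i * D = x1 * D + q * ((y' + l * ?u) * D)" by (simp add: y' w_def algebra_simps)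
    ultimately show ?thesis unfolding tr T1_def by (simp add: r' x' y' w_def algebra_simps power2_eq_square)
  qed
  then show "q\<^sup>2 dvd r - w * (x1 * y3 + y2 * tri x1 - x1 * D)" using 2 by (metis dvd_add_left_iff dvd_triv_left)
  define T2 where "T2 = l * (- (x' + l * ?v) * D + r' * tri ?j + x' * y3 - y' * tri x2)"
  have "?j + s + w * (- (?j * D) + r * tri ?j) - (x2 + y2 + w * (- (x2 * y3) + y1 * tri x2))
     = s - w * (y2 * x3 - x1 * tri y2 + y2 * D) + q\<^sup>2 * T2"
  proof -
    have "?j * D = y2 * D + q * ((x' + l * ?v) * D)" by (simp add: x' w_def algebra_simps)
    then show ?thesis unfolding T2_def by (simp add: r' x' y' w_def algebra_simps power2_eq_square)
  qed
  then show "q\<^sup>2 dvd s - w * (y2 * x3 - x1 * tri y2 + y2 * D)" using 3 by (metis dvd_add_left_iff dvd_triv_left)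
qed

end

context macdonald_sq
begin

lemma nf_int_pow_right: "nf (q * f) (q * g) 0 [^] (z :: int) = nf (q * (f * z)) (q * (g * z)) 0"
proof -
  have "nf (q * f) (q * g) 0 = c (q * f) \<otimes> a (q * g)" by (simp add: nf_def)
  moreover have "c (q * f) \<otimes> a (q * g) = a (q * g) \<otimes> c (q * f)" by (rule c_central_sq) simp_all
  then have "(c (q * f) \<otimes> a (q * g)) [^] z = c (q * f) [^] z \<otimes> a (q * g) [^] z" by (intro int_pow_mult_distrib) simp_all
  ultimately show ?thesis by (simp add: int_pow_abc nf_def mult.assoc)
qed

lemma nf_int_pow_left: "nf (q * f) 0 (q * g) [^] (z :: int) = nf (q * (f * z)) 0 (q * (g * z))"
proof -
  have "nf (q * f) 0 (q * g) = c (q * f) \<otimes> b (q * g)" by (simp add: nf_def)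
  moreover have "c (q * f) \<otimes> b (q * g) = b (q * g) \<otimes> c (q * f)" by (rule c_central_sq) simp_all
  then have "(c (q * f) \<otimes> b (q * g)) [^] z = c (q * f) [^] z \<otimes> b (q * g) [^] z" by (intro int_pow_mult_distrib) simp_all
  ultimately show ?thesis by (simp add: int_pow_abc nf_def mult.assoc)
qed

lemma nf_pow_Z4:
  assumes "q dvd i" "q dvd j"
  shows "nf k i j [^] n = nf (int n * k) (int n * i) (int n * j)"
  unfolding nf_pow_right[OF assms(2)]
proof (rule nf_cong_sq)
  have "q * q dvd i * j" using assms by (rule mult_dvd_mono)
  then have "q\<^sup>2 dvd - (i * j * tri (int n - 1))" by (simp add: power2_eq_square)
  then show "q\<^sup>2 dvd int n * k - i * j * tri (int n - 1) - int n * k" by simp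
  have "q * q dvd w * (i * k * tri (int n - 1))" using assms(1) by (intro mult_dvd_mono) (simp_all add: w_def)
  then show "q\<^sup>2 dvd int n * i + w * (i * k * tri (int n - 1)) - int n * i" by (simp add: power2_eq_square)
qed simp

end

section \<open>The defining relations modulo the centre\<close>

context macdonald_H
begin

lemma nf_eq_H: "nf k i j = nf k' i' j' \<Longrightarrow> q\<^sup>2 dvd k - k'"
  using nf_one_H[OF nf_eq_imp_one] by blast

text \<open>Exponents of C are compared modulo q^2. The two relations give q x3 l' = x1 s and q y3
  l' = y2 r. After inserting r and s, the unknowns x3 and y3 cancel because l x1 y2 = l' modulo q,
  and what remains is y2 = 1 and x1 = 1 modulo q.\<close>

lemma relations_H:
  assumes rel1: "nf x3 x1 x2 \<otimes> nf D r s = nf D r s \<otimes> (nf x3 x1 x2 \<otimes> (nf x3 x1 x2 [^] (p ^ m)) [^] l')"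
    and rel2: "nf D r s \<otimes> nf y3 y1 y2 = nf y3 y1 y2 \<otimes> (nf y3 y1 y2 [^] (p ^ m)) [^] l' \<otimes> nf D r s"
    and dvds: "q dvd x2" "q dvd y1" "q dvd r" "q dvd s" and D: "q dvd D - (x1 * y2 - x2 * y1)" and lD: "q dvd l * D - l'"
    and r: "q\<^sup>2 dvd r - w * (x1 * y3 + y2 * tri x1 - x1 * D)"
    and s: "q\<^sup>2 dvd s - w * (y2 * x3 - x1 * tri y2 + y2 * D)"
    and l': "\<not> int p dvd l'"
  shows "q dvd l' - l"
proof -
  obtain x' y' r' s' where q: "x2 = q * x'" "y1 = q * y'" "r = q * r'" "s = q * s'"
    using dvds by (elim dvdE) blast
  obtain t where t: "tri (q - 1) = q * t" using sum_tri by blast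
  have pm: "int (p ^ m) = q" by (simp add: q_def)
  have X: "nf x3 x1 x2 [^] (p ^ m) = nf (q * x3) (q * x1) 0"
    unfolding nf_pow_right[OF dvds(1)] pm
    by (rule nf_cong_sq) (simp_all add: t q w_def power2_eq_square)
  have Y: "nf y3 y1 y2 [^] (p ^ m) = nf (q * y3) 0 (q * y2)"
    unfolding nf_pow_left[OF dvds(2)] pm
    by (rule nf_cong_sq) (simp_all add: t q w_def power2_eq_square)
  obtain e where e: "l * D - l' = q * e" using lD by blast
  obtain d where d: "D - (x1 * y2 - x2 * y1) = q * d" using D by blast
  define g where "g = x' * y1 - d"
  define h where "h = e + l * g"
  have g: "x1 * y2 = D + q * g" using d by (simp add: g_def q algebra_simps)
  \<comment> \<open>Since x2 and y1 vanish modulo q, the determinant D is x1 y2 there, and l D = l'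
    takes this form.\<close>
  have h: "l * (x1 * y2) = l' + q * h" unfolding g h_def using e by (simp add: algebra_simps)
  have cancel: "q dvd z" if "q dvd u * z" "\<not> int p dvd u" for u z
    using coprime_dvd_mult_right_iff[of q u z] coprime_q_iff that by blast
  have qh: "int p dvd q * h" using p_dvd_q by simp
  have "\<not> int p dvd l * (x1 * y2)" unfolding h using l' dvd_add_left_iff[OF qh, of l'] by simp
  then have ndv: "\<not> int p dvd x1" "\<not> int p dvd y2" by auto

  define u where "u = x1 * l' + w * (x1 * (x3 * l'))"
  have "nf x3 x1 x2 \<otimes> nf D r s = nf (x3 + D - r * x2) (x1 + r + w * (x1 * D)) (x2 + s - w * (x2 * D))"
    by (rule nf_mult_sq) (use dvds in simp)
  moreover have "nf x3 x1 x2 \<otimes> nf (q * (x3 * l')) (q * (x1 * l')) 0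
     = nf (x3 + q * (x3 * l') - q * (x1 * l') * x2) (x1 + q * u) (x2 - w * (x2 * (q * (x3 * l'))))"
    by (subst nf_mult_sq) (use dvds in \<open>simp_all add: u_def algebra_simps\<close>)
  moreover have "nf D r s \<otimes> nf (x3 + q * (x3 * l') - q * (x1 * l') * x2) i j
     = nf (D + (x3 + q * (x3 * l') - q * (x1 * l') * x2) - i * s) (r + i + w * (r * (x3 + q * (x3 * l') - q * (x1 * l') * x2)))
        (s + j - w * (s * (x3 + q * (x3 * l') - q * (x1 * l') * x2)))" for i j
    by (rule nf_mult_sq) (use dvds in simp)
  ultimately have "q\<^sup>2 dvd x3 + D - r * x2 - (D + (x3 + q * (x3 * l') - q * (x1 * l') * x2) - (x1 + q * u) * s)"
    using rel1[unfolded X nf_int_pow_right] nf_eq_H by metis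
  also have "x3 + D - r * x2 - (D + (x3 + q * (x3 * l') - q * (x1 * l') * x2) - (x1 + q * u) * s)
     = (x1 * s - q * (x3 * l')) + q\<^sup>2 * (- r' * x' + x1 * l' * x' + u * s')"
    by (simp add: q algebra_simps power2_eq_square)
  finally have "q\<^sup>2 dvd x1 * s - q * (x3 * l')" by (metis dvd_add_left_iff dvd_triv_left)
  from dvd_diff[OF this dvd_mult[OF s, of x1]]
  have "q\<^sup>2 dvd q * (l * x1 * (y2 * x3 - x1 * tri y2 + y2 * D) - x3 * l')" by (simp add: w_def algebra_simps)
  then have "q dvd l * x1 * (y2 * x3 - x1 * tri y2 + y2 * D) - x3 * l'" using q_nz by (simp add: power2_eq_square)
  then have "q dvd 2 * (l * x1 * (y2 * x3 - x1 * tri y2 + y2 * D) - x3 * l')" by (rule dvd_mult)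
  also have "2 * (l * x1 * (y2 * x3 - x1 * tri y2 + y2 * D) - x3 * l')
     = 2 * x3 * (l * (x1 * y2)) - x1 * (l * x1 * (2 * tri y2)) + 2 * (l * (x1 * y2)) * D - 2 * x3 * l'"
    by (simp add: algebra_simps)
  also have "\<dots> = 2 * x3 * (l * (x1 * y2)) - x1 * (l * (x1 * y2)) * (y2 + 1) + 2 * (l * (x1 * y2)) * D - 2 * x3 * l'"
    unfolding two_tri by (simp add: algebra_simps)
  also have "\<dots> = 2 * l' * D - x1 * l' * (y2 + 1) + q * (2 * x3 * h - x1 * h * (y2 + 1) + 2 * h * D)"
    unfolding h by (simp add: algebra_simps)
  also have "\<dots> = l' * x1 * (y2 - 1) + q * (2 * x3 * h - x1 * h * (y2 + 1) + 2 * h * D - 2 * l' * g)"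
  proof -
    have D': "D = x1 * y2 - q * g" using g by simp
    have "2 * l' * D = 2 * l' * x1 * y2 - q * (2 * l' * g)" by (subst D') (simp add: algebra_simps)
    then show ?thesis by (simp add: algebra_simps)
  qed
  finally have "q dvd l' * x1 * (y2 - 1)" by (metis dvd_add_left_iff dvd_triv_left)
  then have y: "q dvd y2 - 1" using cancel l' ndv(1) by (metis mult.assoc)

  define v where "v = y2 * l' - w * (y2 * (y3 * l'))"
  have "nf D r s \<otimes> nf y3 y1 y2 = nf (D + y3 - y1 * s) (r + y1 + w * (r * y3)) (s + y2 - w * (s * y3))"
    by (rule nf_mult_sq) (use dvds in simp)
  moreover have "nf y3 y1 y2 \<otimes> nf (q * (y3 * l')) 0 (q * (y2 * l'))
     = nf (y3 + q * (y3 * l')) (y1 + w * (y1 * (q * (y3 * l')))) (y2 + q * v)"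
    by (subst nf_mult_sq) (simp_all add: v_def algebra_simps)
  moreover have "nf (y3 + q * (y3 * l')) i j \<otimes> nf D r s
     = nf (y3 + q * (y3 * l') + D - r * j) (i + r + w * (i * D)) (j + s - w * (j * D))" for i j
    by (rule nf_mult_sq) (use dvds in simp)
  ultimately have "q\<^sup>2 dvd D + y3 - y1 * s - (y3 + q * (y3 * l') + D - r * (y2 + q * v))"
    using rel2[unfolded Y nf_int_pow_left] nf_eq_H by metis
  also have "D + y3 - y1 * s - (y3 + q * (y3 * l') + D - r * (y2 + q * v))
     = (r * y2 - q * (y3 * l')) + q\<^sup>2 * (- y' * s' + r' * v)"
    by (simp add: q algebra_simps power2_eq_square)
  finally have "q\<^sup>2 dvd r * y2 - q * (y3 * l')" by (metis dvd_add_left_iff dvd_triv_left)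
  from dvd_diff[OF dvd_mult[OF r, of y2] this]
  have "q\<^sup>2 dvd q * (y3 * l' - l * y2 * (x1 * y3 + y2 * tri x1 - x1 * D))" by (simp add: w_def algebra_simps)
  then have "q dvd y3 * l' - l * y2 * (x1 * y3 + y2 * tri x1 - x1 * D)" using q_nz by (simp add: power2_eq_square)
  then have "q dvd 2 * (y3 * l' - l * y2 * (x1 * y3 + y2 * tri x1 - x1 * D))" by (rule dvd_mult)
  also have "2 * (y3 * l' - l * y2 * (x1 * y3 + y2 * tri x1 - x1 * D))
     = 2 * y3 * l' - 2 * y3 * (l * (x1 * y2)) - y2 * (l * y2 * (2 * tri x1)) + 2 * (l * (x1 * y2)) * D"
    by (simp add: algebra_simps)
  also have "\<dots> = 2 * y3 * l' - 2 * y3 * (l * (x1 * y2)) - y2 * (l * (x1 * y2)) * (x1 + 1) + 2 * (l * (x1 * y2)) * D"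
    unfolding two_tri by (simp add: algebra_simps)
  also have "\<dots> = 2 * l' * D - y2 * l' * (x1 + 1) + q * (- 2 * y3 * h - y2 * h * (x1 + 1) + 2 * h * D)"
    unfolding h by (simp add: algebra_simps)
  also have "\<dots> = l' * y2 * (x1 - 1) + q * (- 2 * y3 * h - y2 * h * (x1 + 1) + 2 * h * D - 2 * l' * g)"
  proof -
    have D': "D = x1 * y2 - q * g" using g by simp
    have "2 * l' * D = 2 * l' * x1 * y2 - q * (2 * l' * g)" by (subst D') (simp add: algebra_simps)
    then show ?thesis by (simp add: algebra_simps)
  qed
  finally have "q dvd l' * y2 * (x1 - 1)" by (metis dvd_add_left_iff dvd_triv_left)
  then have x: "q dvd x1 - 1" using cancel l' ndv(2) by (metis mult.assoc)

  \<comment> \<open>With x1 = y2 = 1 modulo q, the equation \<open>h\<close> reduces to l = l'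
    modulo q.\<close>
  have "l' - l = l * ((x1 - 1) * y2 + (y2 - 1)) - q * h" using h by (simp add: algebra_simps)
  moreover have "q dvd l * ((x1 - 1) * y2 + (y2 - 1)) - q * h"
    by (rule dvd_diff[OF dvd_mult[OF dvd_add[OF dvd_mult2[OF x] y]] dvd_triv_left])
  ultimately show ?thesis by simp
qed

end

text \<open>To be used with x and y the images of the generators under an isomorphism. What survives
  of bijectivity is \<open>ord\<close>: the commutator of x and y keeps order divisible by q^2,
  which makes the determinant of the exponents prime to p.\<close>

lemma macdonald_H_cong:
  assumes H: "macdonald_H p m l G A B" and K: "macdonald_K p m l G' A' B'"
    and \<pi>: "\<pi> \<in> hom G G'" "\<And>k i j. \<pi> (macdonald.nf G A B k i j) = macdonald.nf G' A' B' k i j"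
    and x: "x \<in> carrier G" and y: "y \<in> carrier G"
    and rel: "group_conj G x (group_comm G x y) = x [^]\<^bsub>G\<^esub> (1 + int p ^ m * l')"
      "group_conj G y (group_comm G y x) = y [^]\<^bsub>G\<^esub> (1 + int p ^ m * l')"
    and ord: "\<And>n. group_comm G x y [^]\<^bsub>G\<^esub> n = \<one>\<^bsub>G\<^esub> \<Longrightarrow> p ^ (2 * m) dvd n"
    and l': "\<not> int p dvd l'" and not_3: "\<not> (p = 3 \<and> m = 1)"
  shows "int p ^ m dvd l' - l"
proof -
  interpret H: macdonald_H p m l G A B by fact
  interpret K: macdonald_K p m l G' A' B' by fact
  interpret \<pi>: group_hom G G' \<pi> by (simp add: group_hom_def group_hom_axioms_def H.is_group K.is_group \<pi>(1))
  have step: "int p ^ m dvd l' - l"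
    if xy: "x \<in> carrier G" "y \<in> carrier G" "x = H.nf x3 x1 x2" "\<not> int p dvd x1"
      and rel: "group_conj G x (group_comm G x y) = x [^]\<^bsub>G\<^esub> (1 + int p ^ m * l')"
      "group_conj G y (group_comm G y x) = y [^]\<^bsub>G\<^esub> (1 + int p ^ m * l')" for x y x3 x1 x2
  proof -
    obtain y3 y1 y2 where y: "y = H.nf y3 y1 y2" using xy(2) by (rule H.nf_surj)
    have "group_comm G x y \<in> carrier G" using xy by simp
    then obtain D r s where D: "group_comm G x y = H.nf D r s" by (rule H.nf_surj)
    have \<pi>x: "\<pi> x = K.nf x3 x1 x2" and \<pi>y: "\<pi> y = K.nf y3 y1 y2" by (simp_all add: xy y \<pi>)
    have DK: "group_comm G' (K.nf x3 x1 x2) (K.nf y3 y1 y2) = K.nf D r s"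
      using \<pi>.hom_group_comm[OF xy(1,2)] by (simp add: D \<pi> flip: \<pi>x \<pi>y)
    have relK: "group_conj G' (\<pi> x) (group_comm G' (\<pi> x) (\<pi> y)) = \<pi> x [^]\<^bsub>G'\<^esub> (1 + int p ^ m * l')"
      "group_conj G' (\<pi> y) (group_comm G' (\<pi> y) (\<pi> x)) = \<pi> y [^]\<^bsub>G'\<^esub> (1 + int p ^ m * l')"
      using \<pi>.hom_relation xy(1,2) rel by blast+
    note dv = K.relations_K[OF relK[unfolded \<pi>x \<pi>y] DK xy(4) l' H.p_dvd_S[OF not_3]]
    note rs = K.comm_K[OF DK] K.comm_K'[OF DK dv(1,2)]
    note pr = H.pow_relations[of x y "p ^ m" l', unfolded of_nat_power, OF xy(1,2) rel, unfolded D]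
    show ?thesis
      using H.relations_H[OF pr[unfolded xy(3) y] dv(1,2) rs(1,2,3) dv(3) rs(4,5) l'] unfolding H.q_def .
  qed
  obtain x3 x1 x2 where xn: "x = H.nf x3 x1 x2" using x by (rule H.nf_surj)
  obtain y3 y1 y2 where yn: "y = H.nf y3 y1 y2" using y by (rule H.nf_surj)
  have "group_comm G x y \<in> carrier G" using x y by simp
  then obtain D r s where D: "group_comm G x y = H.nf D r s" by (rule H.nf_surj)
  have \<pi>x: "\<pi> x = K.nf x3 x1 x2" and \<pi>y: "\<pi> y = K.nf y3 y1 y2" by (simp_all add: xn yn \<pi>)
  have DK: "group_comm G' (K.nf x3 x1 x2) (K.nf y3 y1 y2) = K.nf D r s"
    using \<pi>.hom_group_comm[OF x y] by (simp add: D \<pi> flip: \<pi>x \<pi>y)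
  note rs = K.comm_K[OF DK]
  have "\<not> int p dvd D"
  proof
    assume "int p dvd D"
    \<comment> \<open>This is q^2 / p. If p divided D, the commutator would already be killed by
      it.\<close>
    define n where "n = p ^ (2 * m - 1)"
    have "p * n = p ^ Suc (2 * m - 1)" by (simp add: n_def)
    also have "Suc (2 * m - 1) = 2 * m" using H.m_pos by simp
    finally have pn: "p * n = p ^ (2 * m)" .
    have "int (p * n) = H.q\<^sup>2" unfolding pn H.q_def by (simp add: power_mult[symmetric] mult.commute)
    then have q2: "H.q\<^sup>2 = int n * int p" by (simp add: mult.commute)
    have "H.nf D r s [^]\<^bsub>G\<^esub> n = H.nf (int n * D) (int n * r) (int n * s)"
      by (rule H.nf_pow_Z4[OF rs(1,2)])
    also have "\<dots> = H.nf 0 0 0"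
      unfolding q2[symmetric]
    proof (rule H.nf_cong_sq)
      show "H.q\<^sup>2 dvd int n * D - 0" "H.q\<^sup>2 dvd int n * r - 0" "H.q\<^sup>2 dvd int n * s - 0"
        unfolding q2 using \<open>int p dvd D\<close> dvd_trans[OF H.p_dvd_q rs(1)] dvd_trans[OF H.p_dvd_q rs(2)]
        by (simp_all add: mult_dvd_mono)
    qed
    also have "\<dots> = \<one>\<^bsub>G\<^esub>" by (simp add: H.nf_def)
    finally have "p ^ (2 * m) dvd n" using ord D by simp
    moreover have "n > 0" using H.prime_p by (simp add: n_def prime_gt_0_nat)
    ultimately have "p * n \<le> n" unfolding pn by (rule dvd_imp_le)
    moreover have "p > 1" using H.prime_p by (rule prime_gt_1_nat)
    ultimately show False using \<open>n > 0\<close> by simp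
  qed
  moreover have "int p dvd D - (x1 * y2 - x2 * y1)" using rs(3) H.p_dvd_q dvd_trans by blast
  ultimately have "\<not> int p dvd x1 * y2 - x2 * y1" by (metis diff_add_cancel dvd_add)
  \<comment> \<open>If p divided both x1 and y1, it would divide the determinant. The second case is
    the first with x and y exchanged.\<close>
  then consider "\<not> int p dvd x1" | "\<not> int p dvd y1" by (metis dvd_diff dvd_mult dvd_mult2)
  then show ?thesis
  proof cases
    case 1
    then show ?thesis using step[OF x y xn] rel by blast
  next
    case 2
    then show ?thesis using step[OF y x yn] rel by blast
  qed
qed

section \<open>Passage from J1 to its quotients\<close>

context macdonald_J
begin

lemma macdonald_Mod:
  shows "macdonald p m l (G Mod upper_central G n) (upper_central G n #> A) (upper_central G n #> B)"
    "macdonald.nf (G Mod upper_central G n) (upper_central G n #> A) (upper_central G n #> B) k i j = upper_central G n #> nf k i j"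
proof -
  interpret N: normal "upper_central G n" G by (rule upper_central_normal)
  have h: "(\<lambda>x. upper_central G n #> x) \<in> hom G (G Mod upper_central G n)"
    using N.group_hom_rcos by (simp add: group_hom_def group_hom_axioms_def)
  have im: "(\<lambda>x. upper_central G n #> x) ` carrier G = carrier (G Mod upper_central G n)"
    by (simp add: carrier_FactGroup)
  note image = macdonald_image[OF macdonald_axioms N.factorgroup_is_group h im]
  show "macdonald p m l (G Mod upper_central G n) (upper_central G n #> A) (upper_central G n #> B)" by (rule image(1))
  show "macdonald.nf (G Mod upper_central G n) (upper_central G n #> A) (upper_central G n #> B) k i j = upper_central G n #> nf k i j"
    by (rule image(2)[symmetric])
qed

lemma nf_Mod_eq_one_iff:
  "macdonald.nf (G Mod upper_central G n) (upper_central G n #> A) (upper_central G n #> B) k i j = \<one>\<^bsub>G Mod upper_central G n\<^esub>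
    \<longleftrightarrow> nf k i j \<in> upper_central G n"
proof -
  interpret N: normal "upper_central G n" G by (rule upper_central_normal)
  show ?thesis unfolding macdonald_Mod(2) by (simp add: N.rcos_eq_self_iff)
qed

lemma macdonald_sq_Mod:
  assumes "n \<ge> 1"
  shows "macdonald_sq p m l (G Mod upper_central G n) (upper_central G n #> A) (upper_central G n #> B)"
proof -
  interpret M: macdonald p m l "G Mod upper_central G n" "upper_central G n #> A" "upper_central G n #> B"
    by (rule macdonald_Mod)
  show ?thesis
  proof unfold_locales
    have "nf 0 (q\<^sup>2) 0 \<in> upper_central G n" using Z_mono[OF a_in_Z1[of "q\<^sup>2"] assms] by (simp add: nf_0)
    then have "M.nf 0 (q\<^sup>2) 0 = \<one>\<^bsub>G Mod upper_central G n\<^esub>" by (simp only: nf_Mod_eq_one_iff)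
    then show "M.a (q\<^sup>2) = \<one>\<^bsub>G Mod upper_central G n\<^esub>" by (simp add: M.nf_def del: one_FactGroup mult_FactGroup)
  qed
qed

lemma macdonald_H_Mod:
  "macdonald_H p m l (G Mod upper_central G 1) (upper_central G 1 #> A) (upper_central G 1 #> B)"
proof -
  interpret M: macdonald_sq p m l "G Mod upper_central G 1" "upper_central G 1 #> A" "upper_central G 1 #> B"
    by (rule macdonald_sq_Mod) simp
  show ?thesis
    by unfold_locales (use nf_Mod_eq_one_iff upper_central_1 in blast)
qed

lemma macdonald_K_Mod:
  "macdonald_K p m l (G Mod upper_central G 2) (upper_central G 2 #> A) (upper_central G 2 #> B)"
proof -
  interpret M: macdonald_sq p m l "G Mod upper_central G 2" "upper_central G 2 #> A" "upper_central G 2 #> B"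
    by (rule macdonald_sq_Mod) simp
  show ?thesis
  proof unfold_locales
    have "nf q 0 0 \<in> upper_central G 2" using c_in_Z2[of q] by (simp add: nf_0)
    then have "M.nf q 0 0 = \<one>\<^bsub>G Mod upper_central G 2\<^esub>" by (simp only: nf_Mod_eq_one_iff)
    then show "M.c q = \<one>\<^bsub>G Mod upper_central G 2\<^esub>" by (simp add: M.nf_def del: one_FactGroup mult_FactGroup)
  qed (use nf_Mod_eq_one_iff upper_central_2 in blast)
qed

text \<open>Carries normal forms of H1 to those of K1, so that one set of exponents serves both
  readings of the relations.\<close>

lemma hom_Mod_1_Mod_2:
  obtains \<pi> where "\<pi> \<in> hom (G Mod upper_central G 1) (G Mod upper_central G 2)"
    "\<And>x. x \<in> carrier G \<Longrightarrow> \<pi> (upper_central G 1 #> x) = upper_central G 2 #> x"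
proof -
  interpret N: normal "upper_central G 2" G by (rule upper_central_normal)
  interpret r: group_hom G "G Mod upper_central G 2" "\<lambda>x. upper_central G 2 #> x" by (rule N.group_hom_rcos)
  have "upper_central G 1 \<subseteq> kernel G (G Mod upper_central G 2) (\<lambda>x. upper_central G 2 #> x)"
  proof
    fix x assume x: "x \<in> upper_central G 1"
    then have "x \<in> upper_central G 2" "x \<in> carrier G" using Z_mono[OF x, of 2] upper_central_closed by auto
    then show "x \<in> kernel G (G Mod upper_central G 2) (\<lambda>x. upper_central G 2 #> x)"
      by (simp add: kernel_def N.rcos_eq_self_iff)
  qed
  then show thesis
    by (rule r.FactGroup_universal_kernel[OF upper_central_normal]) (rule that)
qed

end

lemma H1_cong_of_iso:
  assumes N: "macdonald_numbers p m l" and N': "macdonald_numbers p m l'" and not_3: "\<not> (p = 3 \<and> m = 1)"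
    and iso: "H1 p m (1 + int p ^ m * l') \<cong> H1 p m (1 + int p ^ m * l)"
  shows "int p ^ m dvd l' - l"
proof -
  let ?J = "J1 p m (1 + int p ^ m * l)" and ?J' = "J1 p m (1 + int p ^ m * l')"
  let ?H = "?J Mod upper_central ?J 1" and ?H' = "?J' Mod upper_central ?J' 1"
  interpret J: macdonald_J p m l ?J "J1_gen p m (1 + int p ^ m * l) GenX" "J1_gen p m (1 + int p ^ m * l) GenY"
    by (rule macdonald_numbers.J1_macdonald_J[OF N])
  interpret J': macdonald_J p m l' ?J' "J1_gen p m (1 + int p ^ m * l') GenX" "J1_gen p m (1 + int p ^ m * l') GenY"
    by (rule macdonald_numbers.J1_macdonald_J[OF N'])
  define A' where "A' = upper_central ?J' 1 #>\<^bsub>?J'\<^esub> J1_gen p m (1 + int p ^ m * l') GenX"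
  define B' where "B' = upper_central ?J' 1 #>\<^bsub>?J'\<^esub> J1_gen p m (1 + int p ^ m * l') GenY"
  interpret H': macdonald_H p m l' ?H' A' B' unfolding A'_def B'_def by (rule J'.macdonald_H_Mod)
  note H = J.macdonald_H_Mod
  interpret H: group ?H using H unfolding macdonald_H_def macdonald_sq_def macdonald_def by blast
  obtain \<phi> where \<phi>: "\<phi> \<in> iso ?H' ?H" using iso unfolding H1_def by (auto simp: is_iso_def)
  interpret \<phi>: group_hom ?H' ?H \<phi>
    using \<phi> by (simp add: group_hom_def group_hom_axioms_def iso_def H'.is_group H.is_group del: One_nat_def)
  have inj: "inj_on \<phi> (carrier ?H')" using \<phi> by (simp add: iso_def bij_betw_def)
  obtain \<pi> where \<pi>: "\<pi> \<in> hom ?H (?J Mod upper_central ?J 2)"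
    "\<And>x. x \<in> carrier ?J \<Longrightarrow> \<pi> (upper_central ?J 1 #>\<^bsub>?J\<^esub> x) = upper_central ?J 2 #>\<^bsub>?J\<^esub> x"
    using J.hom_Mod_1_Mod_2 by blast
  show ?thesis
  proof (rule macdonald_H_cong[OF H J.macdonald_K_Mod \<pi>(1), where x = "\<phi> A'" and y = "\<phi> B'"])
    show "\<pi> (macdonald.nf ?H (upper_central ?J 1 #>\<^bsub>?J\<^esub> J1_gen p m (1 + int p ^ m * l) GenX)
        (upper_central ?J 1 #>\<^bsub>?J\<^esub> J1_gen p m (1 + int p ^ m * l) GenY) k i j)
      = macdonald.nf (?J Mod upper_central ?J 2) (upper_central ?J 2 #>\<^bsub>?J\<^esub> J1_gen p m (1 + int p ^ m * l) GenX)
        (upper_central ?J 2 #>\<^bsub>?J\<^esub> J1_gen p m (1 + int p ^ m * l) GenY) k i j" for k i j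
      unfolding J.macdonald_Mod(2) by (rule \<pi>(2)) (rule J.nf_closed)
    show "\<phi> A' \<in> carrier ?H" "\<phi> B' \<in> carrier ?H" by (rule \<phi>.hom_closed, rule H'.A_closed H'.B_closed)+
    show "group_conj ?H (\<phi> A') (group_comm ?H (\<phi> A') (\<phi> B')) = \<phi> A' [^]\<^bsub>?H\<^esub> (1 + int p ^ m * l')"
      by (rule \<phi>.hom_relation[OF H'.A_closed H'.B_closed H'.rel_A])
    show "group_conj ?H (\<phi> B') (group_comm ?H (\<phi> B') (\<phi> A')) = \<phi> B' [^]\<^bsub>?H\<^esub> (1 + int p ^ m * l')"
      by (rule \<phi>.hom_relation[OF H'.B_closed H'.A_closed H'.rel_B])
    have comm: "group_comm ?H' A' B' \<in> carrier ?H'" by (rule H'.group_comm_closed[OF H'.A_closed H'.B_closed])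
    \<comment> \<open>The order of the commutator is known in the source, where normal forms are
      faithful, and is transported by injectivity.\<close>
    fix n :: nat assume "group_comm ?H (\<phi> A') (\<phi> B') [^]\<^bsub>?H\<^esub> n = \<one>\<^bsub>?H\<^esub>"
    then have "\<phi> (group_comm ?H' A' B' [^]\<^bsub>?H'\<^esub> n) = \<phi> \<one>\<^bsub>?H'\<^esub>"
      unfolding \<phi>.hom_one \<phi>.hom_nat_pow[OF comm] \<phi>.hom_group_comm[OF H'.A_closed H'.B_closed] .
    then have "group_comm ?H' A' B' [^]\<^bsub>?H'\<^esub> n = \<one>\<^bsub>?H'\<^esub>"
      by (rule inj_onD[OF inj _ H'.nat_pow_closed[OF comm] H'.one_closed])
    then have "H'.c (int n) = \<one>\<^bsub>?H'\<^esub>" by (simp only: H'.c_def int_pow_int)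
    then have "H'.nf (int n) 0 0 = \<one>\<^bsub>?H'\<^esub>" by (simp only: H'.nf_0)
    then have "J'.q\<^sup>2 dvd int n" using H'.nf_one_H by blast
    then have "int (p ^ (2 * m)) dvd int n" by (simp add: J'.q_def power_mult[symmetric] mult.commute)
    then show "p ^ (2 * m) dvd n" by (simp only: int_dvd_int_iff)
  qed (use macdonald_numbers.not_dvd_l[OF N'] not_3 in blast)+
qed

section \<open>Independence of K1 from the parameter\<close>

context macdonald_K
begin

text \<open>The commutator of A^t and B is C^t up to a power of A^q. Conjugation by it raises A^t to
  the exponent 1 + w t, and w t = q l' modulo q^2 makes this the exponent wanted.\<close>

lemma K_relations:
  assumes t: "q dvd l * t - l'"
  defines "C' \<equiv> nf t (w * (tri t - t * t)) 0"
  shows "group_comm G (a t) (b 1) = C'"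
    "group_conj G (a t) (group_comm G (a t) (b 1)) = a t [^] (1 + int p ^ m * l')"
    "group_conj G (b 1) (group_comm G (b 1) (a t)) = b 1 [^] (1 + int p ^ m * l')"
proof -
  define R where "R = w * (tri t - t * t)"
  have R: "R = q * (l * (tri t - t * t))" by (simp add: R_def w_def)
  obtain tr where tr: "tri R = q * tr" using q_dvd_tri[of R] unfolding R by auto
  obtain e where e: "l' = l * t - q * e" using t by (metis dvdE diff_diff_eq2 add_diff_cancel_left')
  have C: "C' = nf t R 0" by (simp add: C'_def R_def)
  have cl: "C' \<in> carrier G" by (simp add: C)
  show comm: "group_comm G (a t) (b 1) = C'"
  proof (rule group_comm_eqI)
    have "b 1 \<otimes> a t = nf 0 0 1 \<otimes> nf 0 t 0" by (simp add: nf_0)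
    also have "\<dots> = nf (- t) (t - w * tri t) (1 + w * t)" unfolding nf_mult_K by simp
    finally have "b 1 \<otimes> a t \<otimes> C' = nf (- t) (t - w * tri t) (1 + w * t) \<otimes> nf t R 0" by (simp add: C)
    also have "\<dots> = nf 0 t 1"
      unfolding nf_mult_K
    proof (rule nf_cong_K)
      show "q dvd - t + t - R * (1 + w * t) - 0" by (simp add: R)
      have "t - w * tri t + R + w * ((t - w * tri t) * t - (t - w * tri t) * R * (1 + w * t) - (1 + w * t) * tri R) - t
        = q\<^sup>2 * (- l * l * tri t * t - l * ((t - w * tri t) * (l * (tri t - t * t)) * (1 + w * t)) - l * (1 + w * t) * tr)"
        unfolding tr unfolding R by (simp add: w_def algebra_simps power2_eq_square)
      then show "q\<^sup>2 dvd t - w * tri t + R + w * ((t - w * tri t) * t - (t - w * tri t) * R * (1 + w * t) - (1 + w * t) * tri R) - t"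
        by simp
      have "1 + w * t + 0 + w * (- ((1 + w * t) * t) + R * tri (1 + w * t)) - 1
         = q\<^sup>2 * (l * (- l * t * t + l * (tri t - t * t) * tri (1 + w * t)))"
        unfolding R by (simp add: w_def algebra_simps power2_eq_square)
      then show "q\<^sup>2 dvd 1 + w * t + 0 + w * (- ((1 + w * t) * t) + R * tri (1 + w * t)) - 1" by simp
    qed
    also have "\<dots> = a t \<otimes> b 1" by (simp add: nf_def)
    finally show "a t \<otimes> b 1 = b 1 \<otimes> a t \<otimes> C'" ..
  qed (simp_all add: cl)
  have pq: "int p ^ m = q" by (simp add: q_def)
  have "a t \<otimes> C' = C' \<otimes> a (t * (1 + q * l'))"
  proof -
    have "a t \<otimes> C' = nf 0 t 0 \<otimes> nf t R 0" by (simp add: nf_0 C)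
    also have "\<dots> = nf t (t + R + w * (t * t)) 0" unfolding nf_mult_K by simp
    also have "\<dots> = nf t (R + t * (1 + q * l')) 0"
      by (rule nf_cong_K) (simp_all add: e w_def algebra_simps power2_eq_square)
    also have "\<dots> = nf t R 0 \<otimes> nf 0 (t * (1 + q * l')) 0" unfolding nf_mult_K by simp
    finally show ?thesis by (simp add: nf_0 C)
  qed
  then show "group_conj G (a t) (group_comm G (a t) (b 1)) = a t [^] (1 + int p ^ m * l')"
    unfolding comm pq by (subst conj_eq_iff) (simp_all add: cl int_pow_abc)
  have "C' \<otimes> b 1 = b (1 + q * l') \<otimes> C'"
  proof -
    let ?j = "1 + q * l'"
    have "b ?j \<otimes> C' = nf 0 0 ?j \<otimes> nf t R 0" by (simp add: nf_0 C)
    also have "\<dots> = nf t R 1"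
      unfolding nf_mult_K
    proof (rule nf_cong_K)
      show "q dvd 0 + t - R * ?j - t" by (simp add: R)
      have "0 + R + w * (0 * t - 0 * R * ?j - ?j * tri R) - R = q\<^sup>2 * (- l * ?j * tr)"
        unfolding tr by (simp add: w_def algebra_simps power2_eq_square)
      then show "q\<^sup>2 dvd 0 + R + w * (0 * t - 0 * R * ?j - ?j * tri R) - R" by (metis dvd_triv_left)
      have "?j + 0 + w * (- (?j * t) + R * tri ?j) - 1 = q\<^sup>2 * (- e + l * (- l' * t + l * (tri t - t * t) * tri ?j))"
        unfolding R by (simp add: w_def algebra_simps power2_eq_square) (simp add: e algebra_simps)
      then show "q\<^sup>2 dvd ?j + 0 + w * (- (?j * t) + R * tri ?j) - 1" by simp
    qed
    also have "\<dots> = C' \<otimes> b 1" by (simp add: C nf_b)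
    finally show ?thesis ..
  qed
  then have "C' \<otimes> b 1 \<otimes> inv C' = b (1 + q * l')" using cl by (simp add: m_assoc)
  then show "group_conj G (b 1) (group_comm G (b 1) (a t)) = b 1 [^] (1 + int p ^ m * l')"
    unfolding pq using cl by (simp add: group_conj_def group_comm_inv[of "a t" "b 1"] comm int_pow_abc)
qed

text \<open>t is invertible modulo q^2, and A^(q^2) = 1 in this quotient.\<close>

lemma K_generate:
  assumes "\<not> int p dvd t"
  shows "generate G {a t, b 1} = carrier G"
proof
  show "generate G {a t, b 1} \<subseteq> carrier G" by (rule generate_incl) simp
  have "coprime q t" using assms coprime_q_iff by blast
  then have "coprime t (q\<^sup>2)" by (simp add: coprime_commute)
  then obtain u where u: "[t * u = 1] (mod q\<^sup>2)" using coprime_iff_invertible_int by blast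
  then have "nf 0 (t * u) 0 = nf 0 1 0" by (intro nf_cong_sq) (simp_all add: cong_iff_dvd_diff)
  then have "a t [^] u = A" by (simp add: nf_0 int_pow_abc a_1)
  have S: "subgroup (generate G {a t, b 1}) G" by (rule generate_is_subgroup) simp
  have at: "a t \<in> generate G {a t, b 1}" and B: "B \<in> generate G {a t, b 1}"
    using generate.incl[of "a t" "{a t, b 1}" G] generate.incl[of "b 1" "{a t, b 1}" G] by (simp_all add: b_1)
  with \<open>a t [^] u = A\<close> have "A \<in> generate G {a t, b 1}" using subgroup_int_pow_closed[OF S at, of u] by simp
  with B have "{A, B} \<subseteq> generate G {a t, b 1}" by simp
  then have "generate G {A, B} \<subseteq> generate G {a t, b 1}" using S by (rule generate_subgroup_incl)
  then show "carrier G \<subseteq> generate G {a t, b 1}" by (simp add: gen)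
qed

lemma surj_hom_Mod_2:
  assumes N': "macdonald_numbers p m l'"
  obtains g where "g \<in> hom (J1 p m (1 + int p ^ m * l') Mod upper_central (J1 p m (1 + int p ^ m * l')) 2) G"
    "g ` carrier (J1 p m (1 + int p ^ m * l') Mod upper_central (J1 p m (1 + int p ^ m * l')) 2) = carrier G"
proof -
  let ?J = "J1 p m (1 + int p ^ m * l')"
  let ?X = "J1_gen p m (1 + int p ^ m * l') GenX" and ?Y = "J1_gen p m (1 + int p ^ m * l') GenY"
  interpret J: macdonald_J p m l' ?J ?X ?Y by (rule macdonald_numbers.J1_macdonald_J[OF N'])
  have "coprime l q" using coprime_q_l by (simp add: coprime_commute)
  then obtain u where u: "[l * u = 1] (mod q)" using coprime_iff_invertible_int by blast
  define t where "t = u * l'"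
  have "q dvd (l * u - 1) * l'" using u by (intro dvd_mult2) (simp only: cong_iff_dvd_diff)
  then have t: "q dvd l * t - l'" by (simp add: t_def algebra_simps)
  have nt: "\<not> int p dvd t"
  proof
    assume "int p dvd t"
    then have "int p dvd l * t" by simp
    from dvd_diff[OF this dvd_trans[OF p_dvd_q t]]
    show False using J.not_dvd_l by simp
  qed
  note rel = K_relations[OF t]
  have pow: "a t [^] (p ^ (3 * m)) = \<one>" "b 1 [^] (p ^ (3 * m)) = \<one>"
  proof -
    have "nf 0 (t * q ^ 3) 0 = nf 0 0 0" "nf 0 0 (q ^ 3) = nf 0 0 0" by (rule nf_cong_sq; simp add: q3_eq)+
    then have "a (t * q ^ 3) = \<one>" "b (q ^ 3) = \<one>" by (simp_all add: nf_0)
    then show "a t [^] (p ^ (3 * m)) = \<one>" "b 1 [^] (p ^ (3 * m)) = \<one>"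
      by (simp_all add: int_pow_abc pow_q flip: int_pow_int)
  qed
  obtain g where g: "g \<in> hom ?J G" "g ?X = a t" "g ?Y = b 1"
    by (rule J1_universal[OF is_group closed(1,2) rel(2,3) pow])
  interpret g: group_hom ?J G g by (simp add: group_hom_def group_hom_axioms_def g(1) is_group J.is_group)
  have surj: "g ` carrier ?J = carrier G"
    using g.generate_img[of "{?X, ?Y}"] by (simp add: J.gen g(2,3) K_generate[OF nt])
  \<comment> \<open>The second term consists of the elements C^k A^s with q dividing k and q^2
    dividing s. They are killed because the image of C satisfies C^q = 1 and that of A has order
    dividing q^2.\<close>
  have "upper_central ?J 2 \<subseteq> kernel ?J G g"
  proof
    fix z assume z: "z \<in> upper_central ?J 2"
    obtain k s where ks: "q dvd k" "q\<^sup>2 dvd s" "z = J.nf k s 0" by (rule J.upper_central_2_form[OF z]) blast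
    obtain k' where k': "k = q * k'" using ks(1) by blast
    let ?C = "nf t (w * (tri t - t * t)) 0"
    have "?C [^] (p ^ m) = nf (q * t) (q * (w * (tri t - t * t))) 0"
      by (subst nf_pow_Z4) (simp_all add: w_def q_def)
    also have "\<dots> = nf 0 0 0" by (rule nf_cong_K) (simp_all add: w_def power2_eq_square)
    finally have C: "?C [^] q = \<one>" by (simp add: nf_0 q_def flip: int_pow_int of_nat_power)
    have "g (J.c k) = ?C [^] (q * k')"
      by (simp add: J.c_def g.hom_int_pow g.hom_group_comm g(2,3) rel(1) k')
    also have "\<dots> = \<one>" using C by (simp flip: int_pow_pow)
    finally have c: "g (J.c k) = \<one>" .
    have "g (J.a s) = a (t * s)" by (simp add: J.a_def g.hom_int_pow g(2) int_pow_abc)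
    also have "\<dots> = \<one>" using ks(2) by (intro a_triv dvd_mult)
    finally have "g z = \<one>" using c by (simp add: ks(3) J.nf_def)
    then show "z \<in> kernel ?J G g" using J.upper_central_closed[OF z] by (simp add: kernel_def)
  qed
  then obtain f where f: "f \<in> hom (?J Mod upper_central ?J 2) G" "\<And>x. x \<in> carrier ?J \<Longrightarrow> f (upper_central ?J 2 #>\<^bsub>?J\<^esub> x) = g x"
    by (rule g.FactGroup_universal_kernel[OF J.upper_central_normal]) blast
  have "f ` carrier (?J Mod upper_central ?J 2) = g ` carrier ?J"
    unfolding carrier_FactGroup image_image using f(2) by (intro image_cong) simp_all
  then show thesis using that f(1) surj by simp
qed

end

lemma K1_iso:
  assumes N: "macdonald_numbers p m l" and N': "macdonald_numbers p m l'"
  shows "K1 p m (1 + int p ^ m * l) \<cong> K1 p m (1 + int p ^ m * l')"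
proof -
  let ?J = "J1 p m (1 + int p ^ m * l)" and ?J' = "J1 p m (1 + int p ^ m * l')"
  note J = macdonald_numbers.J1_macdonald_J[OF N] and J' = macdonald_numbers.J1_macdonald_J[OF N']
  have fin: "finite (carrier (?J Mod upper_central ?J 2))" "finite (carrier (?J' Mod upper_central ?J' 2))"
    using macdonald_J.finite_carrier[OF J] macdonald_J.finite_carrier[OF J'] by (simp_all add: carrier_FactGroup)
  obtain f where f: "f \<in> hom (?J Mod upper_central ?J 2) (?J' Mod upper_central ?J' 2)"
    "f ` carrier (?J Mod upper_central ?J 2) = carrier (?J' Mod upper_central ?J' 2)"
    by (rule macdonald_K.surj_hom_Mod_2[OF macdonald_J.macdonald_K_Mod[OF J'] N])
  obtain g where g: "g ` carrier (?J' Mod upper_central ?J' 2) = carrier (?J Mod upper_central ?J 2)"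
    by (rule macdonald_K.surj_hom_Mod_2[OF macdonald_J.macdonald_K_Mod[OF J] N'])
  show ?thesis unfolding K1_def by (rule finite_iso_of_surj_homs[OF fin f g])
qed

section \<open>The isomorphism problem\<close>

text \<open>Congruence of \<alpha> modulo q^2 is congruence of l modulo q. The equivalences close up
  in a circle: congruence yields an isomorphism of the groups J1, which passes to the groups H1, and
  an isomorphism of these yields congruence.\<close>

theorem theoremA:
  fixes p m :: nat
  assumes "Factorial_Ring.prime p" and "odd p" and "m \<ge> 1"
  shows
    "((\<forall>l l' :: int. admissible p m l \<longrightarrow> admissible p m l' \<longrightarrow>
         (J1 p m (1 + int p ^ m * l) \<cong> J1 p m (1 + int p ^ m * l') \<longleftrightarrow>
          [1 + int p ^ m * l = 1 + int p ^ m * l'] (mod int p ^ (2 * m)))) \<and>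
      (\<not> (p = 3 \<and> m = 1) \<longrightarrow>
         card (iso_classes {J1 p m (1 + int p ^ m * l) | l :: int. admissible p m l})
           = totient (p ^ m)) \<and>
      (p = 3 \<and> m = 1 \<longrightarrow>
         (\<forall>l :: int. admissible p m l \<longrightarrow> J1 p m (1 + 3 * l) \<cong> J1 p m 4)) \<and>
      (\<forall>l l' :: int. admissible p m l \<longrightarrow> admissible p m l' \<longrightarrow>
         isomorphic_upper_central_series
           (J1 p m (1 + int p ^ m * l)) (J1 p m (1 + int p ^ m * l'))))
     \<and>
     ((\<forall>l l' :: int. admissible p m l \<longrightarrow> admissible p m l' \<longrightarrow>
         (H1 p m (1 + int p ^ m * l) \<cong> H1 p m (1 + int p ^ m * l') \<longleftrightarrow>
          [1 + int p ^ m * l = 1 + int p ^ m * l'] (mod int p ^ (2 * m)))) \<and>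
      (\<not> (p = 3 \<and> m = 1) \<longrightarrow>
         card (iso_classes {H1 p m (1 + int p ^ m * l) | l :: int. admissible p m l})
           = totient (p ^ m)) \<and>
      (p = 3 \<and> m = 1 \<longrightarrow>
         (\<forall>l :: int. admissible p m l \<longrightarrow> H1 p m (1 + 3 * l) \<cong> H1 p m 4)) \<and>
      (\<forall>l l' :: int. admissible p m l \<longrightarrow> admissible p m l' \<longrightarrow>
         isomorphic_upper_central_series
           (H1 p m (1 + int p ^ m * l)) (H1 p m (1 + int p ^ m * l'))))
     \<and>
     (\<forall>l :: int. admissible p m l \<longrightarrow>
         K1 p m (1 + int p ^ m * l) \<cong> K1 p m (1 + int p ^ m))"
proof -
  have N: "macdonald_numbers p m l" if "admissible p m l" for l
    using assms that by (simp add: macdonald_numbers_def)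
  have cong: "[1 + int p ^ m * l = 1 + int p ^ m * l'] (mod int p ^ (2 * m)) \<longleftrightarrow> int p ^ m dvd l' - l" for l l'
  proof -
    have "int p ^ (2 * m) = int p ^ m * int p ^ m" by (simp add: mult_2 power_add)
    moreover have "(1 + int p ^ m * l) - (1 + int p ^ m * l') = int p ^ m * (l - l')" by (simp add: algebra_simps)
    moreover have "p > 0" using assms(1) by (rule prime_gt_0_nat)
    ultimately show ?thesis by (simp add: cong_iff_dvd_diff dvd_diff_commute)
  qed
  have J_H: "H1 p m (1 + int p ^ m * l) \<cong> H1 p m (1 + int p ^ m * l')"
    if iso: "J1 p m (1 + int p ^ m * l) \<cong> J1 p m (1 + int p ^ m * l')" for l l'
  proof -
    obtain f where f: "f \<in> iso (J1 p m (1 + int p ^ m * l)) (J1 p m (1 + int p ^ m * l'))"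
      using iso by (auto simp: is_iso_def)
    note img = iso_upper_central[OF group_J1 group_J1 f, of 1]
    show ?thesis
      unfolding H1_def img[symmetric]
      by (rule iso_Mod_iso[OF group_J1 group_J1 f])
        (simp_all only: img group.upper_central_normal[OF group_J1])
  qed
  have H: "int p ^ m dvd l' - l"
    if adm: "admissible p m l" "admissible p m l'" and iso: "H1 p m (1 + int p ^ m * l) \<cong> H1 p m (1 + int p ^ m * l')" for l l'
  \<comment> \<open>In the exceptional case p does not divide \<open>S\<close>, but admissibility
    alone makes l and l' congruent modulo q = 3.\<close>
  proof (cases "p = 3 \<and> m = 1")
    case True
    then have "[l = 1] (mod 3)" "[l' = 1] (mod 3)" using adm by (simp_all add: admissible_def)
    then have "[l' = l] (mod 3)" using cong_trans cong_sym by blast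
    then show ?thesis using True by (simp add: cong_iff_dvd_diff)
  next
    case False
    have "int p ^ m dvd l - l'" by (rule H1_cong_of_iso[OF N[OF adm(2)] N[OF adm(1)] False iso])
    then show ?thesis by (simp only: dvd_diff_commute)
  qed
  have J_iff: "J1 p m (1 + int p ^ m * l) \<cong> J1 p m (1 + int p ^ m * l') \<longleftrightarrow> int p ^ m dvd l' - l"
    and H_iff: "H1 p m (1 + int p ^ m * l) \<cong> H1 p m (1 + int p ^ m * l') \<longleftrightarrow> int p ^ m dvd l' - l"
    if "admissible p m l" "admissible p m l'" for l l'
    using H[OF that] J_H[of l l'] J1_iso[OF N[OF that(1)] N[OF that(2)]] by blast+
  have group_H1: "group (H1 p m \<alpha>)" for \<alpha>
    unfolding H1_def by (rule normal.factorgroup_is_group[OF group.upper_central_normal[OF group_J1]])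
  have residues: "card ((\<lambda>l. l mod int p ^ m) ` {l. admissible p m l}) = totient (p ^ m)" if not_3: "\<not> (p = 3 \<and> m = 1)"
  proof -
    \<comment> \<open>Outside the exceptional case admissible means prime to p, so the admissible
      residues modulo q are the units.\<close>
    have adm: "admissible p m l \<longleftrightarrow> coprime l (int (p ^ m))" for l
      using not_3 assms prime_imp_coprime_int[of "int p" l] not_coprimeI[of "int p" l "int p"] prime_gt_1_nat[OF assms(1)]
      by (auto simp: admissible_def coprime_commute)
    \<comment> \<open>Totatives of n are taken from 1, ..., n, residues from 0, ..., n - 1; for n >
      1 both 0 and n are ruled out by coprimality, so the ranges agree.\<close>
    have pm: "p ^ m > 1" using one_less_power[OF prime_gt_1_nat[OF assms(1)], of m] assms(3) by simp
    have "(\<lambda>l. l mod int p ^ m) ` {l. admissible p m l} = int ` totatives (p ^ m)"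
    proof (intro subset_antisym subsetI)
      fix x assume "x \<in> (\<lambda>l. l mod int p ^ m) ` {l. admissible p m l}"
      then obtain l where l: "coprime l (int (p ^ m))" "x = l mod int (p ^ m)" by (auto simp: adm)
      have pos: "int (p ^ m) > 0" using pm by linarith
      then have nz: "int (p ^ m) \<noteq> 0" by linarith
      have cop: "coprime x (int (p ^ m))" unfolding l(2) using l(1) coprime_mod_left_iff[OF nz] by blast
      have "0 \<le> x" unfolding l(2) by (rule pos_mod_sign[OF pos])
      moreover have "x < int (p ^ m)" unfolding l(2) by (rule pos_mod_bound[OF pos])
      then have "nat x < p ^ m" using pos by (simp only: nat_less_iff \<open>0 \<le> x\<close>)
      moreover have "x \<noteq> 0"
      proof
        assume "x = 0"
        then have "is_unit (int (p ^ m))" using cop by (simp only: coprime_0_left_iff)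
        then show False using pm by (simp only: zdvd1_eq abs_of_nat)
      qed
      moreover have "coprime (nat x) (p ^ m)"
        using cop \<open>0 \<le> x\<close> coprime_int_iff[of "nat x" "p ^ m"] by (simp only: int_nat_eq if_True)
      ultimately have "nat x \<in> totatives (p ^ m)" "x = int (nat x)" by (simp_all add: in_totatives_iff)
      then show "x \<in> int ` totatives (p ^ m)" by blast
    next
      fix x assume "x \<in> int ` totatives (p ^ m)"
      then obtain k where k: "k \<in> totatives (p ^ m)" "x = int k" by blast
      have "k < p ^ m" by (rule totatives_less[OF k(1) pm])
      then have "x = x mod int p ^ m" using k(2) by (simp flip: of_nat_power of_nat_mod)
      moreover have "admissible p m x" using k by (simp add: adm totatives_def del: of_nat_power)
      ultimately show "x \<in> (\<lambda>l. l mod int p ^ m) ` {l. admissible p m l}" by blast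
    qed
    then show ?thesis by (simp add: card_image totient_def)
  qed
  have mod: "l mod int p ^ m = l' mod int p ^ m \<longleftrightarrow> int p ^ m dvd l' - l" for l l'
    by (simp add: mod_eq_dvd_iff dvd_diff_commute)
  have "card (iso_classes ((\<lambda>l. J1 p m (1 + int p ^ m * l)) ` {l. admissible p m l})) = card ((\<lambda>l. l mod int p ^ m) ` {l. admissible p m l})"
    by (rule card_iso_classes) (simp_all add: group_J1 J_iff mod)
  then have J_card: "card (iso_classes {J1 p m (1 + int p ^ m * l) | l :: int. admissible p m l}) = totient (p ^ m)"
    if "\<not> (p = 3 \<and> m = 1)"
    using residues[OF that] by (simp add: image_Collect)
  have "card (iso_classes ((\<lambda>l. H1 p m (1 + int p ^ m * l)) ` {l. admissible p m l})) = card ((\<lambda>l. l mod int p ^ m) ` {l. admissible p m l})"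
    by (rule card_iso_classes) (simp_all add: group_H1 H_iff mod)
  then have H_card: "card (iso_classes {H1 p m (1 + int p ^ m * l) | l :: int. admissible p m l}) = totient (p ^ m)"
    if "\<not> (p = 3 \<and> m = 1)"
    using residues[OF that] by (simp add: image_Collect)
  have three: "J1 p m (1 + 3 * l) \<cong> J1 p m 4 \<and> H1 p m (1 + 3 * l) \<cong> H1 p m 4"
    if 3: "p = 3 \<and> m = 1" and l: "admissible p m l" for l
  proof -
    have 1: "admissible p m 1" using 3 by (simp add: admissible_def)
    have "[l = 1] (mod 3)" using l 3 by (simp add: admissible_def)
    then have "int p ^ m dvd 1 - l" using 3 by (simp add: cong_iff_dvd_diff dvd_diff_commute)
    then show ?thesis using J_iff[OF l 1] H_iff[OF l 1] 3 by simp
  qed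
  have series: "isomorphic_upper_central_series (J1 p m (1 + int p ^ m * l)) (J1 p m (1 + int p ^ m * l'))"
      "isomorphic_upper_central_series (H1 p m (1 + int p ^ m * l)) (H1 p m (1 + int p ^ m * l'))"
    if "admissible p m l" "admissible p m l'" for l l'
    unfolding H1_def
    by (rule macdonald_isomorphic_series[OF macdonald_numbers.J1_macdonald_J[OF N[OF that(1)]]
          macdonald_numbers.J1_macdonald_J[OF N[OF that(2)]]])+
  have K: "K1 p m (1 + int p ^ m * l) \<cong> K1 p m (1 + int p ^ m)" if l: "admissible p m l" for l
  proof -
    have "admissible p m 1" using prime_gt_1_nat[OF assms(1)] by (simp add: admissible_def)
    from K1_iso[OF N[OF l] N[OF this]] show ?thesis by simp
  qed
  show ?thesis
    unfolding cong using J_iff H_iff J_card H_card three series K by blast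
qed

end
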